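(* Let $\Phi$ be a suitable category of underlying spaces and let $\mathcal{A}$ be a $\hat{\otimes}$-algebra whose underlying space belongs to $\Phi$. (i) Suppose that the continuous homology groups satisfy $\mathcal{H}^{naive}_n(\mathcal{A})=\{0\}$ for all $n\ge1$ and $\mathcal{H}^{bar}_n(\mathcal{A})=\{0\}$ for all $n\ge0$. Then, up to isomorphism of linear spaces, $$\mathcal{HH}_n(\mathcal{A})=\{0\}\ \text{for all } n\ge1\ \text{ and }\ \mathcal{HH}_0(\mathcal{A})=\mathcal{A}/\mathrm{Im}\,b_0;$$ $$\mathcal{HC}_{2\ell}(\mathcal{A})=\mathcal{A}/\mathrm{Im}\,b_0\ \text{ and }\ \mathcal{HC}_{2\ell+1}(\mathcal{A})=\{0\}\ \text{for all }\ell\ge0;$$ $$\mathcal{HP}_0(\mathcal{A})=\mathcal{A}/\mathrm{Im}\,b_0\ \text{ and }\ \mathcal{HP}_1(\mathcal{A})=\{0\}.$$ (ii) Suppose that the continuous cohomology groups satisfy $\mathcal{H}_{naive}^n(\mathcal{A})=\{0\}$ for all $n\ge1$ and $\mathcal{H}_{bar}^n(\mathcal{A})=\{0\}$ for all $n\ge0$. Then, up to isomorphism of linear spaces, $$\mathcal{HH}^n(\mathcal{A})=\{0\}\ \text{for all } n\ge1\ \text{ and }\ \mathcal{HH}^0(\mathcal{A})=\mathcal{A}^{tr};$$ $$\mathcal{HC}^{2\ell}(\mathcal{A})=\mathcal{A}^{tr}\ \text{ and }\ \mathcal{HC}^{2\ell+1}(\mathcal{A})=\{0\}\ \text{for all }\ell\ge0;$$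 $$\mathcal{HP}^0(\mathcal{A})=\mathcal{A}^{tr}\ \text{ and }\ \mathcal{HP}^1(\mathcal{A})=\{0\}.$$
   Context: All spaces are over $\mathbf{C}$. $\hat{\otimes}$ is the (completed) projective tensor product of complete Hausdorff locally convex spaces; $X^{\hat{\otimes}n}$ is the $n$-fold power. A $\hat{\otimes}$-algebra is a complete Hausdorff locally convex (associative, not necessarily unital) algebra with jointly continuous multiplication. $E^*$ is the space of continuous linear functionals on $E$ with the strong topology (uniform convergence on bounded sets). Homology groups are $\mathrm{Ker}/\mathrm{Im}$; cohomology groups below are those of the dual complexes (strong dual spaces, dual operators). A suitable category $\Phi$ is a full ("complete") subcategory of the category of complete Hausdorff locally convex spaces and continuous linear operators such that: (i) with a space it contains all spaces topologically isomorphic to it; (ii) with a space it contains all its closed subspaces and the completions of all its Hausdorff quotient spaces; (iii) it contains the direct sum and the projective tensor product of any pair of its spaces; (iv) it contains $\mathbf{C}$. For a $\hat{\otimes}$-algebra $\mathcal{A}$, let $\mathcal{C}_n(\mathcal{A})=\mathcal{A}^{\hat{\otimes}(n+1)}$, $n\ge0$, $b'(a_0\otimes\dots\otimes a_n)=\sum_{i=0}^{n-1}(-1)^i a_0\otimes\dots\otimes a_ia_{i+1}\otimes\dots\otimes a_n$, $b(a_0\otimes\dots\otimes a_n)=b'(a_0\otimes\dots\otimes a_n)+(-1)^n a_na_0\otimes a_1\otimes\dots\otimes a_{n-1}$ (both zero on $\mathcal{C}_0$). $\mathcal{H}^{bar}_*(\mathcal{A})=H_*(\mathcal{C}(\mathcal{A}),b')$,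 $\mathcal{H}^{naive}_*(\mathcal{A})=H_*(\mathcal{C}(\mathcal{A}),b)$; $\mathcal{H}_{bar}^*(\mathcal A)$, $\mathcal{H}_{naive}^*(\mathcal A)$ are the cohomology groups of the dual complexes. The map $b_0:\mathcal{A}\hat{\otimes}\mathcal{A}\to\mathcal{A}$ is determined by $a\otimes b\mapsto ab-ba$. A mixed complex $(\mathcal{M},b,B)$ consists of locally convex spaces $M_n$ ($n\ge0$) and continuous linear operators $b:M_n\to M_{n-1}$, $B:M_n\to M_{n+1}$ with $b^2=bB+Bb=B^2=0$, $b=0$ on $M_0$. Its Hochschild homology is $H_*(\mathcal{M},b)$. Its cyclic homology is the homology of $\mathcal{B}_c\mathcal{M}$: $(\mathcal{B}_c\mathcal{M})_{2k}=M_0\oplus M_2\oplus\dots\oplus M_{2k}$, $(\mathcal{B}_c\mathcal{M})_{2k-1}=M_1\oplus M_3\oplus\dots\oplus M_{2k-1}$, with differential $(b+B)(y_0,\dots,y_{2k})=(by_2+By_0,\dots,by_{2k}+By_{2k-2})$, $(b+B)(y_1,\dots,y_{2k+1})=(by_1,by_3+By_1,\dots,by_{2k+1}+By_{2k-1})$. Its periodic cyclic homology $H^p_\nu$, $\nu\in\mathbf{Z}/2\mathbf{Z}$, is the homology of the 2-periodic complex $\mathcal{B}_p\mathcal{M}$ with even part $\prod_{n\ge0}M_{2n}$ and odd part $\prod_{n\ge0}M_{2n+1}$ (product topologies) and differential the obvious extension of $b+B$. For $\mathcal{A}$ take the mixed complex $(\bar\Omega\mathcal{A}_+,\tilde b,\tilde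 B)$: $\bar\Omega^n\mathcal{A}_+=\mathcal{A}^{\hat{\otimes}(n+1)}\oplus\mathcal{A}^{\hat{\otimes}n}$ for $n\ge1$, $\bar\Omega^0\mathcal{A}_+=\mathcal{A}$, $$\tilde b=\begin{pmatrix}b&1-\lambda\\0&-b'\end{pmatrix},\qquad \tilde B=\begin{pmatrix}0&0\\N&0\end{pmatrix},$$ $\lambda(a_1\otimes\dots\otimes a_n)=(-1)^{n-1}a_n\otimes a_1\otimes\dots\otimes a_{n-1}$, $N=\mathrm{id}+\lambda+\dots+\lambda^{n-1}$ on $\mathcal{A}^{\hat{\otimes}n}$. $\mathcal{HH}_*(\mathcal{A})$, $\mathcal{HC}_*(\mathcal{A})$, $\mathcal{HP}_*(\mathcal{A})$ are its Hochschild, cyclic and periodic cyclic homology; $\mathcal{HH}^*,\mathcal{HC}^*,\mathcal{HP}^*$ are the cohomologies of the corresponding dual complexes. $\mathcal{A}^{tr}=\{f\in\mathcal{A}^*: f(ab)=f(ba)\ \forall a,b\in\mathcal{A}\}$. *)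

theory Defs
  imports
    "HOL-Analysis.Analysis"
    "HOL-Algebra.Module"
    "HOL-Algebra.AbelCoset"
    "HOL-Decision_Procs.Algebra_Aux"
    "HOL-Library.Poly_Mapping"
begin

section \<open>Complex linear spaces\<close>

text \<open>Linear spaces are HOL-Algebra modules over the field of complex numbers. A module record also
  has the fields \<^verbatim>\<open>mult\<close> and \<^verbatim>\<open>one\<close>; only the product of an algebra uses \<^verbatim>\<open>mult\<close>, and \<^verbatim>\<open>one\<close> is
  never used (algebras need not be unital).\<close>

abbreviation complex_ring :: "complex ring" where
  "complex_ring \<equiv> cring_class_ops"

definition linear_space ::
  "'a set \<Rightarrow> 'a \<Rightarrow> ('a \<Rightarrow> 'a \<Rightarrow> 'a) \<Rightarrow> (complex \<Rightarrow> 'a \<Rightarrow> 'a) \<Rightarrow> (complex, 'a) module" where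
  "linear_space S z a s =
    \<lparr>carrier = S, mult = (\<lambda>_ _. undefined), one = undefined, zero = z, add = a, smult = s\<rparr>"

definition linear_map ::
  "(complex, 'a, 'm) module_scheme \<Rightarrow> (complex, 'b, 'n) module_scheme \<Rightarrow> ('a \<Rightarrow> 'b) \<Rightarrow> bool" where
  "linear_map X Y h \<longleftrightarrow> h \<in> carrier X \<rightarrow> carrier Y
    \<and> (\<forall>x\<in>carrier X. \<forall>y\<in>carrier X. h (x \<oplus>\<^bsub>X\<^esub> y) = h x \<oplus>\<^bsub>Y\<^esub> h y)
    \<and> (\<forall>c. \<forall>x\<in>carrier X. h (c \<odot>\<^bsub>X\<^esub> x) = c \<odot>\<^bsub>Y\<^esub> h x)"

definition linear_iso ::
  "(complex, 'a, 'm) module_scheme \<Rightarrow> (complex, 'b, 'n) module_scheme \<Rightarrow> bool"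
  (infix \<open>\<cong>\<^sub>l\<^sub>i\<^sub>n\<close> 50) where
  "X \<cong>\<^sub>l\<^sub>i\<^sub>n Y \<longleftrightarrow> (\<exists>h. linear_map X Y h \<and> bij_betw h (carrier X) (carrier Y))"

definition zero_space :: "(complex, 'a, 'm) module_scheme \<Rightarrow> bool" where
  "zero_space X \<longleftrightarrow> carrier X = {\<zero>\<^bsub>X\<^esub>}"

definition linear_quotient ::
  "(complex, 'a, 'm) module_scheme \<Rightarrow> 'a set \<Rightarrow> (complex, 'a set) module" (infixl \<open>'/\<^sub>l\<^sub>i\<^sub>n\<close> 65) where
  "X /\<^sub>l\<^sub>i\<^sub>n I = linear_space (a_rcosets\<^bsub>X\<^esub> I) I (set_add X)
     (\<lambda>c C. \<Union>x\<in>C. I +>\<^bsub>X\<^esub> (c \<odot>\<^bsub>X\<^esub> x))"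


section \<open>Locally convex spaces\<close>

record 'a lcs = "(complex, 'a) module" +
  topo :: "'a topology"

definition with_topology :: "(complex, 'a) module \<Rightarrow> 'a topology \<Rightarrow> 'a lcs" where
  "with_topology V T = module.extend V (lcs.fields T)"

locale locally_convex = Module.module complex_ring X for X :: "'a lcs" +
  assumes topspace_eq: "topspace (topo X) = carrier X"
    and continuous_add:
      "continuous_map (prod_topology (topo X) (topo X)) (topo X) (\<lambda>(x, y). x \<oplus>\<^bsub>X\<^esub> y)"
    and continuous_smult:
      "continuous_map (prod_topology euclidean (topo X)) (topo X) (\<lambda>(c, x). c \<odot>\<^bsub>X\<^esub> x)"
    and convex_base:
      "\<And>U. openin (topo X) U \<Longrightarrow> \<zero>\<^bsub>X\<^esub> \<in> U \<Longrightarrow>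
        \<exists>V. openin (topo X) V \<and> \<zero>\<^bsub>X\<^esub> \<in> V \<and> V \<subseteq> U \<and>
          (\<forall>x\<in>V. \<forall>y\<in>V. \<forall>t\<in>{0..1::real}.
            (complex_of_real (1 - t) \<odot>\<^bsub>X\<^esub> x) \<oplus>\<^bsub>X\<^esub> (complex_of_real t \<odot>\<^bsub>X\<^esub> y) \<in> V)"

definition equiv_filters :: "'a lcs \<Rightarrow> 'a filter \<Rightarrow> 'a filter \<Rightarrow> bool" where
  "equiv_filters X F G \<longleftrightarrow> (\<forall>U. openin (topo X) U \<and> \<zero>\<^bsub>X\<^esub> \<in> U \<longrightarrow>
     eventually (\<lambda>(x, y). x \<ominus>\<^bsub>X\<^esub> y \<in> U) (F \<times>\<^sub>F G))"

definition cauchy_filter_on :: "'a lcs \<Rightarrow> 'a filter \<Rightarrow> bool" where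
  "cauchy_filter_on X F \<longleftrightarrow> F \<noteq> bot \<and> F \<le> principal (carrier X) \<and> equiv_filters X F F"

locale complete_hausdorff_lcs = locally_convex +
  assumes hausdorff: "Hausdorff_space (topo X)"
    and complete: "\<And>F. cauchy_filter_on X F \<Longrightarrow> \<exists>l. limitin (topo X) (\<lambda>x. x) l F"

definition continuous_linear :: "'a lcs \<Rightarrow> 'b lcs \<Rightarrow> ('a \<Rightarrow> 'b) \<Rightarrow> bool" where
  "continuous_linear X Y h \<longleftrightarrow> linear_map X Y h \<and> continuous_map (topo X) (topo Y) h"

definition topological_iso :: "'a lcs \<Rightarrow> 'b lcs \<Rightarrow> bool" where
  "topological_iso X Y \<longleftrightarrow> (\<exists>h. linear_map X Y h \<and> homeomorphic_map (topo X) (topo Y) h)"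

definition continuous_seminorm :: "'a lcs \<Rightarrow> ('a \<Rightarrow> real) \<Rightarrow> bool" where
  "continuous_seminorm X p \<longleftrightarrow>
    (\<forall>x\<in>carrier X. \<forall>y\<in>carrier X. p (x \<oplus>\<^bsub>X\<^esub> y) \<le> p x + p y)
    \<and> (\<forall>c. \<forall>x\<in>carrier X. p (c \<odot>\<^bsub>X\<^esub> x) = cmod c * p x)
    \<and> continuous_map (topo X) euclideanreal p"

definition seminorm_topology ::
  "(complex, 'a) module \<Rightarrow> ('a \<Rightarrow> real) set \<Rightarrow> 'a topology" where
  "seminorm_topology V P = topology_generated_by (insert (carrier V)
     {{y \<in> carrier V. p (y \<ominus>\<^bsub>V\<^esub> x) < e} | p x e. p \<in> P \<and> x \<in> carrier V \<and> 0 < e})"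

definition complex_lcs :: "complex lcs" where
  "complex_lcs = with_topology (linear_space UNIV 0 (+) (*)) euclidean"

definition lcs_subspace :: "'a lcs \<Rightarrow> 'a set \<Rightarrow> 'a lcs" where
  "lcs_subspace X S = X\<lparr>carrier := S, topo := subtopology (topo X) S\<rparr>"

definition lcs_quotient :: "'a lcs \<Rightarrow> 'a set \<Rightarrow> 'a set lcs" where
  "lcs_quotient X I = with_topology (X /\<^sub>l\<^sub>i\<^sub>n I)
     (topology (\<lambda>U. U \<subseteq> a_rcosets\<^bsub>X\<^esub> I \<and> openin (topo X) (\<Union>U)))"

definition direct_sum :: "'a lcs \<Rightarrow> 'b lcs \<Rightarrow> ('a \<times> 'b) lcs" (infixr \<open>\<oplus>\<^sub>l\<^sub>c\<^sub>s\<close> 65) where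
  "X \<oplus>\<^sub>l\<^sub>c\<^sub>s Y = with_topology
     (linear_space (carrier X \<times> carrier Y) (\<zero>\<^bsub>X\<^esub>, \<zero>\<^bsub>Y\<^esub>)
       (\<lambda>(x, y) (x', y'). (x \<oplus>\<^bsub>X\<^esub> x', y \<oplus>\<^bsub>Y\<^esub> y')) (\<lambda>c (x, y). (c \<odot>\<^bsub>X\<^esub> x, c \<odot>\<^bsub>Y\<^esub> y)))
     (prod_topology (topo X) (topo Y))"

text \<open>For finite \<^term>\<open>I\<close> this is the direct sum.\<close>

definition lcs_product :: "nat set \<Rightarrow> (nat \<Rightarrow> 'a lcs) \<Rightarrow> (nat \<Rightarrow> 'a) lcs" where
  "lcs_product I M = with_topology
     (linear_space (\<Pi>\<^sub>E i\<in>I. carrier (M i)) (\<lambda>i\<in>I. \<zero>\<^bsub>M i\<^esub>)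
       (\<lambda>x y. \<lambda>i\<in>I. x i \<oplus>\<^bsub>M i\<^esub> y i) (\<lambda>c x. \<lambda>i\<in>I. c \<odot>\<^bsub>M i\<^esub> x i))
     (product_topology (\<lambda>i. topo (M i)) I)"


subsection \<open>Strong dual\<close>

definition bounded_in :: "'a lcs \<Rightarrow> 'a set \<Rightarrow> bool" where
  "bounded_in X S \<longleftrightarrow> S \<subseteq> carrier X \<and> (\<forall>p. continuous_seminorm X p \<longrightarrow> bdd_above (p ` S))"

definition dual_space :: "'a lcs \<Rightarrow> (complex, 'a \<Rightarrow> complex) module" where
  "dual_space X = linear_space
     {f \<in> extensional (carrier X). continuous_linear X complex_lcs f} (\<lambda>x\<in>carrier X. 0)
     (\<lambda>f g. \<lambda>x\<in>carrier X. f x + g x) (\<lambda>c f. \<lambda>x\<in>carrier X. c * f x)"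

definition strong_dual :: "'a lcs \<Rightarrow> ('a \<Rightarrow> complex) lcs" where
  "strong_dual X = with_topology (dual_space X) (seminorm_topology (dual_space X)
     {\<lambda>f. (SUP x\<in>S. cmod (f x)) | S. bounded_in X S \<and> S \<noteq> {}})"

text \<open>The dual operator of \<^term>\<open>h\<close>, whose domain is \<^term>\<open>X\<close>.\<close>

definition dual_map :: "'a lcs \<Rightarrow> ('a \<Rightarrow> 'b) \<Rightarrow> ('b \<Rightarrow> complex) \<Rightarrow> 'a \<Rightarrow> complex" where
  "dual_map X h f = (\<lambda>x\<in>carrier X. f (h x))"


subsection \<open>Completion\<close>

text \<open>The Hausdorff completion: equivalence classes of Cauchy filters, topologized by the limits of
  the continuous seminorms of the given space.\<close>

definition cauchy_class :: "'a lcs \<Rightarrow> 'a filter \<Rightarrow> 'a filter set" where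
  "cauchy_class X F = {G. cauchy_filter_on X G \<and> equiv_filters X F G}"

definition completion_space :: "'a lcs \<Rightarrow> (complex, 'a filter set) module" where
  "completion_space X = linear_space
     {cauchy_class X F | F. cauchy_filter_on X F}
     (cauchy_class X (principal {\<zero>\<^bsub>X\<^esub>}))
     (\<lambda>C D. \<Union>F\<in>C. \<Union>G\<in>D. cauchy_class X (filtermap (\<lambda>(x, y). x \<oplus>\<^bsub>X\<^esub> y) (F \<times>\<^sub>F G)))
     (\<lambda>c C. \<Union>F\<in>C. cauchy_class X (filtermap (\<lambda>x. c \<odot>\<^bsub>X\<^esub> x) F))"

definition completion_seminorm :: "('a \<Rightarrow> real) \<Rightarrow> 'a filter set \<Rightarrow> real" where
  "completion_seminorm p C = (THE r. \<forall>F\<in>C. (p \<longlongrightarrow> r) F)"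

definition completion :: "'a lcs \<Rightarrow> 'a filter set lcs" where
  "completion X = with_topology (completion_space X) (seminorm_topology (completion_space X)
     (completion_seminorm ` {p. continuous_seminorm X p}))"

definition to_completion :: "'a lcs \<Rightarrow> 'a \<Rightarrow> 'a filter set" where
  "to_completion X x = cauchy_class X (principal {x})"


section \<open>The completed projective tensor product\<close>

text \<open>The tensor product of a list \<^term>\<open>Xs\<close> of spaces. The algebraic tensor product is the free
  linear space on the set of lists in the product of the spaces, modulo the multilinearity
  relations. Its elements are cosets, so that a tensor is the set of all its representations as a
  finite sum, and the projective seminorm is the infimum over that set. The product is taken in one
  step so that all powers of a space live in one type.\<close>

definition free_space :: "'a lcs list \<Rightarrow> (complex, 'a list \<Rightarrow>\<^sub>0 complex) module" where
  "free_space Xs = linear_space {f. Poly_Mapping.keys f \<subseteq> listset (map carrier Xs)} 0 (+)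
     (\<lambda>c. Poly_Mapping.map (\<lambda>z. c * z))"

inductive_set tensor_relations :: "'a lcs list \<Rightarrow> ('a list \<Rightarrow>\<^sub>0 complex) set" for Xs where
  zero: "0 \<in> tensor_relations Xs"
| add: "f \<in> tensor_relations Xs \<Longrightarrow> g \<in> tensor_relations Xs \<Longrightarrow> f + g \<in> tensor_relations Xs"
| smult: "f \<in> tensor_relations Xs \<Longrightarrow> Poly_Mapping.map (\<lambda>z. c * z) f \<in> tensor_relations Xs"
| additive: "xs \<in> listset (map carrier Xs) \<Longrightarrow> i < length Xs \<Longrightarrow>
    x \<in> carrier (Xs ! i) \<Longrightarrow> y \<in> carrier (Xs ! i) \<Longrightarrow>
    Poly_Mapping.single (xs[i := x \<oplus>\<^bsub>Xs ! i\<^esub> y]) 1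
      - Poly_Mapping.single (xs[i := x]) 1 - Poly_Mapping.single (xs[i := y]) 1
    \<in> tensor_relations Xs"
| homogeneous: "xs \<in> listset (map carrier Xs) \<Longrightarrow> i < length Xs \<Longrightarrow> x \<in> carrier (Xs ! i) \<Longrightarrow>
    Poly_Mapping.single (xs[i := c \<odot>\<^bsub>Xs ! i\<^esub> x]) 1 - Poly_Mapping.single (xs[i := x]) c
    \<in> tensor_relations Xs"

definition projective_seminorm ::
  "('a \<Rightarrow> real) list \<Rightarrow> ('a list \<Rightarrow>\<^sub>0 complex) set \<Rightarrow> real" where
  "projective_seminorm ps C = (INF f\<in>C. \<Sum>xs\<in>Poly_Mapping.keys f.
     cmod (Poly_Mapping.lookup f xs) * (\<Prod>i<length ps. (ps ! i) (xs ! i)))"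

definition alg_tensor :: "'a lcs list \<Rightarrow> ('a list \<Rightarrow>\<^sub>0 complex) set lcs" where
  "alg_tensor Xs =
     (let V = free_space Xs /\<^sub>l\<^sub>i\<^sub>n tensor_relations Xs
      in with_topology V (seminorm_topology V
        (projective_seminorm ` listset (map (\<lambda>X. {p. continuous_seminorm X p}) Xs))))"

type_synonym 'a tensor = "('a list \<Rightarrow>\<^sub>0 complex) set filter set"

definition proj_tensor :: "'a lcs list \<Rightarrow> 'a tensor lcs" where
  "proj_tensor Xs = completion (alg_tensor Xs)"

definition elem_tensor :: "'a lcs list \<Rightarrow> 'a list \<Rightarrow> 'a tensor" where
  "elem_tensor Xs xs = to_completion (alg_tensor Xs)
     (tensor_relations Xs +>\<^bsub>free_space Xs\<^esub> Poly_Mapping.single xs 1)"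

text \<open>The continuous linear operator on the tensor product determined by its values \<^term>\<open>f\<close> on
  elementary tensors.\<close>

definition tensor_lift :: "'a lcs list \<Rightarrow> 'b lcs \<Rightarrow> ('a list \<Rightarrow> 'b) \<Rightarrow> 'a tensor \<Rightarrow> 'b" where
  "tensor_lift Xs Y f = (THE g. g \<in> extensional (carrier (proj_tensor Xs))
     \<and> continuous_linear (proj_tensor Xs) Y g
     \<and> (\<forall>xs\<in>listset (map carrier Xs). g (elem_tensor Xs xs) = f xs))"

definition tensor_power :: "'a lcs \<Rightarrow> nat \<Rightarrow> 'a tensor lcs" where
  "tensor_power A n = proj_tensor (replicate n A)"

definition tens :: "'a lcs \<Rightarrow> 'a list \<Rightarrow> 'a tensor" where
  "tens A as = elem_tensor (replicate (length as) A) as"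


section \<open>Topological algebras and suitable categories\<close>

locale tensor_algebra = complete_hausdorff_lcs A for A :: "'a lcs" +
  assumes mult_closed:
      "a \<in> carrier A \<Longrightarrow> b \<in> carrier A \<Longrightarrow> a \<otimes>\<^bsub>A\<^esub> b \<in> carrier A"
    and mult_assoc:
      "a \<in> carrier A \<Longrightarrow> b \<in> carrier A \<Longrightarrow> c \<in> carrier A \<Longrightarrow>
        (a \<otimes>\<^bsub>A\<^esub> b) \<otimes>\<^bsub>A\<^esub> c = a \<otimes>\<^bsub>A\<^esub> (b \<otimes>\<^bsub>A\<^esub> c)"
    and mult_linear_left: "b \<in> carrier A \<Longrightarrow> linear_map A A (\<lambda>a. a \<otimes>\<^bsub>A\<^esub> b)"
    and mult_linear_right: "a \<in> carrier A \<Longrightarrow> linear_map A A (\<lambda>b. a \<otimes>\<^bsub>A\<^esub> b)"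
    and mult_continuous:
      "continuous_map (prod_topology (topo A) (topo A)) (topo A) (\<lambda>(a, b). a \<otimes>\<^bsub>A\<^esub> b)"

text \<open>A full subcategory is given by its class of objects, here a predicate on the spaces with
  carrier in the type \<^typ>\<open>'a\<close>, which plays the role of the universe. The constructions produce
  spaces over other types; the conditions speak about all their isomorphic copies over \<^typ>\<open>'a\<close>.\<close>

definition suitable_category :: "('a lcs \<Rightarrow> bool) \<Rightarrow> bool" where
  "suitable_category \<Phi> \<longleftrightarrow>
    (\<forall>X. \<Phi> X \<longrightarrow> complete_hausdorff_lcs X)
    \<and> (\<forall>X Z. \<Phi> X \<and> complete_hausdorff_lcs Z \<and> topological_iso X Z \<longrightarrow> \<Phi> Z)
    \<and> (\<forall>X Y. \<Phi> X \<and> submodule Y complex_ring X \<and> closedin (topo X) Y \<longrightarrow> \<Phi> (lcs_subspace X Y))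
    \<and> (\<forall>X Y Z. \<Phi> X \<and> submodule Y complex_ring X \<and> Hausdorff_space (topo (lcs_quotient X Y))
        \<and> complete_hausdorff_lcs Z \<and> topological_iso (completion (lcs_quotient X Y)) Z \<longrightarrow> \<Phi> Z)
    \<and> (\<forall>X Y Z. \<Phi> X \<and> \<Phi> Y \<and> complete_hausdorff_lcs Z \<and> topological_iso (X \<oplus>\<^sub>l\<^sub>c\<^sub>s Y) Z \<longrightarrow> \<Phi> Z)
    \<and> (\<forall>X Y Z. \<Phi> X \<and> \<Phi> Y \<and> complete_hausdorff_lcs Z \<and> topological_iso (proj_tensor [X, Y]) Z
        \<longrightarrow> \<Phi> Z)
    \<and> (\<forall>Z. complete_hausdorff_lcs Z \<and> topological_iso complex_lcs Z \<longrightarrow> \<Phi> Z)"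


section \<open>Homology of complexes and of mixed complexes\<close>

text \<open>The homology of \<open>W \<rightarrow> X \<rightarrow> Y\<close> (operators \<^term>\<open>f\<close> and \<^term>\<open>g\<close>) at \<^term>\<open>X\<close>.\<close>

definition homology_at ::
  "'w lcs \<Rightarrow> ('w \<Rightarrow> 'x) \<Rightarrow> 'x lcs \<Rightarrow> ('x \<Rightarrow> 'y) \<Rightarrow> 'y lcs \<Rightarrow> (complex, 'x set) module" where
  "homology_at W f X g Y = X\<lparr>carrier := a_kernel X Y g\<rparr> /\<^sub>l\<^sub>i\<^sub>n (f ` carrier W)"

text \<open>A chain complex has \<open>d n : M n \<rightarrow> M (n - 1)\<close>. As subtraction on \<^typ>\<open>nat\<close> is truncated,
  \<open>d 0\<close> is an operator from \<open>M 0\<close> to itself; it is the zero operator in all complexes below, so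
  that the homology in degree 0 is the cokernel of \<open>d 1\<close> and the cohomology is the kernel of its dual.\<close>

definition chain_homology ::
  "(nat \<Rightarrow> 'm lcs) \<Rightarrow> (nat \<Rightarrow> 'm \<Rightarrow> 'm) \<Rightarrow> nat \<Rightarrow> (complex, 'm set) module" where
  "chain_homology M d n = homology_at (M (n + 1)) (d (n + 1)) (M n) (d n) (M (n - 1))"

definition dual_cohomology ::
  "(nat \<Rightarrow> 'm lcs) \<Rightarrow> (nat \<Rightarrow> 'm \<Rightarrow> 'm) \<Rightarrow> nat \<Rightarrow> (complex, ('m \<Rightarrow> complex) set) module" where
  "dual_cohomology M d n = homology_at
     (strong_dual (M (n - 1))) (dual_map (M n) (d n))
     (strong_dual (M n)) (dual_map (M (n + 1)) (d (n + 1))) (strong_dual (M (n + 1)))"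

text \<open>The components with index in \<^term>\<open>J\<close> of \<open>(b + B) y\<close>.\<close>

definition total_diff ::
  "(nat \<Rightarrow> 'm lcs) \<Rightarrow> (nat \<Rightarrow> 'm \<Rightarrow> 'm) \<Rightarrow> (nat \<Rightarrow> 'm \<Rightarrow> 'm) \<Rightarrow> nat set
    \<Rightarrow> (nat \<Rightarrow> 'm) \<Rightarrow> nat \<Rightarrow> 'm" where
  "total_diff M b B J y =
     (\<lambda>j\<in>J. b (j + 1) (y (j + 1)) \<oplus>\<^bsub>M j\<^esub> (if j = 0 then \<zero>\<^bsub>M j\<^esub> else B (j - 1) (y (j - 1))))"

definition cyclic_index :: "nat \<Rightarrow> nat set" where
  "cyclic_index n = {j. j \<le> n \<and> j mod 2 = n mod 2}"

definition cyclic_complex :: "(nat \<Rightarrow> 'm lcs) \<Rightarrow> nat \<Rightarrow> (nat \<Rightarrow> 'm) lcs" where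
  "cyclic_complex M n = lcs_product (cyclic_index n) M"

definition cyclic_diff ::
  "(nat \<Rightarrow> 'm lcs) \<Rightarrow> (nat \<Rightarrow> 'm \<Rightarrow> 'm) \<Rightarrow> (nat \<Rightarrow> 'm \<Rightarrow> 'm) \<Rightarrow> nat
    \<Rightarrow> (nat \<Rightarrow> 'm) \<Rightarrow> nat \<Rightarrow> 'm" where
  "cyclic_diff M b B n =
     (if n = 0 then (\<lambda>_. \<zero>\<^bsub>cyclic_complex M 0\<^esub>) else total_diff M b B (cyclic_index (n - 1)))"

text \<open>The 2-periodic complex; only the parity of the degree \<open>\<nu>\<close> matters.\<close>

definition periodic_index :: "nat \<Rightarrow> nat set" where
  "periodic_index \<nu> = {j. j mod 2 = \<nu> mod 2}"

definition periodic_complex :: "(nat \<Rightarrow> 'm lcs) \<Rightarrow> nat \<Rightarrow> (nat \<Rightarrow> 'm) lcs" where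
  "periodic_complex M \<nu> = lcs_product (periodic_index \<nu>) M"

definition periodic_diff ::
  "(nat \<Rightarrow> 'm lcs) \<Rightarrow> (nat \<Rightarrow> 'm \<Rightarrow> 'm) \<Rightarrow> (nat \<Rightarrow> 'm \<Rightarrow> 'm) \<Rightarrow> nat
    \<Rightarrow> (nat \<Rightarrow> 'm) \<Rightarrow> nat \<Rightarrow> 'm" where
  "periodic_diff M b B \<nu> = total_diff M b B (periodic_index (\<nu> + 1))"

definition periodic_homology ::
  "(nat \<Rightarrow> 'm lcs) \<Rightarrow> (nat \<Rightarrow> 'm \<Rightarrow> 'm) \<Rightarrow> (nat \<Rightarrow> 'm \<Rightarrow> 'm) \<Rightarrow> nat
    \<Rightarrow> (complex, (nat \<Rightarrow> 'm) set) module" where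
  "periodic_homology M b B \<nu> = homology_at
     (periodic_complex M (\<nu> + 1)) (periodic_diff M b B (\<nu> + 1))
     (periodic_complex M \<nu>) (periodic_diff M b B \<nu>) (periodic_complex M (\<nu> + 1))"

definition periodic_cohomology ::
  "(nat \<Rightarrow> 'm lcs) \<Rightarrow> (nat \<Rightarrow> 'm \<Rightarrow> 'm) \<Rightarrow> (nat \<Rightarrow> 'm \<Rightarrow> 'm) \<Rightarrow> nat
    \<Rightarrow> (complex, ((nat \<Rightarrow> 'm) \<Rightarrow> complex) set) module" where
  "periodic_cohomology M b B \<nu> = homology_at
     (strong_dual (periodic_complex M (\<nu> + 1)))
     (dual_map (periodic_complex M \<nu>) (periodic_diff M b B \<nu>))
     (strong_dual (periodic_complex M \<nu>))
     (dual_map (periodic_complex M (\<nu> + 1)) (periodic_diff M b B (\<nu> + 1)))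
     (strong_dual (periodic_complex M (\<nu> + 1)))"


section \<open>Homology of topological algebras\<close>

definition chains :: "'a lcs \<Rightarrow> nat \<Rightarrow> 'a tensor lcs" where
  "chains A n = tensor_power A (n + 1)"

definition face :: "'a lcs \<Rightarrow> nat \<Rightarrow> 'a list \<Rightarrow> 'a list" where
  "face A i as = take i as @ (as ! i \<otimes>\<^bsub>A\<^esub> as ! (i + 1)) # drop (i + 2) as"

definition bar_value :: "'a lcs \<Rightarrow> nat \<Rightarrow> 'a list \<Rightarrow> 'a tensor" where
  "bar_value A n as = (\<Oplus>\<^bsub>chains A (n - 1)\<^esub> i\<in>{..<n}. (-1) ^ i \<odot>\<^bsub>chains A (n - 1)\<^esub> tens A (face A i as))"

text \<open>The operators \<open>b'\<close> and \<open>b\<close> on \<^term>\<open>chains A n\<close>; both are zero for \<open>n = 0\<close>.\<close>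

definition bar_diff :: "'a lcs \<Rightarrow> nat \<Rightarrow> 'a tensor \<Rightarrow> 'a tensor" where
  "bar_diff A n = tensor_lift (replicate (n + 1) A) (chains A (n - 1)) (bar_value A n)"

definition naive_diff :: "'a lcs \<Rightarrow> nat \<Rightarrow> 'a tensor \<Rightarrow> 'a tensor" where
  "naive_diff A n = tensor_lift (replicate (n + 1) A) (chains A (n - 1))
     (\<lambda>as. if n = 0 then \<zero>\<^bsub>chains A (n - 1)\<^esub> else
        bar_value A n as \<oplus>\<^bsub>chains A (n - 1)\<^esub>
        ((-1) ^ n \<odot>\<^bsub>chains A (n - 1)\<^esub> tens A ((last as \<otimes>\<^bsub>A\<^esub> hd as) # butlast (tl as))))"

definition bar_homology where "bar_homology A = chain_homology (chains A) (bar_diff A)"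
definition naive_homology where "naive_homology A = chain_homology (chains A) (naive_diff A)"
definition bar_cohomology where "bar_cohomology A = dual_cohomology (chains A) (bar_diff A)"
definition naive_cohomology where "naive_cohomology A = dual_cohomology (chains A) (naive_diff A)"

text \<open>The operator \<open>\<lambda>\<close> on \<^term>\<open>tensor_power A n\<close>, for \<open>n \<ge> 1\<close>.\<close>

definition cyclic_op :: "'a lcs \<Rightarrow> nat \<Rightarrow> 'a tensor \<Rightarrow> 'a tensor" where
  "cyclic_op A n = tensor_lift (replicate n A) (tensor_power A n)
     (\<lambda>as. (-1) ^ (n - 1) \<odot>\<^bsub>tensor_power A n\<^esub> tens A (last as # butlast as))"

definition norm_op :: "'a lcs \<Rightarrow> nat \<Rightarrow> 'a tensor \<Rightarrow> 'a tensor" where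
  "norm_op A n x = (\<Oplus>\<^bsub>tensor_power A n\<^esub> i\<in>{..<n}. (cyclic_op A n ^^ i) x)"

text \<open>The mixed complex. In degree 0 the second summand is the zero subspace of the first one, so
  that all degrees are spaces of pairs.\<close>

definition omega :: "'a lcs \<Rightarrow> nat \<Rightarrow> ('a tensor \<times> 'a tensor) lcs" where
  "omega A n = (if n = 0 then chains A 0 \<oplus>\<^sub>l\<^sub>c\<^sub>s lcs_subspace (chains A 0) {\<zero>\<^bsub>chains A 0\<^esub>}
     else tensor_power A (n + 1) \<oplus>\<^sub>l\<^sub>c\<^sub>s tensor_power A n)"

text \<open>For \<open>n = 1\<close>, the second component of \<open>omega_b A 1\<close> is \<open>- bar_diff A 0 y = 0\<close>, in agreement
  with the definition of \<open>omega A 0\<close>.\<close>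

definition omega_b :: "'a lcs \<Rightarrow> nat \<Rightarrow> 'a tensor \<times> 'a tensor \<Rightarrow> 'a tensor \<times> 'a tensor" where
  "omega_b A n = (\<lambda>(x, y). if n = 0 then (\<zero>\<^bsub>chains A 0\<^esub>, \<zero>\<^bsub>chains A 0\<^esub>) else
     (naive_diff A n x \<oplus>\<^bsub>tensor_power A n\<^esub> (y \<ominus>\<^bsub>tensor_power A n\<^esub> cyclic_op A n y),
      \<ominus>\<^bsub>chains A (n - 2)\<^esub> bar_diff A (n - 1) y))"

definition omega_B :: "'a lcs \<Rightarrow> nat \<Rightarrow> 'a tensor \<times> 'a tensor \<Rightarrow> 'a tensor \<times> 'a tensor" where
  "omega_B A n = (\<lambda>(x, y). (\<zero>\<^bsub>tensor_power A (n + 2)\<^esub>, norm_op A (n + 1) x))"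

definition HH_homology where
  "HH_homology A = chain_homology (omega A) (omega_b A)"
definition HC_homology where
  "HC_homology A = chain_homology (cyclic_complex (omega A)) (cyclic_diff (omega A) (omega_b A) (omega_B A))"
definition HP_homology where
  "HP_homology A = periodic_homology (omega A) (omega_b A) (omega_B A)"

definition HH_cohomology where
  "HH_cohomology A = dual_cohomology (omega A) (omega_b A)"
definition HC_cohomology where
  "HC_cohomology A = dual_cohomology (cyclic_complex (omega A)) (cyclic_diff (omega A) (omega_b A) (omega_B A))"
definition HP_cohomology where
  "HP_cohomology A = periodic_cohomology (omega A) (omega_b A) (omega_B A)"

definition commutator_map :: "'a lcs \<Rightarrow> 'a tensor \<Rightarrow> 'a" where
  "commutator_map A = tensor_lift [A, A] A
     (\<lambda>as. (as ! 0 \<otimes>\<^bsub>A\<^esub> as ! 1) \<ominus>\<^bsub>A\<^esub> (as ! 1 \<otimes>\<^bsub>A\<^esub> as ! 0))"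

definition commutator_quotient :: "'a lcs \<Rightarrow> (complex, 'a set) module" where
  "commutator_quotient A = A /\<^sub>l\<^sub>i\<^sub>n (commutator_map A ` carrier (proj_tensor [A, A]))"

definition traces :: "'a lcs \<Rightarrow> ('a \<Rightarrow> complex) lcs" where
  "traces A = lcs_subspace (strong_dual A)
     {f \<in> carrier (strong_dual A). \<forall>a\<in>carrier A. \<forall>b\<in>carrier A. f (a \<otimes>\<^bsub>A\<^esub> b) = f (b \<otimes>\<^bsub>A\<^esub> a)}"

end

theory Submission
  imports Defs
begin

text \<open>The mixed complex of an algebra is, with respect to \<open>b\<close>, the cone of \<open>1 - \<lambda>\<close> from the bar complex to the
  naive Hochschild complex. If the bar complex is exact and the naive complex is exact in positive degrees, then so is
  the cone in positive degrees (\<open>omega_exact\<close>): for a cycle \<open>(x, y)\<close> one solves \<open>y = b' z\<close> and then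
  \<open>x + (1 - \<lambda>) z = b w\<close>. In degree 0 the image of \<open>b\<close> is that of the commutator map. The same computation
  with continuous functionals gives the statement for dual complexes (\<open>omega_coexact\<close>), where the cokernel is
  replaced by the traces.

  The rest is a general fact about mixed complexes whose Hochschild homology is concentrated in degree 0. An equation
  \<open>(b + B) Y = t\<close> with a cycle \<open>t\<close> is solved degree by degree, as each obstruction is a \<open>b\<close>-cycle of positive
  degree (\<open>solve\<close>). Products of all degrees are allowed, so that infinitely many steps cause no problem and the
  periodic complex needs no limit argument. Hence odd cycles are boundaries, and an even cycle is determined up to
  boundaries by the class of its component in degree 0 (\<open>odd_homology\<close>, \<open>even_homology\<close>). In the dual
  complexes a continuous functional on a product has only finitely many components
  (\<open>functional_finite_support\<close>). A cocycle therefore can be stripped of its components from the top until only one in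
  degree 0 is left (\<open>strip\<close>, \<open>total_cohomology\<close>). This treats cyclic and periodic cohomology alike.

  The relations \<open>b B + B b = 0\<close>, \<open>b (1 - \<lambda>) = (1 - \<lambda>) b'\<close> and \<open>b' N = N b\<close> come from one observation
  (\<open>face_conjugate\<close>): with its sign, every face operator is the conjugate of the zeroth face by powers of the cyclic
  operator. Since these powers form finite cyclic groups, the identities reduce to shifts of summation indices.

  All operators are defined by their values on elementary tensors. That such operators exist and are unique
  is the universal property of the completed tensor power for bounded multilinear maps (\<open>tensor_lift_exists\<close>,
  \<open>tensor_ext\<close>). It rests on the description of locally convex topologies by seminorms (by means of the Minkowski
  gauge, \<open>seminorm_in_neighbourhood\<close>) and on the completion by Cauchy filters, which is shown to be a complete
  Hausdorff space to which continuous operators into complete spaces extend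
  (\<open>complete_hausdorff_completion\<close>, \<open>completion_extension\<close>).\<close>

section \<open>Linear spaces and linear maps\<close>

locale lin_space = Module.module complex_ring X for X (structure)
begin

lemma smult_mem [simp, intro]: "x \<in> carrier X \<Longrightarrow> c \<odot> x \<in> carrier X"
  by (simp add: carrier_class)

lemma smult_add_left: "x \<in> carrier X \<Longrightarrow> (a + b) \<odot> x = a \<odot> x \<oplus> b \<odot> x"
  using smult_l_distr[of a b x] by (simp add: carrier_class plus_class)

lemma smult_add_right: "x \<in> carrier X \<Longrightarrow> y \<in> carrier X \<Longrightarrow> a \<odot> (x \<oplus> y) = a \<odot> x \<oplus> a \<odot> y"
  using smult_r_distr[of a x y] by (simp add: carrier_class)

lemma smult_smult: "x \<in> carrier X \<Longrightarrow> a \<odot> (b \<odot> x) = (a * b) \<odot> x"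
  using smult_assoc1[of a b x] by (simp add: carrier_class times_class)

lemma one_smult [simp]: "x \<in> carrier X \<Longrightarrow> 1 \<odot> x = x"
  using smult_one[of x] by (simp add: one_class)

lemma zero_smult [simp]: "x \<in> carrier X \<Longrightarrow> 0 \<odot> x = \<zero>"
  using smult_l_null[of x] by (simp add: zero_class)

lemma smult_zero [simp]: "c \<odot> \<zero> = \<zero>"
  using smult_r_null[of c] by (simp add: carrier_class)

lemma minus_smult: "x \<in> carrier X \<Longrightarrow> (- c) \<odot> x = \<ominus> (c \<odot> x)"
  using smult_l_minus[of c x] by (simp add: carrier_class uminus_class)

lemma smult_minus: "x \<in> carrier X \<Longrightarrow> c \<odot> (\<ominus> x) = \<ominus> (c \<odot> x)"
  using smult_r_minus[of c x] by (simp add: carrier_class)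

lemma neg_eq_smult: "x \<in> carrier X \<Longrightarrow> \<ominus> x = (- 1) \<odot> x"
  by (simp add: minus_smult)

lemma smult_diff: "x \<in> carrier X \<Longrightarrow> y \<in> carrier X \<Longrightarrow> c \<odot> (x \<ominus> y) = c \<odot> x \<ominus> c \<odot> y"
  by (simp add: M.minus_eq smult_add_right smult_minus)

lemma smult_diff_left: "x \<in> carrier X \<Longrightarrow> (a - b) \<odot> x = a \<odot> x \<ominus> b \<odot> x"
  using smult_add_left[of x a "- b"] by (simp add: M.minus_eq minus_smult)

lemma diff_mem [simp]: "x \<in> carrier X \<Longrightarrow> y \<in> carrier X \<Longrightarrow> x \<ominus> y \<in> carrier X"
  by simp

lemma diff_self [simp]: "x \<in> carrier X \<Longrightarrow> x \<ominus> x = \<zero>"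
  by (simp add: M.minus_eq M.r_neg)

lemma diff_zero [simp]: "x \<in> carrier X \<Longrightarrow> x \<ominus> \<zero> = x"
  by (simp add: M.minus_eq)

lemma zero_diff [simp]: "x \<in> carrier X \<Longrightarrow> \<zero> \<ominus> x = \<ominus> x"
  by (simp add: M.minus_eq)

lemma diff_eq_zero_iff: "x \<in> carrier X \<Longrightarrow> y \<in> carrier X \<Longrightarrow> x \<ominus> y = \<zero> \<longleftrightarrow> x = y"
  by (metis M.add.inv_closed M.add.inv_comm M.minus_eq M.minus_equality M.minus_minus diff_self)

lemma neg_diff: "x \<in> carrier X \<Longrightarrow> y \<in> carrier X \<Longrightarrow> \<ominus> (x \<ominus> y) = y \<ominus> x"
  by (simp add: M.minus_eq M.minus_add M.a_comm)

lemma diff_add_diff: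
  "x \<in> carrier X \<Longrightarrow> y \<in> carrier X \<Longrightarrow> z \<in> carrier X \<Longrightarrow> (x \<ominus> y) \<oplus> (y \<ominus> z) = x \<ominus> z"
  by (simp add: M.minus_eq M.a_assoc M.r_neg2 M.r_neg1)

lemma add_diff_add:
  "x \<in> carrier X \<Longrightarrow> y \<in> carrier X \<Longrightarrow> x' \<in> carrier X \<Longrightarrow> y' \<in> carrier X \<Longrightarrow>
    (x \<oplus> y) \<ominus> (x' \<oplus> y') = (x \<ominus> x') \<oplus> (y \<ominus> y')"
  by (simp add: M.minus_eq M.minus_add M.a_ac)

lemma add_diff_cancel [simp]:
  assumes "x \<in> carrier X" "y \<in> carrier X"
  shows "x \<oplus> (y \<ominus> x) = y" "(y \<ominus> x) \<oplus> x = y" "(y \<oplus> x) \<ominus> x = y" "(x \<oplus> y) \<ominus> x = y"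
proof -
  note * = assms
  show 1: "(y \<ominus> x) \<oplus> x = y" and 2: "(y \<oplus> x) \<ominus> x = y"
    using * by (simp_all add: M.minus_eq M.a_assoc M.l_neg M.r_neg)
  show "x \<oplus> (y \<ominus> x) = y" using 1 * by (simp add: M.a_comm)
  show "(x \<oplus> y) \<ominus> x = y" using 2 * by (simp add: M.a_comm)
qed

lemma diff_eq_iff: 
  "x \<in> carrier X \<Longrightarrow> y \<in> carrier X \<Longrightarrow> z \<in> carrier X \<Longrightarrow> x \<ominus> y = z \<longleftrightarrow> x = z \<oplus> y"
  by (metis add_diff_cancel(2) add_diff_cancel(3))

end

text \<open>The additive inverse is the multiple by \<open>- 1\<close>, so that an axiom for that multiple replaces the
  existence of inverses.\<close>

lemma lin_spaceI:
  fixes X (structure)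
  assumes "\<And>x y. x \<in> carrier X \<Longrightarrow> y \<in> carrier X \<Longrightarrow> x \<oplus> y \<in> carrier X"
    and "\<zero> \<in> carrier X"
    and "\<And>c x. x \<in> carrier X \<Longrightarrow> c \<odot> x \<in> carrier X"
    and "\<And>x y z. x \<in> carrier X \<Longrightarrow> y \<in> carrier X \<Longrightarrow> z \<in> carrier X \<Longrightarrow> (x \<oplus> y) \<oplus> z = x \<oplus> (y \<oplus> z)"
    and "\<And>x y. x \<in> carrier X \<Longrightarrow> y \<in> carrier X \<Longrightarrow> x \<oplus> y = y \<oplus> x"
    and "\<And>x. x \<in> carrier X \<Longrightarrow> \<zero> \<oplus> x = x"
    and neg: "\<And>x. x \<in> carrier X \<Longrightarrow> (-1) \<odot> x \<oplus> x = \<zero>"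
    and "\<And>a b x. x \<in> carrier X \<Longrightarrow> (a + b) \<odot> x = a \<odot> x \<oplus> b \<odot> x"
    and "\<And>a x y. x \<in> carrier X \<Longrightarrow> y \<in> carrier X \<Longrightarrow> a \<odot> (x \<oplus> y) = a \<odot> x \<oplus> a \<odot> y"
    and "\<And>a b x. x \<in> carrier X \<Longrightarrow> (a * b) \<odot> x = a \<odot> (b \<odot> x)"
    and "\<And>x. x \<in> carrier X \<Longrightarrow> 1 \<odot> x = x"
  shows "lin_space X"
  unfolding lin_space_def
proof (rule moduleI)
  show "cring complex_ring" by (rule cring_class)
  show "abelian_group X"
    by (rule abelian_groupI) (use assms in \<open>blast+\<close>)
qed (use assms in \<open>simp_all add: class_simps\<close>)

lemma lin_space_cong:
  assumes "lin_space X" "carrier Y = carrier X" "add Y = add X" "zero Y = zero X" "smult Y = smult X"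
  shows "lin_space Y"
proof -
  interpret lin_space X by fact
  show ?thesis
    by (rule lin_spaceI) (simp_all add: assms(2-5) M.a_assoc smult_add_left smult_add_right
        smult_smult minus_smult M.l_neg, simp add: M.a_comm)
qed

lemma a_inv_cong:
  assumes "carrier Y = carrier X" "add Y = add X" "zero Y = zero X"
  shows "a_inv Y = a_inv X" "a_minus Y = a_minus X"
  using assms by (auto simp: a_inv_def m_inv_def a_minus_def fun_eq_iff)

lemma linear_space_sel [simp]:
  "carrier (linear_space S z a s) = S" "zero (linear_space S z a s) = z"
  "add (linear_space S z a s) = a" "smult (linear_space S z a s) = s"
  by (simp_all add: linear_space_def)

lemma with_topology_sel [simp]:
  "carrier (with_topology V T) = carrier V" "zero (with_topology V T) = zero V"
  "add (with_topology V T) = add V" "smult (with_topology V T) = smult V"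
  "topo (with_topology V T) = T"
  by (simp_all add: with_topology_def module.defs lcs.defs)

lemma with_topology_minus [simp]:
  "a_inv (with_topology V T) = a_inv V" "a_minus (with_topology V T) = a_minus V"
  by (rule a_inv_cong; simp)+

lemma lin_space_with_topology [simp]: "lin_space (with_topology V T) \<longleftrightarrow> lin_space V"
  by (auto elim!: lin_space_cong)

lemma linear_mapD:
  assumes "linear_map X Y h"
  shows "x \<in> carrier X \<Longrightarrow> h x \<in> carrier Y"
    and "x \<in> carrier X \<Longrightarrow> y \<in> carrier X \<Longrightarrow> h (x \<oplus>\<^bsub>X\<^esub> y) = h x \<oplus>\<^bsub>Y\<^esub> h y"
    and "x \<in> carrier X \<Longrightarrow> h (c \<odot>\<^bsub>X\<^esub> x) = c \<odot>\<^bsub>Y\<^esub> h x"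
  using assms by (auto simp: linear_map_def)

lemma linear_mapI:
  assumes "\<And>x. x \<in> carrier X \<Longrightarrow> h x \<in> carrier Y"
    and "\<And>x y. x \<in> carrier X \<Longrightarrow> y \<in> carrier X \<Longrightarrow> h (x \<oplus>\<^bsub>X\<^esub> y) = h x \<oplus>\<^bsub>Y\<^esub> h y"
    and "\<And>c x. x \<in> carrier X \<Longrightarrow> h (c \<odot>\<^bsub>X\<^esub> x) = c \<odot>\<^bsub>Y\<^esub> h x"
  shows "linear_map X Y h"
  using assms by (auto simp: linear_map_def)

lemma linear_map_cong:
  assumes "lin_space X" "\<And>x. x \<in> carrier X \<Longrightarrow> h x = g x"
  shows "linear_map X Y h \<longleftrightarrow> linear_map X Y g"
proof -
  interpret lin_space X by fact
  show ?thesis using assms(2) by (simp add: linear_map_def Pi_iff)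
qed

lemma linear_map_compose: "linear_map X Y h \<Longrightarrow> linear_map Y Z g \<Longrightarrow> linear_map X Z (\<lambda>x. g (h x))"
  by (simp add: linear_map_def Pi_iff)

lemma linear_map_zero:
  assumes "lin_space X" "lin_space Y" "linear_map X Y h"
  shows "h \<zero>\<^bsub>X\<^esub> = \<zero>\<^bsub>Y\<^esub>"
proof -
  interpret X: lin_space X by fact
  interpret Y: lin_space Y by fact
  have "h (0 \<odot>\<^bsub>X\<^esub> \<zero>\<^bsub>X\<^esub>) = 0 \<odot>\<^bsub>Y\<^esub> h \<zero>\<^bsub>X\<^esub>"
    using linear_mapD(3)[OF assms(3) X.M.zero_closed] by simp
  then show ?thesis
    using linear_mapD(1)[OF assms(3) X.M.zero_closed] by simp
qed

lemma linear_map_neg: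
  assumes "lin_space X" "lin_space Y" "linear_map X Y h" "x \<in> carrier X"
  shows "h (\<ominus>\<^bsub>X\<^esub> x) = \<ominus>\<^bsub>Y\<^esub> h x"
proof -
  interpret X: lin_space X by fact
  interpret Y: lin_space Y by fact
  show ?thesis
    using assms(3,4) by (simp add: X.neg_eq_smult Y.neg_eq_smult linear_mapD)
qed

lemma linear_map_diff:
  assumes "lin_space X" "lin_space Y" "linear_map X Y h" "x \<in> carrier X" "y \<in> carrier X"
  shows "h (x \<ominus>\<^bsub>X\<^esub> y) = h x \<ominus>\<^bsub>Y\<^esub> h y"
proof -
  interpret X: lin_space X by fact
  interpret Y: lin_space Y by fact
  show ?thesis
    using assms by (simp add: a_minus_def linear_mapD linear_map_neg)
qed

lemma linear_map_finsum:
  assumes "lin_space X" "lin_space Y" "linear_map X Y h" "finite I" "g \<in> I \<rightarrow> carrier X"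
  shows "h (\<Oplus>\<^bsub>X\<^esub> i\<in>I. g i) = (\<Oplus>\<^bsub>Y\<^esub> i\<in>I. h (g i))"
proof -
  interpret X: lin_space X by fact
  interpret Y: lin_space Y by fact
  show ?thesis using assms(4,5)
  proof (induction I rule: finite_induct)
    case empty
    then show ?case using assms by (simp add: linear_map_zero)
  next
    case (insert i I)
    then have "g \<in> I \<rightarrow> carrier X" "g i \<in> carrier X" by auto
    then show ?case using insert assms(3) X.M.finsum_closed[of g I]
      by (simp add: linear_mapD Pi_iff)
  qed
qed

lemma linear_map_add:
  assumes "lin_space X" "lin_space Y" "linear_map X Y h" "linear_map X Y g"
  shows "linear_map X Y (\<lambda>x. h x \<oplus>\<^bsub>Y\<^esub> g x)"
proof -
  interpret Y: lin_space Y by fact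
  show ?thesis
    by (rule linear_mapI)
      (use assms(3,4) in \<open>simp_all add: linear_mapD Y.smult_add_right Y.M.a_ac\<close>)
qed

lemma linear_map_smult:
  assumes "lin_space X" "lin_space Y" "linear_map X Y h"
  shows "linear_map X Y (\<lambda>x. c \<odot>\<^bsub>Y\<^esub> h x)"
proof -
  interpret Y: lin_space Y by fact
  show ?thesis
    by (rule linear_mapI)
      (use assms(3) in \<open>simp_all add: linear_mapD Y.smult_add_right Y.smult_smult mult.commute\<close>)
qed

lemma linear_map_const_zero:
  assumes "lin_space X" "lin_space Y"
  shows "linear_map X Y (\<lambda>x. \<zero>\<^bsub>Y\<^esub>)"
proof -
  interpret Y: lin_space Y by fact
  show ?thesis by (rule linear_mapI) simp_all
qed

section \<open>Seminorms\<close>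

definition seminorm_on :: "(complex, 'a, 'm) module_scheme \<Rightarrow> ('a \<Rightarrow> real) \<Rightarrow> bool" where
  "seminorm_on X p \<longleftrightarrow>
    (\<forall>x\<in>carrier X. \<forall>y\<in>carrier X. p (x \<oplus>\<^bsub>X\<^esub> y) \<le> p x + p y)
    \<and> (\<forall>c. \<forall>x\<in>carrier X. p (c \<odot>\<^bsub>X\<^esub> x) = cmod c * p x)"

abbreviation cseminorms :: "'a lcs \<Rightarrow> ('a \<Rightarrow> real) set" where
  "cseminorms X \<equiv> {p. continuous_seminorm X p}"

lemma continuous_seminorm_iff:
  "continuous_seminorm X p \<longleftrightarrow> seminorm_on X p \<and> continuous_map (topo X) euclideanreal p"
  by (auto simp: continuous_seminorm_def seminorm_on_def)

context lin_space
begin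

lemma
  assumes "seminorm_on X p"
  shows seminorm_add: "x \<in> carrier X \<Longrightarrow> y \<in> carrier X \<Longrightarrow> p (x \<oplus> y) \<le> p x + p y"
    and seminorm_smult: "x \<in> carrier X \<Longrightarrow> p (c \<odot> x) = cmod c * p x"
    and seminorm_zero: "p \<zero> = 0"
    and seminorm_nonneg: "x \<in> carrier X \<Longrightarrow> 0 \<le> p x"
    and seminorm_diff_commute: "x \<in> carrier X \<Longrightarrow> y \<in> carrier X \<Longrightarrow> p (x \<ominus> y) = p (y \<ominus> x)"
    and seminorm_diff_le: "x \<in> carrier X \<Longrightarrow> y \<in> carrier X \<Longrightarrow> p (x \<ominus> y) \<le> p x + p y"
    and seminorm_triangle: "x \<in> carrier X \<Longrightarrow> y \<in> carrier X \<Longrightarrow> z \<in> carrier X \<Longrightarrow>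
      p (x \<ominus> z) \<le> p (x \<ominus> y) + p (y \<ominus> z)"
    and seminorm_abs_diff: "x \<in> carrier X \<Longrightarrow> y \<in> carrier X \<Longrightarrow> \<bar>p x - p y\<bar> \<le> p (x \<ominus> y)"
proof -
  show *: "p (x \<oplus> y) \<le> p x + p y" if "x \<in> carrier X" "y \<in> carrier X" for x y
    using assms that by (auto simp: seminorm_on_def)
  show **: "p (c \<odot> x) = cmod c * p x" if "x \<in> carrier X" for x c
    using assms that by (auto simp: seminorm_on_def)
  show z: "p \<zero> = 0" using **[of \<zero> 0] by simp
  have n: "p (\<ominus> x) = p x" if "x \<in> carrier X" for x
    using **[of x "-1"] that by (simp add: neg_eq_smult)
  show "0 \<le> p x" if "x \<in> carrier X" for x
    using *[of x "\<ominus> x"] n[of x] z that by (simp add: M.r_neg)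
  show c: "p (x \<ominus> y) = p (y \<ominus> x)" if "x \<in> carrier X" "y \<in> carrier X" for x y
    using n[of "x \<ominus> y"] that by (simp add: neg_diff)
  show "p (x \<ominus> y) \<le> p x + p y" if "x \<in> carrier X" "y \<in> carrier X" for x y
    using *[of x "\<ominus> y"] n[of y] that by (simp add: M.minus_eq)
  show "p (x \<ominus> z) \<le> p (x \<ominus> y) + p (y \<ominus> z)" if "x \<in> carrier X" "y \<in> carrier X" "z \<in> carrier X" for x y z
    using *[of "x \<ominus> y" "y \<ominus> z"] that by (simp add: diff_add_diff)
  show "\<bar>p x - p y\<bar> \<le> p (x \<ominus> y)" if "x \<in> carrier X" "y \<in> carrier X" for x y
    using *[of y "x \<ominus> y"] *[of x "y \<ominus> x"] c[of x y] that by simp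
qed

lemma seminorm_finsum:
  assumes "seminorm_on X p" "finite I" "g \<in> I \<rightarrow> carrier X"
  shows "p (\<Oplus>i\<in>I. g i) \<le> (\<Sum>i\<in>I. p (g i))"
  using assms(2,3)
proof (induction I rule: finite_induct)
  case empty
  then show ?case by (simp add: seminorm_zero[OF assms(1)])
next
  case (insert i I)
  then have *: "g \<in> I \<rightarrow> carrier X" "g i \<in> carrier X" by auto
  show ?case using insert * seminorm_add[OF assms(1) *(2) M.finsum_closed[OF *(1)]]
    by (simp add: Pi_iff)
qed

lemma seminorm_on_add: "seminorm_on X p \<Longrightarrow> seminorm_on X q \<Longrightarrow> seminorm_on X (\<lambda>x. p x + q x)"
  unfolding seminorm_on_def by (auto simp: algebra_simps) (smt (verit))

lemma seminorm_on_zero: "seminorm_on X (\<lambda>x. 0)"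
  by (simp add: seminorm_on_def)

text \<open>An inclusion between balls becomes an inequality between seminorms by homogeneity.\<close>

lemma seminorm_le_of_ball:
  assumes p: "seminorm_on X p" and q: "seminorm_on X q" and e: "0 < e"
    and ball: "\<And>x. x \<in> carrier X \<Longrightarrow> p x < e \<Longrightarrow> q x < 1" and x: "x \<in> carrier X"
  shows "q x \<le> (2 / e) * p x"
proof (cases "p x = 0")
  case True
  have "q x = 0"
  proof (rule ccontr)
    assume "q x \<noteq> 0"
    then have "q x > 0" using seminorm_nonneg[OF q x] by simp
    have "q (complex_of_real (1 / q x) \<odot> x) < 1"
      by (rule ball) (use x e True in \<open>simp_all add: seminorm_smult[OF p]\<close>)
    then show False using \<open>q x > 0\<close> x by (simp add: seminorm_smult[OF q] norm_divide)
  qed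
  then show ?thesis using True by simp
next
  case False
  then have pos: "p x > 0" using seminorm_nonneg[OF p x] by simp
  have "q (complex_of_real (e / (2 * p x)) \<odot> x) < 1"
    by (rule ball) (use x e pos in \<open>simp_all add: seminorm_smult[OF p] norm_divide norm_mult\<close>)
  then show ?thesis using pos x e
    by (simp add: seminorm_smult[OF q] norm_divide norm_mult field_simps)
qed

end

lemma seminorm_on_comp: "linear_map X Y h \<Longrightarrow> seminorm_on Y p \<Longrightarrow> seminorm_on X (\<lambda>x. p (h x))"
  by (simp add: seminorm_on_def linear_mapD)

definition sball :: "(complex, 'a, 'm) module_scheme \<Rightarrow> ('a \<Rightarrow> real) \<Rightarrow> 'a \<Rightarrow> real \<Rightarrow> 'a set" where
  "sball X p x e = {y \<in> carrier X. p (y \<ominus>\<^bsub>X\<^esub> x) < e}"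

text \<open>The topology of a space is given by a family of seminorms: the balls of single members of the
  family are a base of neighbourhoods.\<close>

definition generates :: "'a lcs \<Rightarrow> ('a \<Rightarrow> real) set \<Rightarrow> bool" where
  "generates X P \<longleftrightarrow> P \<noteq> {} \<and> (\<forall>p\<in>P. seminorm_on X p) \<and>
     (\<forall>U. openin (topo X) U \<longleftrightarrow>
        U \<subseteq> carrier X \<and> (\<forall>x\<in>U. \<exists>p\<in>P. \<exists>e>0. sball X p x e \<subseteq> U))"

lemma generates_sball_open:
  assumes "lin_space X" "generates X P" "p \<in> P" "x \<in> carrier X"
  shows "openin (topo X) (sball X p x e)"
proof -
  interpret lin_space X by fact
  have p: "seminorm_on X p" using assms by (auto simp: generates_def)
  have "sball X p y (e - p (y \<ominus>\<^bsub>X\<^esub> x)) \<subseteq> sball X p x e" if "y \<in> sball X p x e" for y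
    using that seminorm_triangle[OF p, of _ y x] assms(4) by (force simp: sball_def)
  moreover have "e - p (y \<ominus>\<^bsub>X\<^esub> x) > 0" if "y \<in> sball X p x e" for y
    using that by (simp add: sball_def)
  moreover have "sball X p x e \<subseteq> carrier X" by (auto simp: sball_def)
  ultimately show ?thesis using assms(2,3) unfolding generates_def by meson
qed

text \<open>The topology generated by a family of seminorms has finite intersections of balls as a base. If the
  family is directed, single balls suffice.\<close>

lemma generates_seminorm_topology:
  assumes "lin_space V" and P: "\<And>p. p \<in> P \<Longrightarrow> seminorm_on V p" and "P \<noteq> {}"
    and dir: "\<And>p q. p \<in> P \<Longrightarrow> q \<in> P \<Longrightarrow> \<exists>r\<in>P. \<forall>x\<in>carrier V. p x \<le> r x \<and> q x \<le> r x"
  shows "generates (with_topology V (seminorm_topology V P)) P" (is "generates ?X P")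
proof -
  interpret lin_space V by fact
  have sball: "sball ?X = sball V" by (simp add: sball_def fun_eq_iff)
  let ?\<S> = "insert (carrier V) {{y \<in> carrier V. p (y \<ominus>\<^bsub>V\<^esub> x) < e} | p x e. p \<in> P \<and> x \<in> carrier V \<and> 0 < e}"
  have carr: "U \<subseteq> carrier V" if "generate_topology_on ?\<S> U" for U
    using that by induction auto
  have sub: "\<exists>p\<in>P. \<exists>e>0. sball V p x e \<subseteq> U"
    if "generate_topology_on ?\<S> U" "x \<in> U" for U x
    using that
  proof (induction arbitrary: x)
    case Empty
    then show ?case by simp
  next
    case (Int a b)
    then have x: "x \<in> a" "x \<in> b" by auto
    obtain p e where p: "p \<in> P" "e > 0" "sball V p x e \<subseteq> a" using Int.IH(1)[OF x(1)] by auto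
    obtain q d where q: "q \<in> P" "d > 0" "sball V q x d \<subseteq> b" using Int.IH(2)[OF x(2)] by auto
    obtain r where r: "r \<in> P" "\<And>x. x \<in> carrier V \<Longrightarrow> p x \<le> r x \<and> q x \<le> r x"
      using dir[OF p(1) q(1)] by blast
    have "x \<in> carrier V" using carr[OF Int(1)] x by auto
    then have "sball V r x (min e d) \<subseteq> sball V p x e \<inter> sball V q x d"
      using order.strict_trans1[OF conjunct1[OF r(2)]] order.strict_trans1[OF conjunct2[OF r(2)]]
      by (auto simp: sball_def)
    then show ?case using r(1) p q
      by (intro bexI[of _ r] exI[of _ "min e d"]) auto
  next
    case (UN K)
    then obtain k where k: "k \<in> K" "x \<in> k" by auto
    from UN.IH[OF this] k show ?case by blast
  next
    case (Basis s)
    then consider "s = carrier V" | q z e where "q \<in> P" "z \<in> carrier V" "e > 0" "s = sball V q z e"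
      by (auto simp: sball_def)
    then show ?case
    proof cases
      case 1
      obtain p where "p \<in> P" using \<open>P \<noteq> {}\<close> by auto
      moreover have "sball V p x 1 \<subseteq> s" using 1 by (auto simp: sball_def)
      ultimately show ?thesis by (meson zero_less_one)
    next
      case 2
      have "x \<in> carrier V" "q (x \<ominus>\<^bsub>V\<^esub> z) < e" using 2 Basis by (auto simp: sball_def)
      moreover have "sball V q x (e - q (x \<ominus>\<^bsub>V\<^esub> z)) \<subseteq> s"
        using 2 seminorm_triangle[OF P[OF 2(1)] _ _ 2(2), of _ x] \<open>x \<in> carrier V\<close>
        by (fastforce simp: sball_def)
      ultimately show ?thesis using 2 by (meson diff_gt_0_iff_gt)
    qed
  qed
  have "generate_topology_on ?\<S> U"
    if U: "U \<subseteq> carrier V" "\<forall>x\<in>U. \<exists>p\<in>P. \<exists>e>0. sball V p x e \<subseteq> U" for U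
  proof -
    let ?K = "{S. S \<subseteq> U \<and> (\<exists>p\<in>P. \<exists>e>0. \<exists>x\<in>carrier V. S = sball V p x e)}"
    have "generate_topology_on ?\<S> (\<Union>?K)"
    proof (rule generate_topology_on.UN)
      fix k assume "k \<in> ?K"
      then obtain p e x where "p \<in> P" "e > 0" "x \<in> carrier V" "k = sball V p x e" by blast
      then have "k \<in> ?\<S>" unfolding sball_def by blast
      then show "generate_topology_on ?\<S> k" by (rule generate_topology_on.Basis)
    qed
    moreover have "\<Union>?K = U"
    proof
      show "U \<subseteq> \<Union>?K"
      proof
        fix x assume x: "x \<in> U"
        then obtain p e where *: "p \<in> P" "e > 0" "sball V p x e \<subseteq> U" using U(2) by meson
        have xV: "x \<in> carrier V" using x U(1) by blast
        then have "x \<in> sball V p x e"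
          using P[OF *(1)] *(2) by (simp add: sball_def seminorm_zero)
        then show "x \<in> \<Union>?K" using * xV by blast
      qed
    qed blast
    ultimately show ?thesis by (simp only:)
  qed
  then have opn: "openin (seminorm_topology V P) U \<longleftrightarrow>
      U \<subseteq> carrier V \<and> (\<forall>x\<in>U. \<exists>p\<in>P. \<exists>e>0. sball V p x e \<subseteq> U)" for U
    unfolding seminorm_topology_def openin_topology_generated_by_iff
    by (intro iffI conjI ballI carr sub) (assumption | blast)+
  show ?thesis unfolding generates_def sball
  proof (intro conjI ballI allI)
    show "seminorm_on ?X p" if "p \<in> P" for p using P[OF that] by (simp add: seminorm_on_def)
  qed (use \<open>P \<noteq> {}\<close> in \<open>simp_all only: with_topology_sel opn not_False_eq_True\<close>)
qed

text \<open>Balls of seminorms are convex, and the operations are continuous by the triangle inequality and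
  homogeneity.\<close>

lemma generates_locally_convex:
  fixes X :: "'a lcs" (structure)
  assumes "lin_space X" and gen: "generates X P"
  shows "locally_convex X"
proof -
  interpret lin_space X by fact
  have P: "seminorm_on X p" if "p \<in> P" for p using gen that by (auto simp: generates_def)
  have opn: "openin (topo X) U \<longleftrightarrow> U \<subseteq> carrier X \<and> (\<forall>x\<in>U. \<exists>p\<in>P. \<exists>e>0. sball X p x e \<subseteq> U)" for U
    using gen by (auto simp: generates_def)
  have mem: "x \<in> sball X p x e" if "x \<in> carrier X" "p \<in> P" "e > 0" for x p e
    using that P by (simp add: sball_def seminorm_zero)
  have sbo: "openin (topo X) (sball X p x e)" if "p \<in> P" "x \<in> carrier X" for p x e
    using generates_sball_open[OF assms] that by blast
  obtain p0 where p0: "p0 \<in> P" using gen by (auto simp: generates_def)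
  have "openin (topo X) (carrier X)"
    unfolding opn using p0 by (auto simp: sball_def intro!: bexI[of _ p0] exI[of _ 1])
  then have ts: "topspace (topo X) = carrier X"
    using opn by (metis openin_subset openin_topspace subset_antisym)
  show ?thesis
  proof unfold_locales
    show "topspace (topo X) = carrier X" by (rule ts)
    show "continuous_map (prod_topology (topo X) (topo X)) (topo X) (\<lambda>(x, y). x \<oplus> y)"
      unfolding continuous_map_def openin_prod_topology_alt
    proof (intro conjI allI impI)
      fix U x y assume U: "openin (topo X) U"
        and "(x, y) \<in> {z \<in> topspace (prod_topology (topo X) (topo X)). (case z of (x, y) \<Rightarrow> x \<oplus> y) \<in> U}"
      then have xy: "x \<in> carrier X" "y \<in> carrier X" "x \<oplus> y \<in> U" by (auto simp: ts)
      then obtain p e where p: "p \<in> P" "e > 0" "sball X p (x \<oplus> y) e \<subseteq> U" using U opn by blast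
      have "x' \<oplus> y' \<in> U" if "x' \<in> sball X p x (e/2)" "y' \<in> sball X p y (e/2)" for x' y'
      proof -
        have *: "x' \<in> carrier X" "y' \<in> carrier X" "p (x' \<ominus> x) < e/2" "p (y' \<ominus> y) < e/2"
          using that by (auto simp: sball_def)
        then have "p ((x' \<oplus> y') \<ominus> (x \<oplus> y)) < e"
          using seminorm_add[OF P[OF p(1)], of "x' \<ominus> x" "y' \<ominus> y"] xy by (simp add: add_diff_add)
        then show ?thesis using p(3) * by (auto simp: sball_def)
      qed
      then show "\<exists>Ua V. openin (topo X) Ua \<and> openin (topo X) V \<and> x \<in> Ua \<and> y \<in> V \<and>
            Ua \<times> V \<subseteq> {z \<in> topspace (prod_topology (topo X) (topo X)). (case z of (x, y) \<Rightarrow> x \<oplus> y) \<in> U}"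
        using p(1,2) xy
        by (intro exI[of _ "sball X p x (e/2)"] exI[of _ "sball X p y (e/2)"])
          (auto simp: sbo mem ts, auto simp: sball_def)
    qed (auto simp: ts)
    show "continuous_map (prod_topology euclidean (topo X)) (topo X) (\<lambda>(c, x). c \<odot> x)"
      unfolding continuous_map_def openin_prod_topology_alt
    proof (intro conjI allI impI)
      fix U and c :: complex and x assume U: "openin (topo X) U"
        and "(c, x) \<in> {z \<in> topspace (prod_topology euclidean (topo X)). (case z of (c, x) \<Rightarrow> c \<odot> x) \<in> U}"
      then have x: "x \<in> carrier X" "c \<odot> x \<in> U" by (auto simp: ts)
      then obtain p e where p: "p \<in> P" "e > 0" "sball X p (c \<odot> x) e \<subseteq> U" using U opn by blast
      define d where "d = e / (2 * (p x + 1))"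
      define r where "r = e / (2 * (cmod c + d + 1))"
      have px: "p x \<ge> 0" using P p(1) x(1) by (simp add: seminorm_nonneg)
      then have d: "d > 0" "d * p x < e / 2" using p(2) by (auto simp: d_def field_simps)
      then have r: "r > 0" "(cmod c + d) * r < e / 2" using p(2)
        by (auto simp: r_def field_simps add_pos_nonneg add_nonneg_pos intro: add_pos_nonneg)
      have "c' \<odot> x' \<in> U" if "c' \<in> ball c d" "x' \<in> sball X p x r" for c' x'
      proof -
        have *: "x' \<in> carrier X" "p (x' \<ominus> x) < r" "cmod (c' - c) < d"
          using that by (auto simp: sball_def dist_norm norm_minus_commute)
        have "cmod c' \<le> cmod c + d" using *(3) norm_triangle_sub[of c' c] by simp
        have "(c' \<odot> x') \<ominus> (c \<odot> x) = c' \<odot> (x' \<ominus> x) \<oplus> (c' - c) \<odot> x"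
          using * x by (simp add: smult_diff smult_diff_left diff_add_diff)
        then have "p ((c' \<odot> x') \<ominus> (c \<odot> x)) \<le> cmod c' * p (x' \<ominus> x) + cmod (c' - c) * p x"
          using * x seminorm_add[OF P[OF p(1)], of "c' \<odot> (x' \<ominus> x)" "(c' - c) \<odot> x"]
          by (simp add: seminorm_smult[OF P[OF p(1)]])
        also have "\<dots> \<le> (cmod c + d) * r + d * p x"
          using * px \<open>cmod c' \<le> cmod c + d\<close> seminorm_nonneg[OF P[OF p(1)], of "x' \<ominus> x"] x d
          by (intro add_mono mult_mono) auto
        finally show ?thesis using p(3) * d r x by (auto simp: sball_def)
      qed
      then show "\<exists>Ua V. openin euclidean Ua \<and> openin (topo X) V \<and> c \<in> Ua \<and> x \<in> V \<and>
            Ua \<times> V \<subseteq> {z \<in> topspace (prod_topology euclidean (topo X)). (case z of (c, x) \<Rightarrow> c \<odot> x) \<in> U}"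
        using p(1) d(1) r(1) x
        by (intro exI[of _ "ball c d"] exI[of _ "sball X p x r"])
          (auto simp: sbo mem ts, auto simp: sball_def)
    qed (auto simp: ts)
    fix U assume "openin (topo X) U" "\<zero> \<in> U"
    then obtain p e where p: "p \<in> P" "e > 0" "sball X p \<zero> e \<subseteq> U" using opn by blast
    have "complex_of_real (1 - t) \<odot> x \<oplus> complex_of_real t \<odot> y \<in> sball X p \<zero> e"
      if "x \<in> sball X p \<zero> e" "y \<in> sball X p \<zero> e" "t \<in> {0..1}" for x y t
    proof -
      have *: "x \<in> carrier X" "y \<in> carrier X" "p x < e" "p y < e"
        using that by (auto simp: sball_def)
      have "p (complex_of_real (1 - t) \<odot> x \<oplus> complex_of_real t \<odot> y) \<le> (1 - t) * p x + t * p y"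
        using seminorm_add[OF P[OF p(1)], of "complex_of_real (1 - t) \<odot> x" "complex_of_real t \<odot> y"]
          * that(3) norm_of_real[of "1 - t", where ?'a = complex] norm_of_real[of t, where ?'a = complex]
        by (simp add: seminorm_smult[OF P[OF p(1)]] del: of_real_diff norm_of_real)
      also have "\<dots> < e"
        using convex_bound_lt[of "p x" e "p y" "1 - t" t] * that(3) by simp
      finally show ?thesis using * by (simp add: sball_def)
    qed
    then show "\<exists>V. openin (topo X) V \<and> \<zero> \<in> V \<and> V \<subseteq> U \<and>
          (\<forall>x\<in>V. \<forall>y\<in>V. \<forall>t\<in>{0..1}. complex_of_real (1 - t) \<odot> x \<oplus> complex_of_real t \<odot> y \<in> V)"
      using p by (intro exI[of _ "sball X p \<zero> e"]) (auto simp: sbo mem)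
  qed
qed

sublocale locally_convex \<subseteq> lin_space X ..

context locally_convex
begin

lemma continuous_scale_translate:
  assumes "x \<in> carrier X"
  shows "continuous_map (topo X) (topo X) (\<lambda>y. c \<odot>\<^bsub>X\<^esub> (y \<ominus>\<^bsub>X\<^esub> x))"
proof -
  have "continuous_map (topo X) (topo X) (\<lambda>y. y \<ominus>\<^bsub>X\<^esub> x)"
  proof -
    have "continuous_map (topo X) (topo X) ((\<lambda>(x, y). x \<oplus>\<^bsub>X\<^esub> y) \<circ> (\<lambda>y. (y, \<ominus>\<^bsub>X\<^esub> x)))"
      by (rule continuous_map_compose[OF _ continuous_add])
        (use assms in \<open>auto simp: continuous_map_pairwise o_def topspace_eq\<close>)
    then show ?thesis by (simp add: o_def a_minus_def)
  qed
  then have "continuous_map (topo X) (topo X) ((\<lambda>(c, x). c \<odot>\<^bsub>X\<^esub> x) \<circ> (\<lambda>y. (c, y \<ominus>\<^bsub>X\<^esub> x)))"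
    by (intro continuous_map_compose[OF _ continuous_smult]) (auto simp: continuous_map_pairwise o_def)
  then show ?thesis by (simp add: o_def)
qed

lemma openin_scale_translate:
  assumes "x \<in> carrier X" "openin (topo X) W"
  shows "openin (topo X) {y \<in> carrier X. c \<odot>\<^bsub>X\<^esub> (y \<ominus>\<^bsub>X\<^esub> x) \<in> W}"
  using openin_continuous_map_preimage[OF continuous_scale_translate[OF assms(1), of c] assms(2)]
  by (simp add: topspace_eq)

text \<open>Homogeneity turns a bound on a neighbourhood of zero into arbitrarily small values on smaller ones,
  and the triangle inequality moves these to any other vector.\<close>

lemma seminorm_continuousI:
  assumes p: "seminorm_on X p" and W: "openin (topo X) W" "\<zero>\<^bsub>X\<^esub> \<in> W"
    and le: "\<And>x. x \<in> W \<Longrightarrow> p x \<le> K"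
  shows "continuous_seminorm X p"
proof -
  have WX: "x \<in> carrier X" if "x \<in> W" for x using openin_subset[OF W(1)] that by (auto simp: topspace_eq)
  have K: "K \<ge> 0" using le[OF W(2)] seminorm_zero[OF p] by simp
  have "openin (topo X) {y \<in> topspace (topo X). p y \<in> U}" if U: "open U" for U
    unfolding openin_subopen[where S = "{y \<in> topspace (topo X). p y \<in> U}"]
  proof
    fix x assume "x \<in> {y \<in> topspace (topo X). p y \<in> U}"
    then have x: "x \<in> carrier X" "p x \<in> U" by (auto simp: topspace_eq)
    then obtain e where e: "e > 0" "ball (p x) e \<subseteq> U" using U open_contains_ball by blast
    define c where "c = (K + 1) / e"
    have c: "c > 0" "c * e = K + 1" using e K by (auto simp: c_def)
    let ?T = "{y \<in> carrier X. complex_of_real c \<odot>\<^bsub>X\<^esub> (y \<ominus>\<^bsub>X\<^esub> x) \<in> W}"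
    have "p y \<in> U" if "y \<in> ?T" for y
    proof -
      have "c * p (y \<ominus>\<^bsub>X\<^esub> x) \<le> K"
        using le[of "complex_of_real c \<odot>\<^bsub>X\<^esub> (y \<ominus>\<^bsub>X\<^esub> x)"] that x c by (simp add: seminorm_smult[OF p])
      then have "c * p (y \<ominus>\<^bsub>X\<^esub> x) < c * e" using c by simp
      then have "p (y \<ominus>\<^bsub>X\<^esub> x) < e" using c(1) by simp
      then have "\<bar>p x - p y\<bar> < e" using seminorm_abs_diff[OF p, of y x] that x by simp
      then show ?thesis using e(2) by (auto simp: dist_real_def)
    qed
    then show "\<exists>T. openin (topo X) T \<and> x \<in> T \<and> T \<subseteq> {y \<in> topspace (topo X). p y \<in> U}"
      using x W by (intro exI[of _ ?T]) (auto simp: topspace_eq openin_scale_translate)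
  qed
  then show ?thesis using p by (simp add: continuous_seminorm_iff continuous_map_def)
qed

text \<open>The Minkowski gauge. Balancedness comes from passing to the set of all vectors whose multiples
  by scalars of modulus at most one stay in a convex neighbourhood; by joint continuity of the
  multiplication by scalars, this set still is a neighbourhood of zero.\<close>

lemma seminorm_in_neighbourhood:
  assumes U: "openin (topo X) U" "\<zero>\<^bsub>X\<^esub> \<in> U"
  obtains p where "continuous_seminorm X p" "\<And>x. x \<in> carrier X \<Longrightarrow> p x < 1 \<Longrightarrow> x \<in> U"
proof -
  obtain V where V: "openin (topo X) V" "\<zero>\<^bsub>X\<^esub> \<in> V" "V \<subseteq> U"
    and conv: "\<And>x y t. x \<in> V \<Longrightarrow> y \<in> V \<Longrightarrow> t \<in> {0..1::real} \<Longrightarrow>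
        (complex_of_real (1 - t) \<odot>\<^bsub>X\<^esub> x) \<oplus>\<^bsub>X\<^esub> (complex_of_real t \<odot>\<^bsub>X\<^esub> y) \<in> V"
    using convex_base[OF U] by blast
  define B where "B = {x \<in> carrier X. \<forall>c. cmod c \<le> 1 \<longrightarrow> c \<odot>\<^bsub>X\<^esub> x \<in> V}"
  have BX: "x \<in> carrier X" if "x \<in> B" for x using that by (simp add: B_def)
  have BV: "x \<in> V" if "x \<in> B" for x
    using that one_smult[of x] by (auto simp: B_def dest: spec[of _ 1])
  have bal: "c \<odot>\<^bsub>X\<^esub> x \<in> B" if "x \<in> B" "cmod c \<le> 1" for c x
    using that by (auto simp: B_def smult_smult norm_mult mult_le_one)
  have Bconv: "(complex_of_real (1 - t) \<odot>\<^bsub>X\<^esub> x) \<oplus>\<^bsub>X\<^esub> (complex_of_real t \<odot>\<^bsub>X\<^esub> y) \<in> B"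
    if "x \<in> B" "y \<in> B" "t \<in> {0..1}" for x y t
  proof -
    have *: "x \<in> carrier X" "y \<in> carrier X" using that by (auto simp: BX)
    have "c \<odot>\<^bsub>X\<^esub> ((complex_of_real (1 - t) \<odot>\<^bsub>X\<^esub> x) \<oplus>\<^bsub>X\<^esub> (complex_of_real t \<odot>\<^bsub>X\<^esub> y)) \<in> V" if "cmod c \<le> 1" for c
    proof -
      have "c \<odot>\<^bsub>X\<^esub> x \<in> V" "c \<odot>\<^bsub>X\<^esub> y \<in> V" using \<open>x \<in> B\<close> \<open>y \<in> B\<close> that by (auto simp: B_def)
      from conv[OF this \<open>t \<in> _\<close>] show ?thesis
        using * by (simp add: smult_add_right smult_smult mult.commute)
    qed
    then show ?thesis using * by (simp add: B_def)
  qed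
  obtain W where W: "openin (topo X) W" "\<zero>\<^bsub>X\<^esub> \<in> W" "\<And>x. x \<in> W \<Longrightarrow> x \<in> B"
  proof -
    have "openin (prod_topology euclidean (topo X))
        {z \<in> topspace (prod_topology euclidean (topo X)). (case z of (c, x) \<Rightarrow> c \<odot>\<^bsub>X\<^esub> x) \<in> V}"
      by (rule openin_continuous_map_preimage[OF continuous_smult V(1)])
    from this[unfolded openin_prod_topology_alt, rule_format, of 0 "\<zero>\<^bsub>X\<^esub>"]
    obtain C W0 where CW: "open C" "openin (topo X) W0" "0 \<in> C" "\<zero>\<^bsub>X\<^esub> \<in> W0"
        and sub: "C \<times> W0 \<subseteq> {z \<in> topspace (prod_topology euclidean (topo X)). (case z of (c, x) \<Rightarrow> c \<odot>\<^bsub>X\<^esub> x) \<in> V}"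
      using V(2) by (auto simp: topspace_eq)
    obtain d where d: "d > 0" "ball 0 d \<subseteq> C" using CW open_contains_ball by blast
    let ?W = "{y \<in> carrier X. complex_of_real (2 / d) \<odot>\<^bsub>X\<^esub> (y \<ominus>\<^bsub>X\<^esub> \<zero>\<^bsub>X\<^esub>) \<in> W0}"
    have "y \<in> B" if "y \<in> ?W" for y
    proof -
      have y: "y \<in> carrier X" "complex_of_real (2 / d) \<odot>\<^bsub>X\<^esub> y \<in> W0" using that by auto
      have "c \<odot>\<^bsub>X\<^esub> y \<in> V" if c: "cmod c \<le> 1" for c
      proof -
        have "cmod (c * complex_of_real (d / 2)) < d" using c d(1) by (simp add: norm_mult)
        then have "c * complex_of_real (d / 2) \<in> C" using d(2) by (auto simp: dist_norm)
        then have "(c * complex_of_real (d / 2)) \<odot>\<^bsub>X\<^esub> (complex_of_real (2 / d) \<odot>\<^bsub>X\<^esub> y) \<in> V"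
          using sub y(2) by auto
        then show ?thesis using y(1) d(1) by (simp add: smult_smult)
      qed
      then show ?thesis using y by (simp add: B_def)
    qed
    moreover have "openin (topo X) ?W" by (rule openin_scale_translate[OF _ CW(2)]) simp
    moreover have "\<zero>\<^bsub>X\<^esub> \<in> ?W" using CW by simp
    ultimately show thesis using that by blast
  qed
  define S where "S x = {t. t > 0 \<and> complex_of_real (1 / t) \<odot>\<^bsub>X\<^esub> x \<in> B}" for x
  define g where "g x = Inf (S x)" for x
  have Sne: "\<exists>t. t \<in> S x" if x: "x \<in> carrier X" for x
  proof -
    have "continuous_map euclidean (topo X) ((\<lambda>(c, x). c \<odot>\<^bsub>X\<^esub> x) \<circ> (\<lambda>c. (c, x)))"
      by (rule continuous_map_compose[OF _ continuous_smult])
        (use x in \<open>auto simp: continuous_map_pairwise o_def topspace_eq\<close>)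
    then have "open {c. c \<odot>\<^bsub>X\<^esub> x \<in> W}"
      using openin_continuous_map_preimage[OF _ W(1), of euclidean] by (simp add: o_def)
    moreover have "0 \<in> {c. c \<odot>\<^bsub>X\<^esub> x \<in> W}" using x W by simp
    ultimately obtain r where r: "r > 0" "ball 0 r \<subseteq> {c. c \<odot>\<^bsub>X\<^esub> x \<in> W}"
      using open_contains_ball by meson
    have "complex_of_real (r / 2) \<in> ball 0 r" using r(1) by (simp add: dist_norm)
    then have "complex_of_real (r / 2) \<odot>\<^bsub>X\<^esub> x \<in> B" using r(2) W(3) by blast
    then have "2 / r \<in> S x" using r(1) by (simp add: S_def)
    then show ?thesis by blast
  qed
  have bdd: "bdd_below (S x)" for x by (rule bdd_belowI[of _ 0]) (simp add: S_def)
  have g_le: "g x \<le> t" if "t \<in> S x" for x t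
    unfolding g_def by (rule cInf_lower[OF that bdd])
  have g_nonneg: "g x \<ge> 0" if "x \<in> carrier X" for x
    unfolding g_def by (rule cInf_greatest) (use Sne[OF that] in \<open>auto simp: S_def\<close>)
  have S_up: "t \<in> S x" if x: "x \<in> carrier X" and t: "g x < t" for x t
  proof -
    obtain s where s: "s \<in> S x" "s < t"
      using t Sne[OF x] cInf_lessD[of "S x" t] by (auto simp: g_def)
    have "complex_of_real (s / t) \<odot>\<^bsub>X\<^esub> (complex_of_real (1 / s) \<odot>\<^bsub>X\<^esub> x) \<in> B"
      by (rule bal) (use s in \<open>auto simp: S_def norm_divide\<close>)
    then show ?thesis using s x by (simp add: S_def smult_smult)
  qed
  have g_scale: "g (c \<odot>\<^bsub>X\<^esub> x) \<le> cmod c * g x" if x: "x \<in> carrier X" and c: "c \<noteq> 0" for c x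
  proof -
    have "g (c \<odot>\<^bsub>X\<^esub> x) / cmod c \<le> t" if t: "g x < t" for t
    proof -
      have t0: "t > 0" using t g_nonneg[OF x] by simp
      have "(c / cmod c) \<odot>\<^bsub>X\<^esub> (complex_of_real (1 / t) \<odot>\<^bsub>X\<^esub> x) \<in> B"
        by (rule bal) (use S_up[OF x t] c in \<open>auto simp: S_def norm_divide\<close>)
      then have "cmod c * t \<in> S (c \<odot>\<^bsub>X\<^esub> x)"
        using x c t0 by (simp add: S_def smult_smult mult.commute)
      then show ?thesis using g_le c by (simp add: field_simps)
    qed
    then have "g (c \<odot>\<^bsub>X\<^esub> x) / cmod c \<le> g x" by (rule dense_ge)
    then show ?thesis using c by (simp add: field_simps)
  qed
  have sem: "seminorm_on X g"
    unfolding seminorm_on_def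
  proof (intro conjI ballI allI)
    fix x y assume x: "x \<in> carrier X" and y: "y \<in> carrier X"
    have "g (x \<oplus>\<^bsub>X\<^esub> y) \<le> g x + g y + e" if e: "e > 0" for e
    proof -
      define s t where "s = g x + e / 2" and "t = g y + e / 2"
      have st: "s > 0" "t > 0" using g_nonneg x y e by (auto simp: s_def t_def add_nonneg_pos)
      have "s \<in> S x" "t \<in> S y" using S_up x y e by (auto simp: s_def t_def)
      then have "(complex_of_real (1 - t / (s + t)) \<odot>\<^bsub>X\<^esub> (complex_of_real (1 / s) \<odot>\<^bsub>X\<^esub> x)) \<oplus>\<^bsub>X\<^esub>
          (complex_of_real (t / (s + t)) \<odot>\<^bsub>X\<^esub> (complex_of_real (1 / t) \<odot>\<^bsub>X\<^esub> y)) \<in> B"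
        using st by (intro Bconv) (auto simp: S_def)
      moreover have "(1 - t / (s + t)) * (1 / s) = 1 / (s + t)" "(t / (s + t)) * (1 / t) = 1 / (s + t)"
        using st by (simp_all add: field_simps)
      then have "complex_of_real (1 - t / (s + t)) \<odot>\<^bsub>X\<^esub> (complex_of_real (1 / s) \<odot>\<^bsub>X\<^esub> x) = complex_of_real (1 / (s + t)) \<odot>\<^bsub>X\<^esub> x"
        "complex_of_real (t / (s + t)) \<odot>\<^bsub>X\<^esub> (complex_of_real (1 / t) \<odot>\<^bsub>X\<^esub> y) = complex_of_real (1 / (s + t)) \<odot>\<^bsub>X\<^esub> y"
        using x y by (simp_all only: smult_smult of_real_mult[symmetric])
      ultimately have "complex_of_real (1 / (s + t)) \<odot>\<^bsub>X\<^esub> (x \<oplus>\<^bsub>X\<^esub> y) \<in> B"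
        by (simp only: smult_add_right[OF x y])
      then have "s + t \<in> S (x \<oplus>\<^bsub>X\<^esub> y)" using st by (simp add: S_def)
      then show ?thesis using g_le by (fastforce simp: s_def t_def)
    qed
    then show "g (x \<oplus>\<^bsub>X\<^esub> y) \<le> g x + g y" by (rule field_le_epsilon)
  next
    fix c x assume x: "x \<in> carrier X"
    show "g (c \<odot>\<^bsub>X\<^esub> x) = cmod c * g x"
    proof (cases "c = 0")
      case True
      have "\<zero>\<^bsub>X\<^esub> \<in> B" using W by blast
      then have "g \<zero>\<^bsub>X\<^esub> \<le> 0 + e" if "e > 0" for e using that by (intro g_le) (simp add: S_def)
      then have "g \<zero>\<^bsub>X\<^esub> \<le> 0" by (rule field_le_epsilon)
      then show ?thesis using True x g_nonneg[of "\<zero>\<^bsub>X\<^esub>"] by simp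
    next
      case False
      have "g x \<le> cmod (1 / c) * g (c \<odot>\<^bsub>X\<^esub> x)"
        using g_scale[of "c \<odot>\<^bsub>X\<^esub> x" "1 / c"] x False by (simp add: smult_smult)
      then have "cmod c * g x \<le> g (c \<odot>\<^bsub>X\<^esub> x)" using False by (simp add: norm_divide field_simps)
      then show ?thesis using g_scale[OF x False] by simp
    qed
  qed
  show thesis
  proof (rule that)
    have "g x \<le> 1" if "x \<in> W" for x
      using g_le[of 1 x] W(3)[OF that] BX by (simp add: S_def)
    then show "continuous_seminorm X g"
      using seminorm_continuousI[OF sem W(1,2)] by blast
    show "x \<in> U" if "x \<in> carrier X" "g x < 1" for x
    proof -
      have "1 \<in> S x" using S_up that by simp
      then have "x \<in> B" using that(1) by (simp add: S_def)
      then show ?thesis using BV V(3) by blast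
    qed
  qed
qed

text \<open>By the existence of gauges, every locally convex topology is described by its continuous seminorms.\<close>

lemma openin_iff_cseminorm:
  "openin (topo X) U \<longleftrightarrow>
    U \<subseteq> carrier X \<and> (\<forall>x\<in>U. \<exists>p\<in>cseminorms X. \<exists>e>0. sball X p x e \<subseteq> U)" (is "_ \<longleftrightarrow> ?R")
proof
  assume U: "openin (topo X) U"
  have UX: "U \<subseteq> carrier X" using openin_subset[OF U] by (simp add: topspace_eq)
  have "\<exists>p\<in>cseminorms X. \<exists>e>0. sball X p x e \<subseteq> U" if x: "x \<in> U" for x
  proof -
    have xX: "x \<in> carrier X" using x UX by blast
    let ?U = "{y \<in> carrier X. 1 \<odot>\<^bsub>X\<^esub> (y \<ominus>\<^bsub>X\<^esub> (\<ominus>\<^bsub>X\<^esub> x)) \<in> U}"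
    have "openin (topo X) ?U" by (rule openin_scale_translate[OF _ U]) (use xX in simp)
    moreover have "\<zero>\<^bsub>X\<^esub> \<in> ?U" using xX x by (simp add: a_minus_def)
    ultimately obtain p where p: "continuous_seminorm X p" "\<And>y. y \<in> carrier X \<Longrightarrow> p y < 1 \<Longrightarrow> y \<in> ?U"
      using seminorm_in_neighbourhood by blast
    have "y \<in> U" if "y \<in> sball X p x 1" for y
    proof -
      have y: "y \<in> carrier X" "p (y \<ominus>\<^bsub>X\<^esub> x) < 1" using that by (auto simp: sball_def)
      then have "y \<ominus>\<^bsub>X\<^esub> x \<in> ?U" using p(2) xX by blast
      then have "(y \<ominus>\<^bsub>X\<^esub> x) \<oplus>\<^bsub>X\<^esub> x \<in> U" using xX y(1) by (auto simp: a_minus_def)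
      then show ?thesis using xX y(1) by simp
    qed
    then show ?thesis using p(1) by (intro bexI[of _ p] exI[of _ 1]) auto
  qed
  then show ?R using UX by blast
next
  assume R: ?R
  show "openin (topo X) U"
    unfolding openin_subopen[where S = U]
  proof
    fix x assume x: "x \<in> U"
    then obtain p e where p: "continuous_seminorm X p" "e > 0" "sball X p x e \<subseteq> U" using R by auto
    have xX: "x \<in> carrier X" using x R by blast
    have "continuous_map (topo X) euclideanreal (p \<circ> (\<lambda>y. 1 \<odot>\<^bsub>X\<^esub> (y \<ominus>\<^bsub>X\<^esub> x)))"
      by (rule continuous_map_compose[OF continuous_scale_translate[OF xX]])
        (use p(1) in \<open>simp add: continuous_seminorm_iff\<close>)
    from openin_continuous_map_preimage[OF this, of "{..<e}"]
    have "openin (topo X) {y \<in> carrier X. p (1 \<odot>\<^bsub>X\<^esub> (y \<ominus>\<^bsub>X\<^esub> x)) < e}"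
      by (simp add: topspace_eq)
    also have "{y \<in> carrier X. p (1 \<odot>\<^bsub>X\<^esub> (y \<ominus>\<^bsub>X\<^esub> x)) < e} = sball X p x e"
      using xX by (auto simp: sball_def)
    finally have "openin (topo X) (sball X p x e)" .
    moreover have "x \<in> sball X p x e"
      using xX p(1,2) seminorm_zero[of p] by (simp add: sball_def continuous_seminorm_iff)
    ultimately show "\<exists>T. openin (topo X) T \<and> x \<in> T \<and> T \<subseteq> U" using p(3) by blast
  qed
qed

lemma generates_cseminorms: "generates X (cseminorms X)"
proof -
  have "continuous_seminorm X (\<lambda>x. 0)" by (simp add: continuous_seminorm_iff seminorm_on_zero)
  then show ?thesis unfolding generates_def openin_iff_cseminorm
    by (auto simp: continuous_seminorm_iff)
qed

lemma cseminormD: "continuous_seminorm X p \<Longrightarrow> seminorm_on X p"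
  by (simp add: continuous_seminorm_iff)

lemma cseminorm_dominated:
  assumes q: "seminorm_on X q" and p: "continuous_seminorm X p"
    and le: "\<And>x. x \<in> carrier X \<Longrightarrow> q x \<le> K * p x"
  shows "continuous_seminorm X q"
proof (rule seminorm_continuousI[OF q])
  show "openin (topo X) (sball X p \<zero>\<^bsub>X\<^esub> 1)"
    by (rule generates_sball_open[OF lin_space_axioms generates_cseminorms]) (use p in simp_all)
  show "\<zero>\<^bsub>X\<^esub> \<in> sball X p \<zero>\<^bsub>X\<^esub> 1" using p by (simp add: sball_def seminorm_zero cseminormD)
  fix x assume "x \<in> sball X p \<zero>\<^bsub>X\<^esub> 1"
  then have x: "x \<in> carrier X" "p x < 1" by (auto simp: sball_def)
  have "K * p x \<le> \<bar>K\<bar> * 1"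
    using x seminorm_nonneg[OF cseminormD[OF p] x(1)] by (intro mult_mono) auto
  then show "q x \<le> \<bar>K\<bar>" using le[OF x(1)] by simp
qed

lemma cseminorm_add:
  assumes "continuous_seminorm X p" "continuous_seminorm X q"
  shows "continuous_seminorm X (\<lambda>x. p x + q x)"
  using assms by (simp add: continuous_seminorm_iff seminorm_on_add continuous_map_add)

lemma cseminorm_zero: "continuous_seminorm X (\<lambda>x. 0)"
  by (simp add: continuous_seminorm_iff seminorm_on_zero)

lemma cseminorm_sum_list:
  assumes "\<And>p. p \<in> set ps \<Longrightarrow> continuous_seminorm X p"
  shows "continuous_seminorm X (\<lambda>x. \<Sum>p\<leftarrow>ps. p x)"
  using assms by (induction ps) (auto intro: cseminorm_zero cseminorm_add)

lemma generator_cseminorm: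
  assumes gen: "generates X P" and p: "p \<in> P"
  shows "continuous_seminorm X p"
proof -
  have s: "seminorm_on X p" using assms by (auto simp: generates_def)
  show ?thesis
    by (rule seminorm_continuousI[OF s generates_sball_open[OF lin_space_axioms gen p M.zero_closed, of 1], of 1])
      (use s in \<open>auto simp: sball_def seminorm_zero\<close>)
qed

lemma cseminorm_le_generator:
  assumes gen: "generates X P" and q: "continuous_seminorm X q"
  obtains p K where "p \<in> P" "K > 0" "\<And>x. x \<in> carrier X \<Longrightarrow> q x \<le> K * p x"
proof -
  have "openin (topo X) (sball X q \<zero>\<^bsub>X\<^esub> 1)"
    by (rule generates_sball_open[OF lin_space_axioms generates_cseminorms]) (use q in simp_all)
  moreover have "\<zero>\<^bsub>X\<^esub> \<in> sball X q \<zero>\<^bsub>X\<^esub> 1" using q by (simp add: sball_def seminorm_zero cseminormD)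
  ultimately obtain p e where p: "p \<in> P" "e > 0" "sball X p \<zero>\<^bsub>X\<^esub> e \<subseteq> sball X q \<zero>\<^bsub>X\<^esub> 1"
    using gen unfolding generates_def by blast
  have sp: "seminorm_on X p" using gen p(1) by (auto simp: generates_def)
  have ball: "q x < 1" if "x \<in> carrier X" "p x < e" for x
  proof -
    have "x \<in> sball X p \<zero>\<^bsub>X\<^esub> e" using that by (simp add: sball_def)
    then have "x \<in> sball X q \<zero>\<^bsub>X\<^esub> 1" using p(3) by blast
    then show ?thesis using that by (simp add: sball_def)
  qed
  show thesis
    by (rule that[OF p(1), of "2 / e"]) (use p(2) seminorm_le_of_ball[OF sp cseminormD[OF q] p(2) ball] in auto)
qed

text \<open>Nearness of filters tested on seminorms instead of neighbourhoods of zero.\<close>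

lemma cauchy_filter_on_iff:
  assumes "F \<le> principal (carrier X)" "G \<le> principal (carrier X)"
  shows "equiv_filters X F G \<longleftrightarrow>
    (\<forall>p. continuous_seminorm X p \<longrightarrow> (\<forall>e>0. eventually (\<lambda>(x, y). p (x \<ominus>\<^bsub>X\<^esub> y) < e) (F \<times>\<^sub>F G)))"
proof
  have carr: "eventually (\<lambda>z. fst z \<in> carrier X \<and> snd z \<in> carrier X) (F \<times>\<^sub>F G)"
    using assms by (auto simp: eventually_prod_filter le_principal)
  show "\<forall>p. continuous_seminorm X p \<longrightarrow> (\<forall>e>0. eventually (\<lambda>(x, y). p (x \<ominus>\<^bsub>X\<^esub> y) < e) (F \<times>\<^sub>F G))"
    if eq: "equiv_filters X F G"
  proof (intro allI impI)
    fix p and e :: real assume p: "continuous_seminorm X p" and e: "e > 0"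
    have "openin (topo X) (sball X p \<zero>\<^bsub>X\<^esub> e)"
      by (rule generates_sball_open[OF lin_space_axioms generates_cseminorms]) (use p in simp_all)
    moreover have "\<zero>\<^bsub>X\<^esub> \<in> sball X p \<zero>\<^bsub>X\<^esub> e" using p e by (simp add: sball_def seminorm_zero cseminormD)
    ultimately have "eventually (\<lambda>(x, y). x \<ominus>\<^bsub>X\<^esub> y \<in> sball X p \<zero>\<^bsub>X\<^esub> e) (F \<times>\<^sub>F G)"
      using eq by (simp add: equiv_filters_def)
    then show "eventually (\<lambda>(x, y). p (x \<ominus>\<^bsub>X\<^esub> y) < e) (F \<times>\<^sub>F G)"
      using carr by eventually_elim (auto simp: sball_def)
  qed
  show "equiv_filters X F G"
    if R: "\<forall>p. continuous_seminorm X p \<longrightarrow> (\<forall>e>0. eventually (\<lambda>(x, y). p (x \<ominus>\<^bsub>X\<^esub> y) < e) (F \<times>\<^sub>F G))"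
    unfolding equiv_filters_def
  proof (intro allI impI, elim conjE)
    fix U assume U: "openin (topo X) U" "\<zero>\<^bsub>X\<^esub> \<in> U"
    then obtain p where p: "continuous_seminorm X p" "\<And>x. x \<in> carrier X \<Longrightarrow> p x < 1 \<Longrightarrow> x \<in> U"
      using seminorm_in_neighbourhood by blast
    have "eventually (\<lambda>(x, y). p (x \<ominus>\<^bsub>X\<^esub> y) < 1) (F \<times>\<^sub>F G)" using R p(1) by simp
    then show "eventually (\<lambda>(x, y). x \<ominus>\<^bsub>X\<^esub> y \<in> U) (F \<times>\<^sub>F G)"
      using carr by eventually_elim (auto intro: p(2))
  qed
qed

end

section \<open>Continuity of linear maps\<close>

lemma continuous_linear_cseminorm:
  assumes "continuous_linear X Y h" "continuous_seminorm Y q"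
  shows "continuous_seminorm X (\<lambda>x. q (h x))"
proof -
  have "continuous_map (topo X) euclideanreal (q \<circ> h)"
    using assms by (intro continuous_map_compose) (auto simp: continuous_linear_def continuous_seminorm_iff)
  then show ?thesis
    using assms seminorm_on_comp[of X Y h q] by (simp add: continuous_linear_def continuous_seminorm_iff o_def)
qed

lemma continuous_linearI:
  assumes X: "locally_convex X" and Y: "lin_space Y" and gen: "generates Y Q" and lin: "linear_map X Y h"
    and le: "\<And>q. q \<in> Q \<Longrightarrow> \<exists>p K. continuous_seminorm X p \<and> (\<forall>x\<in>carrier X. q (h x) \<le> K * p x)"
  shows "continuous_linear X Y h"
proof -
  interpret X: locally_convex X by fact
  interpret Y: lin_space Y by fact
  have c: "continuous_seminorm X (\<lambda>x. q (h x))" if qQ: "q \<in> Q" for q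
  proof -
    obtain p K where p: "continuous_seminorm X p" "\<forall>x\<in>carrier X. q (h x) \<le> K * p x" using le[OF qQ] by blast
    have "seminorm_on Y q" using qQ gen by (auto simp: generates_def)
    then show ?thesis
      using p by (intro X.cseminorm_dominated[OF seminorm_on_comp[OF lin] p(1)]) auto
  qed
  have "openin (topo X) {x \<in> topspace (topo X). h x \<in> U}" if U: "openin (topo Y) U" for U
    unfolding X.openin_iff_cseminorm
  proof (intro conjI ballI)
    fix x assume "x \<in> {x \<in> topspace (topo X). h x \<in> U}"
    then have x: "x \<in> carrier X" "h x \<in> U" by (auto simp: X.topspace_eq)
    then obtain q e where q: "q \<in> Q" "e > 0" "sball Y q (h x) e \<subseteq> U"
      using U gen unfolding generates_def by blast
    have "y \<in> {x \<in> topspace (topo X). h x \<in> U}" if "y \<in> sball X (\<lambda>x. q (h x)) x e" for y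
    proof -
      have "y \<in> carrier X" "q (h y \<ominus>\<^bsub>Y\<^esub> h x) < e"
        using that x by (auto simp: sball_def linear_map_diff[OF X.lin_space_axioms Y lin])
      then have "y \<in> carrier X" "h y \<in> sball Y q (h x) e" by (auto simp: sball_def linear_mapD(1)[OF lin])
      then show ?thesis using q(3) by (auto simp: X.topspace_eq)
    qed
    then show "\<exists>p\<in>cseminorms X. \<exists>e>0. sball X p x e \<subseteq> {x \<in> topspace (topo X). h x \<in> U}"
      using c[OF q(1)] q(2) by (intro bexI[of _ "\<lambda>x. q (h x)"] exI[of _ e]) auto
  qed (auto simp: X.topspace_eq)
  moreover have "h x \<in> topspace (topo Y)" if "x \<in> carrier X" for x
  proof -
    have "openin (topo Y) (carrier Y)"
      using gen unfolding generates_def by (auto simp: sball_def intro!: exI[of _ 1])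
    then show ?thesis using linear_mapD(1)[OF lin that] openin_subset by blast
  qed
  ultimately show ?thesis using lin by (auto simp: continuous_linear_def continuous_map_def X.topspace_eq)
qed

lemma continuous_linear_compose:
  "continuous_linear X Y h \<Longrightarrow> continuous_linear Y Z g \<Longrightarrow> continuous_linear X Z (\<lambda>x. g (h x))"
  using continuous_map_compose[of "topo X" "topo Y" h "topo Z" g]
  by (auto simp: continuous_linear_def o_def intro: linear_map_compose)

lemma continuous_linear_add:
  assumes "locally_convex X" "locally_convex Y" "continuous_linear X Y h" "continuous_linear X Y g"
  shows "continuous_linear X Y (\<lambda>x. h x \<oplus>\<^bsub>Y\<^esub> g x)"
proof -
  interpret X: locally_convex X by fact
  interpret Y: locally_convex Y by fact
  have "continuous_map (topo X) (topo Y) ((\<lambda>(x, y). x \<oplus>\<^bsub>Y\<^esub> y) \<circ> (\<lambda>x. (h x, g x)))"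
    using assms by (intro continuous_map_compose[OF _ Y.continuous_add])
      (auto simp: continuous_linear_def continuous_map_pairwise o_def)
  then show ?thesis
    using assms linear_map_add[OF X.lin_space_axioms Y.lin_space_axioms] by (simp add: continuous_linear_def o_def)
qed

lemma continuous_linear_smult:
  assumes "locally_convex X" "locally_convex Y" "continuous_linear X Y h"
  shows "continuous_linear X Y (\<lambda>x. c \<odot>\<^bsub>Y\<^esub> h x)"
proof -
  interpret X: locally_convex X by fact
  interpret Y: locally_convex Y by fact
  have "continuous_map (topo X) (topo Y) ((\<lambda>(c, x). c \<odot>\<^bsub>Y\<^esub> x) \<circ> (\<lambda>x. (c, h x)))"
    using assms by (intro continuous_map_compose[OF _ Y.continuous_smult])
      (auto simp: continuous_linear_def continuous_map_pairwise o_def)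
  then show ?thesis
    using assms linear_map_smult[OF X.lin_space_axioms Y.lin_space_axioms] by (simp add: continuous_linear_def o_def)
qed

lemma continuous_linear_const_zero:
  assumes "locally_convex X" "locally_convex Y"
  shows "continuous_linear X Y (\<lambda>x. \<zero>\<^bsub>Y\<^esub>)"
proof -
  interpret X: locally_convex X by fact
  interpret Y: locally_convex Y by fact
  show ?thesis using linear_map_const_zero[OF X.lin_space_axioms Y.lin_space_axioms]
    by (simp add: continuous_linear_def Y.topspace_eq)
qed

lemma continuous_linear_cong:
  assumes "locally_convex X" "\<And>x. x \<in> carrier X \<Longrightarrow> h x = g x" "continuous_linear X Y h"
  shows "continuous_linear X Y g"
proof -
  interpret locally_convex X by fact
  have "continuous_map (topo X) (topo Y) g"
    by (rule continuous_map_eq[of "topo X" "topo Y" h]) (use assms in \<open>auto simp: continuous_linear_def topspace_eq\<close>)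
  then show ?thesis using assms linear_map_cong[OF lin_space_axioms assms(2), where Y = Y]
    by (simp add: continuous_linear_def)
qed

lemma continuous_linear_diff:
  assumes "locally_convex X" "locally_convex Y" "continuous_linear X Y h" "continuous_linear X Y g"
  shows "continuous_linear X Y (\<lambda>x. h x \<ominus>\<^bsub>Y\<^esub> g x)"
proof -
  interpret X: locally_convex X by fact
  interpret Y: locally_convex Y by fact
  have *: "continuous_linear X Y (\<lambda>x. h x \<oplus>\<^bsub>Y\<^esub> (- 1) \<odot>\<^bsub>Y\<^esub> g x)"
    by (intro continuous_linear_add continuous_linear_smult assms)
  have "h x \<ominus>\<^bsub>Y\<^esub> g x = h x \<oplus>\<^bsub>Y\<^esub> (- 1) \<odot>\<^bsub>Y\<^esub> g x" if "x \<in> carrier X" for x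
    using that assms(4) linear_mapD(1)[of X Y g x] by (simp add: a_minus_def Y.minus_smult continuous_linear_def)
  then show ?thesis by (intro continuous_linear_cong[OF X.locally_convex_axioms _ *]) simp
qed

lemma (in locally_convex) hausdorff_seminorm:
  assumes "Hausdorff_space (topo X)" "x \<in> carrier X" "y \<in> carrier X"
    and small: "\<And>p e. continuous_seminorm X p \<Longrightarrow> e > 0 \<Longrightarrow> p (x \<ominus>\<^bsub>X\<^esub> y) \<le> e"
  shows "x = y"
proof (rule ccontr)
  assume "x \<noteq> y"
  then obtain U V where U: "openin (topo X) U" "openin (topo X) V" "x \<in> U" "y \<in> V" "disjnt U V"
    using assms(1-3) unfolding Hausdorff_space_def topspace_eq by blast
  obtain p e where p: "continuous_seminorm X p" "e > 0" "sball X p y e \<subseteq> V"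
    using U(2,4) unfolding openin_iff_cseminorm by blast
  have "p (x \<ominus>\<^bsub>X\<^esub> y) < e" using small[OF p(1), of "e/2"] p(2) by simp
  then have "x \<in> V" using p(3) assms(2) by (auto simp: sball_def)
  then show False using U(3,5) by (auto simp: disjnt_def)
qed

section \<open>The completion of a locally convex space\<close>

context locally_convex
begin

abbreviation "\<iota> x \<equiv> to_completion X x"

abbreviation "around p e x F \<equiv> eventually (\<lambda>y. p (y \<ominus>\<^bsub>X\<^esub> x) < e) F"

lemma cauchy_filterD:
  assumes "cauchy_filter_on X F"
  shows "F \<noteq> bot" "F \<le> principal (carrier X)" "eventually (\<lambda>x. x \<in> carrier X) F" "equiv_filters X F F"
  using assms by (auto simp: cauchy_filter_on_def le_principal)

text \<open>Two filters are near each other if they concentrate around a common vector. This form, with one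
  vector instead of pairs, is the one in which Cauchy filters are handled.\<close>

lemma equiv_filtersI:
  assumes F: "F \<le> principal (carrier X)" and G: "G \<le> principal (carrier X)"
    and near: "\<And>p e. continuous_seminorm X p \<Longrightarrow> e > 0 \<Longrightarrow>
      \<exists>x\<in>carrier X. around p e x F \<and> around p e x G"
  shows "equiv_filters X F G"
  unfolding cauchy_filter_on_iff[OF F G]
proof (intro allI impI)
  fix p and e :: real assume p: "continuous_seminorm X p" and e: "e > 0"
  note sp = cseminormD[OF p]
  obtain x where x: "x \<in> carrier X" "around p (e/2) x F"
      "around p (e/2) x G"
    using near[OF p, of "e/2"] e by auto
  have 1: "eventually (\<lambda>y. y \<in> carrier X \<and> p (y \<ominus>\<^bsub>X\<^esub> x) < e/2) F"
    using F x(2) by (simp add: le_principal eventually_conj_iff)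
  have 2: "eventually (\<lambda>y. y \<in> carrier X \<and> p (y \<ominus>\<^bsub>X\<^esub> x) < e/2) G"
    using G x(3) by (simp add: le_principal eventually_conj_iff)
  have 3: "p (y \<ominus>\<^bsub>X\<^esub> z) < e" if "y \<in> carrier X \<and> p (y \<ominus>\<^bsub>X\<^esub> x) < e/2" "z \<in> carrier X \<and> p (z \<ominus>\<^bsub>X\<^esub> x) < e/2" for y z
    using seminorm_triangle[OF sp, of y x z] seminorm_diff_commute[OF sp, of z x] that x(1) by simp
  show "eventually (\<lambda>(y, z). p (y \<ominus>\<^bsub>X\<^esub> z) < e) (F \<times>\<^sub>F G)"
    unfolding eventually_prod_filter
    by (rule exI[of _ "\<lambda>y. y \<in> carrier X \<and> p (y \<ominus>\<^bsub>X\<^esub> x) < e/2"],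
        rule exI[of _ "\<lambda>y. y \<in> carrier X \<and> p (y \<ominus>\<^bsub>X\<^esub> x) < e/2"])
      (use 1 2 3 in simp)
qed

lemma equiv_filtersD:
  assumes F: "cauchy_filter_on X F" and G: "cauchy_filter_on X G" and eq: "equiv_filters X F G"
    and p: "continuous_seminorm X p" and e: "e > 0"
  shows "\<exists>x\<in>carrier X. around p e x F \<and> around p e x G"
proof -
  note sp = cseminormD[OF p]
  have "eventually (\<lambda>(x, y). p (x \<ominus>\<^bsub>X\<^esub> y) < e/2) (F \<times>\<^sub>F G)"
    by (rule eq[unfolded cauchy_filter_on_iff[OF cauchy_filterD(2)[OF F] cauchy_filterD(2)[OF G]], rule_format, OF p])
      (use e in simp)
  then obtain Pf Pg where P: "eventually Pf F" "eventually Pg G" "\<And>x y. Pf x \<Longrightarrow> Pg y \<Longrightarrow> p (x \<ominus>\<^bsub>X\<^esub> y) < e/2"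
    unfolding eventually_prod_filter by auto
  obtain y0 where y0: "Pg y0" "y0 \<in> carrier X"
    using eventually_happens'[OF cauchy_filterD(1)[OF G] eventually_conj[OF P(2) cauchy_filterD(3)[OF G]]] by blast
  obtain x0 where x0: "Pf x0" "x0 \<in> carrier X"
    using eventually_happens'[OF cauchy_filterD(1)[OF F] eventually_conj[OF P(1) cauchy_filterD(3)[OF F]]] by blast
  have "around p e y0 F"
    using P(1) by (rule eventually_mono) (use P(3)[OF _ y0(1)] e in force)
  moreover have "around p e y0 G"
    using P(2) cauchy_filterD(3)[OF G]
  proof eventually_elim
    case (elim y)
    show ?case
      using P(3)[OF x0(1) elim(1)] P(3)[OF x0(1) y0(1)] seminorm_triangle[OF sp, of y x0 y0]
        seminorm_diff_commute[OF sp, of y x0] elim(2) x0 y0 by simp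
  qed
  ultimately show ?thesis using y0(2) by blast
qed

lemma cauchy_filter_near:
  assumes "cauchy_filter_on X F" "continuous_seminorm X p" "e > 0"
  shows "\<exists>x\<in>carrier X. around p e x F"
  using equiv_filtersD[OF assms(1,1) cauchy_filterD(4)[OF assms(1)] assms(2,3)] by blast

lemma cauchy_filterI:
  assumes "F \<noteq> bot" "F \<le> principal (carrier X)"
    and "\<And>p e. continuous_seminorm X p \<Longrightarrow> e > 0 \<Longrightarrow> \<exists>x\<in>carrier X. around p e x F"
  shows "cauchy_filter_on X F"
  unfolding cauchy_filter_on_def using assms by (auto intro!: equiv_filtersI)

lemma equiv_filters_sym:
  assumes "cauchy_filter_on X F" "cauchy_filter_on X G" "equiv_filters X F G"
  shows "equiv_filters X G F"
proof (rule equiv_filtersI)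
  fix p and e :: real assume "continuous_seminorm X p" "e > 0"
  from equiv_filtersD[OF assms this]
  show "\<exists>x\<in>carrier X. around p e x G \<and> around p e x F"
    by auto
qed (use cauchy_filterD assms in auto)

lemma equiv_filters_trans:
  assumes F: "cauchy_filter_on X F" and G: "cauchy_filter_on X G" and H: "cauchy_filter_on X H"
    and FG: "equiv_filters X F G" and GH: "equiv_filters X G H"
  shows "equiv_filters X F H"
proof (rule equiv_filtersI)
  fix p and e :: real assume p: "continuous_seminorm X p" and e: "e > 0"
  note sp = cseminormD[OF p]
  have e3: "e / 3 > 0" using e by simp
  obtain x where x: "x \<in> carrier X" "around p (e/3) x F" "around p (e/3) x G"
    using equiv_filtersD[OF F G FG p e3] by blast
  obtain z where z: "z \<in> carrier X" "around p (e/3) z G" "around p (e/3) z H"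
    using equiv_filtersD[OF G H GH p e3] by blast
  obtain y where y: "y \<in> carrier X" "p (y \<ominus>\<^bsub>X\<^esub> x) < e/3" "p (y \<ominus>\<^bsub>X\<^esub> z) < e/3"
    using eventually_happens'[OF cauchy_filterD(1)[OF G]
        eventually_conj[OF cauchy_filterD(3)[OF G] eventually_conj[OF x(3) z(2)]]] by blast
  have xz: "p (x \<ominus>\<^bsub>X\<^esub> z) < 2*e/3"
    using seminorm_triangle[OF sp, of x y z] seminorm_diff_commute[OF sp, of x y] x(1) y z(1) by simp
  have "around p e z F"
    using x(2) cauchy_filterD(3)[OF F]
  proof eventually_elim
    case (elim w)
    then show ?case using seminorm_triangle[OF sp, of w x z] x(1) z(1) xz by simp
  qed
  moreover have "around p e z H"
    using z(3) by (rule eventually_mono) (use e in simp)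
  ultimately show "\<exists>x\<in>carrier X. around p e x F \<and> around p e x H"
    using z(1) by blast
qed (use cauchy_filterD F H in auto)

lemma cauchy_class_eq:
  assumes "cauchy_filter_on X F" "cauchy_filter_on X G" "equiv_filters X F G"
  shows "cauchy_class X F = cauchy_class X G"
proof -
  have "cauchy_class X G \<subseteq> cauchy_class X F" if "cauchy_filter_on X F" "cauchy_filter_on X G" "equiv_filters X F G" for F G
    using equiv_filters_trans[OF that(1,2) _ that(3)] by (auto simp: cauchy_class_def)
  from this[OF assms] this[OF assms(2,1) equiv_filters_sym[OF assms]] show ?thesis by blast
qed

lemma cauchy_class_self: "cauchy_filter_on X F \<Longrightarrow> F \<in> cauchy_class X F"
  by (simp add: cauchy_class_def cauchy_filterD(4))

abbreviation "Z \<equiv> completion_space X"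

lemma carrier_completion: "carrier Z = {cauchy_class X F | F. cauchy_filter_on X F}"
  by (simp add: completion_space_def)

lemma class_member:
  assumes "C \<in> carrier Z" "F \<in> C"
  shows "cauchy_filter_on X F" "C = cauchy_class X F"
proof -
  obtain G where G: "cauchy_filter_on X G" "C = cauchy_class X G"
    using assms(1) by (auto simp: carrier_completion)
  show F: "cauchy_filter_on X F" using assms(2) G(2) by (simp add: cauchy_class_def)
  show "C = cauchy_class X F" using assms(2) G cauchy_class_eq[OF G(1) F] by (simp add: cauchy_class_def)
qed

lemma class_nonempty: "C \<in> carrier Z \<Longrightarrow> \<exists>F. F \<in> C"
  using cauchy_class_self by (auto simp: carrier_completion)

lemma class_members_equiv:
  assumes "C \<in> carrier Z" "F \<in> C" "G \<in> C"
  shows "equiv_filters X F G"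
  using assms class_member[OF assms(1,2)] by (simp add: cauchy_class_def)

text \<open>A vector is near an element of the completion if some Cauchy filter of that class eventually is
  in a ball around the vector. Two elements are equal if arbitrarily close vectors are near both.\<close>

definition near :: "('a \<Rightarrow> real) \<Rightarrow> real \<Rightarrow> 'a \<Rightarrow> 'a filter set \<Rightarrow> bool" where
  "near p e x C \<longleftrightarrow> x \<in> carrier X \<and> (\<exists>F\<in>C. around p e x F)"

lemma near_mono: "near p e x C \<Longrightarrow> e \<le> d \<Longrightarrow> near p d x C"
  unfolding near_def by (fast elim: eventually_mono less_le_trans)

lemma near_carrier: "near p e x C \<Longrightarrow> x \<in> carrier X"
  by (simp add: near_def)

lemma near_exists:
  assumes "C \<in> carrier Z" "continuous_seminorm X p" "e > 0"
  shows "\<exists>x. near p e x C"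
proof -
  obtain F where F: "F \<in> C" using class_nonempty[OF assms(1)] by blast
  obtain x where "x \<in> carrier X" "around p e x F"
    using cauchy_filter_near[OF class_member(1)[OF assms(1) F] assms(2,3)] by blast
  then show ?thesis using F unfolding near_def by blast
qed

lemma completion_eqI:
  assumes C: "C \<in> carrier Z" and D: "D \<in> carrier Z" and K: "K > 0"
    and *: "\<And>p e. continuous_seminorm X p \<Longrightarrow> e > 0 \<Longrightarrow> \<exists>x. near p (K * e) x C \<and> near p (K * e) x D"
  shows "C = D"
proof -
  obtain F where F: "F \<in> C" using class_nonempty[OF C] by blast
  obtain G where G: "G \<in> D" using class_nonempty[OF D] by blast
  note cF = class_member(1)[OF C F] and cG = class_member(1)[OF D G]
  have "equiv_filters X F G"
  proof (rule equiv_filtersI)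
    fix p and e :: real assume p: "continuous_seminorm X p" and e: "e > 0"
    note sp = cseminormD[OF p]
    have e': "e / (3 * K) > 0" "e / 3 > 0" "K * (e / (3 * K)) = e / 3" using e K by auto
    obtain x where "near p (e/3) x C" "near p (e/3) x D" using *[OF p e'(1)] unfolding e'(3) by auto
    then obtain F' G' where x: "x \<in> carrier X" and F': "F' \<in> C" "around p (e/3) x F'"
        and G': "G' \<in> D" "around p (e/3) x G'"
      unfolding near_def by blast
    have move: "around p e x F"
      if C: "C \<in> carrier Z" and F: "F \<in> C" and F': "F' \<in> C" "around p (e/3) x F'" for C F F'
    proof -
      note cF = class_member(1)[OF C F] and cF' = class_member(1)[OF C F'(1)]
      obtain z where z: "z \<in> carrier X" "around p (e/3) z F" "around p (e/3) z F'"
        using equiv_filtersD[OF cF cF' class_members_equiv[OF C F F'(1)] p e'(2)] by blast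
      obtain w where w: "w \<in> carrier X" "p (w \<ominus>\<^bsub>X\<^esub> z) < e/3" "p (w \<ominus>\<^bsub>X\<^esub> x) < e/3"
        using eventually_happens'[OF cauchy_filterD(1)[OF cF']
            eventually_conj[OF cauchy_filterD(3)[OF cF'] eventually_conj[OF z(3) F'(2)]]] by blast
      show ?thesis using z(2) cauchy_filterD(3)[OF cF]
      proof eventually_elim
        case (elim y)
        then show ?case
          using seminorm_triangle[OF sp, of y z x] seminorm_triangle[OF sp, of z w x]
            seminorm_diff_commute[OF sp, of z w] w x z(1) by simp
      qed
    qed
    show "\<exists>x\<in>carrier X. around p e x F \<and> around p e x G"
      using x move[OF C F F'] move[OF D G G'] by blast
  qed (use cauchy_filterD cF cG in auto)
  then show ?thesis
    using class_member(2)[OF C F] class_member(2)[OF D G] cauchy_class_eq[OF cF cG] by simp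
qed

lemma near_dist:
  assumes C: "C \<in> carrier Z" and p: "continuous_seminorm X p"
    and x: "near p e x C" and y: "near p d y C"
  shows "p (x \<ominus>\<^bsub>X\<^esub> y) \<le> e + d"
proof (rule field_le_epsilon)
  fix k :: real assume k: "k > 0"
  note sp = cseminormD[OF p]
  obtain F where F: "F \<in> C" "around p e x F" using x unfolding near_def by blast
  obtain G where G: "G \<in> C" "around p d y G" using y unfolding near_def by blast
  note cF = class_member(1)[OF C F(1)] and cG = class_member(1)[OF C G(1)]
  obtain z where z: "z \<in> carrier X" "around p (k/2) z F" "around p (k/2) z G"
    using equiv_filtersD[OF cF cG class_members_equiv[OF C F(1) G(1)] p, of "k/2"] k by auto
  obtain u where u: "u \<in> carrier X" "p (u \<ominus>\<^bsub>X\<^esub> z) < k/2" "p (u \<ominus>\<^bsub>X\<^esub> x) < e"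
    using eventually_happens'[OF cauchy_filterD(1)[OF cF]
        eventually_conj[OF cauchy_filterD(3)[OF cF] eventually_conj[OF z(2) F(2)]]] by blast
  obtain v where v: "v \<in> carrier X" "p (v \<ominus>\<^bsub>X\<^esub> z) < k/2" "p (v \<ominus>\<^bsub>X\<^esub> y) < d"
    using eventually_happens'[OF cauchy_filterD(1)[OF cG]
        eventually_conj[OF cauchy_filterD(3)[OF cG] eventually_conj[OF z(3) G(2)]]] by blast
  have "x \<in> carrier X" "y \<in> carrier X" using x y by (auto simp: near_def)
  then show "p (x \<ominus>\<^bsub>X\<^esub> y) \<le> e + d + k"
    using seminorm_triangle[OF sp, of x u y] seminorm_triangle[OF sp, of u z y] seminorm_triangle[OF sp, of z v y]
      seminorm_diff_commute[OF sp, of x u] seminorm_diff_commute[OF sp, of z v] u v z(1) by simp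
qed

lemma near_shift:
  assumes C: "C \<in> carrier Z" and p: "continuous_seminorm X p"
    and x: "near p e x C" and y: "y \<in> carrier X" "p (x \<ominus>\<^bsub>X\<^esub> y) \<le> d"
  shows "near p (e + d) y C"
proof -
  obtain F where F: "F \<in> C" "around p e x F" using x unfolding near_def by blast
  have xX: "x \<in> carrier X" using x by (rule near_carrier)
  have "around p (e + d) y F"
    using F(2) cauchy_filterD(3)[OF class_member(1)[OF C F(1)]]
  proof eventually_elim
    case (elim z)
    then show ?case using seminorm_triangle[OF cseminormD[OF p], of z x y] xX y by simp
  qed
  then show ?thesis using F(1) y(1) unfolding near_def by blast
qed

subsection \<open>Linear structure\<close>

definition filter_sum :: "'a filter \<Rightarrow> 'a filter \<Rightarrow> 'a filter" where
  "filter_sum F G = filtermap (\<lambda>(x, y). x \<oplus>\<^bsub>X\<^esub> y) (F \<times>\<^sub>F G)"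

lemma eventually_filter_sum:
  assumes F: "cauchy_filter_on X F" and G: "cauchy_filter_on X G" and p: "continuous_seminorm X p"
    and x: "x \<in> carrier X" "around p e x F"
    and y: "y \<in> carrier X" "around p d y G"
  shows "eventually (\<lambda>z. p (z \<ominus>\<^bsub>X\<^esub> (x \<oplus>\<^bsub>X\<^esub> y)) < e + d) (filter_sum F G)"
proof -
  have *: "p ((u \<oplus>\<^bsub>X\<^esub> v) \<ominus>\<^bsub>X\<^esub> (x \<oplus>\<^bsub>X\<^esub> y)) < e + d"
    if "p (u \<ominus>\<^bsub>X\<^esub> x) < e \<and> u \<in> carrier X" "p (v \<ominus>\<^bsub>X\<^esub> y) < d \<and> v \<in> carrier X" for u v
    using seminorm_add[OF cseminormD[OF p], of "u \<ominus>\<^bsub>X\<^esub> x" "v \<ominus>\<^bsub>X\<^esub> y"] that x(1) y(1) by (simp add: add_diff_add)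
  show ?thesis
    unfolding filter_sum_def eventually_filtermap eventually_prod_filter
    using eventually_conj[OF x(2) cauchy_filterD(3)[OF F]] eventually_conj[OF y(2) cauchy_filterD(3)[OF G]] *
    by (intro exI[of _ "\<lambda>u. p (u \<ominus>\<^bsub>X\<^esub> x) < e \<and> u \<in> carrier X"] exI[of _ "\<lambda>v. p (v \<ominus>\<^bsub>X\<^esub> y) < d \<and> v \<in> carrier X"]) simp
qed

lemma filter_sum_carrier:
  assumes F: "cauchy_filter_on X F" and G: "cauchy_filter_on X G"
  shows "filter_sum F G \<le> principal (carrier X)"
  unfolding filter_sum_def le_principal eventually_filtermap eventually_prod_filter
  using cauchy_filterD(3)[OF F] cauchy_filterD(3)[OF G]
  by (intro exI[of _ "\<lambda>u. u \<in> carrier X"]) auto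

lemma filter_sum_equiv:
  assumes c: "cauchy_filter_on X F" "cauchy_filter_on X F'" "cauchy_filter_on X G" "cauchy_filter_on X G'"
    and eq: "equiv_filters X F F'" "equiv_filters X G G'"
  shows "equiv_filters X (filter_sum F G) (filter_sum F' G')"
proof (rule equiv_filtersI)
  fix p and e :: real assume p: "continuous_seminorm X p" and e: "e > 0"
  obtain x where x: "x \<in> carrier X" "around p (e/2) x F" "around p (e/2) x F'"
    using equiv_filtersD[OF c(1,2) eq(1) p, of "e/2"] e by auto
  obtain y where y: "y \<in> carrier X" "around p (e/2) y G" "around p (e/2) y G'"
    using equiv_filtersD[OF c(3,4) eq(2) p, of "e/2"] e by auto
  show "\<exists>x\<in>carrier X. eventually (\<lambda>y. p (y \<ominus>\<^bsub>X\<^esub> x) < e) (filter_sum F G) \<and> eventually (\<lambda>y. p (y \<ominus>\<^bsub>X\<^esub> x) < e) (filter_sum F' G')"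
    using eventually_filter_sum[OF c(1,3) p x(1,2) y(1,2)] eventually_filter_sum[OF c(2,4) p x(1,3) y(1,3)] x(1) y(1)
    by (intro bexI[of _ "x \<oplus>\<^bsub>X\<^esub> y"]) auto
qed (use filter_sum_carrier c in auto)

lemma filter_sum_cauchy:
  assumes "cauchy_filter_on X F" "cauchy_filter_on X G"
  shows "cauchy_filter_on X (filter_sum F G)"
  unfolding cauchy_filter_on_def
  using filter_sum_carrier[OF assms] filter_sum_equiv[OF assms(1,1,2,2) cauchy_filterD(4)[OF assms(1)] cauchy_filterD(4)[OF assms(2)]]
    cauchy_filterD(1)[OF assms(1)] cauchy_filterD(1)[OF assms(2)]
  by (auto simp: filter_sum_def filtermap_bot_iff prod_filter_eq_bot)

lemma eventually_filter_smult:
  assumes F: "cauchy_filter_on X F" and p: "continuous_seminorm X p" and e: "e > 0"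
    and x: "x \<in> carrier X" "around p e x F"
  shows "eventually (\<lambda>z. p (z \<ominus>\<^bsub>X\<^esub> (c \<odot>\<^bsub>X\<^esub> x)) < (cmod c + 1) * e) (filtermap (\<lambda>x. c \<odot>\<^bsub>X\<^esub> x) F)"
  unfolding eventually_filtermap using x(2) cauchy_filterD(3)[OF F]
proof eventually_elim
  case (elim y)
  have "p ((c \<odot>\<^bsub>X\<^esub> y) \<ominus>\<^bsub>X\<^esub> (c \<odot>\<^bsub>X\<^esub> x)) = cmod c * p (y \<ominus>\<^bsub>X\<^esub> x)"
    using elim x(1) seminorm_smult[OF cseminormD[OF p], of "y \<ominus>\<^bsub>X\<^esub> x" c] by (simp add: smult_diff)
  also have "\<dots> \<le> cmod c * e" using elim by (intro mult_left_mono) auto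
  also have "\<dots> < (cmod c + 1) * e" using e by simp
  finally show ?case .
qed

lemma filter_smult_carrier:
  assumes F: "cauchy_filter_on X F"
  shows "filtermap (\<lambda>x. c \<odot>\<^bsub>X\<^esub> x) F \<le> principal (carrier X)"
  unfolding le_principal eventually_filtermap using cauchy_filterD(3)[OF F] by eventually_elim simp

lemma filter_smult_equiv:
  assumes c: "cauchy_filter_on X F" "cauchy_filter_on X F'" and eq: "equiv_filters X F F'"
  shows "equiv_filters X (filtermap (\<lambda>x. c \<odot>\<^bsub>X\<^esub> x) F) (filtermap (\<lambda>x. c \<odot>\<^bsub>X\<^esub> x) F')"
proof (rule equiv_filtersI)
  fix p and e :: real assume p: "continuous_seminorm X p" and e: "e > 0"
  have e': "e / (cmod c + 1) > 0" "(cmod c + 1) * (e / (cmod c + 1)) = e"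
    using e by (auto simp: add_nonneg_pos intro!: divide_pos_pos) (smt (verit) norm_ge_zero)
  obtain x where x: "x \<in> carrier X" "eventually (\<lambda>y. p (y \<ominus>\<^bsub>X\<^esub> x) < e / (cmod c + 1)) F" "eventually (\<lambda>y. p (y \<ominus>\<^bsub>X\<^esub> x) < e / (cmod c + 1)) F'"
    using equiv_filtersD[OF c eq p e'(1)] by auto
  show "\<exists>x\<in>carrier X. eventually (\<lambda>y. p (y \<ominus>\<^bsub>X\<^esub> x) < e) (filtermap (\<lambda>x. c \<odot>\<^bsub>X\<^esub> x) F) \<and>
      eventually (\<lambda>y. p (y \<ominus>\<^bsub>X\<^esub> x) < e) (filtermap (\<lambda>x. c \<odot>\<^bsub>X\<^esub> x) F')"
    using eventually_filter_smult[OF c(1) p e'(1) x(1,2), of c] eventually_filter_smult[OF c(2) p e'(1) x(1,3), of c] x(1) e'(2)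
    by (intro bexI[of _ "c \<odot>\<^bsub>X\<^esub> x"]) auto
qed (use filter_smult_carrier c in auto)

lemma filter_smult_cauchy:
  assumes "cauchy_filter_on X F"
  shows "cauchy_filter_on X (filtermap (\<lambda>x. c \<odot>\<^bsub>X\<^esub> x) F)"
  unfolding cauchy_filter_on_def
  using filter_smult_carrier[OF assms] filter_smult_equiv[OF assms assms cauchy_filterD(4)[OF assms]] cauchy_filterD(1)[OF assms]
  by (auto simp: filtermap_bot_iff)

lemma completion_add_eq:
  assumes C: "C \<in> carrier Z" "F \<in> C" and D: "D \<in> carrier Z" "G \<in> D"
  shows "C \<oplus>\<^bsub>Z\<^esub> D = cauchy_class X (filter_sum F G)"
proof -
  have *: "cauchy_class X (filter_sum F' G') = cauchy_class X (filter_sum F G)" if F': "F' \<in> C" and G': "G' \<in> D" for F' G'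
  proof -
    note c = class_member(1)[OF C] class_member(1)[OF D] class_member(1)[OF C(1) F'] class_member(1)[OF D(1) G']
    show ?thesis
      by (rule cauchy_class_eq[OF filter_sum_cauchy[OF c(3,4)] filter_sum_cauchy[OF c(1,2)]
            filter_sum_equiv[OF c(3,1,4,2) class_members_equiv[OF C(1) F' C(2)] class_members_equiv[OF D(1) G' D(2)]]])
  qed
  have "C \<oplus>\<^bsub>Z\<^esub> D = (\<Union>F'\<in>C. \<Union>G'\<in>D. cauchy_class X (filter_sum F' G'))"
    by (simp add: completion_space_def filter_sum_def)
  also have "\<dots> = (\<Union>F'\<in>C. \<Union>G'\<in>D. cauchy_class X (filter_sum F G))"
    by (intro SUP_cong refl *)
  finally show ?thesis using C(2) D(2) by auto
qed

lemma completion_smult_eq: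
  assumes C: "C \<in> carrier Z" "F \<in> C"
  shows "c \<odot>\<^bsub>Z\<^esub> C = cauchy_class X (filtermap (\<lambda>x. c \<odot>\<^bsub>X\<^esub> x) F)"
proof -
  have *: "cauchy_class X (filtermap (\<lambda>x. c \<odot>\<^bsub>X\<^esub> x) F') = cauchy_class X (filtermap (\<lambda>x. c \<odot>\<^bsub>X\<^esub> x) F)" if F': "F' \<in> C" for F'
  proof -
    note c = class_member(1)[OF C(1) F'] class_member(1)[OF C]
    show ?thesis
      by (rule cauchy_class_eq[OF filter_smult_cauchy[OF c(1)] filter_smult_cauchy[OF c(2)]
            filter_smult_equiv[OF c class_members_equiv[OF C(1) F' C(2)]]])
  qed
  have "c \<odot>\<^bsub>Z\<^esub> C = (\<Union>F'\<in>C. cauchy_class X (filtermap (\<lambda>x. c \<odot>\<^bsub>X\<^esub> x) F'))"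
    by (simp add: completion_space_def)
  also have "\<dots> = (\<Union>F'\<in>C. cauchy_class X (filtermap (\<lambda>x. c \<odot>\<^bsub>X\<^esub> x) F))"
    by (intro SUP_cong refl *)
  finally show ?thesis using C(2) by auto
qed

lemma principal_cauchy: "x \<in> carrier X \<Longrightarrow> cauchy_filter_on X (principal {x})"
  by (rule cauchy_filterI)
    (auto simp: eventually_principal principal_eq_bot_iff seminorm_zero cseminormD intro!: bexI[of _ x])

lemma to_completion_mem: "x \<in> carrier X \<Longrightarrow> \<iota> x \<in> carrier Z"
  by (auto simp: carrier_completion to_completion_def principal_cauchy)

lemma near_to_completion:
  "x \<in> carrier X \<Longrightarrow> continuous_seminorm X p \<Longrightarrow> e > 0 \<Longrightarrow> near p e x (\<iota> x)"
  unfolding near_def to_completion_def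
  by (auto simp: eventually_principal seminorm_zero cseminormD intro!: bexI[OF _ cauchy_class_self] principal_cauchy)

lemma zero_completion: "\<zero>\<^bsub>Z\<^esub> = to_completion X \<zero>\<^bsub>X\<^esub>"
  by (simp add: completion_space_def to_completion_def)

lemma completion_add_mem:
  assumes C: "C \<in> carrier Z" and D: "D \<in> carrier Z"
  shows "C \<oplus>\<^bsub>Z\<^esub> D \<in> carrier Z"
proof -
  obtain F G where F: "F \<in> C" and G: "G \<in> D" using class_nonempty[OF C] class_nonempty[OF D] by auto
  show ?thesis unfolding completion_add_eq[OF C F D G]
    using filter_sum_cauchy[OF class_member(1)[OF C F] class_member(1)[OF D G]] by (auto simp: carrier_completion)
qed

lemma completion_smult_mem:
  assumes C: "C \<in> carrier Z"
  shows "c \<odot>\<^bsub>Z\<^esub> C \<in> carrier Z"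
proof -
  obtain F where F: "F \<in> C" using class_nonempty[OF C] by auto
  show ?thesis unfolding completion_smult_eq[OF C F]
    using filter_smult_cauchy[OF class_member(1)[OF C F]] by (auto simp: carrier_completion)
qed

lemma near_add:
  assumes C: "C \<in> carrier Z" and D: "D \<in> carrier Z" and p: "continuous_seminorm X p"
    and x: "near p e x C" and y: "near p d y D"
  shows "near p (e + d) (x \<oplus>\<^bsub>X\<^esub> y) (C \<oplus>\<^bsub>Z\<^esub> D)"
proof -
  obtain F where F: "F \<in> C" "around p e x F" using x unfolding near_def by blast
  obtain G where G: "G \<in> D" "around p d y G" using y unfolding near_def by blast
  note cF = class_member(1)[OF C F(1)] and cG = class_member(1)[OF D G(1)]
  show ?thesis unfolding near_def completion_add_eq[OF C F(1) D G(1)]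
    by (intro conjI bexI[OF _ cauchy_class_self[OF filter_sum_cauchy[OF cF cG]]]
        eventually_filter_sum[OF cF cG p near_carrier[OF x] F(2) near_carrier[OF y] G(2)])
      (use near_carrier[OF x] near_carrier[OF y] in simp)
qed

lemma near_smult:
  assumes C: "C \<in> carrier Z" and p: "continuous_seminorm X p" and x: "near p e x C" and e: "e > 0"
  shows "near p ((cmod c + 1) * e) (c \<odot>\<^bsub>X\<^esub> x) (c \<odot>\<^bsub>Z\<^esub> C)"
proof -
  obtain F where F: "F \<in> C" "around p e x F" using x unfolding near_def by blast
  note cF = class_member(1)[OF C F(1)]
  show ?thesis unfolding near_def completion_smult_eq[OF C F(1)]
    by (intro conjI bexI[OF _ cauchy_class_self[OF filter_smult_cauchy[OF cF]]]
        eventually_filter_smult[OF cF p e near_carrier[OF x] F(2)])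
      (use near_carrier[OF x] in simp)
qed

end

context locally_convex
begin

text \<open>Vectors \<open>s p e\<close>, one for each continuous seminorm and each positive number, that are near an
  element up to a constant factor determine that element. As such families are compatible with the
  linear operations, the laws of a linear space pass from the given space to its completion.\<close>

definition approximates :: "(('a \<Rightarrow> real) \<Rightarrow> real \<Rightarrow> 'a) \<Rightarrow> 'a filter set \<Rightarrow> bool" where
  "approximates s C \<longleftrightarrow> C \<in> carrier Z \<and> (\<forall>p e. s p e \<in> carrier X) \<and>
    (\<exists>K>0. \<forall>p e. continuous_seminorm X p \<longrightarrow> e > 0 \<longrightarrow> near p (K * e) (s p e) C)"

lemma approximatesD:
  assumes "approximates s C"
  shows "C \<in> carrier Z" "s p e \<in> carrier X"
    "\<exists>K>0. \<forall>p e. continuous_seminorm X p \<longrightarrow> e > 0 \<longrightarrow> near p (K * e) (s p e) C"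
  using assms by (auto simp: approximates_def)

lemma approximates_exists:
  assumes C: "C \<in> carrier Z"
  shows "\<exists>s. approximates s C"
proof -
  let ?s = "\<lambda>p e. if continuous_seminorm X p \<and> e > 0 then SOME x. near p e x C else \<zero>\<^bsub>X\<^esub>"
  have n: "near p e (?s p e) C" if "continuous_seminorm X p" "e > 0" for p e
    using someI_ex[OF near_exists[OF C that]] that by simp
  have "?s p e \<in> carrier X" for p e
    using near_carrier[OF n[of p e]] by auto
  then have "approximates ?s C"
    unfolding approximates_def using C n by (intro conjI exI[of _ 1] allI) simp_all
  then show ?thesis by blast
qed

lemma approximates_add:
  assumes s: "approximates s C" and t: "approximates t D"
  shows "approximates (\<lambda>p e. s p e \<oplus>\<^bsub>X\<^esub> t p e) (C \<oplus>\<^bsub>Z\<^esub> D)"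
proof -
  note C = approximatesD(1)[OF s] and D = approximatesD(1)[OF t]
  obtain K where K: "K > 0" "\<forall>p e. continuous_seminorm X p \<longrightarrow> e > 0 \<longrightarrow> near p (K * e) (s p e) C"
    using approximatesD(3)[OF s] by (elim exE conjE)
  obtain L where L: "L > 0" "\<forall>p e. continuous_seminorm X p \<longrightarrow> e > 0 \<longrightarrow> near p (L * e) (t p e) D"
    using approximatesD(3)[OF t] by (elim exE conjE)
  have "near p ((K + L) * e) (s p e \<oplus>\<^bsub>X\<^esub> t p e) (C \<oplus>\<^bsub>Z\<^esub> D)" if "continuous_seminorm X p" "e > 0" for p e
    unfolding distrib_right by (rule near_add[OF C D that(1)]) (use K(2) L(2) that in simp_all)
  then show ?thesis
    unfolding approximates_def using completion_add_mem[OF C D] approximatesD(2)[OF s] approximatesD(2)[OF t] K(1) L(1)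
    by (intro conjI exI[of _ "K + L"]) simp_all
qed

lemma approximates_smult:
  assumes s: "approximates s C"
  shows "approximates (\<lambda>p e. c \<odot>\<^bsub>X\<^esub> s p e) (c \<odot>\<^bsub>Z\<^esub> C)"
proof -
  note C = approximatesD(1)[OF s]
  obtain K where K: "K > 0" "\<forall>p e. continuous_seminorm X p \<longrightarrow> e > 0 \<longrightarrow> near p (K * e) (s p e) C"
    using approximatesD(3)[OF s] by (elim exE conjE)
  have "near p ((cmod c + 1) * K * e) (c \<odot>\<^bsub>X\<^esub> s p e) (c \<odot>\<^bsub>Z\<^esub> C)" if "continuous_seminorm X p" "e > 0" for p e
    unfolding mult.assoc by (rule near_smult[OF C that(1)]) (use K that in simp_all)
  moreover have "0 < (cmod c + 1) * K" using K(1) by (simp add: add_nonneg_pos)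
  ultimately show ?thesis
    unfolding approximates_def using completion_smult_mem[OF C] approximatesD(2)[OF s]
    by (intro conjI exI[of _ "(cmod c + 1) * K"]) simp_all
qed

lemma approximates_const: "x \<in> carrier X \<Longrightarrow> approximates (\<lambda>p e. x) (\<iota> x)"
  unfolding approximates_def by (intro conjI exI[of _ 1]) (simp_all add: to_completion_mem near_to_completion)

lemma approximates_eq:
  assumes s: "approximates s C" and t: "approximates t D" and eq: "\<And>p e. s p e = t p e"
  shows "C = D"
proof -
  obtain K where K: "K > 0" "\<forall>p e. continuous_seminorm X p \<longrightarrow> e > 0 \<longrightarrow> near p (K * e) (s p e) C"
    using approximatesD(3)[OF s] by (elim exE conjE)
  obtain L where L: "L > 0" "\<forall>p e. continuous_seminorm X p \<longrightarrow> e > 0 \<longrightarrow> near p (L * e) (t p e) D"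
    using approximatesD(3)[OF t] by (elim exE conjE)
  show ?thesis
  proof (rule completion_eqI[OF approximatesD(1)[OF s] approximatesD(1)[OF t], where K = "K + L"])
    fix p and e :: real assume "continuous_seminorm X p" "e > 0"
    then have n: "near p (K * e) (s p e) C" "near p (L * e) (s p e) D" "K * e \<le> (K + L) * e" "L * e \<le> (K + L) * e"
      using K L unfolding eq by simp_all
    show "\<exists>x. near p ((K + L) * e) x C \<and> near p ((K + L) * e) x D"
      by (intro exI conjI) (rule near_mono[OF n(1,3)], rule near_mono[OF n(2,4)])
  qed (use K(1) L(1) in simp)
qed

lemma lin_space_completion: "lin_space Z"
proof (rule lin_spaceI)
  show "\<zero>\<^bsub>Z\<^esub> \<in> carrier Z" by (simp add: zero_completion to_completion_mem)
  fix C D E a b assume "C \<in> carrier Z" "D \<in> carrier Z" "E \<in> carrier Z"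
  then obtain s t r where s: "approximates s C" and t: "approximates t D" and r: "approximates r E"
    using approximates_exists by meson
  note [simp] = approximatesD(2)[OF s] approximatesD(2)[OF t] approximatesD(2)[OF r]
  note add = approximates_add and sm = approximates_smult and z = approximates_const[OF M.zero_closed, folded zero_completion]
  show "C \<oplus>\<^bsub>Z\<^esub> D \<in> carrier Z" "a \<odot>\<^bsub>Z\<^esub> C \<in> carrier Z" by (rule approximatesD(1)[OF add[OF s t]] approximatesD(1)[OF sm[OF s]])+
  show "(C \<oplus>\<^bsub>Z\<^esub> D) \<oplus>\<^bsub>Z\<^esub> E = C \<oplus>\<^bsub>Z\<^esub> (D \<oplus>\<^bsub>Z\<^esub> E)"
    by (rule approximates_eq[OF add[OF add[OF s t] r] add[OF s add[OF t r]]]) (simp add: M.a_assoc)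
  show "C \<oplus>\<^bsub>Z\<^esub> D = D \<oplus>\<^bsub>Z\<^esub> C" by (rule approximates_eq[OF add[OF s t] add[OF t s]]) (simp add: M.a_comm)
  show "\<zero>\<^bsub>Z\<^esub> \<oplus>\<^bsub>Z\<^esub> C = C" by (rule approximates_eq[OF add[OF z s] s]) simp
  show "(- 1) \<odot>\<^bsub>Z\<^esub> C \<oplus>\<^bsub>Z\<^esub> C = \<zero>\<^bsub>Z\<^esub>" by (rule approximates_eq[OF add[OF sm[OF s] s] z]) (simp add: minus_smult M.l_neg)
  show "(a + b) \<odot>\<^bsub>Z\<^esub> C = a \<odot>\<^bsub>Z\<^esub> C \<oplus>\<^bsub>Z\<^esub> b \<odot>\<^bsub>Z\<^esub> C"
    by (rule approximates_eq[OF sm[OF s] add[OF sm[OF s] sm[OF s]]]) (simp add: smult_add_left)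
  show "a \<odot>\<^bsub>Z\<^esub> (C \<oplus>\<^bsub>Z\<^esub> D) = a \<odot>\<^bsub>Z\<^esub> C \<oplus>\<^bsub>Z\<^esub> a \<odot>\<^bsub>Z\<^esub> D"
    by (rule approximates_eq[OF sm[OF add[OF s t]] add[OF sm[OF s] sm[OF t]]]) (simp add: smult_add_right)
  show "(a * b) \<odot>\<^bsub>Z\<^esub> C = a \<odot>\<^bsub>Z\<^esub> (b \<odot>\<^bsub>Z\<^esub> C)" by (rule approximates_eq[OF sm[OF s] sm[OF sm[OF s]]]) (simp add: smult_smult)
  show "1 \<odot>\<^bsub>Z\<^esub> C = C" by (rule approximates_eq[OF sm[OF s] s]) simp
qed

interpretation Z: lin_space Z by (rule lin_space_completion)

lemma near_diff:
  assumes C: "C \<in> carrier Z" and D: "D \<in> carrier Z" and p: "continuous_seminorm X p"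
    and x: "near p e x C" and y: "near p d y D" and d: "d > 0"
  shows "near p (e + 2 * d) (x \<ominus>\<^bsub>X\<^esub> y) (C \<ominus>\<^bsub>Z\<^esub> D)"
proof -
  have "near p (e + (cmod (- 1) + 1) * d) (x \<oplus>\<^bsub>X\<^esub> (- 1) \<odot>\<^bsub>X\<^esub> y) (C \<oplus>\<^bsub>Z\<^esub> (- 1) \<odot>\<^bsub>Z\<^esub> D)"
    by (intro near_add near_smult completion_smult_mem C D p x y d)
  then show ?thesis using near_carrier[OF y] D by (simp add: a_minus_def minus_smult Z.minus_smult)
qed

subsection \<open>Seminorms of the completion\<close>

text \<open>A continuous seminorm varies by at most its own value on differences, so its values converge along a
  Cauchy filter; the limit is the supremum of the eventual lower bounds.\<close>

lemma completion_seminorm_limit: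
  assumes C: "C \<in> carrier Z" and p: "continuous_seminorm X p" and F: "F \<in> C"
  shows "(p \<longlongrightarrow> completion_seminorm p C) F"
proof -
  note sp = cseminormD[OF p]
  obtain F0 where F0: "F0 \<in> C" using class_nonempty[OF C] by auto
  note c0 = class_member(1)[OF C F0]
  define S where "S = {r. eventually (\<lambda>y. r \<le> p y) F0}"
  define l where "l = Sup S"
  have bound: "\<bar>l - p x\<bar> \<le> e" if x: "x \<in> carrier X" and ev: "around p e x F0" for x e
  proof -
    have 1: "eventually (\<lambda>y. \<bar>p y - p x\<bar> < e) F0" using ev cauchy_filterD(3)[OF c0]
      by eventually_elim (use seminorm_abs_diff[OF sp _ x] in \<open>force\<close>)
    have a: "p x - e \<in> S" unfolding S_def using 1 by (auto elim: eventually_mono)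
    have b: "r \<le> p x + e" if "r \<in> S" for r
    proof -
      have "eventually (\<lambda>y. r \<le> p y \<and> \<bar>p y - p x\<bar> < e) F0"
        using that 1 unfolding S_def by (auto intro: eventually_conj)
      from eventually_happens'[OF cauchy_filterD(1)[OF c0] this] show ?thesis by auto
    qed
    have "p x - e \<le> l" unfolding l_def by (rule cSup_upper[OF a bdd_aboveI[of _ "p x + e"]]) (use b in auto)
    moreover have "l \<le> p x + e" unfolding l_def by (rule cSup_least) (use a b in auto)
    ultimately show ?thesis by simp
  qed
  have lim: "(p \<longlongrightarrow> l) G" if G: "G \<in> C" for G
  proof (rule tendstoI)
    fix e :: real assume e: "e > 0"
    note cG = class_member(1)[OF C G]
    obtain x where x: "x \<in> carrier X" "around p (e/2) x F0" "around p (e/2) x G"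
      using equiv_filtersD[OF c0 cG class_members_equiv[OF C F0 G] p, of "e/2"] e by auto
    show "eventually (\<lambda>y. dist (p y) l < e) G" using x(3) cauchy_filterD(3)[OF cG]
    proof eventually_elim
      case (elim y)
      then show ?case using seminorm_abs_diff[OF sp, of y x] x(1) bound[OF x(1,2)]
        unfolding dist_real_def by linarith
    qed
  qed
  have "completion_seminorm p C = l"
    unfolding completion_seminorm_def
  proof (rule the_equality)
    show "\<forall>F\<in>C. (p \<longlongrightarrow> l) F" using lim by blast
    fix r assume "\<forall>F\<in>C. (p \<longlongrightarrow> r) F"
    then have "(p \<longlongrightarrow> r) F0" using F0 by blast
    then show "r = l" by (rule tendsto_unique[OF cauchy_filterD(1)[OF c0] _ lim[OF F0]])
  qed
  then show ?thesis using lim[OF F] by simp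
qed

abbreviation "cs \<equiv> completion_seminorm"

lemma completion_seminorm_near:
  assumes C: "C \<in> carrier Z" and p: "continuous_seminorm X p" and x: "near p e x C"
  shows "\<bar>cs p C - p x\<bar> \<le> e"
proof -
  obtain F where F: "F \<in> C" "around p e x F" using x unfolding near_def by blast
  note cF = class_member(1)[OF C F(1)]
  have lim: "((\<lambda>y. \<bar>p y - p x\<bar>) \<longlongrightarrow> \<bar>cs p C - p x\<bar>) F"
    by (intro tendsto_intros completion_seminorm_limit[OF C p F(1)])
  have "eventually (\<lambda>y. \<bar>p y - p x\<bar> \<le> e) F" using F(2) cauchy_filterD(3)[OF cF]
    by eventually_elim (use seminorm_abs_diff[OF cseminormD[OF p] _ near_carrier[OF x]] in force)
  then show ?thesis by (rule tendsto_upperbound[OF lim _ cauchy_filterD(1)[OF cF]])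
qed

lemma completion_seminorm_on:
  assumes p: "continuous_seminorm X p"
  shows "seminorm_on Z (cs p)"
  unfolding seminorm_on_def
proof (intro conjI ballI allI)
  note sp = cseminormD[OF p]
  fix C D assume C: "C \<in> carrier Z" and D: "D \<in> carrier Z"
  show "cs p (C \<oplus>\<^bsub>Z\<^esub> D) \<le> cs p C + cs p D"
  proof (rule field_le_epsilon)
    fix e :: real assume e: "e > 0"
    obtain x y where x: "near p (e/4) x C" and y: "near p (e/4) y D"
      using near_exists[OF C p, of "e/4"] near_exists[OF D p, of "e/4"] e by auto
    show "cs p (C \<oplus>\<^bsub>Z\<^esub> D) \<le> cs p C + cs p D + e"
      using completion_seminorm_near[OF C p x] completion_seminorm_near[OF D p y]
        completion_seminorm_near[OF completion_add_mem[OF C D] p near_add[OF C D p x y]]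
        seminorm_add[OF sp near_carrier[OF x] near_carrier[OF y]] by linarith
  qed
next
  fix c C assume C: "C \<in> carrier Z"
  note sp = cseminormD[OF p]
  have "\<bar>cs p (c \<odot>\<^bsub>Z\<^esub> C) - cmod c * cs p C\<bar> \<le> 0 + d" if d: "d > 0" for d
  proof -
    define e where "e = d / (2 * cmod c + 1)"
    have pos: "2 * cmod c + 1 > 0" using norm_ge_zero[of c] by linarith
    have e: "e > 0" "(2 * cmod c + 1) * e = d" using d pos by (auto simp: e_def)
    obtain x where x: "near p e x C" using near_exists[OF C p e(1)] by auto
    have 1: "\<bar>cs p (c \<odot>\<^bsub>Z\<^esub> C) - cmod c * p x\<bar> \<le> (cmod c + 1) * e"
      using completion_seminorm_near[OF completion_smult_mem[OF C] p near_smult[OF C p x e(1)], of c]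
        seminorm_smult[OF sp near_carrier[OF x], of c] by simp
    have "\<bar>cmod c * p x - cmod c * cs p C\<bar> = cmod c * \<bar>cs p C - p x\<bar>"
      by (simp add: abs_mult abs_minus_commute flip: right_diff_distrib)
    also have "\<dots> \<le> cmod c * e" by (intro mult_left_mono completion_seminorm_near[OF C p x]) simp
    finally have 2: "\<bar>cmod c * p x - cmod c * cs p C\<bar> \<le> cmod c * e" .
    have "(cmod c + 1) * e + cmod c * e = d" using e(2) by (simp add: algebra_simps)
    then show ?thesis using 1 2 by linarith
  qed
  then have "\<bar>cs p (c \<odot>\<^bsub>Z\<^esub> C) - cmod c * cs p C\<bar> \<le> 0" by (rule field_le_epsilon)
  then show "cs p (c \<odot>\<^bsub>Z\<^esub> C) = cmod c * cs p C" by simp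
qed

lemma completion_seminorm_to_completion:
  assumes "continuous_seminorm X p" "x \<in> carrier X"
  shows "cs p (\<iota> x) = p x"
proof -
  have "\<bar>cs p (\<iota> x) - p x\<bar> \<le> 0 + e" if "e > 0" for e
    using completion_seminorm_near[OF to_completion_mem[OF assms(2)] assms(1) near_to_completion[OF assms(2,1) that]] by simp
  then have "\<bar>cs p (\<iota> x) - p x\<bar> \<le> 0" by (rule field_le_epsilon)
  then show ?thesis by simp
qed

lemma completion_seminorm_mono:
  assumes p: "continuous_seminorm X p" and q: "continuous_seminorm X q"
    and le: "\<And>x. x \<in> carrier X \<Longrightarrow> p x \<le> q x" and C: "C \<in> carrier Z"
  shows "cs p C \<le> cs q C"
proof -
  obtain F where F: "F \<in> C" using class_nonempty[OF C] by auto
  note cF = class_member(1)[OF C F]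
  show ?thesis
    by (rule tendsto_le[OF cauchy_filterD(1)[OF cF] completion_seminorm_limit[OF C q F] completion_seminorm_limit[OF C p F]])
      (rule eventually_mono[OF cauchy_filterD(3)[OF cF] le])
qed

lemma linear_to_completion: "linear_map X Z (to_completion X)"
proof (rule linear_mapI)
  note const = approximates_const
  show "\<iota> x \<in> carrier Z" if "x \<in> carrier X" for x by (rule to_completion_mem[OF that])
  show "\<iota> (x \<oplus>\<^bsub>X\<^esub> y) = \<iota> x \<oplus>\<^bsub>Z\<^esub> \<iota> y" if "x \<in> carrier X" "y \<in> carrier X" for x y
    by (rule approximates_eq[OF const[OF M.a_closed[OF that]] approximates_add[OF const[OF that(1)] const[OF that(2)]] refl])
  show "\<iota> (c \<odot>\<^bsub>X\<^esub> x) = c \<odot>\<^bsub>Z\<^esub> \<iota> x" if "x \<in> carrier X" for c x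
    by (rule approximates_eq[OF const[OF smult_mem[OF that]] approximates_smult[OF const[OF that]] refl])
qed

end

context locally_convex
begin

interpretation Z: lin_space Z by (rule lin_space_completion)

lemma completion_sel [simp]:
  "carrier (completion X) = carrier Z" "zero (completion X) = zero Z" "add (completion X) = add Z"
  "smult (completion X) = smult Z" "a_minus (completion X) = a_minus Z"
  by (simp_all add: completion_def)

lemma lin_space_completion': "lin_space (completion X)"
  by (rule lin_space_cong[OF lin_space_completion]) simp_all

lemma generates_completion: "generates (completion X) (cs ` cseminorms X)"
  unfolding completion_def
proof (rule generates_seminorm_topology[OF lin_space_completion])
  show "seminorm_on Z p" if "p \<in> cs ` cseminorms X" for p using that completion_seminorm_on by auto
  show "cs ` cseminorms X \<noteq> {}" using cseminorm_zero by auto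
  fix p q assume "p \<in> cs ` cseminorms X" "q \<in> cs ` cseminorms X"
  then obtain p' q' where p: "continuous_seminorm X p'" "p = cs p'" and q: "continuous_seminorm X q'" "q = cs q'" by auto
  let ?r = "\<lambda>x. p' x + q' x"
  have r: "continuous_seminorm X ?r" using p q by (intro cseminorm_add)
  have "p C \<le> cs ?r C" "q C \<le> cs ?r C" if "C \<in> carrier Z" for C
    unfolding p(2) q(2) using that p(1) q(1) seminorm_nonneg[OF cseminormD[OF p(1)]] seminorm_nonneg[OF cseminormD[OF q(1)]]
    by (auto intro!: completion_seminorm_mono r)
  then show "\<exists>r\<in>cs ` cseminorms X. \<forall>x\<in>carrier Z. p x \<le> r x \<and> q x \<le> r x" using r by blast
qed

lemma locally_convex_completion: "locally_convex (completion X)"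
  by (rule generates_locally_convex[OF lin_space_completion' generates_completion])

lemma to_completion_continuous: "continuous_linear X (completion X) (to_completion X)"
proof (rule continuous_linearI[OF locally_convex_axioms lin_space_completion' generates_completion])
  show "linear_map X (completion X) (to_completion X)"
    using linear_to_completion by (simp add: linear_map_def)
  fix q assume "q \<in> cs ` cseminorms X"
  then obtain p where p: "continuous_seminorm X p" "q = cs p" by auto
  then show "\<exists>p K. continuous_seminorm X p \<and> (\<forall>x\<in>carrier X. q (\<iota> x) \<le> K * p x)"
    by (intro exI[of _ p] exI[of _ 1]) (simp add: completion_seminorm_to_completion)
qed

lemma to_completion_dense:
  assumes C: "C \<in> carrier Z" and p: "continuous_seminorm X p" and e: "e > 0"
  shows "\<exists>x\<in>carrier X. cs p (C \<ominus>\<^bsub>Z\<^esub> \<iota> x) < e"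
proof -
  have e': "e/4 > 0" using e by simp
  obtain x where x: "near p (e/4) x C" using near_exists[OF C p e'] by auto
  note xX = near_carrier[OF x]
  have "near p (e/4 + 2 * (e/4)) (x \<ominus>\<^bsub>X\<^esub> x) (C \<ominus>\<^bsub>Z\<^esub> \<iota> x)"
    by (intro near_diff C to_completion_mem xX p x near_to_completion e')
  from completion_seminorm_near[OF _ p this] have "cs p (C \<ominus>\<^bsub>Z\<^esub> \<iota> x) \<le> e/4 + 2 * (e/4)"
    using C xX to_completion_mem[OF xX] seminorm_zero[OF cseminormD[OF p]] by simp
  then show ?thesis using e xX by (intro bexI[of _ x]) auto
qed

lemma completion_separated:
  assumes C: "C \<in> carrier Z" and D: "D \<in> carrier Z"
    and small: "\<And>p. continuous_seminorm X p \<Longrightarrow> cs p (C \<ominus>\<^bsub>Z\<^esub> D) = 0"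
  shows "C = D"
proof (rule completion_eqI[OF C D, where K = 6])
  fix p and e :: real assume p: "continuous_seminorm X p" and e: "e > 0"
  obtain x y where x: "near p e x C" and y: "near p e y D"
    using near_exists[OF C p e] near_exists[OF D p e] by auto
  have "\<bar>0 - p (x \<ominus>\<^bsub>X\<^esub> y)\<bar> \<le> e + 2 * e"
    using completion_seminorm_near[OF _ p near_diff[OF C D p x y e]] C D small[OF p] by simp
  then have "p (y \<ominus>\<^bsub>X\<^esub> x) \<le> 3 * e"
    using seminorm_diff_commute[OF cseminormD[OF p] near_carrier[OF x] near_carrier[OF y]] by simp
  from near_shift[OF D p y near_carrier[OF x] this] have "near p (6 * e) x D" by (rule near_mono) (use e in simp)
  moreover have "near p (6 * e) x C" using x by (rule near_mono) (use e in simp)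
  ultimately show "\<exists>x. near p (6 * e) x C \<and> near p (6 * e) x D" by blast
qed simp

lemma hausdorff_completion: "Hausdorff_space (topo (completion X))"
proof -
  interpret K: locally_convex "completion X" by (rule locally_convex_completion)
  show ?thesis
    unfolding Hausdorff_space_def K.topspace_eq completion_sel
  proof (intro allI impI, elim conjE)
    fix C D assume C: "C \<in> carrier Z" and D: "D \<in> carrier Z" and ne: "C \<noteq> D"
    obtain p where p: "continuous_seminorm X p" "cs p (C \<ominus>\<^bsub>Z\<^esub> D) \<noteq> 0"
      using completion_separated[OF C D] ne by blast
    note sp = completion_seminorm_on[OF p(1)]
    define e where "e = cs p (C \<ominus>\<^bsub>Z\<^esub> D) / 2"
    have e: "e > 0" using p(2) Z.seminorm_nonneg[OF sp, of "C \<ominus>\<^bsub>Z\<^esub> D"] C D by (simp add: e_def)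
    let ?B = "\<lambda>E. sball (completion X) (cs p) E e"
    have opn: "openin (topo (completion X)) (?B E)" if "E \<in> carrier Z" for E
      by (rule generates_sball_open[OF lin_space_completion' generates_completion]) (use p that in auto)
    have "E \<notin> ?B D" if "E \<in> ?B C" for E
    proof
      assume "E \<in> ?B D"
      then have "E \<in> carrier Z" "cs p (E \<ominus>\<^bsub>Z\<^esub> C) < e" "cs p (E \<ominus>\<^bsub>Z\<^esub> D) < e" using that by (auto simp: sball_def)
      then show False
        using Z.seminorm_triangle[OF sp C _ D, of E] Z.seminorm_diff_commute[OF sp C, of E] by (simp add: e_def)
    qed
    moreover have "C \<in> ?B C" "D \<in> ?B D" using C D e by (auto simp: sball_def Z.seminorm_zero[OF sp])
    ultimately show "\<exists>U V. openin (topo (completion X)) U \<and> openin (topo (completion X)) V \<and> C \<in> U \<and> D \<in> V \<and> disjnt U V"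
      using opn[OF C] opn[OF D] by (intro exI[of _ "?B C"] exI[of _ "?B D"]) (auto simp: disjnt_def)
  qed
qed

text \<open>A Cauchy filter on the completion is approximated by the filter on the given space whose
  sets contain all vectors close to a member of the filter; the class of that filter is the limit.\<close>

lemma complete_completion:
  assumes \<Phi>: "cauchy_filter_on (completion X) \<Phi>"
  shows "\<exists>l. limitin (topo (completion X)) (\<lambda>x. x) l \<Phi>"
proof -
  interpret K: locally_convex "completion X" by (rule locally_convex_completion)
  have \<Phi>b: "\<Phi> \<noteq> bot" and \<Phi>c: "eventually (\<lambda>C. C \<in> carrier Z) \<Phi>"
    using K.cauchy_filterD[OF \<Phi>] by auto
  define good where "good p e Q \<longleftrightarrow> eventually (\<lambda>C. \<forall>x\<in>carrier X. cs p (C \<ominus>\<^bsub>Z\<^esub> \<iota> x) < e \<longrightarrow> Q x) \<Phi>"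
    for p :: "'a \<Rightarrow> real" and e :: real and Q :: "'a \<Rightarrow> bool"
  define F where "F = Abs_filter (\<lambda>Q. \<exists>p e. continuous_seminorm X p \<and> e > 0 \<and> good p e Q)"
  have evF: "eventually Q F \<longleftrightarrow> (\<exists>p e. continuous_seminorm X p \<and> e > 0 \<and> good p e Q)" for Q
    unfolding F_def
  proof (rule eventually_Abs_filter, rule is_filter.intro)
    show "\<exists>p e. continuous_seminorm X p \<and> 0 < e \<and> good p e (\<lambda>x. True)"
      using cseminorm_zero by (auto simp: good_def intro!: exI[of _ 1])
    fix P Q
    assume "\<exists>p e. continuous_seminorm X p \<and> 0 < e \<and> good p e P"
    then obtain p e where p: "continuous_seminorm X p" "e > 0" "good p e P" by auto
    assume "\<exists>p e. continuous_seminorm X p \<and> 0 < e \<and> good p e Q"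
    then obtain q d where q: "continuous_seminorm X q" "d > 0" "good q d Q" by auto
    let ?r = "\<lambda>x. p x + q x"
    have r: "continuous_seminorm X ?r" using p q by (intro cseminorm_add)
    have le: "cs p C \<le> cs ?r C" "cs q C \<le> cs ?r C" if "C \<in> carrier Z" for C
      using that p(1) q(1) seminorm_nonneg[OF cseminormD[OF p(1)]] seminorm_nonneg[OF cseminormD[OF q(1)]]
      by (auto intro!: completion_seminorm_mono r)
    have "good ?r (min e d) (\<lambda>x. P x \<and> Q x)"
      unfolding good_def using p(3)[unfolded good_def] q(3)[unfolded good_def] \<Phi>c
    proof eventually_elim
      case (elim C)
      show ?case
      proof (intro ballI impI)
        fix x assume x: "x \<in> carrier X" "cs ?r (C \<ominus>\<^bsub>Z\<^esub> \<iota> x) < min e d"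
        have "C \<ominus>\<^bsub>Z\<^esub> \<iota> x \<in> carrier Z" using elim(3) to_completion_mem[OF x(1)] by simp
        from le[OF this] x(2) show "P x \<and> Q x" using elim(1,2) x(1) by auto
      qed
    qed
    then show "\<exists>p e. continuous_seminorm X p \<and> 0 < e \<and> good p e (\<lambda>x. P x \<and> Q x)"
      using r p(2) q(2) by (intro exI[of _ ?r] exI[of _ "min e d"]) simp
  next
    fix P Q assume PQ: "\<forall>x. P x \<longrightarrow> Q x" and "\<exists>p e. continuous_seminorm X p \<and> 0 < e \<and> good p e P"
    then obtain p e where p: "continuous_seminorm X p" "e > 0" "good p e P" by auto
    have "good p e Q" unfolding good_def
      by (rule eventually_mono[OF p(3)[unfolded good_def]]) (use PQ in simp)
    then show "\<exists>p e. continuous_seminorm X p \<and> 0 < e \<and> good p e Q" using p by auto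
  qed
  have Fb: "F \<noteq> bot"
  proof
    assume "F = bot"
    then have "eventually (\<lambda>x. False) F" by simp
    then obtain p e where p: "continuous_seminorm X p" "e > 0" "good p e (\<lambda>x. False)" using evF by auto
    have "eventually (\<lambda>C. False) \<Phi>" using p(3)[unfolded good_def] \<Phi>c
    proof eventually_elim
      case (elim C)
      then show ?case using to_completion_dense[OF _ p(1,2), of C] by auto
    qed
    then show False using \<Phi>b by (simp add: trivial_limit_def)
  qed
  have Fc: "F \<le> principal (carrier X)"
    unfolding le_principal evF using cseminorm_zero by (auto simp: good_def intro!: exI[of _ 1])
  have near: "\<exists>x\<in>carrier X. around p e x F \<and> eventually (\<lambda>C. cs p (C \<ominus>\<^bsub>Z\<^esub> \<iota> x) < e) \<Phi>"
    if p: "continuous_seminorm X p" and e: "e > 0" for p e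
  proof -
    note sp = completion_seminorm_on[OF p]
    have e3: "e/3 > 0" using e by simp
    have cp: "continuous_seminorm (completion X) (cs p)"
      by (rule K.generator_cseminorm[OF generates_completion]) (use p in simp)
    obtain D where D: "D \<in> carrier Z" "eventually (\<lambda>C. cs p (C \<ominus>\<^bsub>Z\<^esub> D) < e/3) \<Phi>"
      using K.cauchy_filter_near[OF \<Phi> cp e3] by auto
    obtain x where x: "x \<in> carrier X" "cs p (D \<ominus>\<^bsub>Z\<^esub> \<iota> x) < e/3"
      using to_completion_dense[OF D(1) p e3] by auto
    note xm = to_completion_mem[OF x(1)]
    have 1: "eventually (\<lambda>C. C \<in> carrier Z \<and> cs p (C \<ominus>\<^bsub>Z\<^esub> \<iota> x) < 2*e/3) \<Phi>" using D(2) \<Phi>c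
    proof eventually_elim
      case (elim C)
      then show ?case using Z.seminorm_triangle[OF sp _ D(1) xm, of C] x(2) by simp
    qed
    have "good p (e/3) (\<lambda>y. p (y \<ominus>\<^bsub>X\<^esub> x) < e)" unfolding good_def using 1
    proof eventually_elim
      case (elim C)
      show ?case
      proof (intro ballI impI)
        fix y assume y: "y \<in> carrier X" "cs p (C \<ominus>\<^bsub>Z\<^esub> \<iota> y) < e/3"
        note ym = to_completion_mem[OF y(1)]
        have "p (y \<ominus>\<^bsub>X\<^esub> x) = cs p (\<iota> y \<ominus>\<^bsub>Z\<^esub> \<iota> x)"
          using completion_seminorm_to_completion[OF p, of "y \<ominus>\<^bsub>X\<^esub> x"] x(1) y(1)
            linear_map_diff[OF lin_space_axioms lin_space_completion linear_to_completion y(1) x(1)] by simp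
        then show "p (y \<ominus>\<^bsub>X\<^esub> x) < e"
          using Z.seminorm_triangle[OF sp ym _ xm, of C] Z.seminorm_diff_commute[OF sp ym, of C] elim y(2) by simp
      qed
    qed
    then have "around p e x F" unfolding evF using p e3 by blast
    moreover have "eventually (\<lambda>C. cs p (C \<ominus>\<^bsub>Z\<^esub> \<iota> x) < e) \<Phi>"
      using 1 by (rule eventually_mono) (use e in auto)
    ultimately show ?thesis using x(1) by blast
  qed
  have cF: "cauchy_filter_on X F"
    by (rule cauchy_filterI[OF Fb Fc]) (use near in blast)
  let ?L = "cauchy_class X F"
  have L: "?L \<in> carrier Z" using cF by (auto simp: carrier_completion)
  have "limitin (topo (completion X)) (\<lambda>x. x) ?L \<Phi>"
    unfolding limitin_def
  proof (intro conjI allI impI)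
    show "?L \<in> topspace (topo (completion X))" using L by (simp add: K.topspace_eq)
    fix U assume "openin (topo (completion X)) U \<and> ?L \<in> U"
    then obtain p e where p: "continuous_seminorm X p" "e > 0" "sball (completion X) (cs p) ?L e \<subseteq> U"
      using generates_completion unfolding generates_def by (auto dest!: bspec)
    note sp = completion_seminorm_on[OF p(1)]
    obtain x where x: "x \<in> carrier X" "around p (e/8) x F" "eventually (\<lambda>C. cs p (C \<ominus>\<^bsub>Z\<^esub> \<iota> x) < e/8) \<Phi>"
      using near[OF p(1), of "e/8"] p(2) by auto
    note xm = to_completion_mem[OF x(1)]
    have "near p (e/8) x ?L" unfolding near_def using x cauchy_class_self[OF cF] by blast
    then have "near p (e/8 + 2*(e/8)) (x \<ominus>\<^bsub>X\<^esub> x) (?L \<ominus>\<^bsub>Z\<^esub> \<iota> x)"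
      using p(1,2) x(1) xm L by (intro near_diff near_to_completion) auto
    from completion_seminorm_near[OF _ p(1) this]
    have d: "cs p (?L \<ominus>\<^bsub>Z\<^esub> \<iota> x) \<le> 3 * e / 8"
      using L xm x(1) seminorm_zero[OF cseminormD[OF p(1)]] by simp
    show "eventually (\<lambda>C. C \<in> U) \<Phi>" using x(3) \<Phi>c
    proof eventually_elim
      case (elim C)
      have "cs p (C \<ominus>\<^bsub>Z\<^esub> ?L) < e"
        using Z.seminorm_triangle[OF sp elim(2) xm L] Z.seminorm_diff_commute[OF sp xm L] elim(1) d p(2) by simp
      then show ?case using p(3) elim(2) by (auto simp: sball_def)
    qed
  qed
  then show ?thesis by blast
qed

theorem complete_hausdorff_completion: "complete_hausdorff_lcs (completion X)"
proof -
  interpret K: locally_convex "completion X" by (rule locally_convex_completion)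
  show ?thesis by unfold_locales (rule hausdorff_completion, rule complete_completion)
qed

end

lemma (in lin_space) diff_diff_diff:
  assumes "x \<in> carrier X" "y \<in> carrier X" "z \<in> carrier X"
  shows "(x \<ominus> z) \<ominus> (y \<ominus> z) = x \<ominus> y"
proof -
  have "(x \<ominus> z) \<ominus> (y \<ominus> z) = (x \<ominus> z) \<oplus> (z \<ominus> y)"
    unfolding M.minus_eq[of "x \<ominus> z"] neg_diff[OF assms(2,3)] ..
  then show ?thesis using assms by (simp add: diff_add_diff)
qed

context locally_convex
begin

interpretation Z: lin_space Z by (rule lin_space_completion)

text \<open>The value at a class is the limit of the images of a member of the class, which exists because the
  target is complete. It is characterized by the relation \<open>R\<close>, which speaks about vectors near the class
  only. Hence linearity and the bounds by seminorms follow from the same properties of the given map.\<close>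

lemma completion_extension:
  fixes Y :: "'y lcs"
  assumes Y: "complete_hausdorff_lcs Y" and u: "continuous_linear X Y u"
  shows "\<exists>g. continuous_linear (completion X) Y g \<and> (\<forall>x\<in>carrier X. g (\<iota> x) = u x)"
proof -
  interpret Y: complete_hausdorff_lcs Y by fact
  have lin: "linear_map X Y u" using u by (simp add: continuous_linear_def)
  note um = linear_mapD(1)[OF lin]
  have qu: "continuous_seminorm X (\<lambda>x. q (u x))" if "continuous_seminorm Y q" for q
    by (rule continuous_linear_cseminorm[OF u that])
  define R where "R C y \<longleftrightarrow> y \<in> carrier Y \<and> (\<forall>q e. continuous_seminorm Y q \<longrightarrow> e > 0 \<longrightarrow>
      (\<exists>x. near (\<lambda>x. q (u x)) e x C \<and> q (u x \<ominus>\<^bsub>Y\<^esub> y) < e))" for C y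
  have ex: "\<exists>y. R C y" if C: "C \<in> carrier Z" for C
  proof -
    obtain F where F: "F \<in> C" using class_nonempty[OF C] by auto
    note cF = class_member(1)[OF C F]
    have cauchy: "cauchy_filter_on Y (filtermap u F)"
    proof (rule Y.cauchy_filterI)
      show "filtermap u F \<noteq> bot" using cauchy_filterD(1)[OF cF] by (simp add: filtermap_bot_iff)
      show "filtermap u F \<le> principal (carrier Y)"
        unfolding le_principal eventually_filtermap by (rule eventually_mono[OF cauchy_filterD(3)[OF cF] um])
      fix q and e :: real assume q: "continuous_seminorm Y q" and e: "e > 0"
      obtain x where x: "x \<in> carrier X" "eventually (\<lambda>y. q (u (y \<ominus>\<^bsub>X\<^esub> x)) < e) F"
        using cauchy_filter_near[OF cF qu[OF q] e] by auto
      have "eventually (\<lambda>y. q (y \<ominus>\<^bsub>Y\<^esub> u x) < e) (filtermap u F)"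
        unfolding eventually_filtermap using x(2) cauchy_filterD(3)[OF cF]
        by eventually_elim (use x(1) linear_map_diff[OF lin_space_axioms Y.lin_space_axioms lin] in simp)
      then show "\<exists>x\<in>carrier Y. eventually (\<lambda>y. q (y \<ominus>\<^bsub>Y\<^esub> x) < e) (filtermap u F)" using um[OF x(1)] by blast
    qed
    obtain y where y: "limitin (topo Y) (\<lambda>x. x) y (filtermap u F)" using Y.complete[OF cauchy] by blast
    have yY: "y \<in> carrier Y" using y by (simp add: limitin_def Y.topspace_eq)
    have "\<exists>x. near (\<lambda>x. q (u x)) e x C \<and> q (u x \<ominus>\<^bsub>Y\<^esub> y) < e" if q: "continuous_seminorm Y q" and e: "e > 0" for q e
    proof -
      have e2: "e/2 > 0" using e by simp
      note squ = cseminormD[OF qu[OF q]]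
      have "openin (topo Y) (sball Y q y e)"
        by (rule generates_sball_open[OF Y.lin_space_axioms Y.generates_cseminorms]) (use q yY in auto)
      moreover have "y \<in> sball Y q y e" using yY e Y.seminorm_zero[OF Y.cseminormD[OF q]] by (simp add: sball_def)
      ultimately have 1: "eventually (\<lambda>x. u x \<in> sball Y q y e) F"
        using y by (simp add: limitin_def eventually_filtermap)
      obtain x where x: "x \<in> carrier X" "eventually (\<lambda>y. q (u (y \<ominus>\<^bsub>X\<^esub> x)) < e/2) F"
        using cauchy_filter_near[OF cF qu[OF q] e2] by auto
      obtain z where z: "z \<in> carrier X" "u z \<in> sball Y q y e" "q (u (z \<ominus>\<^bsub>X\<^esub> x)) < e/2"
        using eventually_happens'[OF cauchy_filterD(1)[OF cF]
            eventually_conj[OF cauchy_filterD(3)[OF cF] eventually_conj[OF 1 x(2)]]] by blast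
      have "eventually (\<lambda>w. q (u (w \<ominus>\<^bsub>X\<^esub> z)) < e) F" using x(2) cauchy_filterD(3)[OF cF]
      proof eventually_elim
        case (elim w)
        then show ?case
          using seminorm_triangle[OF squ, of w x z] seminorm_diff_commute[OF squ, of x z] x(1) z by simp
      qed
      then have "near (\<lambda>x. q (u x)) e z C" unfolding near_def using z(1) F by blast
      then show ?thesis using z(2) by (auto simp: sball_def)
    qed
    then show ?thesis using yY unfolding R_def by blast
  qed
  define g where "g C = (SOME y. R C y)" for C
  have R: "R C (g C)" if "C \<in> carrier Z" for C unfolding g_def by (rule someI_ex[OF ex[OF that]])
  have gm: "g C \<in> carrier Y" if "C \<in> carrier Z" for C using R[OF that] by (simp add: R_def)
  have appr: "q (u x \<ominus>\<^bsub>Y\<^esub> g C) \<le> e"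
    if C: "C \<in> carrier Z" and q: "continuous_seminorm Y q" and x: "near (\<lambda>x. q (u x)) e x C" for C q x e
  proof (rule field_le_epsilon)
    fix d :: real assume d: "d > 0"
    have d2: "d/2 > 0" using d by simp
    obtain z where z: "near (\<lambda>x. q (u x)) (d/2) z C" "q (u z \<ominus>\<^bsub>Y\<^esub> g C) < d/2"
      using R[OF C] q d2 unfolding R_def by blast
    have "q (u x \<ominus>\<^bsub>Y\<^esub> u z) \<le> e + d/2"
      using near_dist[OF C qu[OF q] x z(1)] near_carrier[OF x] near_carrier[OF z(1)]
        linear_map_diff[OF lin_space_axioms Y.lin_space_axioms lin] by simp
    then show "q (u x \<ominus>\<^bsub>Y\<^esub> g C) \<le> e + d"
      using Y.seminorm_triangle[OF Y.cseminormD[OF q] um[OF near_carrier[OF x]] um[OF near_carrier[OF z(1)]] gm[OF C]] z(2) by simp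
  qed
  have char: "g C = y"
    if C: "C \<in> carrier Z" and y: "y \<in> carrier Y" and K: "K > 0"
      and *: "\<And>q e. continuous_seminorm Y q \<Longrightarrow> e > 0 \<Longrightarrow> \<exists>x. near (\<lambda>x. q (u x)) (K * e) x C \<and> q (u x \<ominus>\<^bsub>Y\<^esub> y) \<le> K * e" for C y K
  proof (rule Y.hausdorff_seminorm[OF Y.hausdorff gm[OF C] y])
    fix q and e :: real assume q: "continuous_seminorm Y q" and e: "e > 0"
    have e': "e / (2 * K) > 0" "K * (e / (2 * K)) = e / 2" using e K by auto
    obtain x where x: "near (\<lambda>x. q (u x)) (e/2) x C" "q (u x \<ominus>\<^bsub>Y\<^esub> y) \<le> e/2"
      using *[OF q e'(1)] unfolding e'(2) by auto
    note xm = um[OF near_carrier[OF x(1)]]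
    show "q (g C \<ominus>\<^bsub>Y\<^esub> y) \<le> e"
      using appr[OF C q x(1)] x(2) Y.seminorm_triangle[OF Y.cseminormD[OF q] gm[OF C] xm y]
        Y.seminorm_diff_commute[OF Y.cseminormD[OF q] gm[OF C] xm] by simp
  qed
  have gu: "g (\<iota> x) = u x" if x: "x \<in> carrier X" for x
  proof (rule char[of _ _ 1])
    fix q and e :: real assume q: "continuous_seminorm Y q" and e: "e > 0"
    show "\<exists>z. near (\<lambda>x. q (u x)) (1 * e) z (\<iota> x) \<and> q (u z \<ominus>\<^bsub>Y\<^esub> u x) \<le> 1 * e"
      using near_to_completion[OF x qu[OF q] e] um[OF x] e Y.seminorm_zero[OF Y.cseminormD[OF q]]
      by (intro exI[of _ x]) simp
  qed (use x um to_completion_mem in auto)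
  have glin: "linear_map (completion X) Y g"
  proof (rule linear_mapI, unfold completion_sel)
    show "g C \<in> carrier Y" if "C \<in> carrier Z" for C using gm[OF that] .
    fix C D assume C: "C \<in> carrier Z" and D: "D \<in> carrier Z"
    show "g (C \<oplus>\<^bsub>Z\<^esub> D) = g C \<oplus>\<^bsub>Y\<^esub> g D"
    proof (rule char[of _ _ 2])
      fix q and e :: real assume q: "continuous_seminorm Y q" and e: "e > 0"
      obtain x y where x: "near (\<lambda>x. q (u x)) e x C" and y: "near (\<lambda>x. q (u x)) e y D"
        using near_exists[OF C qu[OF q] e] near_exists[OF D qu[OF q] e] by auto
      note xm = near_carrier[OF x] near_carrier[OF y]
      have "u (x \<oplus>\<^bsub>X\<^esub> y) \<ominus>\<^bsub>Y\<^esub> (g C \<oplus>\<^bsub>Y\<^esub> g D) = (u x \<ominus>\<^bsub>Y\<^esub> g C) \<oplus>\<^bsub>Y\<^esub> (u y \<ominus>\<^bsub>Y\<^esub> g D)"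
        using xm um gm C D by (simp add: linear_mapD(2)[OF lin] Y.add_diff_add)
      then have "q (u (x \<oplus>\<^bsub>X\<^esub> y) \<ominus>\<^bsub>Y\<^esub> (g C \<oplus>\<^bsub>Y\<^esub> g D)) \<le> e + e"
        using Y.seminorm_add[OF Y.cseminormD[OF q], of "u x \<ominus>\<^bsub>Y\<^esub> g C" "u y \<ominus>\<^bsub>Y\<^esub> g D"] appr[OF C q x] appr[OF D q y]
          xm um gm C D by simp
      moreover have "near (\<lambda>x. q (u x)) (e + e) (x \<oplus>\<^bsub>X\<^esub> y) (C \<oplus>\<^bsub>Z\<^esub> D)" by (rule near_add[OF C D qu[OF q] x y])
      ultimately show "\<exists>x. near (\<lambda>x. q (u x)) (2 * e) x (C \<oplus>\<^bsub>Z\<^esub> D) \<and> q (u x \<ominus>\<^bsub>Y\<^esub> (g C \<oplus>\<^bsub>Y\<^esub> g D)) \<le> 2 * e"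
        by (intro exI[of _ "x \<oplus>\<^bsub>X\<^esub> y"]) simp
    qed (use C D gm in auto)
  next
    fix c C assume C: "C \<in> carrier Z"
    have pos: "cmod c + 1 > 0" using norm_ge_zero[of c] by linarith
    show "g (c \<odot>\<^bsub>Z\<^esub> C) = c \<odot>\<^bsub>Y\<^esub> g C"
    proof (rule char[of _ _ "cmod c + 1"])
      fix q and e :: real assume q: "continuous_seminorm Y q" and e: "e > 0"
      obtain x where x: "near (\<lambda>x. q (u x)) e x C" using near_exists[OF C qu[OF q] e] by auto
      note xm = near_carrier[OF x]
      have "u (c \<odot>\<^bsub>X\<^esub> x) \<ominus>\<^bsub>Y\<^esub> (c \<odot>\<^bsub>Y\<^esub> g C) = c \<odot>\<^bsub>Y\<^esub> (u x \<ominus>\<^bsub>Y\<^esub> g C)"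
        using xm um gm C by (simp add: linear_mapD(3)[OF lin] Y.smult_diff)
      then have "q (u (c \<odot>\<^bsub>X\<^esub> x) \<ominus>\<^bsub>Y\<^esub> (c \<odot>\<^bsub>Y\<^esub> g C)) = cmod c * q (u x \<ominus>\<^bsub>Y\<^esub> g C)"
        using Y.seminorm_smult[OF Y.cseminormD[OF q], of "u x \<ominus>\<^bsub>Y\<^esub> g C" c] xm um gm C by simp
      also have "\<dots> \<le> cmod c * e" by (intro mult_left_mono appr[OF C q x]) simp
      also have "\<dots> \<le> (cmod c + 1) * e" using e by simp
      finally show "\<exists>x. near (\<lambda>x. q (u x)) ((cmod c + 1) * e) x (c \<odot>\<^bsub>Z\<^esub> C) \<and> q (u x \<ominus>\<^bsub>Y\<^esub> (c \<odot>\<^bsub>Y\<^esub> g C)) \<le> (cmod c + 1) * e"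
        using near_smult[OF C qu[OF q] x e, of c] by (intro exI[of _ "c \<odot>\<^bsub>X\<^esub> x"]) simp
    qed (use C gm pos in auto)
  qed
  have "continuous_linear (completion X) Y g"
  proof (rule continuous_linearI[OF locally_convex_completion Y.lin_space_axioms Y.generates_cseminorms glin], unfold mem_Collect_eq completion_sel)
    fix q assume q: "continuous_seminorm Y q"
    let ?p = "\<lambda>x. q (u x)"
    have "q (g C) \<le> 1 * cs ?p C" if C: "C \<in> carrier Z" for C
    proof (rule field_le_epsilon)
      fix e :: real assume e: "e > 0"
      have e2: "e/2 > 0" using e by simp
      obtain x where x: "near ?p (e/2) x C" using near_exists[OF C qu[OF q] e2] by auto
      note xm = um[OF near_carrier[OF x]]
      have "\<bar>q (u x) - q (g C)\<bar> \<le> q (u x \<ominus>\<^bsub>Y\<^esub> g C)"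
        by (rule Y.seminorm_abs_diff[OF Y.cseminormD[OF q] xm gm[OF C]])
      then show "q (g C) \<le> 1 * cs ?p C + e"
        using appr[OF C q x] completion_seminorm_near[OF C qu[OF q] x] by linarith
    qed
    then show "\<exists>p K. continuous_seminorm (completion X) p \<and> (\<forall>x\<in>carrier Z. q (g x) \<le> K * p x)"
      using locally_convex.generator_cseminorm[OF locally_convex_completion generates_completion, of "cs ?p"] qu[OF q]
      by (intro exI[of _ "cs ?p"] exI[of _ 1]) auto
  qed
  then show ?thesis using gu by blast
qed

text \<open>A vector of the completion differs from one in the dense image by a vector on which both maps are
  small.\<close>

lemma completion_map_unique:
  fixes Y :: "'y lcs"
  assumes Y: "locally_convex Y" and H: "Hausdorff_space (topo Y)"
    and g: "continuous_linear (completion X) Y g" and h: "continuous_linear (completion X) Y h"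
    and eq: "\<And>x. x \<in> carrier X \<Longrightarrow> g (\<iota> x) = h (\<iota> x)"
    and C: "C \<in> carrier (completion X)"
  shows "g C = h C"
proof -
  interpret Y: locally_convex Y by fact
  interpret K: locally_convex "completion X" by (rule locally_convex_completion)
  have CZ: "C \<in> carrier Z" using C by simp
  have lg: "linear_map (completion X) Y g" and lh: "linear_map (completion X) Y h"
    using g h by (auto simp: continuous_linear_def)
  note gm = linear_mapD(1)[OF lg] and hm = linear_mapD(1)[OF lh]
  show ?thesis
  proof (rule Y.hausdorff_seminorm[OF H gm[OF C] hm[OF C]])
    fix q and e :: real assume q: "continuous_seminorm Y q" and e: "e > 0"
    note sq = Y.cseminormD[OF q]
    have "continuous_seminorm (completion X) (\<lambda>C. q (g C) + q (h C))"
      by (intro K.cseminorm_add continuous_linear_cseminorm[OF g q] continuous_linear_cseminorm[OF h q])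
    then obtain r k where r: "r \<in> cs ` cseminorms X" "k > 0"
      and le: "\<And>C. C \<in> carrier (completion X) \<Longrightarrow> q (g C) + q (h C) \<le> k * r C"
      by (rule K.cseminorm_le_generator[OF generates_completion]) blast
    obtain p where p: "continuous_seminorm X p" "r = cs p" using r(1) by auto
    have ek: "e / k > 0" using e r(2) by simp
    obtain x where x: "x \<in> carrier X" "cs p (C \<ominus>\<^bsub>Z\<^esub> \<iota> x) < e / k"
      using to_completion_dense[OF CZ p(1) ek] by auto
    note xm = to_completion_mem[OF x(1)]
    let ?D = "C \<ominus>\<^bsub>Z\<^esub> \<iota> x"
    have D: "?D \<in> carrier (completion X)" using CZ xm by simp
    have "g C \<ominus>\<^bsub>Y\<^esub> h C = g ?D \<ominus>\<^bsub>Y\<^esub> h ?D"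
    proof -
      have "g ?D = g C \<ominus>\<^bsub>Y\<^esub> g (\<iota> x)" "h ?D = h C \<ominus>\<^bsub>Y\<^esub> g (\<iota> x)"
        using linear_map_diff[OF lin_space_completion' Y.lin_space_axioms lg C, of "\<iota> x"]
          linear_map_diff[OF lin_space_completion' Y.lin_space_axioms lh C, of "\<iota> x"] xm eq[OF x(1)] by simp_all
      moreover have "g (\<iota> x) \<in> carrier Y" using gm xm by simp
      ultimately show ?thesis using gm[OF C] hm[OF C]
        by (simp add: Y.diff_diff_diff)
    qed
    then have "q (g C \<ominus>\<^bsub>Y\<^esub> h C) \<le> q (g ?D) + q (h ?D)"
      using Y.seminorm_diff_le[OF sq gm[OF D] hm[OF D]] by simp
    also have "\<dots> \<le> k * cs p ?D" using le[OF D] p(2) by simp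
    also have "\<dots> \<le> k * (e / k)" using x(2) r(2) by (intro mult_left_mono) auto
    finally show "q (g C \<ominus>\<^bsub>Y\<^esub> h C) \<le> e" using r(2) by simp
  qed
qed

end

section \<open>The scalar field\<close>

lemma complex_lcs_sel [simp]:
  "carrier complex_lcs = UNIV" "zero complex_lcs = 0" "add complex_lcs = (+)" "smult complex_lcs = (*)"
  "topo complex_lcs = euclidean"
  by (simp_all add: complex_lcs_def)

lemma lin_space_complex: "lin_space complex_lcs"
  by (rule lin_spaceI) (simp_all add: algebra_simps)

lemma complex_minus [simp]: "x \<ominus>\<^bsub>complex_lcs\<^esub> y = x - y"
proof -
  interpret lin_space complex_lcs by (rule lin_space_complex)
  show ?thesis by (simp add: diff_eq_iff)
qed

lemma locally_convex_complex: "locally_convex complex_lcs"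
proof (rule generates_locally_convex[OF lin_space_complex])
  show "generates complex_lcs {cmod}"
    unfolding generates_def
    by (auto simp: seminorm_on_def norm_triangle_ineq norm_mult sball_def open_contains_ball subset_eq
        Ball_def dist_norm norm_minus_commute)
qed

section \<open>Quotients by subspaces\<close>

definition lin_subspace :: "'a set \<Rightarrow> (complex, 'a, 'm) module_scheme \<Rightarrow> bool" where
  "lin_subspace I X \<longleftrightarrow> I \<subseteq> carrier X \<and> \<zero>\<^bsub>X\<^esub> \<in> I \<and> (\<forall>x\<in>I. \<forall>y\<in>I. x \<oplus>\<^bsub>X\<^esub> y \<in> I) \<and> (\<forall>c. \<forall>x\<in>I. c \<odot>\<^bsub>X\<^esub> x \<in> I)"

lemma a_r_coset_carrier_update [simp]: "a_r_coset (X\<lparr>carrier := K\<rparr>) I x = a_r_coset X I x"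
  by (simp add: a_r_coset_def')

lemma lin_subspaceD:
  assumes "lin_subspace I X"
  shows "x \<in> I \<Longrightarrow> x \<in> carrier X" "\<zero>\<^bsub>X\<^esub> \<in> I" "x \<in> I \<Longrightarrow> y \<in> I \<Longrightarrow> x \<oplus>\<^bsub>X\<^esub> y \<in> I"
    "x \<in> I \<Longrightarrow> c \<odot>\<^bsub>X\<^esub> x \<in> I"
  using assms by (auto simp: lin_subspace_def)

lemma linear_image_subspace:
  assumes "lin_space W" "lin_space X" "linear_map W X f"
  shows "lin_subspace (f ` carrier W) X"
proof -
  interpret W: lin_space W by fact
  have "\<zero>\<^bsub>X\<^esub> \<in> f ` carrier W" using linear_map_zero[OF assms] by (metis W.M.zero_closed imageI)
  moreover have "f x \<oplus>\<^bsub>X\<^esub> f y \<in> f ` carrier W" if "x \<in> carrier W" "y \<in> carrier W" for x y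
    using linear_mapD(2)[OF assms(3) that] that by (metis W.M.a_closed imageI)
  moreover have "c \<odot>\<^bsub>X\<^esub> f x \<in> f ` carrier W" if "x \<in> carrier W" for c x
    using linear_mapD(3)[OF assms(3) that] that by (metis W.smult_mem imageI)
  ultimately show ?thesis using linear_mapD(1)[OF assms(3)] by (auto simp: lin_subspace_def)
qed

context lin_space
begin

lemma subspace_neg: "lin_subspace I X \<Longrightarrow> x \<in> I \<Longrightarrow> \<ominus> x \<in> I"
  using lin_subspaceD[of I X] by (simp add: neg_eq_smult)

lemma mem_coset_iff:
  assumes I: "lin_subspace I X" and x: "x \<in> carrier X"
  shows "z \<in> I +> x \<longleftrightarrow> z \<in> carrier X \<and> z \<ominus> x \<in> I"
proof
  assume "z \<in> I +> x"
  then obtain h where "h \<in> I" "z = h \<oplus> x" by (auto simp: a_r_coset_def')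
  then show "z \<in> carrier X \<and> z \<ominus> x \<in> I" using lin_subspaceD(1)[OF I, of h] x by simp
next
  assume z: "z \<in> carrier X \<and> z \<ominus> x \<in> I"
  then have "z = (z \<ominus> x) \<oplus> x" using x by simp
  then show "z \<in> I +> x" using z unfolding a_r_coset_def' by blast
qed

lemma coset_self: "lin_subspace I X \<Longrightarrow> x \<in> carrier X \<Longrightarrow> x \<in> I +> x"
  by (simp add: mem_coset_iff lin_subspaceD(2))

lemma coset_eq_iff:
  assumes I: "lin_subspace I X" and x: "x \<in> carrier X" and y: "y \<in> carrier X"
  shows "I +> x = I +> y \<longleftrightarrow> x \<ominus> y \<in> I"
proof
  assume "I +> x = I +> y"
  then show "x \<ominus> y \<in> I" using coset_self[OF I x] mem_coset_iff[OF I y] by simp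
next
  assume d: "x \<ominus> y \<in> I"
  have d': "y \<ominus> x \<in> I" using subspace_neg[OF I d] x y by (simp add: neg_diff)
  have "z \<ominus> x \<in> I \<longleftrightarrow> z \<ominus> y \<in> I" if z: "z \<in> carrier X" for z
    using lin_subspaceD(3)[OF I _ d, of "z \<ominus> x"] lin_subspaceD(3)[OF I _ d', of "z \<ominus> y"] x y z
    by (auto simp: diff_add_diff)
  then show "I +> x = I +> y" using mem_coset_iff[OF I x] mem_coset_iff[OF I y] by blast
qed

lemma coset_zero: "lin_subspace I X \<Longrightarrow> I +> \<zero> = I"
  using mem_coset_iff[of I \<zero>] lin_subspaceD(1)[of I X] by auto

lemma coset_add:
  assumes I: "lin_subspace I X" and x: "x \<in> carrier X" and y: "y \<in> carrier X"
  shows "set_add X (I +> x) (I +> y) = I +> (x \<oplus> y)"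
proof
  show "set_add X (I +> x) (I +> y) \<subseteq> I +> (x \<oplus> y)"
  proof
    fix z assume "z \<in> set_add X (I +> x) (I +> y)"
    then obtain u v where uv: "u \<in> I +> x" "v \<in> I +> y" "z = u \<oplus> v" by (auto simp: set_add_def')
    then have *: "u \<in> carrier X" "u \<ominus> x \<in> I" "v \<in> carrier X" "v \<ominus> y \<in> I" using mem_coset_iff I x y by auto
    then show "z \<in> I +> (x \<oplus> y)"
      using uv(3) x y lin_subspaceD(3)[OF I *(2,4)] by (simp add: mem_coset_iff I add_diff_add)
  qed
  show "I +> (x \<oplus> y) \<subseteq> set_add X (I +> x) (I +> y)"
  proof
    fix z assume "z \<in> I +> (x \<oplus> y)"
    then have z: "z \<in> carrier X" "z \<ominus> (x \<oplus> y) \<in> I" using mem_coset_iff[OF I, of "x \<oplus> y"] x y by auto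
    have "(z \<ominus> y) \<ominus> x = z \<ominus> (x \<oplus> y)" using x y z by (simp add: M.minus_eq M.minus_add M.a_ac)
    then have "z \<ominus> y \<in> I +> x" using z x y by (simp add: mem_coset_iff I)
    moreover have "y \<in> I +> y" by (rule coset_self[OF I y])
    moreover have "z = (z \<ominus> y) \<oplus> y" using z y by simp
    ultimately show "z \<in> set_add X (I +> x) (I +> y)" unfolding set_add_def' by blast
  qed
qed

lemma coset_smult:
  assumes I: "lin_subspace I X" and x: "x \<in> carrier X"
  shows "(\<Union>z\<in>I +> x. I +> (c \<odot> z)) = I +> (c \<odot> x)"
proof -
  have "I +> (c \<odot> z) = I +> (c \<odot> x)" if "z \<in> I +> x" for z
  proof -
    have z: "z \<in> carrier X" "z \<ominus> x \<in> I" using that mem_coset_iff[OF I x] by auto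
    then show ?thesis using lin_subspaceD(4)[OF I z(2), of c] x by (simp add: coset_eq_iff I smult_diff)
  qed
  then show ?thesis using coset_self[OF I x] by blast
qed

text \<open>Quotients are taken of a subspace \<^term>\<open>K\<close>, so that the same facts serve for homology. The
  cosets are those of elements of \<^term>\<open>K\<close>, whereas \<^term>\<open>I\<close> can be any subspace of the whole space.\<close>

lemma quotient_sel:
  "carrier (X\<lparr>carrier := K\<rparr> /\<^sub>l\<^sub>i\<^sub>n I) = (\<lambda>x. I +> x) ` K"
  "zero (X\<lparr>carrier := K\<rparr> /\<^sub>l\<^sub>i\<^sub>n I) = I"
  "C \<oplus>\<^bsub>X\<lparr>carrier := K\<rparr> /\<^sub>l\<^sub>i\<^sub>n I\<^esub> D = set_add X C D"
  "c \<odot>\<^bsub>X\<lparr>carrier := K\<rparr> /\<^sub>l\<^sub>i\<^sub>n I\<^esub> C = (\<Union>z\<in>C. I +> (c \<odot> z))"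
  by (auto simp: linear_quotient_def A_RCOSETS_def' set_add_def')

lemma linear_coset:
  assumes I: "lin_subspace I X"
  shows "linear_map X (X /\<^sub>l\<^sub>i\<^sub>n I) (\<lambda>x. I +> x)" "carrier (X /\<^sub>l\<^sub>i\<^sub>n I) = (\<lambda>x. I +> x) ` carrier X" "zero (X /\<^sub>l\<^sub>i\<^sub>n I) = I"
proof -
  have e: "X\<lparr>carrier := carrier X\<rparr> = X" by simp
  note q = quotient_sel[where K = "carrier X", unfolded e]
  show "carrier (X /\<^sub>l\<^sub>i\<^sub>n I) = (\<lambda>x. I +> x) ` carrier X" "zero (X /\<^sub>l\<^sub>i\<^sub>n I) = I"
    by (rule q)+
  show "linear_map X (X /\<^sub>l\<^sub>i\<^sub>n I) (\<lambda>x. I +> x)"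
    by (rule linear_mapI) (simp_all add: q coset_add[OF I] coset_smult[OF I])
qed

lemma lin_space_quotient:
  assumes I: "lin_subspace I X"
  shows "lin_space (X /\<^sub>l\<^sub>i\<^sub>n I)"
proof -
  note q = linear_coset[OF I]
  note d = linear_mapD(2,3)[OF q(1), symmetric]
  have z: "zero (X /\<^sub>l\<^sub>i\<^sub>n I) = I +> \<zero>" using q(3) coset_zero[OF I] by simp
  have ex: "\<exists>x\<in>carrier X. C = I +> x" if "C \<in> carrier (X /\<^sub>l\<^sub>i\<^sub>n I)" for C using that unfolding q(2) by blast
  have mem: "I +> x \<in> carrier (X /\<^sub>l\<^sub>i\<^sub>n I)" if "x \<in> carrier X" for x using that unfolding q(2) by blast
  show ?thesis
    by (rule lin_spaceI; (drule ex)?; (drule ex)?; (drule ex)?; clarify?)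
      (simp_all add: z d mem M.a_assoc smult_add_left smult_add_right smult_smult minus_smult M.l_neg, simp add: M.a_comm)
qed

end

section \<open>The algebraic tensor power\<close>

abbreviation basis :: "'b \<Rightarrow> ('b \<Rightarrow>\<^sub>0 complex)" where
  "basis x \<equiv> Poly_Mapping.single x 1"

definition pscale :: "complex \<Rightarrow> ('b \<Rightarrow>\<^sub>0 complex) \<Rightarrow> 'b \<Rightarrow>\<^sub>0 complex" where
  "pscale c = Poly_Mapping.map (\<lambda>z. c * z)"

lemma lookup_scale [simp]: "Poly_Mapping.lookup (pscale c f) x = c * Poly_Mapping.lookup f x"
  by (simp add: pscale_def Poly_Mapping.map.rep_eq when_def)

lemma keys_scale: "Poly_Mapping.keys (pscale c f) \<subseteq> Poly_Mapping.keys f"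
  by (auto simp: in_keys_iff)

lemma scale_minus_one: "pscale (- 1) f = - f"
  by (rule poly_mapping_eqI) simp

lemma lin_space_free: "lin_space (free_space Xs)"
  unfolding free_space_def pscale_def[symmetric]
proof (rule lin_spaceI, unfold linear_space_sel mem_Collect_eq)
  show "Poly_Mapping.keys (x + y) \<subseteq> listset (map carrier Xs)"
    if "Poly_Mapping.keys x \<subseteq> listset (map carrier Xs)" "Poly_Mapping.keys y \<subseteq> listset (map carrier Xs)" for x y
    using that Poly_Mapping.keys_add[of x y] by blast
  show "Poly_Mapping.keys (pscale c x) \<subseteq> listset (map carrier Xs)"
    if "Poly_Mapping.keys x \<subseteq> listset (map carrier Xs)" for c x
    using that keys_scale[of c x] by blast
qed (simp_all add: poly_mapping_eq_iff fun_eq_iff lookup_add algebra_simps)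

lemma free_space_sel [simp]:
  "carrier (free_space Xs) = {f. Poly_Mapping.keys f \<subseteq> listset (map carrier Xs)}"
  "zero (free_space Xs) = 0" "add (free_space Xs) = (+)" "smult (free_space Xs) = pscale"
  by (auto simp: free_space_def pscale_def fun_eq_iff)

lemma free_space_minus:
  assumes "f \<in> carrier (free_space Xs)" "g \<in> carrier (free_space Xs)"
  shows "f \<ominus>\<^bsub>free_space Xs\<^esub> g = f - g"
proof -
  interpret lin_space "free_space Xs" by (rule lin_space_free)
  have "f \<ominus>\<^bsub>free_space Xs\<^esub> g = f + pscale (- 1) g"
    unfolding M.minus_eq neg_eq_smult[OF assms(2)] by simp
  then show ?thesis by (simp add: scale_minus_one)
qed

lemma free_space_diff_mem:
  "f \<in> carrier (free_space Xs) \<Longrightarrow> g \<in> carrier (free_space Xs) \<Longrightarrow> f - g \<in> carrier (free_space Xs)"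
  using lin_space.diff_mem[OF lin_space_free, of f Xs g] free_space_minus[of f Xs g] by simp

lemma free_space_map_unique:
  fixes Xs :: "'a lcs list"
  assumes Y: "lin_space Y" and g: "linear_map (free_space Xs) Y g" and h: "linear_map (free_space Xs) Y h"
    and eq: "\<And>xs. xs \<in> listset (map carrier Xs) \<Longrightarrow> g (basis xs) = h (basis xs)"
    and f: "f \<in> carrier (free_space Xs)"
  shows "g f = h f"
proof -
  have "\<forall>f. Poly_Mapping.keys f \<subseteq> S \<longrightarrow> g f = h f" if "finite S" "S \<subseteq> listset (map carrier Xs)" for S
    using that
  proof (induction S rule: finite_induct)
    case empty
    then show ?case using linear_map_zero[OF lin_space_free Y g] linear_map_zero[OF lin_space_free Y h] by simp
  next
    case (insert s S)
    show ?case
    proof (intro allI impI)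
      fix f :: "'a list \<Rightarrow>\<^sub>0 complex" assume f: "Poly_Mapping.keys f \<subseteq> insert s S"
      let ?c = "Poly_Mapping.lookup f s"
      let ?s = "Poly_Mapping.single s (1 :: complex)"
      let ?r = "f + pscale (- ?c) ?s"
      have r: "Poly_Mapping.keys ?r \<subseteq> S"
      proof
        fix x assume x: "x \<in> Poly_Mapping.keys ?r"
        then have "x \<noteq> s" by (auto simp: in_keys_iff lookup_add)
        then have "x \<in> Poly_Mapping.keys f" using x by (auto simp: in_keys_iff lookup_add lookup_single)
        then show "x \<in> S" using f \<open>x \<noteq> s\<close> by auto
      qed
      have s: "s \<in> listset (map carrier Xs)" using insert.prems by simp
      have sc: "?s \<in> carrier (free_space Xs)" "pscale ?c ?s \<in> carrier (free_space Xs)"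
        using s keys_scale[of ?c ?s] by auto
      have rc: "?r \<in> carrier (free_space Xs)" using r insert.prems by simp blast
      have fe: "?r + pscale ?c ?s = f" by (rule poly_mapping_eqI) (simp add: lookup_add)
      have "g ?r = h ?r" using insert.IH r insert.prems by simp
      moreover have "g (pscale ?c ?s) = h (pscale ?c ?s)"
        using linear_mapD(3)[OF g sc(1), of ?c] linear_mapD(3)[OF h sc(1), of ?c] eq[OF s] by simp
      ultimately have "g (?r + pscale ?c ?s) = h (?r + pscale ?c ?s)"
        using linear_mapD(2)[OF g rc sc(2)] linear_mapD(2)[OF h rc sc(2)] by simp
      then show "g f = h f" unfolding fe .
    qed
  qed
  from this[OF finite_keys[of f]] show ?thesis using f by simp
qed

definition words :: "'a lcs \<Rightarrow> nat \<Rightarrow> 'a list set" where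
  "words X n = {xs. length xs = n \<and> set xs \<subseteq> carrier X}"

lemma listset_replicate: "listset (replicate n S) = {xs. length xs = n \<and> set xs \<subseteq> S}"
proof (induction n)
  case (Suc n)
  then show ?case by (auto simp: set_Cons_def length_Suc_conv)
qed auto

lemma listset_words [simp]: "listset (replicate n (carrier X)) = words X n"
  by (simp add: words_def listset_replicate)

lemma words_update: "xs \<in> words X n \<Longrightarrow> x \<in> carrier X \<Longrightarrow> xs[i := x] \<in> words X n"
  using set_update_subset_insert[of xs i x] by (auto simp: words_def)

lemma words_nth: "xs \<in> words X n \<Longrightarrow> i < n \<Longrightarrow> xs ! i \<in> carrier X"
  by (auto simp: words_def)

text \<open>The projective seminorm of a tensor is the infimum of the costs of its representations.\<close>

definition cost :: "('a \<Rightarrow> real) list \<Rightarrow> ('a list \<Rightarrow>\<^sub>0 complex) \<Rightarrow> real" where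
  "cost ps f = (\<Sum>xs\<in>Poly_Mapping.keys f. cmod (Poly_Mapping.lookup f xs) * (\<Prod>i<length ps. (ps ! i) (xs ! i)))"

lemma projective_seminorm_cost: "projective_seminorm ps C = (INF f\<in>C. cost ps f)"
  by (simp add: projective_seminorm_def cost_def)

lemma cost_superset:
  fixes f :: "'a list \<Rightarrow>\<^sub>0 complex" and ps :: "('a \<Rightarrow> real) list"
  assumes "finite S" "Poly_Mapping.keys f \<subseteq> S"
  shows "cost ps f = (\<Sum>xs\<in>S. cmod (Poly_Mapping.lookup f xs) * (\<Prod>i<length ps. (ps ! i) (xs ! i)))"
  unfolding cost_def by (rule sum.mono_neutral_left[OF assms]) (auto simp: in_keys_iff)

context locally_convex
begin

definition "sn_lists n = {ps. length ps = n \<and> set ps \<subseteq> cseminorms X}"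

lemma sn_lists_nonneg:
  assumes "ps \<in> sn_lists n" "xs \<in> words X n"
  shows "0 \<le> (\<Prod>i<length ps. (ps ! i) (xs ! i))"
proof (rule prod_nonneg)
  fix i assume "i \<in> {..<length ps}"
  then have i: "i < n" "ps ! i \<in> cseminorms X"
    using assms(1) subsetD[OF _ nth_mem, of ps "cseminorms X" i] by (auto simp: sn_lists_def)
  then show "0 \<le> (ps ! i) (xs ! i)"
    using seminorm_nonneg[OF cseminormD, of "ps ! i" "xs ! i"] words_nth[OF assms(2) i(1)] by simp
qed

abbreviation "Fr n \<equiv> free_space (replicate n X)"
abbreviation "Rel n \<equiv> tensor_relations (replicate n X)"
abbreviation "Alg n \<equiv> Fr n /\<^sub>l\<^sub>i\<^sub>n Rel n"

lemma Fr_carrier: "f \<in> carrier (Fr n) \<longleftrightarrow> Poly_Mapping.keys f \<subseteq> words X n"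
  by simp

text \<open>The relations are closed under the operations by the first three introduction rules.\<close>

lemma relations_subspace: "lin_subspace (Rel n) (Fr n)"
proof -
  interpret F: lin_space "Fr n" by (rule lin_space_free)
  have single: "Poly_Mapping.single xs c \<in> carrier (Fr n)" if "xs \<in> words X n" for xs c
    using that by (auto simp: Fr_carrier split: if_splits)
  have "f \<in> carrier (Fr n)" if "f \<in> Rel n" for f
    using that
  proof induction
    case zero
    then show ?case using F.M.zero_closed by simp
  next
    case (add f g)
    then show ?case using F.M.a_closed[of f g] by simp
  next
    case (smult f c)
    then show ?case using F.smult_mem[of f c] by (simp flip: pscale_def)
  next
    case (additive xs i x y)
    then have xs: "xs \<in> words X n" "x \<in> carrier X" "y \<in> carrier X" by simp_all
    then have "x \<oplus>\<^bsub>X\<^esub> y \<in> carrier X" by simp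
    note s = single[OF words_update[OF xs(1) this]] single[OF words_update[OF xs(1,2)]] single[OF words_update[OF xs(1,3)]]
    have ri: "replicate n X ! i = X" using additive(2) by simp
    show ?case unfolding ri by (rule free_space_diff_mem[OF free_space_diff_mem[OF s(1,2)] s(3)])
  next
    case (homogeneous xs i x c)
    then have xs: "xs \<in> words X n" "x \<in> carrier X" by simp_all
    then have "c \<odot>\<^bsub>X\<^esub> x \<in> carrier X" by simp
    note s = single[OF words_update[OF xs(1) this]] single[OF words_update[OF xs(1,2)]]
    have ri: "replicate n X ! i = X" using homogeneous(2) by simp
    show ?case unfolding ri by (rule free_space_diff_mem[OF s])
  qed
  then show ?thesis
    unfolding lin_subspace_def by (auto intro: tensor_relations.zero tensor_relations.add tensor_relations.smult[folded pscale_def])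
qed

lemma cost_nonneg: "ps \<in> sn_lists n \<Longrightarrow> f \<in> carrier (Fr n) \<Longrightarrow> 0 \<le> cost ps f"
  unfolding cost_def Fr_carrier by (intro sum_nonneg mult_nonneg_nonneg sn_lists_nonneg) auto

lemma cost_add:
  assumes ps: "ps \<in> sn_lists n" and f: "f \<in> carrier (Fr n)" and g: "g \<in> carrier (Fr n)"
  shows "cost ps (f + g) \<le> cost ps f + cost ps g"
proof -
  let ?S = "Poly_Mapping.keys f \<union> Poly_Mapping.keys g"
  have S: "finite ?S" "?S \<subseteq> words X n" using f g unfolding Fr_carrier by auto
  have "cost ps (f + g) = (\<Sum>xs\<in>?S. cmod (Poly_Mapping.lookup (f + g) xs) * (\<Prod>i<length ps. (ps ! i) (xs ! i)))"
    by (rule cost_superset[OF S(1) Poly_Mapping.keys_add])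
  also have "\<dots> \<le> (\<Sum>xs\<in>?S. cmod (Poly_Mapping.lookup f xs) * (\<Prod>i<length ps. (ps ! i) (xs ! i)) +
      cmod (Poly_Mapping.lookup g xs) * (\<Prod>i<length ps. (ps ! i) (xs ! i)))"
  proof (rule sum_mono)
    fix xs assume "xs \<in> ?S"
    then have "0 \<le> (\<Prod>i<length ps. (ps ! i) (xs ! i))" using sn_lists_nonneg[OF ps] S(2) by blast
    then show "cmod (Poly_Mapping.lookup (f + g) xs) * (\<Prod>i<length ps. (ps ! i) (xs ! i)) \<le>
        cmod (Poly_Mapping.lookup f xs) * (\<Prod>i<length ps. (ps ! i) (xs ! i)) +
        cmod (Poly_Mapping.lookup g xs) * (\<Prod>i<length ps. (ps ! i) (xs ! i))"
      unfolding lookup_add distrib_right[symmetric] by (intro mult_right_mono norm_triangle_ineq)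
  qed
  also have "\<dots> = cost ps f + cost ps g"
    using cost_superset[OF S(1), where f = f and ps = ps] cost_superset[OF S(1), where f = g and ps = ps] by (simp add: sum.distrib)
  finally show ?thesis .
qed

lemma cost_scale: "cost ps (pscale c f) = cmod c * cost ps f"
proof -
  have "cost ps (pscale c f) = (\<Sum>xs\<in>Poly_Mapping.keys f. cmod (Poly_Mapping.lookup (pscale c f) xs) * (\<Prod>i<length ps. (ps ! i) (xs ! i)))"
    by (rule cost_superset[OF finite_keys keys_scale])
  then show ?thesis by (simp add: cost_def norm_mult sum_distrib_left mult.assoc)
qed

lemma coset_rep:
  assumes "C \<in> carrier (Alg n)"
  obtains f where "f \<in> carrier (Fr n)" "C = Rel n +>\<^bsub>Fr n\<^esub> f"
  using assms lin_space.linear_coset(2)[OF lin_space_free relations_subspace, of n] by auto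

lemma coset_elem:
  assumes "C \<in> carrier (Alg n)"
  shows "C \<noteq> {}" "f \<in> C \<Longrightarrow> f \<in> carrier (Fr n)" "f \<in> C \<Longrightarrow> C = Rel n +>\<^bsub>Fr n\<^esub> f"
proof -
  interpret F: lin_space "Fr n" by (rule lin_space_free)
  obtain g where g: "g \<in> carrier (Fr n)" "C = Rel n +>\<^bsub>Fr n\<^esub> g" using coset_rep[OF assms] .
  show "C \<noteq> {}" using F.coset_self[OF relations_subspace g(1)] g(2) by auto
  show f: "f \<in> carrier (Fr n)" if "f \<in> C" for f using that g F.mem_coset_iff[OF relations_subspace g(1)] by simp
  show "C = Rel n +>\<^bsub>Fr n\<^esub> f" if "f \<in> C"
    using that f[OF that] g F.mem_coset_iff[OF relations_subspace g(1)] F.coset_eq_iff[OF relations_subspace f[OF that] g(1)]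
    by simp
qed

lemma projective_seminorm_le:
  assumes "ps \<in> sn_lists n" "C \<in> carrier (Alg n)" "f \<in> C"
  shows "projective_seminorm ps C \<le> cost ps f"
  unfolding projective_seminorm_cost
  by (rule cINF_lower[OF bdd_belowI2[of _ 0] assms(3)]) (use assms cost_nonneg coset_elem in blast)

lemma projective_seminorm_approx:
  assumes "C \<in> carrier (Alg n)" "e > 0"
  obtains f where "f \<in> C" "cost ps f < projective_seminorm ps C + e"
proof -
  have "Inf (cost ps ` C) < projective_seminorm ps C + e" using assms(2) by (simp add: projective_seminorm_cost)
  from cInf_lessD[OF _ this] show thesis using coset_elem(1)[OF assms(1)] that by blast
qed

text \<open>Representations of two tensors add up to one of their sum; the infimum makes this the triangle
  inequality.\<close>

lemma projective_seminorm_seminorm: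
  assumes ps: "ps \<in> sn_lists n"
  shows "seminorm_on (Alg n) (projective_seminorm ps)"
proof -
  interpret F: lin_space "Fr n" by (rule lin_space_free)
  interpret Q: lin_space "Alg n" by (rule F.lin_space_quotient[OF relations_subspace])
  note lin = F.linear_coset(1)[OF relations_subspace]
  let ?p = "projective_seminorm ps"
  have scale_le: "?p (c \<odot>\<^bsub>Alg n\<^esub> C) \<le> cmod c * ?p C" if C: "C \<in> carrier (Alg n)" for c C
  proof (rule field_le_epsilon)
    fix e :: real assume e: "e > 0"
    have pos: "cmod c + 1 > 0" using norm_ge_zero[of c] by linarith
    then have e': "e / (cmod c + 1) > 0" "(cmod c + 1) * (e / (cmod c + 1)) = e" using e by auto
    obtain f where f: "f \<in> C" "cost ps f < ?p C + e / (cmod c + 1)" by (rule projective_seminorm_approx[OF C e'(1)])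
    note fc = coset_elem(2,3)[OF C f(1)]
    have "c \<odot>\<^bsub>Alg n\<^esub> C = Rel n +>\<^bsub>Fr n\<^esub> (pscale c f)"
      using linear_mapD(3)[OF lin fc(1), of c] fc(2) by simp
    then have "pscale c f \<in> c \<odot>\<^bsub>Alg n\<^esub> C"
      using F.coset_self[OF relations_subspace F.smult_mem[OF fc(1), of c]] by simp
    then have "?p (c \<odot>\<^bsub>Alg n\<^esub> C) \<le> cmod c * cost ps f"
      using projective_seminorm_le[OF ps Q.smult_mem[OF C], of "pscale c f" c] by (simp add: cost_scale)
    also have "\<dots> \<le> cmod c * (?p C + e / (cmod c + 1))" using f(2) by (intro mult_left_mono) auto
    also have "\<dots> \<le> cmod c * ?p C + (cmod c + 1) * (e / (cmod c + 1))"
      using e'(1) unfolding distrib_left distrib_right by linarith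
    finally show "?p (c \<odot>\<^bsub>Alg n\<^esub> C) \<le> cmod c * ?p C + e" using e'(2) by simp
  qed
  have nonneg: "0 \<le> ?p C" if C: "C \<in> carrier (Alg n)" for C
    unfolding projective_seminorm_cost
    by (rule cINF_greatest) (use coset_elem[OF C] cost_nonneg[OF ps] in auto)
  show ?thesis
    unfolding seminorm_on_def
  proof (intro conjI ballI allI)
    fix C D assume C: "C \<in> carrier (Alg n)" and D: "D \<in> carrier (Alg n)"
    show "?p (C \<oplus>\<^bsub>Alg n\<^esub> D) \<le> ?p C + ?p D"
    proof (rule field_le_epsilon)
      fix e :: real assume e: "e > 0"
      have e2: "e/2 > 0" using e by simp
      obtain f where f: "f \<in> C" "cost ps f < ?p C + e/2" by (rule projective_seminorm_approx[OF C e2])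
      obtain g where g: "g \<in> D" "cost ps g < ?p D + e/2" by (rule projective_seminorm_approx[OF D e2])
      note fc = coset_elem(2,3)[OF C f(1)] and gc = coset_elem(2,3)[OF D g(1)]
      have "C \<oplus>\<^bsub>Alg n\<^esub> D = Rel n +>\<^bsub>Fr n\<^esub> (f + g)"
        using linear_mapD(2)[OF lin fc(1) gc(1)] fc(2) gc(2) by simp
      then have "f + g \<in> C \<oplus>\<^bsub>Alg n\<^esub> D"
        using F.coset_self[OF relations_subspace F.M.a_closed[OF fc(1) gc(1)]] by simp
      then have "?p (C \<oplus>\<^bsub>Alg n\<^esub> D) \<le> cost ps (f + g)"
        by (rule projective_seminorm_le[OF ps Q.M.a_closed[OF C D]])
      then show "?p (C \<oplus>\<^bsub>Alg n\<^esub> D) \<le> ?p C + ?p D + e"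
        using cost_add[OF ps fc(1) gc(1)] f(2) g(2) by simp
    qed
  next
    fix c C assume C: "C \<in> carrier (Alg n)"
    show "?p (c \<odot>\<^bsub>Alg n\<^esub> C) = cmod c * ?p C"
    proof (cases "c = 0")
      case True
      then show ?thesis using scale_le[OF C, of 0] nonneg[OF Q.smult_mem[OF C, of 0]] by simp
    next
      case False
      have "?p C \<le> cmod (1 / c) * ?p (c \<odot>\<^bsub>Alg n\<^esub> C)"
        using scale_le[OF Q.smult_mem[OF C, of c], of "1 / c"] C False by (simp add: Q.smult_smult)
      then have "cmod c * ?p C \<le> ?p (c \<odot>\<^bsub>Alg n\<^esub> C)" using False by (simp add: norm_divide field_simps)
      then show ?thesis using scale_le[OF C, of c] by simp
    qed
  qed
qed

end

context locally_convex
begin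

lemma sn_lists_listset: "listset (map (\<lambda>X. {p. continuous_seminorm X p}) (replicate n X)) = sn_lists n"
  by (simp add: listset_replicate sn_lists_def map_replicate)

lemma sum_list_bound:
  assumes ps: "ps \<in> sn_lists n" and i: "i < n" and x: "x \<in> carrier X"
  shows "(ps ! i) x \<le> (\<Sum>p\<leftarrow>ps. p x)"
proof -
  have "(ps ! i) x \<in> set (map (\<lambda>p. p x) ps)" using ps i by (auto simp: sn_lists_def)
  moreover have "0 \<le> y" if "y \<in> set (map (\<lambda>p. p x) ps)" for y
    using that ps x by (auto simp: sn_lists_def intro!: seminorm_nonneg cseminormD)
  ultimately show ?thesis using member_le_sum_list[of "(ps ! i) x" "map (\<lambda>p. p x) ps"] by simp
qed

lemma cost_mono:
  assumes ps: "ps \<in> sn_lists n" and qs: "qs \<in> sn_lists n"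
    and le: "\<And>i x. i < n \<Longrightarrow> x \<in> carrier X \<Longrightarrow> (ps ! i) x \<le> (qs ! i) x" and f: "f \<in> carrier (Fr n)"
  shows "cost ps f \<le> cost qs f"
  unfolding cost_def
proof (intro sum_mono mult_left_mono)
  fix xs assume "xs \<in> Poly_Mapping.keys f"
  then have xs: "xs \<in> words X n" using f by auto
  have l: "length ps = n" "length qs = n" using ps qs by (auto simp: sn_lists_def)
  show "(\<Prod>i<length ps. (ps ! i) (xs ! i)) \<le> (\<Prod>i<length qs. (qs ! i) (xs ! i))"
    unfolding l
  proof (rule prod_mono)
    fix i assume "i \<in> {..<n}"
    then have i: "i < n" by simp
    note x = words_nth[OF xs i]
    have "ps ! i \<in> cseminorms X" using ps i l(1) subsetD[OF _ nth_mem, of ps "cseminorms X" i] by (auto simp: sn_lists_def)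
    then show "0 \<le> (ps ! i) (xs ! i) \<and> (ps ! i) (xs ! i) \<le> (qs ! i) (xs ! i)"
      using le[OF i x] seminorm_nonneg[OF cseminormD x] by simp
  qed
qed simp

lemma projective_seminorm_mono:
  assumes ps: "ps \<in> sn_lists n" and qs: "qs \<in> sn_lists n"
    and le: "\<And>i x. i < n \<Longrightarrow> x \<in> carrier X \<Longrightarrow> (ps ! i) x \<le> (qs ! i) x" and C: "C \<in> carrier (Alg n)"
  shows "projective_seminorm ps C \<le> projective_seminorm qs C"
proof (rule field_le_epsilon)
  fix e :: real assume "e > 0"
  then obtain f where f: "f \<in> C" "cost qs f < projective_seminorm qs C + e" by (rule projective_seminorm_approx[OF C])
  show "projective_seminorm ps C \<le> projective_seminorm qs C + e"
    using projective_seminorm_le[OF ps C f(1)] cost_mono[OF ps qs le coset_elem(2)[OF C f(1)]] f(2) by linarith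
qed

abbreviation "AT n \<equiv> alg_tensor (replicate n X)"

lemma alg_tensor_eq: "AT n = with_topology (Alg n) (seminorm_topology (Alg n) (projective_seminorm ` sn_lists n))"
  unfolding alg_tensor_def Let_def sn_lists_listset ..

lemma alg_tensor_sel [simp]:
  "carrier (AT n) = carrier (Alg n)" "zero (AT n) = zero (Alg n)" "add (AT n) = add (Alg n)" "smult (AT n) = smult (Alg n)"
  by (simp_all add: alg_tensor_eq)

lemma lin_space_Alg: "lin_space (Alg n)"
  by (rule lin_space.lin_space_quotient[OF lin_space_free relations_subspace])

lemma lin_space_AT: "lin_space (AT n)"
  by (rule lin_space_cong[OF lin_space_Alg]) simp_all

text \<open>The family is directed, because two lists of seminorms are dominated, slot by slot, by the list of
  their sums.\<close>

lemma generates_alg_tensor: "generates (AT n) (projective_seminorm ` sn_lists n)"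
  unfolding alg_tensor_eq
proof (rule generates_seminorm_topology[OF lin_space_Alg])
  show "seminorm_on (Alg n) p" if "p \<in> projective_seminorm ` sn_lists n" for p
    using that projective_seminorm_seminorm by auto
  have "replicate n (\<lambda>x. 0) \<in> sn_lists n" using cseminorm_zero by (auto simp: sn_lists_def)
  then show "projective_seminorm ` sn_lists n \<noteq> {}" by blast
  fix p q assume "p \<in> projective_seminorm ` sn_lists n" "q \<in> projective_seminorm ` sn_lists n"
  then obtain ps qs where ps: "ps \<in> sn_lists n" "p = projective_seminorm ps" and qs: "qs \<in> sn_lists n" "q = projective_seminorm qs"
    by auto
  let ?rs = "map2 (\<lambda>p q x. p x + q x) ps qs"
  have l: "length ps = n" "length qs = n" using ps qs by (auto simp: sn_lists_def)
  have m: "ps ! i \<in> cseminorms X" "qs ! i \<in> cseminorms X" if "i < n" for i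
    using that ps(1) qs(1) l subsetD[OF _ nth_mem, of ps "cseminorms X" i] subsetD[OF _ nth_mem, of qs "cseminorms X" i]
    by (auto simp: sn_lists_def)
  have rs: "?rs \<in> sn_lists n"
    using ps(1) qs(1) by (fastforce simp: sn_lists_def intro: cseminorm_add dest: set_zip_leftD set_zip_rightD)
  have "p C \<le> projective_seminorm ?rs C \<and> q C \<le> projective_seminorm ?rs C" if C: "C \<in> carrier (Alg n)" for C
    unfolding ps(2) qs(2)
    by (intro conjI projective_seminorm_mono[OF ps(1) rs _ C] projective_seminorm_mono[OF qs(1) rs _ C])
      (use l m seminorm_nonneg[OF cseminormD] in auto)
  then show "\<exists>r\<in>projective_seminorm ` sn_lists n. \<forall>x\<in>carrier (Alg n). p x \<le> r x \<and> q x \<le> r x" using rs by blast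
qed

lemma locally_convex_alg_tensor: "locally_convex (AT n)"
  by (rule generates_locally_convex[OF lin_space_AT generates_alg_tensor])

lemma complete_tensor_power: "complete_hausdorff_lcs (tensor_power X n)"
  unfolding tensor_power_def proj_tensor_def
  by (rule locally_convex.complete_hausdorff_completion[OF locally_convex_alg_tensor])

subsection \<open>Bounded multilinear maps\<close>

text \<open>Boundedness by a product of continuous seminorms is joint continuity in the form that bounds the
  linear extension by a projective seminorm.\<close>

definition bounded_multilinear :: "nat \<Rightarrow> 'y lcs \<Rightarrow> ('a list \<Rightarrow> 'y) \<Rightarrow> bool" where
  "bounded_multilinear n Y f \<longleftrightarrow>
    (\<forall>xs\<in>words X n. f xs \<in> carrier Y) \<and>
    (\<forall>xs\<in>words X n. \<forall>i<n. \<forall>x\<in>carrier X. \<forall>y\<in>carrier X.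
      f (xs[i := x \<oplus>\<^bsub>X\<^esub> y]) = f (xs[i := x]) \<oplus>\<^bsub>Y\<^esub> f (xs[i := y])) \<and>
    (\<forall>xs\<in>words X n. \<forall>i<n. \<forall>x\<in>carrier X. \<forall>c. f (xs[i := c \<odot>\<^bsub>X\<^esub> x]) = c \<odot>\<^bsub>Y\<^esub> f (xs[i := x])) \<and>
    (\<forall>q. continuous_seminorm Y q \<longrightarrow> (\<exists>p K. continuous_seminorm X p \<and> 0 \<le> K \<and>
      (\<forall>xs\<in>words X n. q (f xs) \<le> K * (\<Prod>i<n. p (xs ! i)))))"

lemma bounded_multilinearD:
  assumes "bounded_multilinear n Y f"
  shows "xs \<in> words X n \<Longrightarrow> f xs \<in> carrier Y"
    and "xs \<in> words X n \<Longrightarrow> i < n \<Longrightarrow> x \<in> carrier X \<Longrightarrow> y \<in> carrier X \<Longrightarrow>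
      f (xs[i := x \<oplus>\<^bsub>X\<^esub> y]) = f (xs[i := x]) \<oplus>\<^bsub>Y\<^esub> f (xs[i := y])"
    and "xs \<in> words X n \<Longrightarrow> i < n \<Longrightarrow> x \<in> carrier X \<Longrightarrow> f (xs[i := c \<odot>\<^bsub>X\<^esub> x]) = c \<odot>\<^bsub>Y\<^esub> f (xs[i := x])"
    and "continuous_seminorm Y q \<Longrightarrow> \<exists>p K. continuous_seminorm X p \<and> 0 \<le> K \<and>
      (\<forall>xs\<in>words X n. q (f xs) \<le> K * (\<Prod>i<n. p (xs ! i)))"
  using assms unfolding bounded_multilinear_def by blast+

definition free_lift :: "'y lcs \<Rightarrow> ('a list \<Rightarrow> 'y) \<Rightarrow> ('a list \<Rightarrow>\<^sub>0 complex) \<Rightarrow> 'y" where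
  "free_lift Y F f = (\<Oplus>\<^bsub>Y\<^esub> xs\<in>Poly_Mapping.keys f. Poly_Mapping.lookup f xs \<odot>\<^bsub>Y\<^esub> F xs)"

lemma
  fixes Y :: "'y lcs"
  assumes Y: "lin_space Y" and F: "F \<in> words X n \<rightarrow> carrier Y"
  shows linear_free_lift: "linear_map (Fr n) Y (free_lift Y F)"
    and free_lift_single: "xs \<in> words X n \<Longrightarrow> free_lift Y F (Poly_Mapping.single xs c) = c \<odot>\<^bsub>Y\<^esub> F xs"
proof -
  interpret Y: lin_space Y by fact
  have Fm: "F xs \<in> carrier Y" if "xs \<in> words X n" for xs using F that by (rule funcset_mem)
  have mem: "(\<lambda>xs. Poly_Mapping.lookup f xs \<odot>\<^bsub>Y\<^esub> F xs) \<in> S \<rightarrow> carrier Y" if "S \<subseteq> words X n" for f S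
    using that F by auto
  have super: "free_lift Y F f = (\<Oplus>\<^bsub>Y\<^esub> xs\<in>S. Poly_Mapping.lookup f xs \<odot>\<^bsub>Y\<^esub> F xs)"
    if "finite S" "Poly_Mapping.keys f \<subseteq> S" "S \<subseteq> words X n" for f S
    unfolding free_lift_def
    by (rule Y.M.add.finprod_mono_neutral_cong_left[OF that(1,2)])
      (use that(3) funcset_mem[OF F] in \<open>auto simp: in_keys_iff subset_iff\<close>)
  show "linear_map (Fr n) Y (free_lift Y F)"
  proof (rule linear_mapI)
    fix f assume "f \<in> carrier (Fr n)"
    then have k: "Poly_Mapping.keys f \<subseteq> words X n" by simp
    show "free_lift Y F f \<in> carrier Y" unfolding free_lift_def by (rule Y.M.finsum_closed[OF mem[OF k]])
  next
    fix f g assume "f \<in> carrier (Fr n)" "g \<in> carrier (Fr n)"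
    then have k: "Poly_Mapping.keys f \<union> Poly_Mapping.keys g \<subseteq> words X n" (is "?S \<subseteq> _") by simp
    have fin: "finite ?S" by simp
    have "free_lift Y F (f + g) = (\<Oplus>\<^bsub>Y\<^esub> xs\<in>?S. (Poly_Mapping.lookup f xs \<odot>\<^bsub>Y\<^esub> F xs) \<oplus>\<^bsub>Y\<^esub> (Poly_Mapping.lookup g xs \<odot>\<^bsub>Y\<^esub> F xs))"
      unfolding super[OF fin Poly_Mapping.keys_add k]
      by (rule Y.M.finsum_cong') (use Fm[OF subsetD[OF k]] in \<open>auto simp: lookup_add Y.smult_add_left\<close>)
    also have "\<dots> = free_lift Y F f \<oplus>\<^bsub>Y\<^esub> free_lift Y F g"
      unfolding super[OF fin Un_upper1 k] super[OF fin Un_upper2 k]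
      by (rule Y.M.finsum_addf[OF mem[OF k] mem[OF k]])
    finally show "free_lift Y F (f \<oplus>\<^bsub>Fr n\<^esub> g) = free_lift Y F f \<oplus>\<^bsub>Y\<^esub> free_lift Y F g" by simp
  next
    fix c f assume "f \<in> carrier (Fr n)"
    then have k: "Poly_Mapping.keys f \<subseteq> words X n" by simp
    have "linear_map Y Y (\<lambda>y. c \<odot>\<^bsub>Y\<^esub> y)"
      by (rule linear_map_smult[OF Y Y, of "\<lambda>y. y"]) (simp add: linear_map_def)
    note sm = linear_map_finsum[OF Y Y this finite_keys mem[OF k]]
    have "free_lift Y F (pscale c f) = (\<Oplus>\<^bsub>Y\<^esub> xs\<in>Poly_Mapping.keys f. c \<odot>\<^bsub>Y\<^esub> (Poly_Mapping.lookup f xs \<odot>\<^bsub>Y\<^esub> F xs))"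
      unfolding super[OF finite_keys keys_scale k]
      by (rule Y.M.finsum_cong') (use Fm[OF subsetD[OF k]] in \<open>auto simp: Y.smult_smult\<close>)
    then show "free_lift Y F (c \<odot>\<^bsub>Fr n\<^esub> f) = c \<odot>\<^bsub>Y\<^esub> free_lift Y F f"
      using sm by (simp add: free_lift_def)
  qed
  show "free_lift Y F (Poly_Mapping.single xs c) = c \<odot>\<^bsub>Y\<^esub> F xs" if "xs \<in> words X n"
    using funcset_mem[OF F that] by (cases "c = 0") (simp_all add: free_lift_def)
qed

lemma free_lift_diff:
  assumes Y: "lin_space Y" and F: "F \<in> words X n \<rightarrow> carrier Y"
    and f: "f \<in> carrier (Fr n)" and g: "g \<in> carrier (Fr n)"
  shows "free_lift Y F (f - g) = free_lift Y F f \<ominus>\<^bsub>Y\<^esub> free_lift Y F g"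
  using linear_map_diff[OF lin_space_free Y linear_free_lift[OF Y F] f g] unfolding free_space_minus[OF f g] .

lemma free_lift_relations:
  assumes Y: "lin_space Y" and F: "bounded_multilinear n Y F" and f: "f \<in> Rel n"
  shows "free_lift Y F f = \<zero>\<^bsub>Y\<^esub>"
proof -
  interpret Y: lin_space Y by fact
  note Fm = bounded_multilinearD(1)[OF F]
  have FP: "F \<in> words X n \<rightarrow> carrier Y" using Fm by auto
  note lin = linear_free_lift[OF Y FP] and sg = free_lift_single[OF Y FP] and df = free_lift_diff[OF Y FP]
  note rel = lin_subspaceD(1)[OF relations_subspace]
  have single: "Poly_Mapping.single xs c \<in> carrier (Fr n)" if "xs \<in> words X n" for xs c
    using that by (auto split: if_splits)
  show ?thesis using f
  proof induction
    case zero
    then show ?case using linear_map_zero[OF lin_space_free Y lin] by simp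
  next
    case (add f g)
    then show ?case using linear_mapD(2)[OF lin rel[OF add(1)] rel[OF add(2)]] by simp
  next
    case (smult f c)
    then show ?case using linear_mapD(3)[OF lin rel[OF smult(1)], where c = c] by (simp flip: pscale_def)
  next
    case (additive xs i x y)
    have ri: "replicate n X ! i = X" using additive(2) by simp
    have xs: "xs \<in> words X n" "x \<in> carrier X" "y \<in> carrier X" "i < n" using additive by simp_all
    have w: "xs[i := x \<oplus>\<^bsub>X\<^esub> y] \<in> words X n" "xs[i := x] \<in> words X n" "xs[i := y] \<in> words X n"
      using xs by (simp_all add: words_update)
    show ?case unfolding ri df[OF free_space_diff_mem[OF single[OF w(1)] single[OF w(2)]] single[OF w(3)]]
        df[OF single[OF w(1)] single[OF w(2)]] sg[OF w(1)] sg[OF w(2)] sg[OF w(3)]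
      using Fm[OF w(2)] Fm[OF w(3)] bounded_multilinearD(2)[OF F xs(1,4,2,3)] by simp
  next
    case (homogeneous xs i x c)
    have ri: "replicate n X ! i = X" using homogeneous(2) by simp
    have xs: "xs \<in> words X n" "x \<in> carrier X" "i < n" using homogeneous by simp_all
    have w: "xs[i := c \<odot>\<^bsub>X\<^esub> x] \<in> words X n" "xs[i := x] \<in> words X n"
      using xs by (simp_all add: words_update)
    show ?case unfolding ri df[OF single[OF w(1)] single[OF w(2)]] sg[OF w(1)] sg[OF w(2)]
      using Fm[OF w(2)] bounded_multilinearD(3)[OF F xs(1,3,2)] by simp
  qed
qed

text \<open>A multilinear map dominated by a product of seminorms is bounded by the corresponding projective
  seminorm, since the bound holds for each way of writing a tensor as a finite sum.\<close>

lemma alg_tensor_lift: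
  assumes Y: "locally_convex Y" and F: "bounded_multilinear n Y F"
  shows "\<exists>u. continuous_linear (AT n) Y u \<and>
    (\<forall>xs\<in>words X n. u (Rel n +>\<^bsub>Fr n\<^esub> basis xs) = F xs)"
proof -
  interpret Y: locally_convex Y by fact
  interpret Fr: lin_space "Fr n" by (rule lin_space_free)
  note Ys = Y.lin_space_axioms
  note Fm = bounded_multilinearD(1)[OF F]
  have FP: "F \<in> words X n \<rightarrow> carrier Y" using Fm by auto
  note lin = linear_free_lift[OF Ys FP]
  note coset = Fr.linear_coset(1)[OF relations_subspace]
  define u where "u C = free_lift Y F (SOME f. f \<in> C)" for C
  have u: "u C = free_lift Y F f" if C: "C \<in> carrier (Alg n)" and f: "f \<in> C" for C f
  proof -
    have g: "(SOME f. f \<in> C) \<in> C" using f by (rule someI)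
    let ?g = "SOME f. f \<in> C"
    note fc = coset_elem(2)[OF C f] and gc = coset_elem(2)[OF C g]
    have "?g \<ominus>\<^bsub>Fr n\<^esub> f \<in> Rel n"
      using Fr.coset_eq_iff[OF relations_subspace gc fc] coset_elem(3)[OF C f] coset_elem(3)[OF C g] by simp
    from free_lift_relations[OF Ys F this]
    have "free_lift Y F ?g \<ominus>\<^bsub>Y\<^esub> free_lift Y F f = \<zero>\<^bsub>Y\<^esub>"
      using linear_map_diff[OF lin_space_free Ys lin gc fc] by simp
    then show ?thesis unfolding u_def
      using Y.diff_eq_zero_iff linear_mapD(1)[OF lin gc] linear_mapD(1)[OF lin fc] by simp
  qed
  have uc: "u (Rel n +>\<^bsub>Fr n\<^esub> f) = free_lift Y F f" if "f \<in> carrier (Fr n)" for f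
    by (rule u) (use that linear_mapD(1)[OF coset that] Fr.coset_self[OF relations_subspace that] in auto)
  have ulin: "linear_map (AT n) Y u"
  proof (rule linear_mapI, unfold alg_tensor_sel)
    fix C D assume C: "C \<in> carrier (Alg n)" and D: "D \<in> carrier (Alg n)"
    obtain f where f: "f \<in> carrier (Fr n)" "C = Rel n +>\<^bsub>Fr n\<^esub> f" using coset_rep[OF C] .
    obtain g where g: "g \<in> carrier (Fr n)" "D = Rel n +>\<^bsub>Fr n\<^esub> g" using coset_rep[OF D] .
    show "u C \<in> carrier Y" unfolding f(2) uc[OF f(1)] by (rule linear_mapD(1)[OF lin f(1)])
    show "u (C \<oplus>\<^bsub>Alg n\<^esub> D) = u C \<oplus>\<^bsub>Y\<^esub> u D"
      unfolding f(2) g(2) linear_mapD(2)[OF coset f(1) g(1), symmetric] uc[OF f(1)] uc[OF g(1)] uc[OF Fr.M.a_closed[OF f(1) g(1)]]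
      by (rule linear_mapD(2)[OF lin f(1) g(1)])
    show "u (c \<odot>\<^bsub>Alg n\<^esub> C) = c \<odot>\<^bsub>Y\<^esub> u C" for c
      unfolding f(2) linear_mapD(3)[OF coset f(1), symmetric] uc[OF f(1)] uc[OF Fr.smult_mem[OF f(1)]]
      by (rule linear_mapD(3)[OF lin f(1)])
  qed
  have "continuous_linear (AT n) Y u"
  proof (rule continuous_linearI[OF locally_convex_alg_tensor Ys Y.generates_cseminorms ulin], unfold mem_Collect_eq alg_tensor_sel)
    fix q assume q: "continuous_seminorm Y q"
    note sq = Y.cseminormD[OF q]
    obtain p K where p: "continuous_seminorm X p" "K \<ge> 0" "\<And>xs. xs \<in> words X n \<Longrightarrow> q (F xs) \<le> K * (\<Prod>i<n. p (xs ! i))"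
      using bounded_multilinearD(4)[OF F q] by auto
    let ?ps = "replicate n p"
    have ps: "?ps \<in> sn_lists n" using p(1) by (auto simp: sn_lists_def)
    have "q (u C) \<le> K * projective_seminorm ?ps C" if C: "C \<in> carrier (Alg n)" for C
    proof (rule field_le_epsilon)
      fix e :: real assume e: "e > 0"
      have e': "e / (K + 1) > 0" "(K + 1) * (e / (K + 1)) = e" using e p(2) by auto
      obtain f where f: "f \<in> C" "cost ?ps f < projective_seminorm ?ps C + e / (K + 1)"
        by (rule projective_seminorm_approx[OF C e'(1)])
      have k: "Poly_Mapping.keys f \<subseteq> words X n" using coset_elem(2)[OF C f(1)] by simp
      have mem: "(\<lambda>xs. Poly_Mapping.lookup f xs \<odot>\<^bsub>Y\<^esub> F xs) \<in> Poly_Mapping.keys f \<rightarrow> carrier Y" using k Fm by auto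
      have "q (u C) \<le> (\<Sum>xs\<in>Poly_Mapping.keys f. q (Poly_Mapping.lookup f xs \<odot>\<^bsub>Y\<^esub> F xs))"
        unfolding u[OF C f(1)] free_lift_def by (rule Y.seminorm_finsum[OF sq finite_keys mem])
      also have "\<dots> \<le> (\<Sum>xs\<in>Poly_Mapping.keys f. K * (cmod (Poly_Mapping.lookup f xs) * (\<Prod>i<length ?ps. (?ps ! i) (xs ! i))))"
      proof (rule sum_mono)
        fix xs assume "xs \<in> Poly_Mapping.keys f"
        then have xs: "xs \<in> words X n" using k by blast
        have "q (Poly_Mapping.lookup f xs \<odot>\<^bsub>Y\<^esub> F xs) = cmod (Poly_Mapping.lookup f xs) * q (F xs)"
          by (rule Y.seminorm_smult[OF sq Fm[OF xs]])
        also have "\<dots> \<le> cmod (Poly_Mapping.lookup f xs) * (K * (\<Prod>i<n. p (xs ! i)))"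
          by (intro mult_left_mono p(3)[OF xs]) simp
        finally show "q (Poly_Mapping.lookup f xs \<odot>\<^bsub>Y\<^esub> F xs) \<le> K * (cmod (Poly_Mapping.lookup f xs) * (\<Prod>i<length ?ps. (?ps ! i) (xs ! i)))"
          by (simp add: mult.left_commute)
      qed
      also have "\<dots> = K * cost ?ps f" by (simp add: cost_def sum_distrib_left)
      also have "\<dots> \<le> K * (projective_seminorm ?ps C + e / (K + 1))" using f(2) p(2) by (intro mult_left_mono) auto
      also have "\<dots> \<le> K * projective_seminorm ?ps C + (K + 1) * (e / (K + 1))"
        using e'(1) unfolding distrib_left distrib_right by linarith
      finally show "q (u C) \<le> K * projective_seminorm ?ps C + e" using e'(2) by simp
    qed
    moreover have "continuous_seminorm (AT n) (projective_seminorm ?ps)"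
      by (rule locally_convex.generator_cseminorm[OF locally_convex_alg_tensor generates_alg_tensor]) (use ps in blast)
    ultimately show "\<exists>p K. continuous_seminorm (AT n) p \<and> (\<forall>x\<in>carrier (Alg n). q (u x) \<le> K * p x)" by blast
  qed
  moreover have "u (Rel n +>\<^bsub>Fr n\<^esub> basis xs) = F xs" if xs: "xs \<in> words X n" for xs
    using uc[of "basis xs"] free_lift_single[OF Ys FP xs, where c = 1] xs Fm[OF xs] by simp
  ultimately show ?thesis by blast
qed

end

context locally_convex
begin

lemma tens_eq: "xs \<in> words X n \<Longrightarrow> tens X xs = to_completion (AT n) (Rel n +>\<^bsub>Fr n\<^esub> basis xs)"
  by (simp add: tens_def elem_tensor_def words_def)

lemma single_coset_mem: "xs \<in> words X n \<Longrightarrow> Rel n +>\<^bsub>Fr n\<^esub> Poly_Mapping.single xs c \<in> carrier (AT n)"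
  using linear_mapD(1)[OF lin_space.linear_coset(1)[OF lin_space_free relations_subspace], of "Poly_Mapping.single xs c" n]
  by (auto split: if_splits)

text \<open>The elementary tensors span the algebraic tensor power, which is dense in its completion.\<close>

lemma tensor_ext:
  fixes Y :: "'y lcs"
  assumes Y: "locally_convex Y" and H: "Hausdorff_space (topo Y)"
    and g: "continuous_linear (tensor_power X n) Y g" and h: "continuous_linear (tensor_power X n) Y h"
    and eq: "\<And>xs. xs \<in> words X n \<Longrightarrow> g (tens X xs) = h (tens X xs)"
    and t: "t \<in> carrier (tensor_power X n)"
  shows "g t = h t"
proof -
  interpret Y: locally_convex Y by fact
  interpret AT: locally_convex "AT n" by (rule locally_convex_alg_tensor)
  note coset = lin_space.linear_coset(1)[OF lin_space_free relations_subspace, of n]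
  have coset': "linear_map (Fr n) (AT n) (\<lambda>f. Rel n +>\<^bsub>Fr n\<^esub> f)" using coset by (simp add: linear_map_def)
  note gh = g[unfolded tensor_power_def proj_tensor_def] h[unfolded tensor_power_def proj_tensor_def]
  have lin: "linear_map (Fr n) Y (\<lambda>f. k (to_completion (AT n) (Rel n +>\<^bsub>Fr n\<^esub> f)))"
    if "continuous_linear (completion (AT n)) Y k" for k
    using linear_map_compose[OF coset' linear_map_compose[of "AT n" "completion (AT n)" "to_completion (AT n)" Y k]]
      AT.to_completion_continuous that by (simp add: continuous_linear_def)
  show ?thesis
  proof (rule AT.completion_map_unique[OF Y H gh])
    show "t \<in> carrier (completion (AT n))" using t by (simp add: tensor_power_def proj_tensor_def)
    fix C assume "C \<in> carrier (AT n)"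
    then obtain f where f: "f \<in> carrier (Fr n)" "C = Rel n +>\<^bsub>Fr n\<^esub> f" using coset_rep[of C n] by auto
    show "g (to_completion (AT n) C) = h (to_completion (AT n) C)"
      unfolding f(2)
      by (rule free_space_map_unique[OF Y.lin_space_axioms lin[OF gh(1)] lin[OF gh(2)] _ f(1)])
        (use eq tens_eq in \<open>simp add: map_replicate\<close>)
  qed
qed

lemma tens_in_power: "xs \<in> words X n \<Longrightarrow> tens X xs \<in> carrier (tensor_power X n)"
proof -
  interpret AT: locally_convex "AT n" by (rule locally_convex_alg_tensor)
  show "xs \<in> words X n \<Longrightarrow> tens X xs \<in> carrier (tensor_power X n)"
    using AT.to_completion_mem[OF single_coset_mem] by (simp add: tens_eq tensor_power_def proj_tensor_def)
qed

text \<open>Uniqueness turns any operator with the right values on elementary tensors into the lift.\<close>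

lemma tensor_lift_eq:
  fixes Y :: "'y lcs"
  assumes Y: "locally_convex Y" and H: "Hausdorff_space (topo Y)"
    and g: "continuous_linear (tensor_power X n) Y g" and val: "\<forall>xs\<in>words X n. g (tens X xs) = f xs"
  shows "tensor_lift (replicate n X) Y f = restrict g (carrier (tensor_power X n))"
proof -
  let ?g = "restrict g (carrier (tensor_power X n))"
  have lc: "locally_convex (tensor_power X n)" using complete_tensor_power[of n] by (simp add: complete_hausdorff_lcs_def)
  have pt: "proj_tensor (replicate n X) = tensor_power X n" by (simp add: tensor_power_def)
  have elem: "elem_tensor (replicate n X) xs = tens X xs" if "xs \<in> words X n" for xs
    using that by (simp add: tens_def words_def)
  have gc: "continuous_linear (tensor_power X n) Y ?g" by (rule continuous_linear_cong[OF lc _ g]) simp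
  show ?thesis
    unfolding tensor_lift_def pt map_replicate listset_words
  proof (rule the_equality)
    show "?g \<in> extensional (carrier (tensor_power X n)) \<and> continuous_linear (tensor_power X n) Y ?g \<and>
        (\<forall>xs\<in>words X n. ?g (elem_tensor (replicate n X) xs) = f xs)"
      using gc val elem tens_in_power by simp
    fix h assume h: "h \<in> extensional (carrier (tensor_power X n)) \<and> continuous_linear (tensor_power X n) Y h \<and>
        (\<forall>xs\<in>words X n. h (elem_tensor (replicate n X) xs) = f xs)"
    have eq: "h (tens X xs) = ?g (tens X xs)" if "xs \<in> words X n" for xs
      using h val elem tens_in_power that by simp
    have hc: "continuous_linear (tensor_power X n) Y h" using h by simp
    show "h = ?g"
      by (rule extensionalityI[of _ "carrier (tensor_power X n)"]) (use h tensor_ext[OF Y H hc gc eq] in simp_all)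
  qed
qed

text \<open>The universal property: the extension to the algebraic tensor power is bounded by a projective
  seminorm and therefore extends further to the completion.\<close>

lemma tensor_lift_exists:
  fixes Y :: "'y lcs"
  assumes Y: "complete_hausdorff_lcs Y" and f: "bounded_multilinear n Y f"
  shows "continuous_linear (tensor_power X n) Y (tensor_lift (replicate n X) Y f)"
    and "xs \<in> words X n \<Longrightarrow> tensor_lift (replicate n X) Y f (tens X xs) = f xs"
proof -
  interpret Y: complete_hausdorff_lcs Y by fact
  interpret AT: locally_convex "AT n" by (rule locally_convex_alg_tensor)
  interpret T: complete_hausdorff_lcs "tensor_power X n" by (rule complete_tensor_power)
  obtain u where u: "continuous_linear (AT n) Y u"
    "\<And>xs. xs \<in> words X n \<Longrightarrow> u (Rel n +>\<^bsub>Fr n\<^esub> basis xs) = f xs"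
    using alg_tensor_lift[OF Y.locally_convex_axioms f] by auto
  obtain g where g: "continuous_linear (tensor_power X n) Y g"
    "\<And>x. x \<in> carrier (AT n) \<Longrightarrow> g (to_completion (AT n) x) = u x"
    using AT.completion_extension[OF Y u(1)] by (auto simp: tensor_power_def proj_tensor_def)
  have val: "\<forall>xs\<in>words X n. g (tens X xs) = f xs"
    using g(2)[OF single_coset_mem[of _ n 1]] u(2) tens_eq by simp
  note lift = tensor_lift_eq[OF Y.locally_convex_axioms Y.hausdorff g(1) val]
  show "continuous_linear (tensor_power X n) Y (tensor_lift (replicate n X) Y f)"
    unfolding lift by (rule continuous_linear_cong[OF T.locally_convex_axioms _ g(1)]) simp
  show "tensor_lift (replicate n X) Y f (tens X xs) = f xs" if "xs \<in> words X n"
    unfolding lift using bspec[OF val that] tens_in_power[OF that] by simp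
qed

text \<open>Additivity and homogeneity in each slot hold because the relations have class zero. The bound is the
  cost of the representation of an elementary tensor by itself.\<close>

lemma tens_bounded_multilinear: "bounded_multilinear n (tensor_power X n) (tens X)"
proof -
  interpret AT: locally_convex "AT n" by (rule locally_convex_alg_tensor)
  interpret Fr: lin_space "Fr n" by (rule lin_space_free)
  let ?T = "tensor_power X n"
  have T: "?T = completion (AT n)" by (simp add: tensor_power_def proj_tensor_def)
  define k where "k f = to_completion (AT n) (Rel n +>\<^bsub>Fr n\<^esub> f)" for f
  note coset = Fr.linear_coset(1)[OF relations_subspace]
  have toc: "linear_map (AT n) ?T (to_completion (AT n))"
    using AT.to_completion_continuous by (simp add: T continuous_linear_def)
  have klin: "linear_map (Fr n) ?T k"
    unfolding k_def by (rule linear_map_compose[OF _ toc]) (use coset in \<open>simp add: linear_map_def\<close>)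
  have ksingle: "k (basis xs) = tens X xs" if "xs \<in> words X n" for xs
    unfolding k_def tens_eq[OF that] ..
  have ls: "lin_space ?T" unfolding T by (rule AT.lin_space_completion')
  interpret T: lin_space ?T by (rule ls)
  have single: "Poly_Mapping.single xs c \<in> carrier (Fr n)" if "xs \<in> words X n" for xs c
    using that by (auto split: if_splits)
  have kzero: "k f = \<zero>\<^bsub>?T\<^esub>" if f: "f \<in> Rel n" for f
  proof -
    have fc: "f \<in> carrier (Fr n)" by (rule lin_subspaceD(1)[OF relations_subspace f])
    have "Rel n +>\<^bsub>Fr n\<^esub> f = \<zero>\<^bsub>AT n\<^esub>"
      using Fr.coset_eq_iff[OF relations_subspace fc Fr.M.zero_closed] Fr.coset_zero[OF relations_subspace]
        Fr.linear_coset(3)[OF relations_subspace] f fc Fr.diff_zero[OF fc] by simp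
    then show ?thesis unfolding k_def using linear_map_zero[OF lin_space_AT ls toc] by simp
  qed
  have kdiff: "k (f - g) = k f \<ominus>\<^bsub>?T\<^esub> k g" if "f \<in> carrier (Fr n)" "g \<in> carrier (Fr n)" for f g
    using linear_map_diff[OF lin_space_free ls klin that] unfolding free_space_minus[OF that] .
  show ?thesis
    unfolding bounded_multilinear_def
  proof (intro conjI ballI allI impI)
    fix xs assume xs: "xs \<in> words X n"
    show "tens X xs \<in> carrier ?T" by (rule tens_in_power[OF xs])
    note tm = tens_in_power
    fix i assume i: "i < n"
    have ri: "replicate n X ! i = X" using i by simp
    have xl: "xs \<in> listset (map carrier (replicate n X))" using xs by simp
    have il: "i < length (replicate n X)" using i by simp
    fix x assume x: "x \<in> carrier X"
    have wx: "xs[i := x] \<in> words X n" using xs x by (rule words_update)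
    have xr: "x \<in> carrier (replicate n X ! i)" using x by (simp add: ri)
    {
      fix y assume y: "y \<in> carrier X"
      have w: "xs[i := x \<oplus>\<^bsub>X\<^esub> y] \<in> words X n" "xs[i := y] \<in> words X n" using xs x y by (simp_all add: words_update)
      have yr: "y \<in> carrier (replicate n X ! i)" using y by (simp add: ri)
      have "k (basis (xs[i := x \<oplus>\<^bsub>X\<^esub> y]) - basis (xs[i := x]) - basis (xs[i := y])) = \<zero>\<^bsub>?T\<^esub>"
        using kzero[OF tensor_relations.additive[OF xl il xr yr]] unfolding ri .
      then have "(tens X (xs[i := x \<oplus>\<^bsub>X\<^esub> y]) \<ominus>\<^bsub>?T\<^esub> tens X (xs[i := x])) \<ominus>\<^bsub>?T\<^esub> tens X (xs[i := y]) = \<zero>\<^bsub>?T\<^esub>"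
        unfolding kdiff[OF free_space_diff_mem[OF single[OF w(1)] single[OF wx]] single[OF w(2)]]
          kdiff[OF single[OF w(1)] single[OF wx]] ksingle[OF w(1)] ksingle[OF wx] ksingle[OF w(2)] .
      then show "tens X (xs[i := x \<oplus>\<^bsub>X\<^esub> y]) = tens X (xs[i := x]) \<oplus>\<^bsub>?T\<^esub> tens X (xs[i := y])"
        using tm[OF w(1)] tm[OF wx] tm[OF w(2)] by (simp add: T.diff_eq_zero_iff T.diff_eq_iff T.M.a_comm)
    }
    {
      fix c
      have w: "xs[i := c \<odot>\<^bsub>X\<^esub> x] \<in> words X n" using xs x by (simp add: words_update)
      have "Poly_Mapping.single (xs[i := x]) c = c \<odot>\<^bsub>Fr n\<^esub> basis (xs[i := x])"
        by (rule poly_mapping_eqI) (simp add: lookup_single when_def)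
      then have kc: "k (Poly_Mapping.single (xs[i := x]) c) = c \<odot>\<^bsub>?T\<^esub> tens X (xs[i := x])"
        using linear_mapD(3)[OF klin single[OF wx, of 1], of c] ksingle[OF wx] by simp
      have "k (basis (xs[i := c \<odot>\<^bsub>X\<^esub> x]) - Poly_Mapping.single (xs[i := x]) c) = \<zero>\<^bsub>?T\<^esub>"
        using kzero[OF tensor_relations.homogeneous[OF xl il xr, of c]] unfolding ri .
      then show "tens X (xs[i := c \<odot>\<^bsub>X\<^esub> x]) = c \<odot>\<^bsub>?T\<^esub> tens X (xs[i := x])"
        unfolding kdiff[OF single[OF w] single[OF wx]] ksingle[OF w] kc
        using tm[OF w] tm[OF wx] by (simp add: T.diff_eq_zero_iff)
    }
  next
    fix q assume "continuous_seminorm ?T q"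
    then have "continuous_seminorm (AT n) (\<lambda>x. q (to_completion (AT n) x))"
      unfolding T by (rule continuous_linear_cseminorm[OF AT.to_completion_continuous])
    then obtain r K where r: "r \<in> projective_seminorm ` sn_lists n" "K > 0"
      and le: "\<And>C. C \<in> carrier (AT n) \<Longrightarrow> q (to_completion (AT n) C) \<le> K * r C"
      by (rule AT.cseminorm_le_generator[OF generates_alg_tensor]) blast
    obtain ps where ps: "ps \<in> sn_lists n" "r = projective_seminorm ps" using r(1) by auto
    have l: "length ps = n" using ps(1) by (simp add: sn_lists_def)
    let ?p = "\<lambda>x. \<Sum>p\<leftarrow>ps. p x"
    have p: "continuous_seminorm X ?p" using ps(1) by (intro cseminorm_sum_list) (auto simp: sn_lists_def)
    have "q (tens X xs) \<le> K * (\<Prod>i<n. ?p (xs ! i))" if xs: "xs \<in> words X n" for xs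
    proof -
      let ?C = "Rel n +>\<^bsub>Fr n\<^esub> basis xs"
      have C: "?C \<in> carrier (Alg n)" using single_coset_mem[OF xs, of 1] by simp
      have "r ?C \<le> cost ps (basis xs)"
        unfolding ps(2) by (rule projective_seminorm_le[OF ps(1) C Fr.coset_self[OF relations_subspace single[OF xs]]])
      also have "\<dots> = (\<Prod>i<n. (ps ! i) (xs ! i))" by (simp add: cost_def l)
      also have "\<dots> \<le> (\<Prod>i<n. ?p (xs ! i))"
      proof (rule prod_mono)
        fix i assume "i \<in> {..<n}"
        then have i: "i < n" by simp
        have "ps ! i \<in> cseminorms X" using ps i l subsetD[OF _ nth_mem, of ps "cseminorms X" i] by (auto simp: sn_lists_def)
        then show "0 \<le> (ps ! i) (xs ! i) \<and> (ps ! i) (xs ! i) \<le> ?p (xs ! i)"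
          using sum_list_bound[OF ps(1) i words_nth[OF xs i]] seminorm_nonneg[OF cseminormD words_nth[OF xs i]] by simp
      qed
      finally have "r ?C \<le> (\<Prod>i<n. ?p (xs ! i))" .
      then have "K * r ?C \<le> K * (\<Prod>i<n. ?p (xs ! i))" using r(2) by simp
      then show ?thesis using le[OF single_coset_mem[OF xs, of 1]] tens_eq[OF xs] by simp
    qed
    then show "\<exists>p K. continuous_seminorm X p \<and> 0 \<le> K \<and> (\<forall>xs\<in>words X n. q (tens X xs) \<le> K * (\<Prod>i<n. p (xs ! i)))"
      using p r(2) by (intro exI[of _ ?p] exI[of _ K]) auto
  qed
qed

end

section \<open>Operations on bounded multilinear maps\<close>

lemma prod_nth: "(\<Prod>i<length xs. p (xs ! i)) = prod_list (map p xs)"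
  by (induction xs) (simp_all add: prod.lessThan_Suc_shift del: prod.lessThan_Suc)

lemma prod_words: "xs \<in> words X n \<Longrightarrow> (\<Prod>i<n. p (xs ! i)) = prod_list (map (p :: 'a \<Rightarrow> real) xs)"
  using prod_nth[of p xs] by (auto simp: words_def)

context locally_convex
begin

text \<open>Precomposition with an operation on words that, in each slot, acts by a linear map on one slot
  of the result.\<close>

lemma bounded_multilinear_reindex:
  assumes f: "bounded_multilinear n Y f"
    and \<phi>: "\<And>xs. xs \<in> words X m \<Longrightarrow> \<phi> xs \<in> words X n"
    and slot: "\<And>xs j. xs \<in> words X m \<Longrightarrow> j < m \<Longrightarrow>
      \<exists>i<n. \<exists>L. linear_map X X L \<and> (\<forall>x\<in>carrier X. \<phi> (xs[j := x]) = (\<phi> xs)[i := L x])"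
    and bound: "\<And>p. continuous_seminorm X p \<Longrightarrow> \<exists>s. continuous_seminorm X s \<and>
      (\<forall>xs\<in>words X m. prod_list (map p (\<phi> xs)) \<le> prod_list (map s xs))"
  shows "bounded_multilinear m Y (\<lambda>xs. f (\<phi> xs))"
  unfolding bounded_multilinear_def
proof (intro conjI ballI allI impI)
  fix xs assume xs: "xs \<in> words X m"
  show "f (\<phi> xs) \<in> carrier Y" by (rule bounded_multilinearD(1)[OF f \<phi>[OF xs]])
  fix j assume j: "j < m"
  obtain i L where i: "i < n" and L: "linear_map X X L"
    and eq: "\<And>x. x \<in> carrier X \<Longrightarrow> \<phi> (xs[j := x]) = (\<phi> xs)[i := L x]"
    using slot[OF xs j] by auto
  fix x assume x: "x \<in> carrier X"
  show "f (\<phi> (xs[j := x \<oplus>\<^bsub>X\<^esub> y])) = f (\<phi> (xs[j := x])) \<oplus>\<^bsub>Y\<^esub> f (\<phi> (xs[j := y]))" if y: "y \<in> carrier X" for y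
    using eq[OF M.a_closed[OF x y]] eq[OF x] eq[OF y] linear_mapD(2)[OF L x y]
      bounded_multilinearD(2)[OF f \<phi>[OF xs] i linear_mapD(1)[OF L x] linear_mapD(1)[OF L y]] by simp
  show "f (\<phi> (xs[j := c \<odot>\<^bsub>X\<^esub> x])) = c \<odot>\<^bsub>Y\<^esub> f (\<phi> (xs[j := x]))" for c
    using eq[OF smult_mem[OF x, of c]] eq[OF x] linear_mapD(3)[OF L x, of c]
      bounded_multilinearD(3)[OF f \<phi>[OF xs] i linear_mapD(1)[OF L x]] by simp
next
  fix q assume "continuous_seminorm Y q"
  then obtain p K where p: "continuous_seminorm X p" "0 \<le> K" "\<And>xs. xs \<in> words X n \<Longrightarrow> q (f xs) \<le> K * (\<Prod>i<n. p (xs ! i))"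
    using bounded_multilinearD(4)[OF f] by meson
  obtain s where s: "continuous_seminorm X s" "\<And>xs. xs \<in> words X m \<Longrightarrow> prod_list (map p (\<phi> xs)) \<le> prod_list (map s xs)"
    using bound[OF p(1)] by auto
  have "q (f (\<phi> xs)) \<le> K * (\<Prod>i<m. s (xs ! i))" if xs: "xs \<in> words X m" for xs
    using p(3)[OF \<phi>[OF xs]] mult_left_mono[OF s(2)[OF xs] p(2)] prod_words[OF xs, of s] prod_words[OF \<phi>[OF xs], of p] by simp
  then show "\<exists>p K. continuous_seminorm X p \<and> 0 \<le> K \<and> (\<forall>xs\<in>words X m. q (f (\<phi> xs)) \<le> K * (\<Prod>i<m. p (xs ! i)))"
    using s(1) p(2) by auto
qed

lemma words_rotate:
  assumes "xs \<in> words X n" "0 < n"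
  shows "last xs # butlast xs \<in> words X n"
proof -
  have "xs = butlast xs @ [last xs]" using assms by (cases xs) (auto simp: words_def)
  then have "set xs = insert (last xs) (set (butlast xs))" by (metis list.simps(15) rotate1.simps(2) set_rotate1)
  then show ?thesis using assms by (simp add: words_def)
qed

lemma bounded_multilinear_rotate:
  assumes f: "bounded_multilinear n Y f" and n: "0 < n"
  shows "bounded_multilinear n Y (\<lambda>xs. f (last xs # butlast xs))"
proof (rule bounded_multilinear_reindex[OF f])
  fix xs assume xs: "xs \<in> words X n"
  show "last xs # butlast xs \<in> words X n" by (rule words_rotate[OF xs n])
  obtain ys z where yz: "xs = ys @ [z]" using xs n by (cases xs rule: rev_cases) (auto simp: words_def)
  have l: "length ys = n - 1" using xs yz by (auto simp: words_def)
  fix j assume j: "j < n"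
  have id: "linear_map X X (\<lambda>x. x)" by (simp add: linear_map_def)
  show "\<exists>i<n. \<exists>L. linear_map X X L \<and> (\<forall>x\<in>carrier X. last (xs[j := x]) # butlast (xs[j := x]) = (last xs # butlast xs)[i := L x])"
  proof (cases "j < n - 1")
    case True
    have "last (xs[j := x]) # butlast (xs[j := x]) = (last xs # butlast xs)[Suc j := x]" for x
      using True l by (simp add: yz list_update_append)
    then show ?thesis using True id by (intro exI[of _ "Suc j"]) auto
  next
    case False
    then have "j = length ys" using l j by simp
    then have "last (xs[j := x]) # butlast (xs[j := x]) = (last xs # butlast xs)[0 := x]" for x
      by (simp add: yz)
    then show ?thesis using n id by (intro exI[of _ 0]) auto
  qed
next
  fix p assume p: "continuous_seminorm X p"
  have "prod_list (map p (last xs # butlast xs)) = prod_list (map p xs)" if xs: "xs \<in> words X n" for xs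
    using xs n by (cases xs rule: rev_cases) (auto simp: words_def)
  then show "\<exists>s. continuous_seminorm X s \<and> (\<forall>xs\<in>words X n. prod_list (map p (last xs # butlast xs)) \<le> prod_list (map s xs))"
    using p by (intro exI[of _ p]) simp
qed

lemma prod_list_mono:
  assumes "\<And>x. x \<in> set xs \<Longrightarrow> 0 \<le> p x \<and> p x \<le> (s x :: real)"
  shows "0 \<le> prod_list (map p xs) \<and> prod_list (map p xs) \<le> prod_list (map s xs)"
  using assms
proof (induction xs)
  case (Cons x xs)
  have h: "0 \<le> p x \<and> p x \<le> s x" using Cons.prems[of x] by simp
  have t: "0 \<le> prod_list (map p xs) \<and> prod_list (map p xs) \<le> prod_list (map s xs)"
    by (rule Cons.IH) (use Cons.prems in simp)
  have "p x * prod_list (map p xs) \<le> s x * prod_list (map s xs)" by (rule mult_mono) (use h t in auto)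
  moreover have "0 \<le> p x * prod_list (map p xs)" using h t by simp
  ultimately show ?case by simp
qed simp

end

section \<open>Faces and the cyclic operator\<close>

context tensor_algebra
begin

text \<open>Continuity at the origin gives \<open>p (ab) < 1\<close> on the product of two balls, and scaling both factors turns
  this into \<open>p (ab) \<le> q a * r b\<close>. The sum of the seminorms serves for both factors and dominates
  \<^term>\<open>p\<close> itself, which is needed for the remaining slots of a face.\<close>

lemma mult_seminorm:
  assumes p: "continuous_seminorm A p"
  shows "\<exists>s. continuous_seminorm A s \<and> (\<forall>a\<in>carrier A. p a \<le> s a) \<and>
    (\<forall>a\<in>carrier A. \<forall>b\<in>carrier A. p (a \<otimes>\<^bsub>A\<^esub> b) \<le> s a * s b)"
proof -
  note sp = cseminormD[OF p]
  have "openin (topo A) (sball A p \<zero>\<^bsub>A\<^esub> 1)"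
    by (rule generates_sball_open[OF lin_space_axioms generates_cseminorms]) (use p in simp_all)
  from openin_continuous_map_preimage[OF mult_continuous this]
  have "openin (prod_topology (topo A) (topo A))
      {z \<in> topspace (prod_topology (topo A) (topo A)). (case z of (a, b) \<Rightarrow> a \<otimes>\<^bsub>A\<^esub> b) \<in> sball A p \<zero>\<^bsub>A\<^esub> 1}" .
  moreover have "\<zero>\<^bsub>A\<^esub> \<otimes>\<^bsub>A\<^esub> \<zero>\<^bsub>A\<^esub> = \<zero>\<^bsub>A\<^esub>"
    using linear_map_zero[OF lin_space_axioms lin_space_axioms mult_linear_left[of "\<zero>\<^bsub>A\<^esub>"]] by simp
  ultimately obtain U V where U: "openin (topo A) U" "openin (topo A) V" "\<zero>\<^bsub>A\<^esub> \<in> U" "\<zero>\<^bsub>A\<^esub> \<in> V"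
    and UV: "U \<times> V \<subseteq> {z \<in> topspace (prod_topology (topo A) (topo A)). (case z of (a, b) \<Rightarrow> a \<otimes>\<^bsub>A\<^esub> b) \<in> sball A p \<zero>\<^bsub>A\<^esub> 1}"
    unfolding openin_prod_topology_alt
    by (auto simp: topspace_eq sball_def seminorm_zero[OF sp] dest!: spec[of _ "\<zero>\<^bsub>A\<^esub>"])
  obtain q where q: "continuous_seminorm A q" "\<And>a. a \<in> carrier A \<Longrightarrow> q a < 1 \<Longrightarrow> a \<in> U"
    by (rule seminorm_in_neighbourhood[OF U(1,3)]) blast
  obtain r where r: "continuous_seminorm A r" "\<And>a. a \<in> carrier A \<Longrightarrow> r a < 1 \<Longrightarrow> a \<in> V"
    by (rule seminorm_in_neighbourhood[OF U(2,4)]) blast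
  have ball: "p (a \<otimes>\<^bsub>A\<^esub> b) < 1" if "a \<in> carrier A" "b \<in> carrier A" "q a < 1" "r b < 1" for a b
  proof -
    have "(a, b) \<in> U \<times> V" using q(2)[OF that(1,3)] r(2)[OF that(2,4)] by simp
    then have "a \<otimes>\<^bsub>A\<^esub> b \<in> sball A p \<zero>\<^bsub>A\<^esub> 1" using UV by auto
    then show ?thesis using that by (simp add: sball_def mult_closed)
  qed
  have qn: "0 \<le> q a" "0 \<le> r a" "0 \<le> p a" if "a \<in> carrier A" for a
    using seminorm_nonneg[OF cseminormD that] q(1) r(1) p by auto
  have scaled: "p (a \<otimes>\<^bsub>A\<^esub> b) \<le> (q a + e) * (r b + e)" if a: "a \<in> carrier A" and b: "b \<in> carrier A" and e: "e > 0" for a b and e :: real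
  proof -
    let ?c = "q a + e" and ?d = "r b + e"
    let ?a = "complex_of_real (1 / ?c) \<odot>\<^bsub>A\<^esub> a" and ?b = "complex_of_real (1 / ?d) \<odot>\<^bsub>A\<^esub> b"
    have pos: "?c > 0" "?d > 0" using qn[OF a] qn[OF b] e by linarith+
    have "q ?a = \<bar>1 / ?c\<bar> * q a" "r ?b = \<bar>1 / ?d\<bar> * r b"
      unfolding seminorm_smult[OF cseminormD[OF q(1)] a] seminorm_smult[OF cseminormD[OF r(1)] b] norm_of_real by (rule refl)+
    moreover have "\<bar>1 / ?c\<bar> * q a < 1" "\<bar>1 / ?d\<bar> * r b < 1" using pos e by (simp_all add: divide_simps)
    ultimately have "q ?a < 1" "r ?b < 1" by (simp_all only:)
    then have "p (?a \<otimes>\<^bsub>A\<^esub> ?b) < 1" by (intro ball) (use a b in simp_all)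
    moreover have "?a \<otimes>\<^bsub>A\<^esub> ?b = complex_of_real (1 / (?c * ?d)) \<odot>\<^bsub>A\<^esub> (a \<otimes>\<^bsub>A\<^esub> b)"
      using linear_mapD(3)[OF mult_linear_left[OF smult_mem[OF b]] a] linear_mapD(3)[OF mult_linear_right[OF a] b] a b
      by (simp add: smult_smult mult_closed)
    moreover have "p (complex_of_real (1 / (?c * ?d)) \<odot>\<^bsub>A\<^esub> (a \<otimes>\<^bsub>A\<^esub> b)) = \<bar>1 / (?c * ?d)\<bar> * p (a \<otimes>\<^bsub>A\<^esub> b)"
      unfolding seminorm_smult[OF sp mult_closed[OF a b]] norm_of_real ..
    ultimately have "\<bar>1 / (?c * ?d)\<bar> * p (a \<otimes>\<^bsub>A\<^esub> b) < 1" by (simp only:)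
    moreover have "0 < ?c * ?d" using pos by simp
    ultimately have "p (a \<otimes>\<^bsub>A\<^esub> b) < ?c * ?d" by (simp only: abs_of_pos zero_less_divide_1_iff) (simp add: field_simps)
    then show ?thesis by simp
  qed
  have both: "p (a \<otimes>\<^bsub>A\<^esub> b) \<le> q a * r b" if a: "a \<in> carrier A" and b: "b \<in> carrier A" for a b
  proof (rule tendsto_lowerbound)
    show "((\<lambda>e. (q a + e) * (r b + e)) \<longlongrightarrow> q a * r b) (at_right 0)" by (auto intro!: tendsto_eq_intros)
    show "\<forall>\<^sub>F e in at_right 0. p (a \<otimes>\<^bsub>A\<^esub> b) \<le> (q a + e) * (r b + e)"
      using scaled[OF a b] by (auto simp: eventually_at_right_field intro!: exI[of _ 1])
  qed simp
  let ?s = "\<lambda>a. p a + (q a + r a)"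
  have "continuous_seminorm A ?s" by (intro cseminorm_add p q(1) r(1))
  moreover have "p (a \<otimes>\<^bsub>A\<^esub> b) \<le> ?s a * ?s b" if a: "a \<in> carrier A" and b: "b \<in> carrier A" for a b
    by (rule order_trans[OF both[OF a b] mult_mono]) (use qn[OF a] qn[OF b] in simp_all)
  ultimately show ?thesis using qn by (intro exI[of _ ?s]) simp
qed

lemma face_split: "length us = i \<Longrightarrow> face A i (us @ a # b # vs) = us @ (a \<otimes>\<^bsub>A\<^esub> b) # vs"
  by (simp add: face_def nth_append)

lemma words_split:
  assumes "xs \<in> words A (Suc n)" "i < n"
  obtains us a b vs where "xs = us @ a # b # vs" "length us = i" "length vs = n - Suc i"
    "set us \<subseteq> carrier A" "a \<in> carrier A" "b \<in> carrier A" "set vs \<subseteq> carrier A"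
proof -
  have l: "length xs = Suc n" "set xs \<subseteq> carrier A" using assms by (auto simp: words_def)
  have "xs = take i xs @ xs ! i # xs ! Suc i # drop (Suc (Suc i)) xs"
    using assms(2) l(1) by (simp add: Cons_nth_drop_Suc)
  moreover have "xs ! i \<in> carrier A" "xs ! Suc i \<in> carrier A" using l assms(2) by auto
  moreover have "set (take i xs) \<subseteq> carrier A" "set (drop (Suc (Suc i)) xs) \<subseteq> carrier A"
    using l(2) set_take_subset[of i xs] set_drop_subset[of "Suc (Suc i)" xs] by auto
  ultimately show thesis using that[of "take i xs"] l(1) assms(2) by simp
qed

lemma words_face:
  assumes "xs \<in> words A (Suc n)" "i < n"
  shows "face A i xs \<in> words A n"
  by (rule words_split[OF assms]) (use assms in \<open>auto simp: words_def face_split mult_closed\<close>)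

lemma bounded_multilinear_face:
  assumes f: "bounded_multilinear n Y f" and n: "0 < n"
  shows "bounded_multilinear (Suc n) Y (\<lambda>xs. f (face A 0 xs))"
proof (rule bounded_multilinear_reindex[OF f])
  have split: "\<exists>a b vs. xs = a # b # vs \<and> a \<in> carrier A \<and> b \<in> carrier A \<and> set vs \<subseteq> carrier A" if "xs \<in> words A (Suc n)" for xs
    by (rule words_split[OF that n]) auto
  fix xs assume xs: "xs \<in> words A (Suc n)"
  show "face A 0 xs \<in> words A n" by (rule words_face[OF xs n])
  obtain a b vs where s: "xs = a # b # vs" "a \<in> carrier A" "b \<in> carrier A" using split[OF xs] by (elim exE conjE)
  have id: "linear_map A A (\<lambda>x. x)" by (simp add: linear_map_def)
  fix j assume j: "j < Suc n"
  consider "j = 0" | "j = Suc 0" | k where "j = Suc (Suc k)" by (metis not0_implies_Suc)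
  then show "\<exists>k<n. \<exists>L. linear_map A A L \<and> (\<forall>x\<in>carrier A. face A 0 (xs[j := x]) = (face A 0 xs)[k := L x])"
  proof cases
    case 1
    then show ?thesis
      using n mult_linear_left[OF s(3)] by (intro exI[of _ 0] conjI exI[of _ "\<lambda>x. x \<otimes>\<^bsub>A\<^esub> b"]) (simp_all add: s(1) face_def)
  next
    case 2
    then show ?thesis
      using n mult_linear_right[OF s(2)] by (intro exI[of _ 0] conjI exI[of _ "\<lambda>x. a \<otimes>\<^bsub>A\<^esub> x"]) (simp_all add: s(1) face_def)
  next
    case 3
    then show ?thesis using j id by (intro exI[of _ "Suc k"] conjI exI[of _ "\<lambda>x. x"]) (simp_all add: s(1) face_def)
  qed
next
  fix p assume p: "continuous_seminorm A p"
  obtain s where s: "continuous_seminorm A s" "\<And>a. a \<in> carrier A \<Longrightarrow> p a \<le> s a"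
      "\<And>a b. a \<in> carrier A \<Longrightarrow> b \<in> carrier A \<Longrightarrow> p (a \<otimes>\<^bsub>A\<^esub> b) \<le> s a * s b"
    using mult_seminorm[OF p] by auto
  have nn: "0 \<le> p a \<and> p a \<le> s a" if "a \<in> carrier A" for a
    using seminorm_nonneg[OF cseminormD[OF p] that] s(2)[OF that] by simp
  have "prod_list (map p (face A 0 xs)) \<le> prod_list (map s xs)" if xs: "xs \<in> words A (Suc n)" for xs
  proof (rule words_split[OF xs n])
    fix us a b vs assume x: "xs = us @ a # b # vs" "length us = 0" "a \<in> carrier A" "b \<in> carrier A" "set vs \<subseteq> carrier A"
    have v: "0 \<le> prod_list (map p vs) \<and> prod_list (map p vs) \<le> prod_list (map s vs)"
      by (rule prod_list_mono) (use x(5) nn in blast)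
    have "p (a \<otimes>\<^bsub>A\<^esub> b) * prod_list (map p vs) \<le> (s a * s b) * prod_list (map s vs)"
      by (rule mult_mono[OF s(3)[OF x(3,4)]]) (use v nn[OF x(3)] nn[OF x(4)] in auto)
    then show ?thesis using x(1,2) by (simp add: face_def mult.assoc)
  qed
  then show "\<exists>s. continuous_seminorm A s \<and> (\<forall>xs\<in>words A (Suc n). prod_list (map p (face A 0 xs)) \<le> prod_list (map s xs))"
    using s(1) by blast
qed

abbreviation "T n \<equiv> tensor_power A n"

lemma T_lc: "locally_convex (T n)"
  using complete_tensor_power[of n] by (simp add: complete_hausdorff_lcs_def)

lemma T_haus: "Hausdorff_space (topo (T n))"
  using complete_hausdorff_lcs.hausdorff[OF complete_tensor_power[of n]] .

lemma T_lin: "lin_space (T n)"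
  by (rule locally_convex.axioms(1)[OF T_lc, folded lin_space_def])

lemma tens_mem: "xs \<in> words A n \<Longrightarrow> tens A xs \<in> carrier (T n)"
  by (rule tens_in_power)

lemma T_ext:
  assumes "continuous_linear (T n) (T m) g" "continuous_linear (T n) (T m) h"
    and "\<And>xs. xs \<in> words A n \<Longrightarrow> g (tens A xs) = h (tens A xs)" "t \<in> carrier (T n)"
  shows "g t = h t"
  using tensor_ext[OF T_lc T_haus assms] .

definition rot :: "'a list \<Rightarrow> 'a list" where
  "rot xs = last xs # butlast xs"

lemma words_rot: "xs \<in> words A n \<Longrightarrow> 0 < n \<Longrightarrow> rot xs \<in> words A n"
  unfolding rot_def by (rule words_rotate)

lemma rot_rotate1: "xs \<noteq> [] \<Longrightarrow> rot (rotate1 xs) = xs"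
  by (cases xs) (simp_all add: rot_def)

lemma words_rotate1: "xs \<in> words A n \<Longrightarrow> rotate1 xs \<in> words A n"
  by (simp add: words_def)

lemma rot_power: "xs \<noteq> [] \<Longrightarrow> (rot ^^ length xs) xs = xs"
proof -
  assume xs: "xs \<noteq> []"
  have "(rot ^^ k) (rotate k xs) = xs" for k
  proof (induction k)
    case (Suc k)
    have ne: "rotate k xs \<noteq> []" using xs by simp
    show ?case using Suc by (simp only: funpow_Suc_right o_apply rotate_Suc rot_rotate1[OF ne])
  qed simp
  from this[of "length xs"] show ?thesis by simp
qed

lemma rot_face:
  assumes "ys \<in> words A (Suc n)" "Suc i < n"
  shows "rot (face A i ys) = face A (Suc i) (rot ys)"
proof -
  obtain us a b vs where s: "ys = us @ a # b # vs" "length us = i" "length vs = n - Suc i"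
    by (rule words_split[OF assms(1), of i]) (use assms in auto)
  then obtain vs' z where vs: "vs = vs' @ [z]" using assms(2) by (cases vs rule: rev_cases) auto
  have "rot (face A i ys) = (z # us) @ (a \<otimes>\<^bsub>A\<^esub> b) # vs'"
    using s(2) by (simp add: s(1) vs rot_def face_split butlast_append)
  moreover have "rot ys = (z # us) @ a # b # vs'" by (simp add: s(1) vs rot_def butlast_append)
  ultimately show ?thesis using face_split[of "z # us" "Suc i" a b vs'] s(2) by simp
qed

abbreviation "lam n \<equiv> cyclic_op A n"

text \<open>Any continuous operator with the prescribed values on elementary tensors computes the lift. So
  it suffices to lift the rotation and the zeroth face directly; the other operators are combinations
  of these two.\<close>

lemma T_lift_eq:
  assumes "continuous_linear (T n) (T m) g" "\<forall>xs\<in>words A n. g (tens A xs) = f xs"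
  shows "continuous_linear (T n) (T m) (tensor_lift (replicate n A) (T m) f)"
    and "x \<in> carrier (T n) \<Longrightarrow> tensor_lift (replicate n A) (T m) f x = g x"
  unfolding tensor_lift_eq[OF T_lc T_haus assms]
  using continuous_linear_cong[OF T_lc _ assms(1), of "restrict g (carrier (T n))"] by simp_all

lemma lam_linear: "0 < n \<Longrightarrow> continuous_linear (T n) (T n) (lam n)"
  and lam_tens: "0 < n \<Longrightarrow> xs \<in> words A n \<Longrightarrow> lam n (tens A xs) = (- 1) ^ (n - 1) \<odot>\<^bsub>T n\<^esub> tens A (rot xs)"
proof -
  assume n: "0 < n"
  let ?r = "tensor_lift (replicate n A) (T n) (\<lambda>xs. tens A (last xs # butlast xs))"
  note t = tensor_lift_exists[OF complete_tensor_power bounded_multilinear_rotate[OF tens_bounded_multilinear n]]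
  have v: "\<forall>xs\<in>words A n. (- 1) ^ (n - 1) \<odot>\<^bsub>T n\<^esub> ?r (tens A xs) = (- 1) ^ (n - 1) \<odot>\<^bsub>T n\<^esub> tens A (last xs # butlast xs)"
    using t(2) by simp
  note l = T_lift_eq[OF continuous_linear_smult[OF T_lc T_lc t(1)] v, folded cyclic_op_def]
  show "continuous_linear (T n) (T n) (lam n)" by (rule l(1))
  show "lam n (tens A xs) = (- 1) ^ (n - 1) \<odot>\<^bsub>T n\<^esub> tens A (rot xs)" if "xs \<in> words A n"
    using l(2)[OF tens_mem[OF that]] bspec[OF v that] by (simp add: rot_def)
qed

definition d0 :: "nat \<Rightarrow> 'a tensor \<Rightarrow> 'a tensor" where
  "d0 n = tensor_lift (replicate (Suc n) A) (T n) (\<lambda>xs. tens A (face A 0 xs))"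

lemma d0_linear: "0 < n \<Longrightarrow> continuous_linear (T (Suc n)) (T n) (d0 n)"
  and d0_tens: "0 < n \<Longrightarrow> xs \<in> words A (Suc n) \<Longrightarrow> d0 n (tens A xs) = tens A (face A 0 xs)"
  unfolding d0_def
  by (rule tensor_lift_exists[OF complete_tensor_power bounded_multilinear_face[OF tens_bounded_multilinear]]; assumption)+

lemma bar_diff_0:
  assumes "x \<in> carrier (T (Suc 0))"
  shows "bar_diff A 0 x = \<zero>\<^bsub>T (Suc 0)\<^esub>"
proof -
  interpret T: lin_space "T (Suc 0)" by (rule T_lin)
  have "\<forall>xs\<in>words A (Suc 0). \<zero>\<^bsub>T (Suc 0)\<^esub> = bar_value A 0 xs" by (simp add: bar_value_def chains_def)
  from T_lift_eq(2)[OF continuous_linear_const_zero[OF T_lc T_lc] this assms]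
  show ?thesis by (simp add: bar_diff_def chains_def)
qed

end

section \<open>Identities of the cyclic operator\<close>

text \<open>The identities between the differentials, the cyclic operator and the norm only use two finite
  cyclic actions and one linear map between the spaces on which they act: in signed form, every face
  operator is a conjugate of the zeroth one. Hence the identities reduce to shifting summation indices.\<close>

locale cyclic_face = U: lin_space U + V: lin_space V
  for U :: "(complex, 'u, 'p) module_scheme" and V :: "(complex, 'v, 'q) module_scheme" +
  fixes L :: "'u \<Rightarrow> 'u" and M :: "'v \<Rightarrow> 'v" and E :: "'u \<Rightarrow> 'v" and n :: nat
  assumes L: "linear_map U U L" and M: "linear_map V V M" and E: "linear_map U V E"
    and n: "0 < n" and Ln: "\<And>x. x \<in> carrier U \<Longrightarrow> (L ^^ Suc n) x = x" and Mn: "\<And>y. y \<in> carrier V \<Longrightarrow> (M ^^ n) y = y"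
begin

text \<open>The model for the operators on chains: \<open>term i\<close> is the \<open>i\<close>-th face with its sign, \<open>bar\<close> and \<open>full\<close> are
  \<open>b'\<close> and \<open>b\<close>, and \<open>NU\<close>, \<open>NV\<close> are the norms.\<close>

definition "term i x = (M ^^ i) (E ((L ^^ (Suc n - i)) x))"
definition "bar x = (\<Oplus>\<^bsub>V\<^esub> i\<in>{..<n}. term i x)"
definition "full x = bar x \<oplus>\<^bsub>V\<^esub> E (L x)"
definition "NU x = (\<Oplus>\<^bsub>U\<^esub> i\<in>{..<Suc n}. (L ^^ i) x)"
definition "NV y = (\<Oplus>\<^bsub>V\<^esub> i\<in>{..<n}. (M ^^ i) y)"

lemma pow_mem [simp]: "x \<in> carrier U \<Longrightarrow> (L ^^ k) x \<in> carrier U" "y \<in> carrier V \<Longrightarrow> (M ^^ k) y \<in> carrier V"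
  by (induction k) (use linear_mapD(1)[OF L] linear_mapD(1)[OF M] in auto)

lemma mem [simp]: "x \<in> carrier U \<Longrightarrow> L x \<in> carrier U" "y \<in> carrier V \<Longrightarrow> M y \<in> carrier V" "x \<in> carrier U \<Longrightarrow> E x \<in> carrier V"
  using linear_mapD(1)[OF L] linear_mapD(1)[OF M] linear_mapD(1)[OF E] by auto

lemma term_mem [simp]: "x \<in> carrier U \<Longrightarrow> term i x \<in> carrier V"
  by (simp add: term_def)

lemma sums_mem [simp]: "x \<in> carrier U \<Longrightarrow> bar x \<in> carrier V" "x \<in> carrier U \<Longrightarrow> NU x \<in> carrier U" "y \<in> carrier V \<Longrightarrow> NV y \<in> carrier V"
  unfolding bar_def NU_def NV_def by (auto intro!: U.M.finsum_closed V.M.finsum_closed)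

lemma linear_pow: "linear_map V V (\<lambda>y. (M ^^ k) y)" "linear_map U U (\<lambda>y. (L ^^ k) y)"
proof (induction k)
  case (Suc k)
  case 1 show ?case using linear_map_compose[OF Suc(1) M] by simp
  case 2 show ?case using linear_map_compose[OF Suc(2) L] by simp
qed (simp_all add: linear_map_def)

lemma linear_NV: "linear_map V V NV"
proof -
  have "linear_map V V (\<lambda>y. \<Oplus>\<^bsub>V\<^esub> i\<in>{..<k}. (M ^^ i) y)" for k
  proof (induction k)
    case 0
    then show ?case using linear_map_const_zero[OF V.lin_space_axioms V.lin_space_axioms] by simp
  next
    case (Suc k)
    have "linear_map V V (\<lambda>y. (M ^^ k) y \<oplus>\<^bsub>V\<^esub> (\<Oplus>\<^bsub>V\<^esub> i\<in>{..<k}. (M ^^ i) y))"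
      by (rule linear_map_add[OF V.lin_space_axioms V.lin_space_axioms linear_pow(1) Suc])
    moreover have "(\<Oplus>\<^bsub>V\<^esub> i\<in>{..<Suc k}. (M ^^ i) y) = (M ^^ k) y \<oplus>\<^bsub>V\<^esub> (\<Oplus>\<^bsub>V\<^esub> i\<in>{..<k}. (M ^^ i) y)" if "y \<in> carrier V" for y
      unfolding lessThan_Suc by (rule V.M.finsum_insert) (use that in auto)
    ultimately show ?case by (subst linear_map_cong[OF V.lin_space_axioms]) auto
  qed
  then show ?thesis unfolding NV_def[abs_def] .
qed

lemma (in lin_space) finsum_shift:
  assumes "f \<in> UNIV \<rightarrow> carrier X" and closed: "f k = f 0"
  shows "(\<Oplus>i\<in>{..<k}. f (Suc i)) = (\<Oplus>i\<in>{..<k}. f i)"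
proof (cases k)
  case (Suc m)
  have f: "f i \<in> carrier X" for i using assms(1) by auto
  have "(\<Oplus>i\<in>{..m}. f (Suc i)) \<oplus> f 0 = (\<Oplus>i\<in>{..Suc m}. f i)"
    by (rule M.finsum_Suc2[symmetric]) (use f in auto)
  also have "\<dots> = f (Suc m) \<oplus> (\<Oplus>i\<in>{..m}. f i)"
    by (rule M.finsum_Suc) (use f in auto)
  also have "\<dots> = (\<Oplus>i\<in>{..m}. f i) \<oplus> f 0"
    using closed Suc f by (simp add: M.a_comm M.finsum_closed)
  finally show ?thesis using f Suc by (simp add: lessThan_Suc_atMost M.finsum_closed)
qed simp

lemma NU_L: "x \<in> carrier U \<Longrightarrow> NU (L x) = NU x"
  unfolding NU_def using U.finsum_shift[of "\<lambda>i. (L ^^ i) x" "Suc n"] Ln[of x] by (simp add: funpow_swap1)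

lemma NV_M: "y \<in> carrier V \<Longrightarrow> NV (M y) = NV y"
  unfolding NV_def using V.finsum_shift[of "\<lambda>i. (M ^^ i) y" n] Mn[of y] by (simp add: funpow_swap1)

lemma NV_pow: "y \<in> carrier V \<Longrightarrow> NV ((M ^^ k) y) = NV y"
  by (induction k) (simp_all add: NV_M)

lemma L_NU: "x \<in> carrier U \<Longrightarrow> L (NU x) = NU x"
proof -
  assume x: "x \<in> carrier U"
  have "L (NU x) = (\<Oplus>\<^bsub>U\<^esub> i\<in>{..<Suc n}. L ((L ^^ i) x))"
    unfolding NU_def by (rule linear_map_finsum[OF U.lin_space_axioms U.lin_space_axioms L]) (use x in auto)
  also have "\<dots> = NU (L x)" unfolding NU_def by (simp add: funpow_swap1)
  finally show ?thesis using NU_L[OF x] by simp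
qed

lemma term_n: "x \<in> carrier U \<Longrightarrow> term n x = E (L x)"
  unfolding term_def using Mn[of "E (L x)"] by simp

lemma full_eq: "x \<in> carrier U \<Longrightarrow> full x = (\<Oplus>\<^bsub>V\<^esub> i\<in>{..<Suc n}. term i x)"
proof -
  assume x: "x \<in> carrier U"
  have "(\<Oplus>\<^bsub>V\<^esub> i\<in>{..<Suc n}. term i x) = term n x \<oplus>\<^bsub>V\<^esub> bar x"
    unfolding bar_def lessThan_Suc by (rule V.M.finsum_insert) (use x in auto)
  then show ?thesis unfolding full_def term_n[OF x] using x by (simp add: V.M.a_comm)
qed

lemma full_L:
  assumes x: "x \<in> carrier U"
  shows "full (L x) = E (L x) \<oplus>\<^bsub>V\<^esub> M (bar x)"
proof -
  obtain m where m: "n = Suc m" using n by (cases n) auto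
  have sm: "{..<Suc n} = {..Suc m}" by (simp add: m lessThan_Suc_atMost)
  have mn: "{..m} = {..<n}" by (simp add: m lessThan_Suc_atMost)
  have 0: "term 0 (L x) = E (L x)" unfolding term_def using Ln[of "L x"] x by simp
  have Suc: "term (Suc i) (L x) = M (term i x)" if "i < n" for i
  proof -
    have "Suc n - i = Suc (Suc n - Suc i)" using that by simp
    then show ?thesis unfolding term_def by (simp only: funpow.simps o_apply funpow_swap1)
  qed
  have "full (L x) = (\<Oplus>\<^bsub>V\<^esub> i\<in>{..Suc m}. term i (L x))"
    using full_eq[OF mem(1)[OF x]] unfolding sm .
  also have "\<dots> = (\<Oplus>\<^bsub>V\<^esub> i\<in>{..m}. term (Suc i) (L x)) \<oplus>\<^bsub>V\<^esub> term 0 (L x)"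
    by (rule V.M.finsum_Suc2) (use x in auto)
  also have "(\<Oplus>\<^bsub>V\<^esub> i\<in>{..m}. term (Suc i) (L x)) = (\<Oplus>\<^bsub>V\<^esub> i\<in>{..<n}. M (term i x))"
    by (rule V.M.finsum_cong'[OF mn]) (use x Suc in auto)
  also have "\<dots> = M (bar x)"
    unfolding bar_def by (rule linear_map_finsum[OF V.lin_space_axioms V.lin_space_axioms M, symmetric]) (use x in auto)
  finally show ?thesis using x by (simp add: 0 V.M.a_comm)
qed

text \<open>Both sides of \<open>b (1 - \<lambda>) = (1 - \<lambda>) b'\<close> are telescoping: rotating the argument shifts the summands of
  \<open>b'\<close> by one place.\<close>

theorem full_minus:
  assumes x: "x \<in> carrier U" and lin: "linear_map U V full"
  shows "full (x \<ominus>\<^bsub>U\<^esub> L x) = bar x \<ominus>\<^bsub>V\<^esub> M (bar x)"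
proof -
  have "full (x \<ominus>\<^bsub>U\<^esub> L x) = full x \<ominus>\<^bsub>V\<^esub> full (L x)"
    by (rule linear_map_diff[OF U.lin_space_axioms V.lin_space_axioms lin]) (use x in auto)
  also have "\<dots> = (bar x \<oplus>\<^bsub>V\<^esub> E (L x)) \<ominus>\<^bsub>V\<^esub> (M (bar x) \<oplus>\<^bsub>V\<^esub> E (L x))"
    unfolding full_L[OF x] using x by (simp add: full_def V.M.a_comm)
  also have "\<dots> = bar x \<ominus>\<^bsub>V\<^esub> M (bar x)"
    using x by (simp add: V.add_diff_add)
  finally show ?thesis .
qed

text \<open>Summing over all rotations of the argument makes \<open>b' N\<close> and \<open>N b\<close> the same double sum of conjugates of
  \<open>E\<close>, because a norm is invariant under rotation of its argument.\<close>

theorem bar_norm: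
  assumes x: "x \<in> carrier U"
  shows "bar (NU x) = NV (full x)"
proof -
  have LN: "(L ^^ k) (NU x) = NU x" for k using x by (induction k) (simp_all add: L_NU)
  have "bar (NU x) = NV (E (NU x))" unfolding bar_def NV_def term_def LN ..
  also have "E (NU x) = (\<Oplus>\<^bsub>V\<^esub> i\<in>{..<Suc n}. E ((L ^^ (Suc n - i)) x))"
  proof -
    have bij: "bij_betw (\<lambda>i. n - i) {..<Suc n} {..<Suc n}"
      by (rule bij_betwI[of _ _ _ "\<lambda>i. n - i"]) auto
    have "E (NU x) = E (NU (L x))" using NU_L[OF x] by simp
    also have "\<dots> = (\<Oplus>\<^bsub>V\<^esub> i\<in>{..<Suc n}. E ((L ^^ i) (L x)))"
      unfolding NU_def by (rule linear_map_finsum[OF U.lin_space_axioms V.lin_space_axioms E]) (use x in auto)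
    also have "\<dots> = (\<Oplus>\<^bsub>V\<^esub> i\<in>(\<lambda>i. n - i) ` {..<Suc n}. E ((L ^^ i) (L x)))"
      using bij by (simp only: bij_betw_imp_surj_on)
    also have "\<dots> = (\<Oplus>\<^bsub>V\<^esub> i\<in>{..<Suc n}. E ((L ^^ (n - i)) (L x)))"
      by (rule V.M.finsum_reindex) (use x bij in \<open>auto simp: bij_betw_def\<close>)
    also have "\<dots> = (\<Oplus>\<^bsub>V\<^esub> i\<in>{..<Suc n}. E ((L ^^ (Suc n - i)) x))"
      by (rule V.M.finsum_cong') (use x in \<open>auto simp: Suc_diff_le funpow_swap1\<close>)
    finally show ?thesis .
  qed
  also have "NV \<dots> = (\<Oplus>\<^bsub>V\<^esub> i\<in>{..<Suc n}. NV (E ((L ^^ (Suc n - i)) x)))"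
    by (rule linear_map_finsum[OF V.lin_space_axioms V.lin_space_axioms linear_NV]) (use x in auto)
  also have "\<dots> = (\<Oplus>\<^bsub>V\<^esub> i\<in>{..<Suc n}. NV (term i x))"
    unfolding term_def using x by (simp add: NV_pow)
  also have "\<dots> = NV (full x)"
    unfolding full_eq[OF x] by (rule linear_map_finsum[OF V.lin_space_axioms V.lin_space_axioms linear_NV, symmetric]) (use x in auto)
  finally show ?thesis .
qed

end

lemma continuous_linear_finsum:
  assumes X: "locally_convex X" and Y: "locally_convex Y" and "finite I"
    and "\<And>i. i \<in> I \<Longrightarrow> continuous_linear X Y (h i)"
  shows "continuous_linear X Y (\<lambda>x. \<Oplus>\<^bsub>Y\<^esub> i\<in>I. h i x)"
proof -
  interpret X: locally_convex X by fact
  interpret Y: locally_convex Y by fact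
  show ?thesis using assms(3,4)
  proof (induction I rule: finite_induct)
    case empty
    then show ?case using continuous_linear_const_zero[OF X Y] by simp
  next
    case (insert i I)
    have m: "h j x \<in> carrier Y" if "j \<in> insert i I" "x \<in> carrier X" for j x
      using insert.prems[OF that(1)] that(2) linear_mapD(1)[of X Y "h j" x] by (simp add: continuous_linear_def)
    show ?case
    proof (rule continuous_linear_cong[OF X])
      show "continuous_linear X Y (\<lambda>x. h i x \<oplus>\<^bsub>Y\<^esub> (\<Oplus>\<^bsub>Y\<^esub> i\<in>I. h i x))"
        using insert by (intro continuous_linear_add[OF X Y]) auto
      show "h i x \<oplus>\<^bsub>Y\<^esub> (\<Oplus>\<^bsub>Y\<^esub> i\<in>I. h i x) = (\<Oplus>\<^bsub>Y\<^esub> i\<in>insert i I. h i x)" if "x \<in> carrier X" for x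
        by (rule Y.M.finsum_insert[symmetric]) (use insert.hyps m that in auto)
    qed
  qed
qed

context tensor_algebra
begin

lemma cl_lin: "continuous_linear (T m) (T n) h \<Longrightarrow> linear_map (T m) (T n) h"
  by (simp add: continuous_linear_def)

lemma lam_pow_linear: "0 < n \<Longrightarrow> continuous_linear (T n) (T n) (lam n ^^ k)"
proof (induction k)
  case 0
  then show ?case by (simp add: continuous_linear_def linear_map_def)
next
  case (Suc k)
  then show ?case using continuous_linear_compose[OF Suc.IH lam_linear] by (simp add: o_def)
qed

lemma words_rot_pow: "0 < n \<Longrightarrow> xs \<in> words A n \<Longrightarrow> (rot ^^ k) xs \<in> words A n"
  by (induction k) (simp_all add: words_rot)

lemma lam_pow_tens:
  assumes n: "0 < n" and xs: "xs \<in> words A n"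
  shows "(lam n ^^ k) (tens A xs) = ((- 1) ^ (n - 1)) ^ k \<odot>\<^bsub>T n\<^esub> tens A ((rot ^^ k) xs)"
proof -
  interpret T: lin_space "T n" by (rule T_lin)
  show ?thesis
  proof (induction k)
    case 0
    then show ?case using tens_mem[OF xs] by simp
  next
    case (Suc k)
    note w = words_rot_pow[OF n xs, of k]
    show ?case using Suc linear_mapD(3)[OF cl_lin[OF lam_linear[OF n]] tens_mem[OF w]]
        lam_tens[OF n w] tens_mem[OF words_rot[OF w n]] by (simp add: T.smult_smult mult.commute)
  qed
qed

text \<open>A full rotation of \<open>n\<close> letters restores the word, and its sign is \<open>(- 1) ^ ((n - 1) * n) = 1\<close>.\<close>

lemma lam_power:
  assumes n: "0 < n" and x: "x \<in> carrier (T n)"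
  shows "(lam n ^^ n) x = x"
proof (rule T_ext[OF lam_pow_linear[OF n] _ _ x])
  interpret T: lin_space "T n" by (rule T_lin)
  show "continuous_linear (T n) (T n) (\<lambda>x. x)" by (simp add: continuous_linear_def linear_map_def)
  fix xs assume xs: "xs \<in> words A n"
  have "(rot ^^ n) xs = xs" using rot_power[of xs] xs n by (auto simp: words_def)
  moreover have "((- 1) ^ (n - 1)) ^ n = (1 :: complex)" using n by (cases "even n") (auto simp flip: power_mult)
  ultimately show "(lam n ^^ n) (tens A xs) = tens A xs"
    using lam_pow_tens[OF n xs, of n] tens_mem[OF xs] by simp
qed

lemma cyclic_face_T:
  assumes n: "0 < n"
  shows "cyclic_face (T (Suc n)) (T n) (lam (Suc n)) (lam n) (d0 n) n"
  by (rule cyclic_face.intro[OF T_lin T_lin cyclic_face_axioms.intro])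
    (use n lam_power in \<open>auto intro!: cl_lin lam_linear d0_linear simp del: funpow.simps\<close>)

lemma face_conjugate:
  assumes i: "i < n" and xs: "xs \<in> words A (Suc n)"
  shows "(lam n ^^ i) (d0 n ((lam (Suc n) ^^ (Suc n - i)) (tens A xs))) = (- 1) ^ i \<odot>\<^bsub>T n\<^esub> tens A (face A i xs)"
  using assms
proof (induction i arbitrary: xs)
  case 0
  interpret T: lin_space "T n" by (rule T_lin)
  show ?case using lam_power[OF zero_less_Suc tens_mem[OF 0(2)]] d0_tens[OF 0] tens_mem[OF words_face[OF 0(2,1)]]
    by (simp del: funpow.simps)
next
  case (Suc i)
  interpret T: lin_space "T n" by (rule T_lin)
  interpret T': lin_space "T (Suc n)" by (rule T_lin)
  have n: "0 < n" and i: "i < n" using Suc.prems by auto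
  let ?ys = "rotate1 xs"
  have ys: "?ys \<in> words A (Suc n)" using Suc.prems by (simp add: words_rotate1)
  have rys: "rot ?ys = xs" using Suc.prems by (intro rot_rotate1) (auto simp: words_def)
  note ty = tens_mem[OF ys] and tx = tens_mem[OF Suc.prems(2)]
  let ?s = "(- 1 :: complex) ^ n"
  have ss: "?s * ?s = 1" by (simp flip: power_add)
  have "lam (Suc n) (tens A ?ys) = ?s \<odot>\<^bsub>T (Suc n)\<^esub> tens A xs"
    using lam_tens[OF zero_less_Suc ys] by (simp add: rys)
  then have 1: "tens A xs = ?s \<odot>\<^bsub>T (Suc n)\<^esub> lam (Suc n) (tens A ?ys)"
    using tx by (simp add: T'.smult_smult ss)
  have lm: "lam (Suc n) (tens A ?ys) \<in> carrier (T (Suc n))"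
    by (rule linear_mapD(1)[OF cl_lin[OF lam_linear] ty]) simp
  have k: "Suc n - i = Suc (n - i)" "Suc n - Suc i = n - i" using i by auto
  note l1 = cl_lin[OF lam_pow_linear[OF zero_less_Suc]] and l2 = cl_lin[OF d0_linear[OF n]] and l3 = cl_lin[OF lam_pow_linear[OF n]]
  have "(lam (Suc n) ^^ (n - i)) (tens A xs) = ?s \<odot>\<^bsub>T (Suc n)\<^esub> (lam (Suc n) ^^ (Suc n - i)) (tens A ?ys)"
    unfolding k by (subst 1, subst linear_mapD(3)[OF l1 lm]) (simp only: funpow_Suc_right o_apply)
  moreover have m1: "(lam (Suc n) ^^ (Suc n - i)) (tens A ?ys) \<in> carrier (T (Suc n))" by (rule linear_mapD(1)[OF l1 ty])
  ultimately have "(lam n ^^ i) (d0 n ((lam (Suc n) ^^ (n - i)) (tens A xs))) =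
      ?s \<odot>\<^bsub>T n\<^esub> (lam n ^^ i) (d0 n ((lam (Suc n) ^^ (Suc n - i)) (tens A ?ys)))"
    using linear_mapD(3)[OF l2 m1, where c = ?s] linear_mapD(3)[OF l3 linear_mapD(1)[OF l2 m1], where c = ?s] by simp
  also have "\<dots> = ?s \<odot>\<^bsub>T n\<^esub> ((- 1) ^ i \<odot>\<^bsub>T n\<^esub> tens A (face A i ?ys))"
    by (simp only: Suc.IH[OF i ys])
  finally have 2: "(lam n ^^ i) (d0 n ((lam (Suc n) ^^ (n - i)) (tens A xs))) = (?s * (- 1) ^ i) \<odot>\<^bsub>T n\<^esub> tens A (face A i ?ys)"
    using tens_mem[OF words_face[OF ys i]] by (simp add: T.smult_smult)
  have "lam n (tens A (face A i ?ys)) = (- 1) ^ (n - 1) \<odot>\<^bsub>T n\<^esub> tens A (face A (Suc i) xs)"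
    using lam_tens[OF n words_face[OF ys i]] rot_face[OF ys Suc.prems(1)] by (simp add: rys)
  then have "lam n ((lam n ^^ i) (d0 n ((lam (Suc n) ^^ (n - i)) (tens A xs)))) =
      (?s * (- 1) ^ i * (- 1) ^ (n - 1)) \<odot>\<^bsub>T n\<^esub> tens A (face A (Suc i) xs)"
    unfolding 2 using linear_mapD(3)[OF cl_lin[OF lam_linear[OF n]] tens_mem[OF words_face[OF ys i]]]
      tens_mem[OF words_face[OF Suc.prems(2,1)]] by (simp add: T.smult_smult)
  moreover have "?s * (- 1) ^ i * (- 1) ^ (n - 1) = (- 1) ^ Suc i"
  proof -
    obtain m where m: "n = Suc m" using n by (cases n) auto
    have "(- 1 :: complex) ^ m * (- 1) ^ m = 1" by (simp flip: power_add)
    then show ?thesis by (simp add: m)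
  qed
  ultimately show ?case unfolding k by (simp only: funpow.simps o_apply)
qed

text \<open>The two differentials are the sums of the conjugates of the zeroth face operator; hence they are
  well-defined operators, and the identities between them are instances of those for a cyclic face.\<close>

lemma differentials:
  assumes n: "0 < n"
  shows bar_linear: "continuous_linear (T (Suc n)) (T n) (bar_diff A n)"
    and bar_diff_eq: "x \<in> carrier (T (Suc n)) \<Longrightarrow> bar_diff A n x = cyclic_face.bar (T n) (lam (Suc n)) (lam n) (d0 n) n x"
    and naive_linear: "continuous_linear (T (Suc n)) (T n) (naive_diff A n)"
    and naive_diff_eq: "x \<in> carrier (T (Suc n)) \<Longrightarrow> naive_diff A n x = bar_diff A n x \<oplus>\<^bsub>T n\<^esub> d0 n (lam (Suc n) x)"
    and naive_tens: "xs \<in> words A (Suc n) \<Longrightarrow>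
      naive_diff A n (tens A xs) = bar_value A n xs \<oplus>\<^bsub>T n\<^esub> (- 1) ^ n \<odot>\<^bsub>T n\<^esub> tens A (face A 0 (rot xs))"
proof -
  interpret T: lin_space "T n" by (rule T_lin)
  interpret F: cyclic_face "T (Suc n)" "T n" "lam (Suc n)" "lam n" "d0 n" n by (rule cyclic_face_T[OF n])
  have c: "chains A (n - Suc 0) = T n" using n by (simp add: chains_def)
  have "continuous_linear (T (Suc n)) (T n) (\<lambda>x. (lam n ^^ i) (d0 n ((lam (Suc n) ^^ k) x)))" for i k
    using continuous_linear_compose[OF continuous_linear_compose[OF lam_pow_linear[OF zero_less_Suc] d0_linear[OF n]] lam_pow_linear[OF n]] .
  then have lin: "continuous_linear (T (Suc n)) (T n) F.bar"
    unfolding F.bar_def[abs_def] F.term_def[abs_def] by (intro continuous_linear_finsum[OF T_lc T_lc]) auto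
  have val: "F.bar (tens A xs) = bar_value A n xs" if xs: "xs \<in> words A (Suc n)" for xs
    unfolding bar_value_def F.bar_def F.term_def using c
    by (simp, intro T.M.finsum_cong') (use face_conjugate[OF _ xs] tens_mem[OF words_face[OF xs]] in auto)
  have b: "bar_diff A n = tensor_lift (replicate (Suc n) A) (T n) (bar_value A n)" by (simp add: bar_diff_def c)
  have "\<forall>xs\<in>words A (Suc n). F.bar (tens A xs) = bar_value A n xs" by (rule ballI, rule val)
  note bl = T_lift_eq[OF lin this, folded b]
  show "continuous_linear (T (Suc n)) (T n) (bar_diff A n)" by (rule bl(1))
  show be: "bar_diff A n x = F.bar x" if "x \<in> carrier (T (Suc n))" for x by (rule bl(2)[OF that])
  let ?g = "\<lambda>x. bar_diff A n x \<oplus>\<^bsub>T n\<^esub> d0 n (lam (Suc n) x)"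
  let ?f = "\<lambda>xs. bar_value A n xs \<oplus>\<^bsub>T n\<^esub> (- 1) ^ n \<odot>\<^bsub>T n\<^esub> tens A (face A 0 (rot xs))"
  let ?v = "\<lambda>as. if n = 0 then \<zero>\<^bsub>chains A (n - 1)\<^esub> else
        bar_value A n as \<oplus>\<^bsub>chains A (n - 1)\<^esub>
        ((-1) ^ n \<odot>\<^bsub>chains A (n - 1)\<^esub> tens A ((last as \<otimes>\<^bsub>A\<^esub> hd as) # butlast (tl as)))"
  have gl: "continuous_linear (T (Suc n)) (T n) ?g"
    by (rule continuous_linear_add[OF T_lc T_lc bl(1) continuous_linear_compose[OF lam_linear[OF zero_less_Suc] d0_linear[OF n]]])
  have gf: "?g (tens A xs) = ?f xs" if xs: "xs \<in> words A (Suc n)" for xs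
  proof -
    note w = words_rot[OF xs zero_less_Suc]
    have "d0 n (lam (Suc n) (tens A xs)) = (- 1) ^ n \<odot>\<^bsub>T n\<^esub> tens A (face A 0 (rot xs))"
      using lam_tens[OF zero_less_Suc xs] linear_mapD(3)[OF cl_lin[OF d0_linear[OF n]] tens_mem[OF w]] d0_tens[OF n w] by simp
    then show ?thesis using be[OF tens_mem[OF xs]] val[OF xs] by simp
  qed
  have gv: "?g (tens A xs) = ?v xs" if xs: "xs \<in> words A (Suc n)" for xs
  proof -
    obtain a zs where a: "xs = a # zs" using xs by (cases xs) (auto simp: words_def)
    obtain ys z where z: "zs = ys @ [z]" using xs n a by (cases zs rule: rev_cases) (auto simp: words_def)
    have "face A 0 (rot xs) = (last xs \<otimes>\<^bsub>A\<^esub> hd xs) # butlast (tl xs)" by (simp add: a z face_def rot_def)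
    then show ?thesis using gf[OF xs] n by (simp add: c)
  qed
  have nv: "naive_diff A n = tensor_lift (replicate (Suc n) A) (T n) ?v" by (simp add: naive_diff_def c)
  have "\<forall>xs\<in>words A (Suc n). ?g (tens A xs) = ?v xs" by (rule ballI, rule gv)
  note nl = T_lift_eq[OF gl this, folded nv]
  show "continuous_linear (T (Suc n)) (T n) (naive_diff A n)" by (rule nl(1))
  show "naive_diff A n x = ?g x" if "x \<in> carrier (T (Suc n))" for x by (rule nl(2)[OF that])
  show "naive_diff A n (tens A xs) = ?f xs" if "xs \<in> words A (Suc n)"
    using nl(2)[OF tens_mem[OF that]] gf[OF that] by simp
qed

lemma norm_linear: "0 < n \<Longrightarrow> continuous_linear (T n) (T n) (norm_op A n)"
  unfolding norm_op_def[abs_def] by (intro continuous_linear_finsum[OF T_lc T_lc] lam_pow_linear) auto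

lemma naive_minus_lam:
  assumes n: "0 < n" and x: "x \<in> carrier (T (Suc n))"
  shows "naive_diff A n (x \<ominus>\<^bsub>T (Suc n)\<^esub> lam (Suc n) x) = bar_diff A n x \<ominus>\<^bsub>T n\<^esub> lam n (bar_diff A n x)"
proof -
  interpret F: cyclic_face "T (Suc n)" "T n" "lam (Suc n)" "lam n" "d0 n" n by (rule cyclic_face_T[OF n])
  have full: "naive_diff A n y = F.full y" if "y \<in> carrier (T (Suc n))" for y
    using naive_diff_eq[OF n that] bar_diff_eq[OF n that] by (simp add: F.full_def)
  have "linear_map (T (Suc n)) (T n) F.full"
    using linear_map_cong[OF T_lin full, where Y = "T n"] cl_lin[OF naive_linear[OF n]] by simp
  from F.full_minus[OF x this] show ?thesis using full[of "x \<ominus>\<^bsub>T (Suc n)\<^esub> lam (Suc n) x"] bar_diff_eq[OF n x] x by simp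
qed

lemma bar_norm:
  assumes n: "0 < n" and x: "x \<in> carrier (T (Suc n))"
  shows "bar_diff A n (norm_op A (Suc n) x) = norm_op A n (naive_diff A n x)"
proof -
  interpret F: cyclic_face "T (Suc n)" "T n" "lam (Suc n)" "lam n" "d0 n" n by (rule cyclic_face_T[OF n])
  have N: "norm_op A (Suc n) x = F.NU x" "norm_op A n y = F.NV y" for y
    by (simp_all only: norm_op_def F.NU_def F.NV_def)
  have "naive_diff A n x = F.full x"
    using naive_diff_eq[OF n x] bar_diff_eq[OF n x] by (simp add: F.full_def)
  then show ?thesis using F.bar_norm[OF x] bar_diff_eq[OF n F.sums_mem(2)[OF x]] by (simp add: N)
qed

lemma
  assumes n: "0 < n" and x: "x \<in> carrier (T n)"
  shows norm_minus_lam: "norm_op A n (x \<ominus>\<^bsub>T n\<^esub> lam n x) = \<zero>\<^bsub>T n\<^esub>"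
    and minus_lam_norm: "norm_op A n x \<ominus>\<^bsub>T n\<^esub> lam n (norm_op A n x) = \<zero>\<^bsub>T n\<^esub>"
proof -
  interpret F: cyclic_face "T (Suc n)" "T n" "lam (Suc n)" "lam n" "d0 n" n by (rule cyclic_face_T[OF n])
  have N: "norm_op A n y = F.NV y" for y by (simp only: norm_op_def F.NV_def)
  show "norm_op A n (x \<ominus>\<^bsub>T n\<^esub> lam n x) = \<zero>\<^bsub>T n\<^esub>"
    using linear_map_diff[OF T_lin T_lin cl_lin[OF norm_linear[OF n]] x, of "lam n x"] F.NV_M[OF x] x by (simp add: N)
  have "lam n (norm_op A n x) = (\<Oplus>\<^bsub>T n\<^esub> i\<in>{..<n}. lam n ((lam n ^^ i) x))"
    unfolding norm_op_def
    by (rule linear_map_finsum[OF T_lin T_lin cl_lin[OF lam_linear[OF n]]]) (use x in auto)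
  also have "\<dots> = norm_op A n (lam n x)" unfolding norm_op_def by (simp add: funpow_swap1)
  finally show "norm_op A n x \<ominus>\<^bsub>T n\<^esub> lam n (norm_op A n x) = \<zero>\<^bsub>T n\<^esub>"
    using F.NV_M[OF x] x by (simp add: N)
qed

end

section \<open>Homology of complexes\<close>

lemma a_kernel_mem: "x \<in> a_kernel X Y g \<longleftrightarrow> x \<in> carrier X \<and> g x = \<zero>\<^bsub>Y\<^esub>"
  by (simp add: a_kernel_def')

lemma homology_sel:
  assumes "lin_space W" "lin_space X" "linear_map W X f"
  shows "carrier (homology_at W f X g Y) = (\<lambda>x. f ` carrier W +>\<^bsub>X\<^esub> x) ` a_kernel X Y g"
    and "zero (homology_at W f X g Y) = f ` carrier W"
    and "x \<in> carrier X \<Longrightarrow> y \<in> carrier X \<Longrightarrow>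
      (f ` carrier W +>\<^bsub>X\<^esub> x) \<oplus>\<^bsub>homology_at W f X g Y\<^esub> (f ` carrier W +>\<^bsub>X\<^esub> y) = f ` carrier W +>\<^bsub>X\<^esub> (x \<oplus>\<^bsub>X\<^esub> y)"
    and "x \<in> carrier X \<Longrightarrow>
      c \<odot>\<^bsub>homology_at W f X g Y\<^esub> (f ` carrier W +>\<^bsub>X\<^esub> x) = f ` carrier W +>\<^bsub>X\<^esub> (c \<odot>\<^bsub>X\<^esub> x)"
  unfolding homology_at_def lin_space.quotient_sel[OF assms(2)]
  by (simp_all add: lin_space.coset_add[OF assms(2) linear_image_subspace[OF assms]]
      lin_space.coset_smult[OF assms(2) linear_image_subspace[OF assms]])

lemma zero_homology_iff:
  assumes "lin_space W" "lin_space X" "linear_map W X f" and g: "g \<zero>\<^bsub>X\<^esub> = \<zero>\<^bsub>Y\<^esub>"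
  shows "zero_space (homology_at W f X g Y) \<longleftrightarrow> (\<forall>x\<in>carrier X. g x = \<zero>\<^bsub>Y\<^esub> \<longrightarrow> x \<in> f ` carrier W)"
proof -
  interpret X: lin_space X by fact
  note I = linear_image_subspace[OF assms(1-3)]
  have in_iff: "f ` carrier W +>\<^bsub>X\<^esub> x = f ` carrier W \<longleftrightarrow> x \<in> f ` carrier W" if "x \<in> carrier X" for x
    using X.coset_eq_iff[OF I that X.M.zero_closed] X.coset_zero[OF I] that by simp
  have 0: "\<zero>\<^bsub>X\<^esub> \<in> a_kernel X Y g" using g by (simp add: a_kernel_mem)
  show ?thesis unfolding zero_space_def homology_sel[OF assms(1-3)]
  proof
    assume *: "(\<lambda>x. f ` carrier W +>\<^bsub>X\<^esub> x) ` a_kernel X Y g = {f ` carrier W}"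
    show "\<forall>x\<in>carrier X. g x = \<zero>\<^bsub>Y\<^esub> \<longrightarrow> x \<in> f ` carrier W"
    proof (intro ballI impI)
      fix x assume x: "x \<in> carrier X" "g x = \<zero>\<^bsub>Y\<^esub>"
      then have "f ` carrier W +>\<^bsub>X\<^esub> x \<in> {f ` carrier W}" unfolding *[symmetric] by (intro imageI) (simp add: a_kernel_mem)
      then show "x \<in> f ` carrier W" using in_iff[OF x(1)] by simp
    qed
  next
    assume R: "\<forall>x\<in>carrier X. g x = \<zero>\<^bsub>Y\<^esub> \<longrightarrow> x \<in> f ` carrier W"
    have "f ` carrier W +>\<^bsub>X\<^esub> x = f ` carrier W" if "x \<in> a_kernel X Y g" for x
      using that R in_iff[of x] by (simp add: a_kernel_mem)
    then show "(\<lambda>x. f ` carrier W +>\<^bsub>X\<^esub> x) ` a_kernel X Y g = {f ` carrier W}" using 0 by auto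
  qed
qed

text \<open>Homology is computed by a linear map on the cycles that is onto and identifies exactly the
  homologous cycles.\<close>

lemma homology_iso:
  assumes "lin_space W" and X: "lin_space X" and "linear_map W X f" and Y: "lin_space Y" and g: "linear_map X Y g"
    and onto: "\<phi> ` a_kernel X Y g = carrier Z"
    and add: "\<And>x y. x \<in> a_kernel X Y g \<Longrightarrow> y \<in> a_kernel X Y g \<Longrightarrow> \<phi> (x \<oplus>\<^bsub>X\<^esub> y) = \<phi> x \<oplus>\<^bsub>Z\<^esub> \<phi> y"
    and smult: "\<And>c x. x \<in> a_kernel X Y g \<Longrightarrow> \<phi> (c \<odot>\<^bsub>X\<^esub> x) = c \<odot>\<^bsub>Z\<^esub> \<phi> x"
    and eq: "\<And>x y. x \<in> a_kernel X Y g \<Longrightarrow> y \<in> a_kernel X Y g \<Longrightarrow> \<phi> x = \<phi> y \<longleftrightarrow> x \<ominus>\<^bsub>X\<^esub> y \<in> f ` carrier W"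
  shows "homology_at W f X g Y \<cong>\<^sub>l\<^sub>i\<^sub>n Z"
proof -
  interpret X: lin_space X by fact
  interpret Y: lin_space Y by fact
  note I = linear_image_subspace[OF assms(1-3)]
  let ?K = "a_kernel X Y g" and ?c = "\<lambda>x. f ` carrier W +>\<^bsub>X\<^esub> x" and ?H = "homology_at W f X g Y"
  note sel = homology_sel[OF assms(1-3), where g = g and Y = Y]
  have KX: "x \<in> carrier X" if "x \<in> ?K" for x using that by (simp add: a_kernel_mem)
  have Kadd: "x \<oplus>\<^bsub>X\<^esub> y \<in> ?K" if "x \<in> ?K" "y \<in> ?K" for x y
    using that linear_mapD(2)[OF g] by (simp add: a_kernel_mem)
  have Ksm: "c \<odot>\<^bsub>X\<^esub> x \<in> ?K" if "x \<in> ?K" for c x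
    using that linear_mapD(3)[OF g] by (simp add: a_kernel_mem)
  have ceq: "?c x = ?c y \<longleftrightarrow> \<phi> x = \<phi> y" if "x \<in> ?K" "y \<in> ?K" for x y
    using X.coset_eq_iff[OF I KX[OF that(1)] KX[OF that(2)]] eq[OF that] by simp
  define h where "h C = \<phi> (SOME x. x \<in> ?K \<and> C = ?c x)" for C
  have h: "h (?c x) = \<phi> x" if x: "x \<in> ?K" for x
  proof -
    define s where "s = (SOME y. y \<in> ?K \<and> ?c x = ?c y)"
    have "s \<in> ?K \<and> ?c x = ?c s" unfolding s_def by (rule someI[of _ x]) (use x in simp)
    then have "\<phi> x = \<phi> s" using ceq[OF x, of s] by blast
    then show ?thesis unfolding h_def s_def by simp
  qed
  have "linear_map ?H Z h"
  proof (rule linear_mapI)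
    fix C D c assume "C \<in> carrier ?H"
    then obtain x where x: "x \<in> ?K" "C = ?c x" unfolding sel(1) by auto
    show "h C \<in> carrier Z" unfolding x(2) h[OF x(1)] using x(1) onto by blast
    show "h (c \<odot>\<^bsub>?H\<^esub> C) = c \<odot>\<^bsub>Z\<^esub> h C"
      unfolding x(2) sel(4)[OF KX[OF x(1)]] h[OF x(1)] h[OF Ksm[OF x(1)]] by (rule smult[OF x(1)])
    assume "D \<in> carrier ?H"
    then obtain y where y: "y \<in> ?K" "D = ?c y" unfolding sel(1) by auto
    show "h (C \<oplus>\<^bsub>?H\<^esub> D) = h C \<oplus>\<^bsub>Z\<^esub> h D"
      unfolding x(2) y(2) sel(3)[OF KX[OF x(1)] KX[OF y(1)]] h[OF x(1)] h[OF y(1)] h[OF Kadd[OF x(1) y(1)]] by (rule add[OF x(1) y(1)])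
  qed
  moreover have "bij_betw h (carrier ?H) (carrier Z)"
    unfolding bij_betw_def
  proof
    show "inj_on h (carrier ?H)"
    proof (rule inj_onI)
      fix C D assume "C \<in> carrier ?H" "D \<in> carrier ?H" and e: "h C = h D"
      then obtain x y where "x \<in> ?K" "C = ?c x" "y \<in> ?K" "D = ?c y" unfolding sel(1) by auto
      then show "C = D" using e h[of x] h[of y] ceq[of x y] by simp
    qed
    have "h ` carrier ?H = \<phi> ` ?K" unfolding sel(1) image_image by (rule image_cong[OF refl h])
    then show "h ` carrier ?H = carrier Z" using onto by simp
  qed
  ultimately show ?thesis unfolding linear_iso_def by blast
qed

text \<open>The same from the other side: a linear family of cycles that represents each class once.\<close>

lemma homology_iso_section:
  assumes W: "lin_space W" and X: "lin_space X" and f: "linear_map W X f"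
    and Z: "lin_space Z" and \<psi>: "linear_map Z X \<psi>"
    and cyc: "\<And>z. z \<in> carrier Z \<Longrightarrow> g (\<psi> z) = \<zero>\<^bsub>Y\<^esub>"
    and onto: "\<And>x. x \<in> carrier X \<Longrightarrow> g x = \<zero>\<^bsub>Y\<^esub> \<Longrightarrow> \<exists>z\<in>carrier Z. x \<ominus>\<^bsub>X\<^esub> \<psi> z \<in> f ` carrier W"
    and inj: "\<And>z. z \<in> carrier Z \<Longrightarrow> \<psi> z \<in> f ` carrier W \<Longrightarrow> z = \<zero>\<^bsub>Z\<^esub>"
  shows "homology_at W f X g Y \<cong>\<^sub>l\<^sub>i\<^sub>n Z"
proof -
  interpret X: lin_space X by fact
  interpret Z: lin_space Z by fact
  let ?H = "homology_at W f X g Y" and ?h = "\<lambda>z. f ` carrier W +>\<^bsub>X\<^esub> \<psi> z"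
  note I = linear_image_subspace[OF W X f] and m = linear_mapD(1)[OF \<psi>]
  note sel = homology_sel[OF W X f, where g = g and Y = Y]
  have hm: "?h z \<in> carrier ?H" if "z \<in> carrier Z" for z
    unfolding sel(1) using m[OF that] cyc[OF that] by (intro imageI) (simp add: a_kernel_mem)
  have hi: "inj_on ?h (carrier Z)"
  proof (rule inj_onI)
    fix y z assume yz: "y \<in> carrier Z" "z \<in> carrier Z" and "?h y = ?h z"
    then have "\<psi> (y \<ominus>\<^bsub>Z\<^esub> z) \<in> f ` carrier W"
      unfolding X.coset_eq_iff[OF I m[OF yz(1)] m[OF yz(2)]] linear_map_diff[OF Z X \<psi> yz] by simp
    then show "y = z" using inj[OF Z.diff_mem[OF yz]] Z.diff_eq_zero_iff[OF yz] by simp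
  qed
  have ho: "?h ` carrier Z = carrier ?H"
  proof
    show "?h ` carrier Z \<subseteq> carrier ?H" using hm by (rule image_subsetI)
    show "carrier ?H \<subseteq> ?h ` carrier Z"
      unfolding sel(1)
    proof (rule image_subsetI)
      fix x assume "x \<in> a_kernel X Y g"
      then have x: "x \<in> carrier X" "g x = \<zero>\<^bsub>Y\<^esub>" by (simp_all add: a_kernel_mem)
      from onto[OF x] obtain z where z: "z \<in> carrier Z" "x \<ominus>\<^bsub>X\<^esub> \<psi> z \<in> f ` carrier W" by (rule bexE)
      then show "f ` carrier W +>\<^bsub>X\<^esub> x \<in> ?h ` carrier Z"
        using X.coset_eq_iff[OF I x(1) m[OF z(1)]] by (intro image_eqI[of _ _ z]) simp_all
    qed
  qed
  let ?k = "inv_into (carrier Z) ?h"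
  have k: "?k C \<in> carrier Z" "?h (?k C) = C" if "C \<in> carrier ?H" for C
    using that inv_into_into[of C ?h "carrier Z"] f_inv_into_f[of C ?h "carrier Z"] unfolding ho by blast+
  have "linear_map ?H Z ?k"
  proof (rule linear_mapI)
    fix C D c assume C: "C \<in> carrier ?H"
    show "?k C \<in> carrier Z" by (rule k(1)[OF C])
    note kC = k(1)[OF C]
    have "?h (c \<odot>\<^bsub>Z\<^esub> ?k C) = c \<odot>\<^bsub>?H\<^esub> ?h (?k C)" unfolding sel(4)[OF m[OF kC]] linear_mapD(3)[OF \<psi> kC] ..
    then have "?k (c \<odot>\<^bsub>?H\<^esub> C) = ?k (?h (c \<odot>\<^bsub>Z\<^esub> ?k C))" unfolding k(2)[OF C] by (simp only:)
    then show "?k (c \<odot>\<^bsub>?H\<^esub> C) = c \<odot>\<^bsub>Z\<^esub> ?k C" unfolding inv_into_f_f[OF hi Z.smult_mem[OF kC]] .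
    assume D: "D \<in> carrier ?H"
    note kD = k(1)[OF D]
    have "?h (?k C \<oplus>\<^bsub>Z\<^esub> ?k D) = ?h (?k C) \<oplus>\<^bsub>?H\<^esub> ?h (?k D)"
      unfolding sel(3)[OF m[OF kC] m[OF kD]] linear_mapD(2)[OF \<psi> kC kD] ..
    then have "?k (C \<oplus>\<^bsub>?H\<^esub> D) = ?k (?h (?k C \<oplus>\<^bsub>Z\<^esub> ?k D))" unfolding k(2)[OF C] k(2)[OF D] by (simp only:)
    then show "?k (C \<oplus>\<^bsub>?H\<^esub> D) = ?k C \<oplus>\<^bsub>Z\<^esub> ?k D" unfolding inv_into_f_f[OF hi Z.M.a_closed[OF kC kD]] .
  qed
  moreover have "bij_betw ?k (carrier ?H) (carrier Z)"
    by (rule bij_betw_inv_into) (use hi ho in \<open>simp add: bij_betw_def\<close>)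
  ultimately show ?thesis unfolding linear_iso_def by blast
qed

section \<open>Products and the total complex\<close>

lemma lcs_product_sel [simp]:
  "carrier (lcs_product J M) = (\<Pi>\<^sub>E i\<in>J. carrier (M i))"
  "zero (lcs_product J M) = (\<lambda>i\<in>J. \<zero>\<^bsub>M i\<^esub>)"
  "add (lcs_product J M) = (\<lambda>x y. \<lambda>i\<in>J. x i \<oplus>\<^bsub>M i\<^esub> y i)"
  "smult (lcs_product J M) = (\<lambda>c x. \<lambda>i\<in>J. c \<odot>\<^bsub>M i\<^esub> x i)"
  "topo (lcs_product J M) = product_topology (\<lambda>i. topo (M i)) J"
  by (simp_all add: lcs_product_def)

lemma lin_space_product:
  assumes "\<And>i. lin_space (M i)"
  shows "lin_space (lcs_product J M)"
proof -
  note [simp] = abelian_monoid.a_closed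
  interpret M: lin_space "M i" for i by (rule assms)
  show ?thesis
    by (rule lin_spaceI)
      (auto simp: fun_eq_iff PiE_iff extensional_def M.M.a_assoc M.smult_add_left M.smult_add_right M.smult_smult
        M.minus_smult M.M.l_neg intro: M.M.a_comm)
qed

lemma product_minus:
  assumes "\<And>i. lin_space (M i)" "x \<in> carrier (lcs_product J M)" "y \<in> carrier (lcs_product J M)"
  shows "x \<ominus>\<^bsub>lcs_product J M\<^esub> y = (\<lambda>i\<in>J. x i \<ominus>\<^bsub>M i\<^esub> y i)"
proof -
  interpret M: lin_space "M i" for i by (rule assms)
  interpret P: lin_space "lcs_product J M" by (rule lin_space_product[OF assms(1)])
  have "x \<ominus>\<^bsub>lcs_product J M\<^esub> y = x \<oplus>\<^bsub>lcs_product J M\<^esub> (- 1) \<odot>\<^bsub>lcs_product J M\<^esub> y"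
    using assms(3) unfolding P.M.minus_eq by (simp only: P.neg_eq_smult)
  then show ?thesis using assms(3) by (auto simp: fun_eq_iff a_minus_def M.minus_smult PiE_iff)
qed

section \<open>Homology of mixed complexes\<close>

text \<open>In degree 0 there is no boundary to apply \<open>B\<close> to, so that \<open>b B + B b = 0\<close> has a single summand there
  and is stated separately.\<close>

locale mixed =
  fixes M :: "nat \<Rightarrow> 'm lcs" and b B :: "nat \<Rightarrow> 'm \<Rightarrow> 'm"
  assumes lc: "locally_convex (M n)"
    and b_cont: "continuous_linear (M (Suc n)) (M n) (b (Suc n))"
    and b_0: "x \<in> carrier (M 0) \<Longrightarrow> b 0 x = \<zero>\<^bsub>M 0\<^esub>"
    and B_cont: "continuous_linear (M n) (M (Suc n)) (B n)"
    and BB: "x \<in> carrier (M n) \<Longrightarrow> B (Suc n) (B n x) = \<zero>\<^bsub>M (Suc (Suc n))\<^esub>"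
    and bB_0: "x \<in> carrier (M 0) \<Longrightarrow> b (Suc 0) (B 0 x) = \<zero>\<^bsub>M 0\<^esub>"
    and bB: "x \<in> carrier (M (Suc n)) \<Longrightarrow>
      b (Suc (Suc n)) (B (Suc n) x) \<oplus>\<^bsub>M (Suc n)\<^esub> B n (b (Suc n) x) = \<zero>\<^bsub>M (Suc n)\<^esub>"
begin

sublocale S: locally_convex "M n" for n by (rule lc)

lemma b_lin: "linear_map (M (Suc n)) (M n) (b (Suc n))" and B_lin: "linear_map (M n) (M (Suc n)) (B n)"
  using b_cont B_cont by (auto simp: continuous_linear_def)

lemma b_mem [simp]: "x \<in> carrier (M (Suc n)) \<Longrightarrow> b (Suc n) x \<in> carrier (M n)"
  and B_mem [simp]: "x \<in> carrier (M n) \<Longrightarrow> B n x \<in> carrier (M (Suc n))"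
  by (rule linear_mapD(1)[OF b_lin] linear_mapD(1)[OF B_lin]; assumption)+

lemma b_zero [simp]: "b (Suc n) \<zero>\<^bsub>M (Suc n)\<^esub> = \<zero>\<^bsub>M n\<^esub>" and B_zero [simp]: "B n \<zero>\<^bsub>M n\<^esub> = \<zero>\<^bsub>M (Suc n)\<^esub>"
  using linear_map_zero[OF S.lin_space_axioms S.lin_space_axioms b_lin]
    linear_map_zero[OF S.lin_space_axioms S.lin_space_axioms B_lin] by auto

lemma bB_neg: "x \<in> carrier (M (Suc n)) \<Longrightarrow> b (Suc (Suc n)) (B (Suc n) x) = \<ominus>\<^bsub>M (Suc n)\<^esub> B n (b (Suc n) x)"
  using bB[of x n] by (intro S.M.minus_equality[symmetric]) simp_all

text \<open>The \<open>j\<close>-th component of \<open>(b + B) y\<close> for a sequence \<open>y\<close> of elements of all degrees.\<close>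

definition D :: "(nat \<Rightarrow> 'm) \<Rightarrow> nat \<Rightarrow> 'm" where
  "D y j = b (Suc j) (y (Suc j)) \<oplus>\<^bsub>M j\<^esub> (case j of 0 \<Rightarrow> \<zero>\<^bsub>M j\<^esub> | Suc i \<Rightarrow> B i (y i))"

lemma D_0: "y (Suc 0) \<in> carrier (M (Suc 0)) \<Longrightarrow> D y 0 = b (Suc 0) (y (Suc 0))"
  by (simp add: D_def)

lemma D_Suc: "D y (Suc j) = b (Suc (Suc j)) (y (Suc (Suc j))) \<oplus>\<^bsub>M (Suc j)\<^esub> B j (y j)"
  by (simp add: D_def)

lemma total_diff_eq: "total_diff M b B J y = (\<lambda>j\<in>J. D y j)"
  by (auto simp: total_diff_def D_def fun_eq_iff split: nat.split)

end

locale exact_mixed = mixed M b B for M :: "nat \<Rightarrow> 'm lcs" and b B :: "nat \<Rightarrow> 'm \<Rightarrow> 'm" +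
  assumes exact: "0 < n \<Longrightarrow> x \<in> carrier (M n) \<Longrightarrow> b n x = \<zero>\<^bsub>M (n - 1)\<^esub> \<Longrightarrow>
    \<exists>w\<in>carrier (M (Suc n)). b (Suc n) w = x"
begin

text \<open>A system \<open>D Y = t\<close> with a cycle on the right is solved degree by degree. The next component
  exists by exactness, since the obstruction is a cycle; for that, the previous components
  only matter through \<open>B\<close> of their boundaries. Starting from a partial solution, this both completes truncated cycles
  and bounds cycles.\<close>

lemma solve:
  assumes t: "\<And>j. t j \<in> carrier (M j)" and Dt: "\<And>j. D t j = \<zero>\<^bsub>M j\<^esub>"
    and y: "\<And>j. y j \<in> carrier (M j)" and Dy: "\<And>j. j < n \<Longrightarrow> D y j = t j" and n: "0 < n"
  shows "\<exists>Y. (\<forall>j. Y j \<in> carrier (M j)) \<and> (\<forall>j\<le>n. Y j = y j) \<and> (\<forall>j. D Y j = t j)"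
proof -
  \<comment> \<open>A state at stage \<open>j\<close> is the pair of components \<open>j\<close> and \<open>j + 1\<close>; the next equation involves both.\<close>
  define P where "P j z \<longleftrightarrow> fst z \<in> carrier (M j) \<and> snd z \<in> carrier (M (Suc j)) \<and>
      (case j of 0 \<Rightarrow> True | Suc i \<Rightarrow> B i (b (Suc i) (fst z)) = B i (t i)) \<and>
      B j (b (Suc j) (snd z)) = B j (t j) \<and> (j \<le> n \<longrightarrow> fst z = y j) \<and> (Suc j \<le> n \<longrightarrow> snd z = y (Suc j))" for j z
  define Q where "Q j z z' \<longleftrightarrow> fst z' = snd z \<and> b (Suc (Suc j)) (snd z') \<oplus>\<^bsub>M (Suc j)\<^esub> B j (fst z) = t (Suc j)" for j and z z' :: "'m \<times> 'm"
  have "\<exists>f. \<forall>j. P j (f j) \<and> Q j (f j) (f (Suc j))"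
  proof (rule dependent_nat_choice)
    have "b (Suc 0) (y (Suc 0)) = t 0" using Dy[OF n] D_0[of y, OF y] by simp
    then show "\<exists>z. P 0 z" using y[of 0] y[of "Suc 0"] unfolding P_def by (intro exI[of _ "(y 0, y (Suc 0))"]) simp
  next
    fix z j assume z: "P j z"
    then have u: "fst z \<in> carrier (M j)" and v: "snd z \<in> carrier (M (Suc j))" by (auto simp: P_def)
    have "\<exists>w\<in>carrier (M (Suc (Suc j))). b (Suc (Suc j)) w \<oplus>\<^bsub>M (Suc j)\<^esub> B j (fst z) = t (Suc j) \<and>
        (Suc (Suc j) \<le> n \<longrightarrow> w = y (Suc (Suc j)))"
    proof (cases "Suc (Suc j) \<le> n")
      case True
      then have "fst z = y j" using z by (simp add: P_def)
      then show ?thesis using Dy[of "Suc j"] True y by (intro bexI[of _ "y (Suc (Suc j))"]) (auto simp: D_Suc)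
    next
      case False
      let ?x = "t (Suc j) \<ominus>\<^bsub>M (Suc j)\<^esub> B j (fst z)"
      have x: "?x \<in> carrier (M (Suc j))" using t u by simp
      have bx: "b (Suc j) ?x = b (Suc j) (t (Suc j)) \<ominus>\<^bsub>M j\<^esub> b (Suc j) (B j (fst z))"
        using linear_map_diff[OF S.lin_space_axioms S.lin_space_axioms b_lin] t u by simp
      have "b (Suc j) ?x = \<zero>\<^bsub>M j\<^esub>"
      proof (cases j)
        case 0
        then show ?thesis unfolding bx using Dt[of 0] D_0[of t, OF t] bB_0[of "fst z"] u by simp
      next
        case (Suc i)
        have e: "b (Suc j) (B j (fst z)) = \<ominus>\<^bsub>M j\<^esub> B i (t i)"
          using z bB_neg[of "fst z" i] u by (simp add: P_def Suc)
        show ?thesis unfolding bx e using Dt[of j] t[of i] t[of "Suc j"] by (simp add: Suc D_Suc a_minus_def)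
      qed
      then obtain w where w: "w \<in> carrier (M (Suc (Suc j)))" "b (Suc (Suc j)) w = ?x"
        using exact[OF zero_less_Suc x] by auto
      then show ?thesis using False t u by (intro bexI[of _ w]) auto
    qed
    then obtain w where w: "w \<in> carrier (M (Suc (Suc j)))" "b (Suc (Suc j)) w \<oplus>\<^bsub>M (Suc j)\<^esub> B j (fst z) = t (Suc j)"
        "Suc (Suc j) \<le> n \<longrightarrow> w = y (Suc (Suc j))" by auto
    have "B (Suc j) (b (Suc (Suc j)) w) \<oplus>\<^bsub>M (Suc (Suc j))\<^esub> B (Suc j) (B j (fst z)) = B (Suc j) (t (Suc j))"
      using linear_mapD(2)[OF B_lin b_mem[OF w(1)] B_mem[OF u]] w(2) by simp
    then have Bb: "B (Suc j) (b (Suc (Suc j)) w) = B (Suc j) (t (Suc j))" using BB[OF u] w(1) by simp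
    show "\<exists>z'. P (Suc j) z' \<and> Q j z z'"
      using z w v Bb by (intro exI[of _ "(snd z, w)"]) (simp add: P_def Q_def)
  qed
  then obtain f where P: "\<And>j. P j (f j)" and Q: "\<And>j. Q j (f j) (f (Suc j))" by auto
  define Y where "Y j = fst (f j)" for j
  have s: "snd (f j) = Y (Suc j)" for j using Q[of j] by (simp add: Q_def Y_def)
  have "D Y j = t j" for j
  proof (cases j)
    case 0
    have "Y (Suc 0) = y (Suc 0)" using P[of 0] n by (simp add: P_def s)
    then show ?thesis using Dy[OF n] 0 by (simp add: D_def)
  next
    case (Suc i)
    then show ?thesis using Q[of i] by (simp add: Q_def s D_Suc) (simp add: Y_def)
  qed
  then show ?thesis using P unfolding P_def by (intro exI[of _ Y]) (simp add: Y_def)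
qed

end

text \<open>The index sets of the cyclic complexes and, for the bound \<open>\<infinity>\<close>, of the periodic one.\<close>

definition idx :: "nat \<Rightarrow> enat \<Rightarrow> nat set" where
  "idx p N = {j. j mod 2 = p mod 2 \<and> enat j \<le> N}"

lemma cyclic_index_idx: "cyclic_index n = idx n (enat n)"
  by (auto simp: cyclic_index_def idx_def)

lemma periodic_index_idx: "periodic_index \<nu> = idx \<nu> \<infinity>"
  by (auto simp: periodic_index_def idx_def)

lemma parity_Suc: "Suc i mod 2 = p mod 2 \<longleftrightarrow> i mod 2 \<noteq> p mod 2"
  by presburger

lemma idx_Suc: "j \<in> idx p N \<Longrightarrow> Suc j \<in> idx (Suc p) (eSuc N)"
  by (cases N) (auto simp: idx_def mod_Suc eSuc_enat)

lemma idx_pred: "Suc j \<in> idx p N \<Longrightarrow> j \<in> idx (Suc p) (eSuc N)"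
  by (cases N) (auto simp: idx_def parity_Suc eSuc_enat, presburger+)

lemma idx_two: "Suc (Suc j) \<in> idx p N \<Longrightarrow> j \<in> idx p N"
  by (cases N) (auto simp: idx_def)

context mixed
begin

abbreviation "tot \<equiv> total_diff M b B"
abbreviation "P J \<equiv> lcs_product J M"

text \<open>Extension by zero makes an element of a total complex a sequence with a component in every degree.\<close>

definition extend :: "nat set \<Rightarrow> (nat \<Rightarrow> 'm) \<Rightarrow> nat \<Rightarrow> 'm" where
  "extend J x j = (if j \<in> J then x j else \<zero>\<^bsub>M j\<^esub>)"

lemma extend_mem: "x \<in> carrier (P J) \<Longrightarrow> extend J x j \<in> carrier (M j)"
  by (auto simp: extend_def)

lemma D_extend_cycle:
  assumes x: "x \<in> carrier (P (idx p N))"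
    and cyc: "\<And>j. Suc j \<in> idx p N \<Longrightarrow> D x j = \<zero>\<^bsub>M j\<^esub>" and j: "enat j < N \<or> j = 0"
  shows "D (extend (idx p N) x) j = \<zero>\<^bsub>M j\<^esub>"
proof (cases "Suc j \<in> idx p N")
  case True
  have "D (extend (idx p N) x) j = D x j"
    using True idx_two by (auto simp: D_def extend_def split: nat.split)
  then show ?thesis using cyc[OF True] by simp
next
  case False
  have "i \<notin> idx p N" if i: "j = Suc i" for i
  proof
    assume "i \<in> idx p N"
    then have "Suc (Suc i) mod 2 = p mod 2" by (simp add: idx_def)
    moreover have "enat (Suc j) \<le> N" using j i by (cases N) auto
    ultimately show False using False i by (simp add: idx_def)
  qed
  then show ?thesis using False by (auto simp: D_def extend_def split: nat.split)
qed

lemma lin_product: "lin_space (P J)"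
  by (rule lin_space_product) (rule S.lin_space_axioms)

lemma D_mem: "y (Suc j) \<in> carrier (M (Suc j)) \<Longrightarrow> (\<And>i. j = Suc i \<Longrightarrow> y i \<in> carrier (M i)) \<Longrightarrow> D y j \<in> carrier (M j)"
  by (auto simp: D_def split: nat.split)

lemma D_add:
  assumes "x (Suc j) \<in> carrier (M (Suc j))" "y (Suc j) \<in> carrier (M (Suc j))"
    "\<And>i. j = Suc i \<Longrightarrow> x i \<in> carrier (M i) \<and> y i \<in> carrier (M i)"
    "z (Suc j) = x (Suc j) \<oplus>\<^bsub>M (Suc j)\<^esub> y (Suc j)" "\<And>i. j = Suc i \<Longrightarrow> z i = x i \<oplus>\<^bsub>M i\<^esub> y i"
  shows "D z j = D x j \<oplus>\<^bsub>M j\<^esub> D y j"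
  using assms linear_mapD(2)[OF b_lin] linear_mapD(2)[OF B_lin]
  by (cases j) (simp_all add: D_def S.M.a_ac)

lemma D_smult:
  assumes "x (Suc j) \<in> carrier (M (Suc j))" "\<And>i. j = Suc i \<Longrightarrow> x i \<in> carrier (M i)"
    "z (Suc j) = c \<odot>\<^bsub>M (Suc j)\<^esub> x (Suc j)" "\<And>i. j = Suc i \<Longrightarrow> z i = c \<odot>\<^bsub>M i\<^esub> x i"
  shows "D z j = c \<odot>\<^bsub>M j\<^esub> D x j"
  using assms linear_mapD(3)[OF b_lin] linear_mapD(3)[OF B_lin]
  by (cases j) (simp_all add: D_def S.smult_add_right)

lemma linear_total_diff:
  assumes JX: "\<And>j. j \<in> J \<Longrightarrow> Suc j \<in> J' \<and> (\<forall>i. j = Suc i \<longrightarrow> i \<in> J')"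
  shows "linear_map (P J') (P J) (tot J)"
proof (rule linear_mapI)
  fix x c assume x: "x \<in> carrier (P J')"
  have xm: "x (Suc j) \<in> carrier (M (Suc j))" "j = Suc i \<Longrightarrow> x i \<in> carrier (M i)" if "j \<in> J" for i j
    using JX[OF that] x by auto
  show "tot J x \<in> carrier (P J)"
    using xm by (auto simp: total_diff_eq intro!: D_mem)
  have "D (\<lambda>i\<in>J'. c \<odot>\<^bsub>M i\<^esub> x i) j = c \<odot>\<^bsub>M j\<^esub> D x j" if j: "j \<in> J" for j
    by (rule D_smult) (use JX[OF j] xm[OF j] in auto)
  then show "tot J (c \<odot>\<^bsub>P J'\<^esub> x) = c \<odot>\<^bsub>P J\<^esub> tot J x"
    by (auto simp: total_diff_eq fun_eq_iff)
  fix y assume y: "y \<in> carrier (P J')"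
  have ym: "y (Suc j) \<in> carrier (M (Suc j))" "j = Suc i \<Longrightarrow> y i \<in> carrier (M i)" if "j \<in> J" for i j
    using JX[OF that] y by auto
  have "D (\<lambda>i\<in>J'. x i \<oplus>\<^bsub>M i\<^esub> y i) j = D x j \<oplus>\<^bsub>M j\<^esub> D y j" if j: "j \<in> J" for j
    by (rule D_add) (use JX[OF j] xm[OF j] ym[OF j] in auto)
  then show "tot J (x \<oplus>\<^bsub>P J'\<^esub> y) = tot J x \<oplus>\<^bsub>P J\<^esub> tot J y"
    by (auto simp: total_diff_eq fun_eq_iff)
qed

lemma linear_total_diff_idx:
  "linear_map (P (idx (Suc p) (eSuc N))) (P (idx p N)) (tot (idx p N))"
  by (rule linear_total_diff) (use idx_Suc idx_pred in auto)

end

context exact_mixed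
begin

text \<open>A cycle of the truncated complex continues to an infinite one: the sequence extended by zero solves
  \<open>D Y = 0\<close> below the truncation.\<close>

lemma complete_cycle:
  assumes x: "x \<in> carrier (P (idx p N))" and cyc: "\<And>j. Suc j \<in> idx p N \<Longrightarrow> D x j = \<zero>\<^bsub>M j\<^esub>"
  shows "\<exists>Y. (\<forall>j. Y j \<in> carrier (M j)) \<and> (\<forall>j\<in>idx p N. Y j = x j) \<and> (\<forall>j. D Y j = \<zero>\<^bsub>M j\<^esub>) \<and> (0 \<notin> idx p N \<longrightarrow> Y 0 = \<zero>\<^bsub>M 0\<^esub>)"
proof (cases N)
  case infinity
  then show ?thesis using extend_mem[OF x] D_extend_cycle[OF x cyc]
    by (intro exI[of _ "extend (idx p N) x"]) (auto simp: extend_def)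
next
  case (enat k)
  have z: "D (\<lambda>j. \<zero>\<^bsub>M j\<^esub>) j = \<zero>\<^bsub>M j\<^esub>" for j by (auto simp: D_def split: nat.split)
  have "\<exists>Y. (\<forall>j. Y j \<in> carrier (M j)) \<and> (\<forall>j\<le>max k 1. Y j = extend (idx p N) x j) \<and> (\<forall>j. D Y j = \<zero>\<^bsub>M j\<^esub>)"
    by (rule solve[where t = "\<lambda>j. \<zero>\<^bsub>M j\<^esub>"])
      (use z extend_mem[OF x] D_extend_cycle[OF x cyc] enat in \<open>auto simp: less_max_iff_disj\<close>)
  then obtain Y where Y: "\<And>j. Y j \<in> carrier (M j)" "\<And>j. j \<le> max k 1 \<Longrightarrow> Y j = extend (idx p N) x j" "\<And>j. D Y j = \<zero>\<^bsub>M j\<^esub>"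
    by auto
  have "Y j = x j" if "j \<in> idx p N" for j
    using Y(2)[of j] that enat by (auto simp: idx_def extend_def)
  moreover have "Y 0 = \<zero>\<^bsub>M 0\<^esub>" if "0 \<notin> idx p N" using Y(2)[of 0] that by (simp add: extend_def)
  ultimately show ?thesis using Y(1,3) by blast
qed

text \<open>A preimage of the bottom component starts a solution of \<open>D Y = X\<close>, where \<open>X\<close> is the continued cycle.\<close>

lemma cycle_boundary:
  assumes x: "x \<in> carrier (P (idx p N))" and cyc: "\<And>j. Suc j \<in> idx p N \<Longrightarrow> D x j = \<zero>\<^bsub>M j\<^esub>"
    and z: "z \<in> carrier (M (Suc 0))" "0 \<in> idx p N \<Longrightarrow> b (Suc 0) z = x 0" "0 \<notin> idx p N \<Longrightarrow> b (Suc 0) z = \<zero>\<^bsub>M 0\<^esub>"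
  shows "x \<in> tot (idx p N) ` carrier (P (idx (Suc p) (eSuc N)))"
proof -
  obtain Y where Y: "\<And>j. Y j \<in> carrier (M j)" "\<And>j. j \<in> idx p N \<Longrightarrow> Y j = x j" "\<And>j. D Y j = \<zero>\<^bsub>M j\<^esub>"
      "0 \<notin> idx p N \<Longrightarrow> Y 0 = \<zero>\<^bsub>M 0\<^esub>"
    using complete_cycle[OF x cyc] by auto
  have Y0: "b (Suc 0) z = Y 0" using z(2,3) Y(2)[of 0] Y(4) by (cases "0 \<in> idx p N") auto
  let ?y = "\<lambda>j. if j = Suc 0 then z else \<zero>\<^bsub>M j\<^esub>"
  have "\<exists>W. (\<forall>j. W j \<in> carrier (M j)) \<and> (\<forall>j\<le>1. W j = ?y j) \<and> (\<forall>j. D W j = Y j)"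
    by (rule solve[OF Y(1,3)]) (use z(1) Y0 in \<open>auto simp: D_0\<close>)
  then obtain W where W: "\<And>j. W j \<in> carrier (M j)" "\<And>j. D W j = Y j" by auto
  let ?J = "idx (Suc p) (eSuc N)"
  have "D (restrict W ?J) j = x j" if j: "j \<in> idx p N" for j
  proof -
    have "D (restrict W ?J) j = D W j"
      using idx_Suc[OF j] idx_pred j by (auto simp: D_def split: nat.split)
    then show ?thesis using W(2) Y(2)[OF j] by simp
  qed
  then have "tot (idx p N) (restrict W ?J) = x"
    using x by (auto simp: total_diff_eq fun_eq_iff PiE_iff extensional_def)
  moreover have "restrict W ?J \<in> carrier (lcs_product ?J M)" using W(1) by auto
  ultimately show ?thesis by blast
qed

text \<open>The total complex is truncated (finite \<^term>\<open>N\<close>) or periodic. The operator \<^term>\<open>g\<close> out of the middle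
  space is described by its kernel, since it maps to a shorter product or to that of the other
  parity and is zero in cyclic degree 0. In odd total degree a cycle is a boundary; in even total
  degree, the class of a cycle is that of its component in degree 0, and every such component occurs.\<close>

lemma odd_homology:
  assumes p: "odd p" and g: "\<And>x. x \<in> carrier (P (idx p N)) \<Longrightarrow>
      g x = \<zero>\<^bsub>Y\<^esub> \<longleftrightarrow> (\<forall>j. Suc j \<in> idx p N \<longrightarrow> D x j = \<zero>\<^bsub>M j\<^esub>)"
    and g0: "g \<zero>\<^bsub>P (idx p N)\<^esub> = \<zero>\<^bsub>Y\<^esub>"
  shows "zero_space (homology_at (P (idx (Suc p) (eSuc N))) (tot (idx p N)) (P (idx p N)) g Y)"
proof -
  have 0: "0 \<notin> idx p N" using p by (auto simp: idx_def odd_iff_mod_2_eq_one)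
  show ?thesis
    unfolding zero_homology_iff[OF lin_product lin_product linear_total_diff_idx, of g p N Y, OF g0]
    using g 0 by (auto intro!: cycle_boundary[where z = "\<zero>\<^bsub>M (Suc 0)\<^esub>"] simp del: lcs_product_sel)
qed

lemma even_homology:
  assumes p: "even p" and Y: "lin_space Y" and gl: "linear_map (P (idx p N)) Y g"
    and g: "\<And>x. x \<in> carrier (P (idx p N)) \<Longrightarrow>
      g x = \<zero>\<^bsub>Y\<^esub> \<longleftrightarrow> (\<forall>j. Suc j \<in> idx p N \<longrightarrow> D x j = \<zero>\<^bsub>M j\<^esub>)"
    and \<rho>: "linear_map (M 0) Z \<rho>" "\<rho> ` carrier (M 0) = carrier Z"
      "\<And>u v. u \<in> carrier (M 0) \<Longrightarrow> v \<in> carrier (M 0) \<Longrightarrow> \<rho> u = \<rho> v \<longleftrightarrow> u \<ominus>\<^bsub>M 0\<^esub> v \<in> b (Suc 0) ` carrier (M (Suc 0))"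
  shows "homology_at (P (idx (Suc p) (eSuc N))) (tot (idx p N)) (P (idx p N)) g Y \<cong>\<^sub>l\<^sub>i\<^sub>n Z"
proof -
  let ?J = "idx p N"
  let ?X = "lcs_product ?J M"
  have 0: "0 \<in> ?J" using p by (auto simp: idx_def even_iff_mod_2_eq_zero simp flip: zero_enat_def)
  have K: "x \<in> a_kernel ?X Y g \<longleftrightarrow> x \<in> carrier ?X \<and> (\<forall>j. Suc j \<in> ?J \<longrightarrow> D x j = \<zero>\<^bsub>M j\<^esub>)" for x
    using g[of x] by (auto simp: a_kernel_mem simp del: lcs_product_sel)
  have m0: "x 0 \<in> carrier (M 0)" if "x \<in> a_kernel ?X Y g" for x using that 0 unfolding K by auto
  show ?thesis
  proof (rule homology_iso[OF lin_product lin_product linear_total_diff_idx Y gl, where \<phi> = "\<lambda>x. \<rho> (x 0)"])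
    show "(\<lambda>x. \<rho> (x 0)) ` a_kernel ?X Y g = carrier Z"
    proof
      show "(\<lambda>x. \<rho> (x 0)) ` a_kernel ?X Y g \<subseteq> carrier Z" using m0 linear_mapD(1)[OF \<rho>(1)] by auto
      show "carrier Z \<subseteq> (\<lambda>x. \<rho> (x 0)) ` a_kernel ?X Y g"
      proof
        fix z assume "z \<in> carrier Z"
        then obtain u where u: "u \<in> carrier (M 0)" "z = \<rho> u" using \<rho>(2) by auto
        let ?y = "\<lambda>j. if j = 0 then u else \<zero>\<^bsub>M j\<^esub>"
        have "\<exists>V. (\<forall>j. V j \<in> carrier (M j)) \<and> (\<forall>j\<le>1. V j = ?y j) \<and> (\<forall>j. D V j = \<zero>\<^bsub>M j\<^esub>)"
          by (rule solve[where t = "\<lambda>j. \<zero>\<^bsub>M j\<^esub>"]) (use u in \<open>auto simp: D_def split: nat.split\<close>)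
        then obtain V where V: "\<And>j. V j \<in> carrier (M j)" "\<forall>j\<le>1. V j = ?y j" "\<And>j. D V j = \<zero>\<^bsub>M j\<^esub>" by blast
        have V0: "V 0 = u" using V(2) by simp
        have "D (restrict V ?J) j = D V j" if "Suc j \<in> ?J" for j
          using that idx_two by (auto simp: D_def split: nat.split)
        then have "restrict V ?J \<in> a_kernel ?X Y g" unfolding K using V(1,3) by auto
        moreover have "z = \<rho> (restrict V ?J 0)" using 0 V0 u(2) by simp
        ultimately show "z \<in> (\<lambda>x. \<rho> (x 0)) ` a_kernel ?X Y g" by blast
      qed
    qed
    fix x assume x: "x \<in> a_kernel ?X Y g"
    show "\<rho> ((c \<odot>\<^bsub>?X\<^esub> x) 0) = c \<odot>\<^bsub>Z\<^esub> \<rho> (x 0)" for c using 0 linear_mapD(3)[OF \<rho>(1) m0[OF x]] by simp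
    fix y assume y: "y \<in> a_kernel ?X Y g"
    show "\<rho> ((x \<oplus>\<^bsub>?X\<^esub> y) 0) = \<rho> (x 0) \<oplus>\<^bsub>Z\<^esub> \<rho> (y 0)" using 0 linear_mapD(2)[OF \<rho>(1) m0[OF x] m0[OF y]] by simp
    have xX: "x \<in> carrier ?X" and yX: "y \<in> carrier ?X" using x y unfolding K by auto
    interpret X: lin_space ?X by (rule lin_product)
    let ?v = "x \<ominus>\<^bsub>?X\<^esub> y"
    have vX: "?v \<in> carrier ?X" by (rule X.diff_mem[OF xX yX])
    have v0: "?v 0 = x 0 \<ominus>\<^bsub>M 0\<^esub> y 0" using 0 product_minus[OF S.lin_space_axioms xX yX] by simp
    have "g ?v = \<zero>\<^bsub>Y\<^esub>"
    proof -
      interpret Y: lin_space Y by fact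
      show ?thesis using linear_map_diff[OF lin_product Y gl xX yX] x y by (simp add: a_kernel_mem)
    qed
    then have vK: "\<And>j. Suc j \<in> ?J \<Longrightarrow> D ?v j = \<zero>\<^bsub>M j\<^esub>" using g[OF vX] by simp
    show "\<rho> (x 0) = \<rho> (y 0) \<longleftrightarrow> ?v \<in> tot ?J ` carrier (P (idx (Suc p) (eSuc N)))"
      unfolding \<rho>(3)[OF m0[OF x] m0[OF y]] v0[symmetric]
    proof
      assume "?v 0 \<in> b (Suc 0) ` carrier (M (Suc 0))"
      then obtain z where "z \<in> carrier (M (Suc 0))" "b (Suc 0) z = ?v 0" by auto
      then show "?v \<in> tot ?J ` carrier (P (idx (Suc p) (eSuc N)))"
        using 0 by (intro cycle_boundary[OF vX vK, of z]) auto
    next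
      assume "?v \<in> tot ?J ` carrier (P (idx (Suc p) (eSuc N)))"
      then obtain w where w: "w \<in> carrier (P (idx (Suc p) (eSuc N)))" "?v = tot ?J w" by auto
      have w1: "w (Suc 0) \<in> carrier (M (Suc 0))" using w(1) idx_Suc[OF 0] by auto
      have "?v 0 = b (Suc 0) (w (Suc 0))" unfolding w(2) total_diff_eq using 0 D_0[of w, OF w1] by simp
      then show "?v 0 \<in> b (Suc 0) ` carrier (M (Suc 0))" using w1 by blast
    qed
  qed
qed

end

section \<open>Continuous linear functionals\<close>

abbreviation functional :: "'x lcs \<Rightarrow> ('x \<Rightarrow> complex) \<Rightarrow> bool" where
  "functional X \<equiv> continuous_linear X complex_lcs"

lemma functional_iff:
  "functional X f \<longleftrightarrow> (\<forall>x\<in>carrier X. \<forall>y\<in>carrier X. f (x \<oplus>\<^bsub>X\<^esub> y) = f x + f y) \<and>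
    (\<forall>c. \<forall>x\<in>carrier X. f (c \<odot>\<^bsub>X\<^esub> x) = c * f x) \<and> continuous_map (topo X) euclidean f"
  by (simp add: continuous_linear_def linear_map_def)

lemma functionalD:
  assumes "functional X f"
  shows "x \<in> carrier X \<Longrightarrow> y \<in> carrier X \<Longrightarrow> f (x \<oplus>\<^bsub>X\<^esub> y) = f x + f y"
    and "x \<in> carrier X \<Longrightarrow> f (c \<odot>\<^bsub>X\<^esub> x) = c * f x"
  using assms by (auto simp: functional_iff)

lemma functional_add: "functional X f \<Longrightarrow> functional X g \<Longrightarrow> functional X (\<lambda>x. f x + g x)"
  by (simp add: functional_iff continuous_map_add algebra_simps)

lemma functional_diff: "functional X f \<Longrightarrow> functional X g \<Longrightarrow> functional X (\<lambda>x. f x - g x)"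
  by (simp add: functional_iff continuous_map_diff algebra_simps)

lemma functional_scale: "functional X f \<Longrightarrow> functional X (\<lambda>x. c * f x)"
  using continuous_map_compose[of "topo X" euclidean f euclidean "\<lambda>z. c * z"]
  by (simp add: functional_iff algebra_simps o_def continuous_intros)

lemma functional_zero [simp]: "functional X (\<lambda>x. 0)"
  by (simp add: functional_iff)

lemma functional_sum: "(\<And>i. i \<in> I \<Longrightarrow> functional X (f i)) \<Longrightarrow> functional X (\<lambda>x. \<Sum>i\<in>I. f i x)"
  by (induction I rule: infinite_finite_induct) (auto intro: functional_add)

lemma functional_at_zero: "lin_space X \<Longrightarrow> functional X f \<Longrightarrow> f \<zero>\<^bsub>X\<^esub> = 0"
  using linear_map_zero[OF _ lin_space_complex, of X f] by (simp add: continuous_linear_def)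

lemma functional_at_diff:
  "lin_space X \<Longrightarrow> functional X f \<Longrightarrow> x \<in> carrier X \<Longrightarrow> y \<in> carrier X \<Longrightarrow> f (x \<ominus>\<^bsub>X\<^esub> y) = f x - f y"
  using linear_map_diff[OF _ lin_space_complex, of X f x y] by (simp add: continuous_linear_def)

lemma functional_cong:
  assumes "lin_space X" "topspace (topo X) = carrier X" "functional X f" "\<And>x. x \<in> carrier X \<Longrightarrow> f x = g x"
  shows "functional X g"
proof -
  interpret lin_space X by fact
  have "continuous_map (topo X) euclidean g"
    by (rule continuous_map_eq[of _ _ f]) (use assms in \<open>auto simp: functional_iff\<close>)
  then show ?thesis using assms(3) by (simp add: functional_iff assms(4)[symmetric])
qed

lemma strong_dual_sel [simp]:
  "carrier (strong_dual X) = {f \<in> extensional (carrier X). functional X f}"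
  "zero (strong_dual X) = (\<lambda>x\<in>carrier X. 0)"
  "add (strong_dual X) = (\<lambda>f g. \<lambda>x\<in>carrier X. f x + g x)"
  "smult (strong_dual X) = (\<lambda>c f. \<lambda>x\<in>carrier X. c * f x)"
  by (simp_all add: strong_dual_def dual_space_def)

lemma lin_space_strong_dual:
  assumes "lin_space X" "topspace (topo X) = carrier X"
  shows "lin_space (strong_dual X)"
proof -
  have r: "functional X (restrict f (carrier X))" if "functional X f" for f
    by (rule functional_cong[OF assms that]) simp
  show ?thesis
    by (rule lin_spaceI)
      (auto simp: fun_eq_iff algebra_simps extensional_def intro!: functional_add functional_scale r)
qed

lemma dual_map_mem:
  assumes "lin_space X" "topspace (topo X) = carrier X" "continuous_linear X Y h" "functional Y f"
  shows "dual_map X h f \<in> carrier (strong_dual X)"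
  using functional_cong[OF assms(1,2) continuous_linear_compose[OF assms(3,4)], of "dual_map X h f"]
  by (simp add: dual_map_def)

lemma linear_dual_map:
  assumes "lin_space X" "topspace (topo X) = carrier X" "continuous_linear X Y h"
  shows "linear_map (strong_dual Y) (strong_dual X) (dual_map X h)"
proof (rule linear_mapI)
  show "dual_map X h f \<in> carrier (strong_dual X)" if "f \<in> carrier (strong_dual Y)" for f
    using dual_map_mem[OF assms] that by simp
qed (use linear_mapD(1)[of X Y h] assms(3) in \<open>auto simp: dual_map_def fun_eq_iff continuous_linear_def\<close>)

lemma dual_imageI:
  assumes Y: "lin_space Y" "topspace (topo Y) = carrier Y" and h: "linear_map X Y h"
    and f: "f \<in> carrier (strong_dual X)" and G: "functional Y G" and eq: "\<And>x. x \<in> carrier X \<Longrightarrow> f x = G (h x)"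
  shows "f \<in> dual_map X h ` carrier (strong_dual Y)"
proof (rule image_eqI)
  show "restrict G (carrier Y) \<in> carrier (strong_dual Y)"
    using functional_cong[OF Y G, of "restrict G (carrier Y)"] by simp
  show "f = dual_map X h (restrict G (carrier Y))"
    using f eq linear_mapD(1)[OF h] by (auto simp: dual_map_def fun_eq_iff extensional_def)
qed

lemma dual_map_zero_iff: "dual_map X h f = zero (strong_dual X) \<longleftrightarrow> (\<forall>x\<in>carrier X. f (h x) = 0)"
  by (auto simp: dual_map_def fun_eq_iff)

lemma strong_dual_minus:
  assumes "lin_space X" "topspace (topo X) = carrier X" "f \<in> carrier (strong_dual X)" "g \<in> carrier (strong_dual X)"
  shows "f \<ominus>\<^bsub>strong_dual X\<^esub> g = (\<lambda>x\<in>carrier X. f x - g x)"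
proof -
  interpret D: lin_space "strong_dual X" by (rule lin_space_strong_dual[OF assms(1,2)])
  have "f \<ominus>\<^bsub>strong_dual X\<^esub> g = f \<oplus>\<^bsub>strong_dual X\<^esub> (- 1) \<odot>\<^bsub>strong_dual X\<^esub> g"
    unfolding D.M.minus_eq D.neg_eq_smult[OF assms(4)] ..
  then show ?thesis by (simp add: fun_eq_iff)
qed

section \<open>Cohomology of mixed complexes\<close>

context mixed
begin

text \<open>The transpose of \<open>b + B\<close> on families of functionals, one for each degree.\<close>

definition dD :: "(nat \<Rightarrow> 'm \<Rightarrow> complex) \<Rightarrow> nat \<Rightarrow> 'm \<Rightarrow> complex" where
  "dD F i x = (case i of 0 \<Rightarrow> 0 | Suc k \<Rightarrow> F k (b i x)) + F (Suc i) (B i x)"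

text \<open>The family with \<open>g\<close> in degree \<open>N\<close> and zero elsewhere.\<close>

definition delta :: "nat \<Rightarrow> ('m \<Rightarrow> complex) \<Rightarrow> nat \<Rightarrow> 'm \<Rightarrow> complex" where
  "delta N g j x = (if j = N then g x else 0)"

lemma functional_delta: "functional (M N) g \<Longrightarrow> functional (M j) (delta N g j)"
  unfolding delta_def[abs_def] by (cases "j = N") auto

lemma functional_dD:
  assumes "\<And>j. functional (M j) (F j)"
  shows "functional (M i) (dD F i)"
proof (cases i)
  case 0
  then show ?thesis using continuous_linear_compose[OF B_cont assms] by (simp add: dD_def[abs_def])
next
  case (Suc k)
  then show ?thesis
    using functional_add[OF continuous_linear_compose[OF b_cont assms] continuous_linear_compose[OF B_cont assms]]
    by (simp add: dD_def[abs_def])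
qed

lemma dD_diff: "dD (\<lambda>j x. F j x - G j x) i x = dD F i x - dD G i x"
  by (simp add: dD_def split: nat.split)

lemma dD_dD_delta:
  assumes g: "functional (M N) g" and x: "x \<in> carrier (M i)"
    and bb: "i = Suc (Suc N) \<Longrightarrow> g (b (Suc N) (b i x)) = 0"
  shows "dD (dD (delta N g)) i x = 0"
proof -
  note F = functional_delta[OF g]
  note z = functional_at_zero[OF S.lin_space_axioms F]
  have BBx: "delta N g (Suc (Suc i)) (B (Suc i) (B i x)) = 0" using BB[OF x] z by simp
  show ?thesis
  proof (cases i)
    case 0
    then show ?thesis using BBx bB_0[of x] x z by (simp add: dD_def)
  next
    case (Suc k)
    then have x': "x \<in> carrier (M (Suc k))" using x by simp
    have "delta N g i (b (Suc i) (B i x)) + delta N g i (B k (b i x)) = 0"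
      using functionalD(1)[OF F, of "b (Suc (Suc k)) (B (Suc k) x)" "Suc k" "B k (b (Suc k) x)"] bB[OF x'] x' z Suc by simp
    moreover have "(case k of 0 \<Rightarrow> 0 | Suc l \<Rightarrow> delta N g l (b k (b (Suc k) x))) = 0"
      using bb Suc by (auto simp: delta_def split: nat.split)
    ultimately show ?thesis using BBx Suc by (simp add: dD_def algebra_simps)
  qed
qed

end

locale coexact_mixed = mixed M b B for M :: "nat \<Rightarrow> 'm lcs" and b B :: "nat \<Rightarrow> 'm \<Rightarrow> 'm" +
  assumes coexact: "functional (M (Suc n)) F \<Longrightarrow> (\<And>w. w \<in> carrier (M (Suc (Suc n))) \<Longrightarrow> F (b (Suc (Suc n)) w) = 0) \<Longrightarrow>
    \<exists>G. functional (M n) G \<and> (\<forall>x\<in>carrier (M (Suc n)). F x = G (b (Suc n) x))"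
begin

text \<open>A finitely supported cocycle is stripped of its top component by a coboundary until only the
  component in degree 0 is left.\<close>

lemma strip:
  assumes "\<And>j. functional (M j) (F j)" "\<And>j x. K < j \<Longrightarrow> x \<in> carrier (M j) \<Longrightarrow> F j x = 0"
    and "\<And>i x. x \<in> carrier (M i) \<Longrightarrow> dD F i x = 0"
  shows "\<exists>G. (\<forall>j. functional (M j) (G j)) \<and> (\<forall>j\<ge>K. \<forall>x\<in>carrier (M j). G j x = 0) \<and>
    (\<forall>i>0. \<forall>x\<in>carrier (M i). F i x = dD G i x)"
  using assms
proof (induction K arbitrary: F)
  case 0
  have z: "dD (\<lambda>j x. 0) i x = 0" for i x by (simp add: dD_def split: nat.split)
  show ?case by (rule exI[of _ "\<lambda>j x. 0"]) (use 0(2) z in auto)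
next
  case (Suc K)
  note F = Suc.prems(1) and bd = Suc.prems(2) and cyc = Suc.prems(3)
  have Fb: "F (Suc K) (b (Suc (Suc K)) w) = 0" if w: "w \<in> carrier (M (Suc (Suc K)))" for w
    using cyc[OF w] bd[of "Suc (Suc (Suc K))" "B (Suc (Suc K)) w"] w by (simp add: dD_def)
  obtain g where g: "functional (M K) g" "\<And>x. x \<in> carrier (M (Suc K)) \<Longrightarrow> F (Suc K) x = g (b (Suc K) x)"
    using coexact[OF F Fb] by auto
  let ?d = "delta K g"
  note d = functional_delta[OF g(1)]
  let ?F = "\<lambda>j x. F j x - dD ?d j x"
  have "\<exists>G. (\<forall>j. functional (M j) (G j)) \<and> (\<forall>j\<ge>K. \<forall>x\<in>carrier (M j). G j x = 0) \<and>
      (\<forall>i>0. \<forall>x\<in>carrier (M i). ?F i x = dD G i x)"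
  proof (rule Suc.IH)
    show "functional (M j) (?F j)" for j by (rule functional_diff[OF F functional_dD[OF d]])
    show "?F j x = 0" if j: "K < j" and x: "x \<in> carrier (M j)" for j x
    proof (cases "j = Suc K")
      case True
      then show ?thesis using g(2) x by (simp add: dD_def delta_def)
    next
      case False
      then have "Suc K < j" using j by simp
      then show ?thesis using bd[OF _ x] by (auto simp: dD_def delta_def split: nat.split)
    qed
    show "dD ?F i x = 0" if x: "x \<in> carrier (M i)" for i x
    proof -
      have "dD (dD ?d) i x = 0"
        by (rule dD_dD_delta[OF g(1) x]) (use Fb g(2) x in auto)
      then show ?thesis using cyc[OF x] by (simp add: dD_diff)
    qed
  qed
  then obtain G where G: "\<And>j. functional (M j) (G j)" "\<And>j x. K \<le> j \<Longrightarrow> x \<in> carrier (M j) \<Longrightarrow> G j x = 0"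
      "\<And>i x. 0 < i \<Longrightarrow> x \<in> carrier (M i) \<Longrightarrow> F i x - dD ?d i x = dD G i x" by blast
  have a: "dD (\<lambda>j x. G j x + ?d j x) i x = dD G i x + dD ?d i x" for i x
    by (simp add: dD_def split: nat.split)
  show ?case
  proof (intro exI conjI allI impI ballI)
    show "functional (M j) (\<lambda>x. G j x + ?d j x)" for j by (rule functional_add[OF G(1) d])
    show "G j x + ?d j x = 0" if "Suc K \<le> j" "x \<in> carrier (M j)" for j x
      using G(2)[of j x] that by (simp add: delta_def)
    show "F i x = dD (\<lambda>j x. G j x + ?d j x) i x" if "0 < i" "x \<in> carrier (M i)" for i x
      using G(3)[OF that] by (simp add: a algebra_simps)
  qed
qed

text \<open>If only the component in degree 0 of a finitely supported coboundary can be nonzero, it is zero as well: the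
  top component of the bounding family is a cocycle, hence a coboundary, and subtracting the coboundary of a preimage
  lowers the degree of the support.\<close>

lemma no_coboundary:
  assumes "\<And>j. functional (M j) (G j)" "\<And>j x. K < j \<Longrightarrow> x \<in> carrier (M j) \<Longrightarrow> G j x = 0"
    and "\<And>i x. 0 < i \<Longrightarrow> x \<in> carrier (M i) \<Longrightarrow> dD G i x = 0" and "x \<in> carrier (M 0)"
  shows "dD G 0 x = 0"
  using assms(1-3)
proof (induction K arbitrary: G)
  case 0
  then show ?case using assms(4) by (simp add: dD_def)
next
  case (Suc K)
  note G = Suc.prems(1) and bd = Suc.prems(2) and cyc = Suc.prems(3)
  have Gb: "G (Suc K) (b (Suc (Suc K)) w) = 0" if w: "w \<in> carrier (M (Suc (Suc K)))" for w
    using cyc[OF _ w] bd[of "Suc (Suc (Suc K))" "B (Suc (Suc K)) w"] w by (simp add: dD_def)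
  obtain h where h: "functional (M K) h" "\<And>x. x \<in> carrier (M (Suc K)) \<Longrightarrow> G (Suc K) x = h (b (Suc K) x)"
    using coexact[OF G Gb] by auto
  let ?d = "delta K h"
  note d = functional_delta[OF h(1)]
  have dd: "dD (dD ?d) i x = 0" if "x \<in> carrier (M i)" for i x
    by (rule dD_dD_delta[OF h(1) that]) (use Gb h(2) that in auto)
  have "dD (\<lambda>j x. G j x - dD ?d j x) 0 x = 0"
  proof (rule Suc.IH)
    show "functional (M j) (\<lambda>x. G j x - dD ?d j x)" for j by (rule functional_diff[OF G functional_dD[OF d]])
    show "G j x - dD ?d j x = 0" if j: "K < j" and x: "x \<in> carrier (M j)" for j x
    proof (cases "j = Suc K")
      case True
      then show ?thesis using h(2) x by (simp add: dD_def delta_def)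
    next
      case False
      then have "Suc K < j" using j by simp
      then show ?thesis using bd[OF _ x] by (auto simp: dD_def delta_def split: nat.split)
    qed
    show "dD (\<lambda>j x. G j x - dD ?d j x) i x = 0" if "0 < i" "x \<in> carrier (M i)" for i x
      using cyc[OF that] dd[OF that(2)] by (simp add: dD_diff)
  qed
  then show ?case using dd[OF assms(4)] by (simp add: dD_diff)
qed

end

subsection \<open>Functionals on products\<close>

text \<open>All neighbours of indices in \<^term>\<open>J\<close> belong to \<^term>\<open>J'\<close>, so that \<open>b + B\<close> maps the product over \<^term>\<open>J'\<close> to
  that over \<^term>\<open>J\<close>.\<close>

definition adjacent :: "nat set \<Rightarrow> nat set \<Rightarrow> bool" where
  "adjacent J J' \<longleftrightarrow> (\<forall>j\<in>J. Suc j \<in> J' \<and> (\<forall>i. j = Suc i \<longrightarrow> i \<in> J'))"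

lemma adjacentD: "adjacent J J' \<Longrightarrow> j \<in> J \<Longrightarrow> Suc j \<in> J' \<and> (\<forall>i. j = Suc i \<longrightarrow> i \<in> J')"
  by (simp add: adjacent_def)

lemma adjacent_idx: "adjacent (idx p N) (idx (Suc p) (eSuc N))"
  using idx_Suc idx_pred by (auto simp: adjacent_def)

context mixed
begin

definition incl :: "nat set \<Rightarrow> nat \<Rightarrow> 'm \<Rightarrow> nat \<Rightarrow> 'm" where
  "incl J j x = (\<lambda>i\<in>J. if i = j then x else \<zero>\<^bsub>M i\<^esub>)"

lemma topspace_product: "topspace (topo (P J)) = carrier (P J)"
  by (simp add: S.topspace_eq)

lemma incl_mem: "x \<in> carrier (M j) \<Longrightarrow> incl J j x \<in> carrier (P J)"
  by (auto simp: incl_def)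

lemma incl_continuous: "continuous_linear (M j) (P J) (incl J j)"
  unfolding continuous_linear_def
proof
  show "linear_map (M j) (P J) (incl J j)"
  proof (rule linear_mapI)
    show "incl J j x \<in> carrier (P J)" if "x \<in> carrier (M j)" for x by (rule incl_mem[OF that])
  qed (auto simp: incl_def fun_eq_iff)
  have "continuous_map (topo (M j)) (topo (M i)) (\<lambda>x. if i = j then x else \<zero>\<^bsub>M i\<^esub>)" for i
    by (cases "i = j") (auto simp: S.topspace_eq)
  then show "continuous_map (topo (M j)) (topo (P J)) (incl J j)"
    by (auto simp: continuous_map_componentwise incl_def)
qed

text \<open>A neighbourhood of zero in a product restricts finitely many coordinates. A functional that is bounded
  on the subspace where these vanish is zero on it.\<close>

lemma functional_finite_support:
  assumes f: "functional (P J) f"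
  shows "\<exists>K. \<forall>x\<in>carrier (P J). (\<forall>i\<in>J. i \<le> K \<longrightarrow> x i = \<zero>\<^bsub>M i\<^esub>) \<longrightarrow> f x = 0"
proof -
  let ?U = "{x \<in> topspace (topo (P J)). f x \<in> ball 0 1}"
  have "openin (topo (P J)) ?U"
    by (rule openin_continuous_map_preimage[where Y = euclidean]) (use f in \<open>auto simp: functional_iff\<close>)
  moreover have "\<zero>\<^bsub>P J\<^esub> \<in> ?U"
    using functional_at_zero[OF lin_product f] by (auto simp: S.topspace_eq)
  ultimately have "\<exists>U. finite {i \<in> J. U i \<noteq> topspace (topo (M i))} \<and> (\<forall>i\<in>J. openin (topo (M i)) (U i)) \<and>
      \<zero>\<^bsub>P J\<^esub> \<in> Pi\<^sub>E J U \<and> Pi\<^sub>E J U \<subseteq> ?U"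
    unfolding lcs_product_sel(5) openin_product_topology_alt by (rule bspec)
  then obtain U where fin: "finite {i \<in> J. U i \<noteq> topspace (topo (M i))}"
    and zU: "\<zero>\<^bsub>P J\<^esub> \<in> Pi\<^sub>E J U" and sub: "Pi\<^sub>E J U \<subseteq> ?U" by (elim exE conjE)
  from finite_nat_set_iff_bounded_le[THEN iffD1, OF fin]
  obtain K where K: "\<forall>i\<in>{i \<in> J. U i \<noteq> topspace (topo (M i))}. i \<le> K" by (rule exE)
  have "f x = 0" if x: "x \<in> carrier (P J)" and z: "\<forall>i\<in>J. i \<le> K \<longrightarrow> x i = \<zero>\<^bsub>M i\<^esub>" for x
  proof (rule ccontr)
    assume ne: "f x \<noteq> 0"
    let ?y = "(1 / f x) \<odot>\<^bsub>P J\<^esub> x"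
    have "?y i \<in> U i" if i: "i \<in> J" for i
    proof (cases "U i = topspace (topo (M i))")
      case True
      then show ?thesis using x i by (auto simp: S.topspace_eq)
    next
      case False
      have "i \<in> {i \<in> J. U i \<noteq> topspace (topo (M i))}" using i False by simp
      then have "x i = \<zero>\<^bsub>M i\<^esub>" using bspec[OF K] bspec[OF z i] by simp
      then show ?thesis using zU i by auto
    qed
    then have "?y \<in> Pi\<^sub>E J U" by auto
    then have "f ?y \<in> ball 0 1" using sub by blast
    then show False using functionalD(2)[OF f x, of "1 / f x"] ne by simp
  qed
  then show ?thesis by blast
qed

text \<open>By finite support, a functional on the product is the sum of its restrictions to finitely many factors.\<close>

lemma functional_ext:
  assumes f: "functional (P J) f" and g: "functional (P J) g"
    and eq: "\<And>i x. i \<in> J \<Longrightarrow> x \<in> carrier (M i) \<Longrightarrow> f (incl J i x) = g (incl J i x)" and y: "y \<in> carrier (P J)"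
  shows "f y = g y"
proof -
  let ?h = "\<lambda>x. f x - g x"
  have h: "functional (P J) ?h" by (rule functional_diff[OF f g])
  interpret P: lin_space "P J" by (rule lin_product)
  obtain K where K: "\<And>x. x \<in> carrier (P J) \<Longrightarrow> (\<forall>i\<in>J. i \<le> K \<longrightarrow> x i = \<zero>\<^bsub>M i\<^esub>) \<Longrightarrow> ?h x = 0"
    using functional_finite_support[OF h] by blast
  define cut where "cut k = (\<lambda>i\<in>J. if i < k then y i else \<zero>\<^bsub>M i\<^esub>)" for k
  have cm: "cut k \<in> carrier (P J)" for k using y by (auto simp: cut_def)
  have "?h (cut k) = 0" for k
  proof (induction k)
    case 0
    have "cut 0 = \<zero>\<^bsub>P J\<^esub>" by (simp add: cut_def)
    then show ?case using functional_at_zero[OF lin_product h] by (simp only:)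
  next
    case (Suc k)
    show ?case
    proof (cases "k \<in> J")
      case True
      have yk: "y k \<in> carrier (M k)" using y True by auto
      have "cut (Suc k) = cut k \<oplus>\<^bsub>P J\<^esub> incl J k (y k)"
        using y True by (auto simp: cut_def incl_def fun_eq_iff less_Suc_eq PiE_iff)
      then have "?h (cut (Suc k)) = ?h (cut k) + ?h (incl J k (y k))"
        using functionalD(1)[OF h cm[of k] incl_mem[OF yk]] by (simp only:)
      then show ?thesis using Suc eq[OF True yk] by simp
    next
      case False
      then have "cut (Suc k) = cut k" by (auto simp: cut_def fun_eq_iff less_Suc_eq)
      then show ?thesis using Suc by simp
    qed
  qed
  moreover have "?h (y \<ominus>\<^bsub>P J\<^esub> cut (Suc K)) = 0"
  proof (rule K[OF P.diff_mem[OF y cm]])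
    show "\<forall>i\<in>J. i \<le> K \<longrightarrow> (y \<ominus>\<^bsub>P J\<^esub> cut (Suc K)) i = \<zero>\<^bsub>M i\<^esub>"
      using y unfolding product_minus[OF S.lin_space_axioms y cm] by (auto simp: cut_def PiE_iff S.M.minus_eq S.M.r_neg)
  qed
  ultimately have "?h y = 0" using functional_at_diff[OF lin_product h y cm[of "Suc K"]] by simp
  then show ?thesis by simp
qed

lemma functional_proj:
  assumes "functional (M j) G" "j \<in> J"
  shows "functional (P J) (\<lambda>x. G (x j))"
proof (rule continuous_linear_compose[of _ "M j"])
  show "continuous_linear (P J) (M j) (\<lambda>x. x j)"
    unfolding continuous_linear_def linear_map_def
    using assms(2) continuous_map_product_projection[OF assms(2), of "\<lambda>i. topo (M i)"] by auto
qed (rule assms(1))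

lemma total_diff_continuous:
  assumes J: "adjacent J J'"
  shows "continuous_linear (P J') (P J) (tot J)"
  unfolding continuous_linear_def
proof
  show "linear_map (P J') (P J) (tot J)" by (rule linear_total_diff[OF adjacentD[OF J]])
  have pr: "continuous_map (topo (P J')) (topo (M i)) (\<lambda>x. x i)" if "i \<in> J'" for i
    using continuous_map_product_projection[OF that, of "\<lambda>i. topo (M i)"] by simp
  have "continuous_map (topo (P J')) (topo (M j)) (\<lambda>x. D x j)" if j: "j \<in> J" for j
  proof -
    have 1: "continuous_map (topo (P J')) (topo (M j)) (\<lambda>x. b (Suc j) (x (Suc j)))"
      using continuous_map_compose[OF pr[of "Suc j"], of "topo (M j)" "b (Suc j)"] adjacentD[OF J j] b_cont[of j]
      by (simp add: continuous_linear_def o_def)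
    have 2: "continuous_map (topo (P J')) (topo (M j)) (\<lambda>x. case j of 0 \<Rightarrow> \<zero>\<^bsub>M j\<^esub> | Suc i \<Rightarrow> B i (x i))"
    proof (cases j)
      case 0
      then show ?thesis by (simp add: S.topspace_eq)
    next
      case (Suc i)
      then show ?thesis using continuous_map_compose[OF pr[of i], of "topo (M j)" "B i"] adjacentD[OF J j] B_cont[of i]
        by (simp add: continuous_linear_def o_def)
    qed
    have "continuous_map (topo (P J')) (topo (M j)) ((\<lambda>(x, y). x \<oplus>\<^bsub>M j\<^esub> y) \<circ>
        (\<lambda>x. (b (Suc j) (x (Suc j)), case j of 0 \<Rightarrow> \<zero>\<^bsub>M j\<^esub> | Suc i \<Rightarrow> B i (x i))))"
      by (rule continuous_map_compose[OF _ S.continuous_add]) (use 1 2 in \<open>simp add: continuous_map_pairwise o_def\<close>)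
    then show ?thesis by (simp add: D_def[abs_def] o_def)
  qed
  then show "continuous_map (topo (P J')) (topo (P J)) (tot J)"
    by (auto simp: continuous_map_componentwise total_diff_eq)
qed

lemma total_diff_incl:
  assumes J: "adjacent J J'" and x: "x \<in> carrier (M i)"
  shows "tot J (incl J' i x) = (case i of 0 \<Rightarrow> \<zero>\<^bsub>P J\<^esub> | Suc k \<Rightarrow> incl J k (b i x)) \<oplus>\<^bsub>P J\<^esub> incl J (Suc i) (B i x)"
proof -
  have "D (incl J' i x) j = ((case i of 0 \<Rightarrow> \<zero>\<^bsub>P J\<^esub> | Suc k \<Rightarrow> incl J k (b i x)) \<oplus>\<^bsub>P J\<^esub> incl J (Suc i) (B i x)) j" if j: "j \<in> J" for j
  proof -
    have 1: "b (Suc j) (incl J' i x (Suc j)) = (case i of 0 \<Rightarrow> \<zero>\<^bsub>P J\<^esub> | Suc k \<Rightarrow> incl J k (b i x)) j"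
      using adjacentD[OF J j] j by (auto simp: incl_def split: nat.split)
    have 2: "(case j of 0 \<Rightarrow> \<zero>\<^bsub>M j\<^esub> | Suc i' \<Rightarrow> B i' (incl J' i x i')) = incl J (Suc i) (B i x) j"
      using adjacentD[OF J j] j by (auto simp: incl_def split: nat.split)
    show ?thesis unfolding D_def 1 2 using j by simp
  qed
  then show ?thesis by (auto simp: total_diff_eq fun_eq_iff)
qed

definition component :: "nat set \<Rightarrow> ((nat \<Rightarrow> 'm) \<Rightarrow> complex) \<Rightarrow> nat \<Rightarrow> 'm \<Rightarrow> complex" where
  "component J f j x = f (incl J j x)"

lemma functional_component: "functional (P J) f \<Longrightarrow> functional (M j) (component J f j)"
  unfolding component_def[abs_def] by (rule continuous_linear_compose[OF incl_continuous])

lemma component_outside: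
  assumes f: "functional (P J) f" and j: "j \<notin> J"
  shows "component J f j x = 0"
proof -
  have "incl J j x = \<zero>\<^bsub>P J\<^esub>" using j by (auto simp: incl_def fun_eq_iff)
  then show ?thesis using functional_at_zero[OF lin_product f] by (simp add: component_def)
qed

lemma component_bounded:
  assumes f: "functional (P J) f"
  shows "\<exists>K. \<forall>j>K. \<forall>x\<in>carrier (M j). component J f j x = 0"
proof -
  obtain K where K: "\<forall>x\<in>carrier (P J). (\<forall>i\<in>J. i \<le> K \<longrightarrow> x i = \<zero>\<^bsub>M i\<^esub>) \<longrightarrow> f x = 0"
    using functional_finite_support[OF f] by blast
  have "component J f j x = 0" if "K < j" "x \<in> carrier (M j)" for j x
    unfolding component_def using K incl_mem[OF that(2), of J] that(1) by (auto simp: incl_def)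
  then show ?thesis by blast
qed

lemma functional_total_diff_incl:
  assumes J: "adjacent J J'" and f: "functional (P J) f" and x: "x \<in> carrier (M i)"
  shows "f (tot J (incl J' i x)) = dD (component J f) i x"
proof -
  interpret P: lin_space "P J" by (rule lin_product)
  have m: "(case i of 0 \<Rightarrow> \<zero>\<^bsub>P J\<^esub> | Suc k \<Rightarrow> incl J k (b i x)) \<in> carrier (P J)"
    using x P.M.zero_closed incl_mem by (auto split: nat.split simp del: lcs_product_sel)
  have "f (tot J (incl J' i x)) = f (case i of 0 \<Rightarrow> \<zero>\<^bsub>P J\<^esub> | Suc k \<Rightarrow> incl J k (b i x)) + f (incl J (Suc i) (B i x))"
    unfolding total_diff_incl[OF J x] by (rule functionalD(1)[OF f m incl_mem[OF B_mem[OF x]]])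
  then show ?thesis using functional_at_zero[OF lin_product f] by (simp add: dD_def component_def split: nat.split)
qed

end

text \<open>The indices of the total complex one degree below: the other parity in the periodic case, the cyclic index of
  \<open>n - 1\<close> in the cyclic complex of degree \<open>n > 0\<close>, and none in degree 0.\<close>

definition below :: "nat \<Rightarrow> enat \<Rightarrow> nat set" where
  "below p N = {j. Suc j \<in> idx p N}"

lemma below_periodic: "below \<nu> \<infinity> = idx (Suc \<nu>) \<infinity>"
proof (rule Set.set_eqI)
  fix j
  have "Suc j mod 2 = \<nu> mod 2 \<longleftrightarrow> j mod 2 = Suc \<nu> mod 2" by presburger
  then show "j \<in> below \<nu> \<infinity> \<longleftrightarrow> j \<in> idx (Suc \<nu>) \<infinity>" by (simp only: below_def idx_def mem_Collect_eq enat_ord_code)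
qed

lemma below_cyclic: "below (Suc n) (enat (Suc n)) = idx n (enat n)"
proof (rule Set.set_eqI)
  fix j
  have "Suc j mod 2 = Suc n mod 2 \<longleftrightarrow> j mod 2 = n mod 2" by presburger
  then show "j \<in> below (Suc n) (enat (Suc n)) \<longleftrightarrow> j \<in> idx n (enat n)"
    by (simp only: below_def idx_def mem_Collect_eq enat_ord_simps Suc_le_mono)
qed

lemma adjacent_below: "adjacent (below p N) (idx p N)"
  unfolding adjacent_def
proof (intro ballI conjI allI impI)
  fix j assume j: "j \<in> below p N"
  then show "Suc j \<in> idx p N" by (simp add: below_def)
  show "i \<in> idx p N" if "j = Suc i" for i using j that idx_two[of i p N] by (simp add: below_def)
qed

context coexact_mixed
begin

text \<open>The components of a cocycle form a finitely supported family, which can be stripped to degree 0. In the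
  truncated complex the support of the bounding family stays below the truncation, so that it is a functional
  on the shorter product. The bottom component is compared on boundaries only: there it agrees with the coboundary,
  and the difference of the two descends to the cokernel of \<^term>\<open>b\<close>.\<close>

lemma cocycle_strip:
  assumes f: "functional (P (idx p N)) f"
    and cyc: "\<forall>w\<in>carrier (P (idx (Suc p) (eSuc N))). f (tot (idx p N) w) = 0"
  shows "\<exists>G. functional (P (below p N)) G \<and>
    (\<forall>i\<in>idx p N. 0 < i \<longrightarrow> (\<forall>x\<in>carrier (M i). f (incl (idx p N) i x) = G (tot (below p N) (incl (idx p N) i x)))) \<and>
    (0 \<in> idx p N \<longrightarrow> (\<forall>x\<in>carrier (M (Suc 0)).
      f (incl (idx p N) 0 (b (Suc 0) x)) = G (tot (below p N) (incl (idx p N) 0 (b (Suc 0) x)))))"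
proof -
  let ?J = "idx p N" and ?J' = "idx (Suc p) (eSuc N)" and ?L = "below p N"
  let ?F = "component ?J f"
  note JJ = adjacent_idx[of p N] and below_adj = adjacent_below[of p N]
  note F = functional_component[OF f]
  have Fcyc: "dD ?F i x = 0" if x: "x \<in> carrier (M i)" for i x
  proof (cases "i \<in> ?J'")
    case True
    have "f (tot ?J (incl ?J' i x)) = 0" by (rule bspec[OF cyc incl_mem[OF x]])
    then show ?thesis unfolding functional_total_diff_incl[OF JJ f x] .
  next
    case False
    have 1: "Suc i \<notin> ?J"
    proof
      assume "Suc i \<in> ?J"
      from adjacentD[OF JJ this] show False using False by simp
    qed
    have 2: "k \<notin> ?J" if "i = Suc k" for k
    proof
      assume "k \<in> ?J"
      from adjacentD[OF JJ this] show False using False that by simp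
    qed
    show ?thesis
    proof (cases i)
      case 0
      then show ?thesis using component_outside[OF f 1] by (simp add: dD_def)
    next
      case (Suc k)
      then show ?thesis using component_outside[OF f 1] component_outside[OF f 2[OF Suc]] by (simp add: dD_def)
    qed
  qed
  have "\<exists>K. (\<forall>j>K. \<forall>x\<in>carrier (M j). ?F j x = 0) \<and> (\<forall>k. N = enat k \<longrightarrow> K = k)"
  proof (cases N)
    case infinity
    then show ?thesis using component_bounded[OF f] by simp
  next
    case (enat k)
    have out: "j \<notin> ?J" if "k < j" for j using that enat by (simp add: idx_def)
    show ?thesis
    proof (intro exI[of _ k] conjI allI impI ballI)
      show "?F j x = 0" if "k < j" for j x by (rule component_outside[OF f out[OF that]])
      show "k = k'" if "N = enat k'" for k' using that enat by simp
    qed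
  qed
  then obtain K where K0: "\<forall>j>K. \<forall>x\<in>carrier (M j). ?F j x = 0" and K2: "\<forall>k. N = enat k \<longrightarrow> K = k" by (elim exE conjE)
  have K1: "?F j x = 0" if "K < j" "x \<in> carrier (M j)" for j x using K0 that by simp
  have "\<exists>G. (\<forall>j. functional (M j) (G j)) \<and> (\<forall>j\<ge>K. \<forall>x\<in>carrier (M j). G j x = 0) \<and>
      (\<forall>i>0. \<forall>x\<in>carrier (M i). ?F i x = dD G i x)"
    by (rule strip[OF F K1 Fcyc])
  then obtain G where G1: "\<forall>j. functional (M j) (G j)" and G2: "\<forall>j\<ge>K. \<forall>x\<in>carrier (M j). G j x = 0"
    and G3: "\<forall>i>0. \<forall>x\<in>carrier (M i). ?F i x = dD G i x" by (elim exE conjE)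
  note G = G1[THEN spec] G2[rule_format] G3[rule_format]
  define H where "H y = (\<Sum>j\<in>{..K} \<inter> ?L. G j (y j))" for y
  have H: "functional (P ?L) H"
    unfolding H_def[abs_def] by (rule functional_sum, rule functional_proj[OF G(1)], simp)
  have HG: "component ?L H j x = G j x" if j: "j mod 2 \<noteq> p mod 2" and x: "x \<in> carrier (M j)" for j x
  proof (cases "j \<in> ?L \<and> j \<le> K")
    case True
    have "component ?L H j x = (\<Sum>i\<in>{..K} \<inter> ?L. if i = j then G j x else 0)"
      unfolding component_def H_def using functional_at_zero[OF S.lin_space_axioms G(1)]
      by (intro sum.cong) (auto simp: incl_def)
    then show ?thesis using True by simp
  next
    case False
    have "component ?L H j x = 0"
      unfolding component_def H_def using functional_at_zero[OF S.lin_space_axioms G(1)] False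
      by (intro sum.neutral) (auto simp: incl_def)
    moreover have "K \<le> j"
    proof (cases "j \<in> ?L")
      case True
      then show ?thesis using False by auto
    next
      case False
      moreover have "Suc j mod 2 = p mod 2" using j by presburger
      ultimately have "\<not> enat (Suc j) \<le> N" by (simp add: below_def idx_def)
      then show ?thesis using K2 by (cases N) simp_all
    qed
    ultimately show ?thesis using G(2)[of j x] x by simp
  qed
  have HD: "dD (component ?L H) i x = dD G i x" if i: "i \<in> ?J" and x: "x \<in> carrier (M i)" for i x
  proof -
    have ip: "i mod 2 = p mod 2" using i by (simp add: idx_def)
    have p: "Suc i mod 2 \<noteq> p mod 2" using ip by presburger
    have q: "k mod 2 \<noteq> p mod 2" if "i = Suc k" for k using ip that by presburger
    show ?thesis
    proof (cases i)
      case 0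
      then show ?thesis using HG[OF p B_mem[OF x]] by (simp add: dD_def)
    next
      case (Suc k)
      have "b i x \<in> carrier (M k)" using x Suc by simp
      from HG[OF q[OF Suc] this] show ?thesis using HG[OF p B_mem[OF x]] Suc by (simp add: dD_def)
    qed
  qed
  show ?thesis
  proof (intro exI[of _ H] conjI H ballI impI)
    fix i x assume i: "i \<in> ?J" "0 < i" and x: "x \<in> carrier (M i)"
    show "f (incl ?J i x) = H (tot ?L (incl ?J i x))"
      unfolding functional_total_diff_incl[OF below_adj H x] HD[OF i(1) x] using G(3)[OF i(2) x] by (simp add: component_def)
  next
    fix x assume x: "x \<in> carrier (M (Suc 0))" and 0: "0 \<in> ?J"
    have bx: "b (Suc 0) x \<in> carrier (M 0)" using x by simp
    have Bx: "B (Suc 0) x \<in> carrier (M (Suc (Suc 0)))" using x by simp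
    have "?F 0 (b (Suc 0) x) = - ?F (Suc (Suc 0)) (B (Suc 0) x)"
      using Fcyc[OF x] by (simp add: dD_def eq_neg_iff_add_eq_0)
    also have "?F (Suc (Suc 0)) (B (Suc 0) x) = G (Suc 0) (b (Suc (Suc 0)) (B (Suc 0) x))"
      using G(3)[OF _ Bx] BB[OF x] functional_at_zero[OF S.lin_space_axioms G(1)] by (simp add: dD_def)
    also have "G (Suc 0) (b (Suc (Suc 0)) (B (Suc 0) x)) = - G (Suc 0) (B 0 (b (Suc 0) x))"
      using functionalD(1)[OF G(1), of "b (Suc (Suc 0)) (B (Suc 0) x)" "Suc 0" "B 0 (b (Suc 0) x)"] bB[OF x] x
        functional_at_zero[OF S.lin_space_axioms G(1)] by (simp add: eq_neg_iff_add_eq_0)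
    finally have "?F 0 (b (Suc 0) x) = dD G 0 (b (Suc 0) x)" by (simp add: dD_def)
    then show "f (incl ?J 0 (b (Suc 0) x)) = H (tot ?L (incl ?J 0 (b (Suc 0) x)))"
      unfolding functional_total_diff_incl[OF below_adj H bx] HD[OF 0 bx] by (simp add: component_def)
  qed
qed

end

text \<open>The pairing \<^term>\<open>\<theta>\<close> identifies \<^term>\<open>Z\<close> with the functionals in degree 0 that vanish on boundaries.\<close>

locale augmented_coexact_mixed = coexact_mixed M b B for M :: "nat \<Rightarrow> 'm lcs" and b B +
  fixes Z :: "(complex, 'z, 'k) module_scheme" and \<theta> :: "'z \<Rightarrow> 'm \<Rightarrow> complex"
  assumes Z: "lin_space Z" and \<theta>: "z \<in> carrier Z \<Longrightarrow> functional (M 0) (\<theta> z)"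
    and \<theta>_b: "z \<in> carrier Z \<Longrightarrow> x \<in> carrier (M (Suc 0)) \<Longrightarrow> \<theta> z (b (Suc 0) x) = 0"
    and \<theta>_add: "y \<in> carrier Z \<Longrightarrow> z \<in> carrier Z \<Longrightarrow> x \<in> carrier (M 0) \<Longrightarrow> \<theta> (y \<oplus>\<^bsub>Z\<^esub> z) x = \<theta> y x + \<theta> z x"
    and \<theta>_smult: "z \<in> carrier Z \<Longrightarrow> x \<in> carrier (M 0) \<Longrightarrow> \<theta> (c \<odot>\<^bsub>Z\<^esub> z) x = c * \<theta> z x"
    and \<theta>_onto: "functional (M 0) F \<Longrightarrow> (\<And>x. x \<in> carrier (M (Suc 0)) \<Longrightarrow> F (b (Suc 0) x) = 0) \<Longrightarrow>
        \<exists>z\<in>carrier Z. \<forall>x\<in>carrier (M 0). F x = \<theta> z x"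
    and \<theta>_inj: "z \<in> carrier Z \<Longrightarrow> (\<And>x. x \<in> carrier (M 0) \<Longrightarrow> \<theta> z x = 0) \<Longrightarrow> z = \<zero>\<^bsub>Z\<^esub>"
begin

text \<open>Odd cocycles have no component in degree 0, so stripping shows that they are coboundaries. An even cocycle is
  cohomologous to its component in degree 0, corrected to vanish on boundaries, and this representative is unique.\<close>

lemma total_cohomology:
  fixes p N
  defines "J \<equiv> idx p N" and "J' \<equiv> idx (Suc p) (eSuc N)" and "J0 \<equiv> below p N"
  defines "H \<equiv> homology_at (strong_dual (P J0)) (dual_map (P J) (tot J0)) (strong_dual (P J))
      (dual_map (P J') (tot J)) (strong_dual (P J'))"
  shows odd_cohomology: "odd p \<Longrightarrow> zero_space H" and even_cohomology: "even p \<Longrightarrow> H \<cong>\<^sub>l\<^sub>i\<^sub>n Z"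
proof -
  note defs = J_def J'_def J0_def
  note JJ = adjacent_idx[of p N, folded defs] and J0 = adjacent_below[of p N, folded defs]
  have ls: "lin_space (strong_dual (P I))" for I by (rule lin_space_strong_dual[OF lin_product topspace_product])
  note d0 = total_diff_continuous[OF J0] and d1 = total_diff_continuous[OF JJ]
  have l0: "linear_map (strong_dual (P J0)) (strong_dual (P J)) (dual_map (P J) (tot J0))"
    by (rule linear_dual_map[OF lin_product topspace_product d0])
  have l1: "linear_map (strong_dual (P J)) (strong_dual (P J')) (dual_map (P J') (tot J))"
    by (rule linear_dual_map[OF lin_product topspace_product d1])
  have image: "f \<in> dual_map (P J) (tot J0) ` carrier (strong_dual (P J0))"
    if f: "f \<in> carrier (strong_dual (P J))" and G: "functional (P J0) G"
      and eq: "\<And>i x. i \<in> J \<Longrightarrow> x \<in> carrier (M i) \<Longrightarrow> f (incl J i x) = G (tot J0 (incl J i x))" for f G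
  proof (rule dual_imageI[OF lin_product topspace_product linear_total_diff[OF adjacentD[OF J0]] f G])
    show "f x = G (tot J0 x)" if "x \<in> carrier (P J)" for x
      by (rule functional_ext[OF _ continuous_linear_compose[OF d0 G] eq that]) (use f in auto)
  qed
  show "zero_space H" if odd: "odd p"
    unfolding H_def zero_homology_iff[OF ls ls l0, where g = "dual_map (P J') (tot J)" and Y = "strong_dual (P J')", OF linear_map_zero[OF ls ls l1]]
  proof (intro ballI impI)
    fix f assume f: "f \<in> carrier (strong_dual (P J))" "dual_map (P J') (tot J) f = \<zero>\<^bsub>strong_dual (P J')\<^esub>"
    have fc: "functional (P J) f" using f(1) by simp
    note fz = f(2)[unfolded dual_map_zero_iff]
    from cocycle_strip[OF fc[unfolded defs] fz[unfolded defs]]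
    obtain G where G: "functional (P J0) G" and G2: "\<forall>i\<in>J. 0 < i \<longrightarrow> (\<forall>x\<in>carrier (M i). f (incl J i x) = G (tot J0 (incl J i x)))"
      unfolding defs by (elim exE conjE)
    have "0 < i" if "i \<in> J" for i using that odd by (cases i) (auto simp: defs idx_def odd_iff_mod_2_eq_one)
    then show "f \<in> dual_map (P J) (tot J0) ` carrier (strong_dual (P J0))"
      using G2 by (intro image[OF f(1) G]) simp
  qed
  assume p: "even p"
  have 0: "0 \<in> J" using p by (auto simp: defs idx_def even_iff_mod_2_eq_zero simp flip: zero_enat_def)
  let ?\<psi> = "\<lambda>z. \<lambda>x\<in>carrier (P J). \<theta> z (x 0)"
  have \<psi>f: "functional (P J) (\<lambda>x. \<theta> z (x 0))" if "z \<in> carrier Z" for z by (rule functional_proj[OF \<theta>[OF that] 0])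
  have \<psi>m: "?\<psi> z \<in> carrier (strong_dual (P J))" if "z \<in> carrier Z" for z
    using functional_cong[OF lin_product topspace_product \<psi>f[OF that], of "?\<psi> z"] by simp
  have x0: "x 0 \<in> carrier (M 0)" if "x \<in> carrier (P J)" for x using that 0 by auto
  show "H \<cong>\<^sub>l\<^sub>i\<^sub>n Z"
    unfolding H_def
  proof (rule homology_iso_section[OF ls ls l0 Z, where \<psi> = ?\<psi>])
    show "linear_map Z (strong_dual (P J)) ?\<psi>"
    proof (rule linear_mapI)
      show "?\<psi> z \<in> carrier (strong_dual (P J))" if "z \<in> carrier Z" for z by (rule \<psi>m[OF that])
      show "?\<psi> (y \<oplus>\<^bsub>Z\<^esub> z) = ?\<psi> y \<oplus>\<^bsub>strong_dual (P J)\<^esub> ?\<psi> z" if "y \<in> carrier Z" "z \<in> carrier Z" for y z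
        using \<theta>_add[OF that x0] by (auto simp: fun_eq_iff simp del: lcs_product_sel)
      show "?\<psi> (c \<odot>\<^bsub>Z\<^esub> z) = c \<odot>\<^bsub>strong_dual (P J)\<^esub> ?\<psi> z" if "z \<in> carrier Z" for c z
        using \<theta>_smult[OF that x0] by (auto simp: fun_eq_iff simp del: lcs_product_sel)
    qed
    fix z assume z: "z \<in> carrier Z"
    show "dual_map (P J') (tot J) (?\<psi> z) = \<zero>\<^bsub>strong_dual (P J')\<^esub>"
      unfolding dual_map_zero_iff
    proof
      fix w assume w: "w \<in> carrier (P J')"
      have w1: "w (Suc 0) \<in> carrier (M (Suc 0))" using w adjacentD[OF JJ 0] by auto
      have "tot J w 0 = b (Suc 0) (w (Suc 0))" using 0 D_0[of w, OF w1] by (simp add: total_diff_eq)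
      then show "?\<psi> z (tot J w) = 0"
        using \<theta>_b[OF z w1] linear_mapD(1)[OF linear_total_diff[OF adjacentD[OF JJ]] w] by simp
    qed
    assume "?\<psi> z \<in> dual_map (P J) (tot J0) ` carrier (strong_dual (P J0))"
    then obtain g where g: "functional (P J0) g" "?\<psi> z = dual_map (P J) (tot J0) g" by auto
    have val: "\<theta> z (y 0) = g (tot J0 y)" if "y \<in> carrier (P J)" for y
      using fun_cong[OF g(2), of y] that by (simp add: dual_map_def del: lcs_product_sel)
    from component_bounded[OF g(1)] obtain K where K: "\<forall>j>K. \<forall>x\<in>carrier (M j). component J0 g j x = 0" by (rule exE)
    have i0: "incl J i x 0 = \<zero>\<^bsub>M 0\<^esub>" if "0 < i" for i x using that 0 by (simp add: incl_def)
    have cyc0: "dD (component J0 g) i x = 0" if i: "0 < i" and x: "x \<in> carrier (M i)" for i x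
    proof -
      have "\<theta> z (incl J i x 0) = 0" unfolding i0[OF i] by (rule functional_at_zero[OF S.lin_space_axioms \<theta>[OF z]])
      then show ?thesis using val[OF incl_mem[OF x]] functional_total_diff_incl[OF J0 g(1) x] by simp
    qed
    have nc: "dD (component J0 g) 0 x = 0" if "x \<in> carrier (M 0)" for x
      by (rule no_coboundary[where K = K, OF functional_component[OF g(1)] K[rule_format] cyc0 that])
    show "z = \<zero>\<^bsub>Z\<^esub>"
    proof (rule \<theta>_inj[OF z])
      fix x assume x: "x \<in> carrier (M 0)"
      have "\<theta> z x = \<theta> z (incl J 0 x 0)" using 0 by (simp add: incl_def)
      then show "\<theta> z x = 0"
        using nc[OF x] val[OF incl_mem[OF x]] functional_total_diff_incl[OF J0 g(1) x] by simp
    qed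
  next
    fix f assume f: "f \<in> carrier (strong_dual (P J))" "dual_map (P J') (tot J) f = \<zero>\<^bsub>strong_dual (P J')\<^esub>"
    have fc: "functional (P J) f" using f(1) by simp
    note fz = f(2)[unfolded dual_map_zero_iff]
    from cocycle_strip[OF fc[unfolded defs] fz[unfolded defs]]
    obtain G where G1: "functional (P J0) G"
      and G2: "\<forall>i\<in>J. 0 < i \<longrightarrow> (\<forall>x\<in>carrier (M i). f (incl J i x) = G (tot J0 (incl J i x)))"
      and G3: "0 \<in> J \<longrightarrow> (\<forall>x\<in>carrier (M (Suc 0)). f (incl J 0 (b (Suc 0) x)) = G (tot J0 (incl J 0 (b (Suc 0) x))))"
      unfolding defs by (elim exE conjE)
    note G = G1 G2[rule_format] G3[rule_format]
    have dG: "functional (P J) (\<lambda>x. G (tot J0 x))" by (rule continuous_linear_compose[OF d0 G(1)])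
    have "functional (M 0) (\<lambda>x. f (incl J 0 x) - G (tot J0 (incl J 0 x)))"
      by (rule continuous_linear_compose[OF incl_continuous functional_diff[OF fc dG]])
    then obtain z where z: "z \<in> carrier Z" "\<And>x. x \<in> carrier (M 0) \<Longrightarrow> f (incl J 0 x) - G (tot J0 (incl J 0 x)) = \<theta> z x"
      using \<theta>_onto[of "\<lambda>x. f (incl J 0 x) - G (tot J0 (incl J 0 x))"] G(3) 0 by auto
    have "f \<ominus>\<^bsub>strong_dual (P J)\<^esub> ?\<psi> z \<in> dual_map (P J) (tot J0) ` carrier (strong_dual (P J0))"
    proof (rule image[OF lin_space.diff_mem[OF ls f(1) \<psi>m[OF z(1)]] G(1)])
      fix i x assume i: "i \<in> J" and x: "x \<in> carrier (M i)"
      have "(f \<ominus>\<^bsub>strong_dual (P J)\<^esub> ?\<psi> z) (incl J i x) = f (incl J i x) - \<theta> z (incl J i x 0)"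
        unfolding strong_dual_minus[OF lin_product topspace_product f(1) \<psi>m[OF z(1)]] using incl_mem[OF x, of J]
        by (simp del: lcs_product_sel)
      also have "\<dots> = G (tot J0 (incl J i x))"
      proof (cases "i = 0")
        case True
        then show ?thesis using z(2)[of x] x 0 by (simp add: incl_def algebra_simps)
      next
        case False
        then have "incl J i x 0 = \<zero>\<^bsub>M 0\<^esub>" using 0 by (simp add: incl_def)
        then show ?thesis using G(2)[OF i _ x] False functional_at_zero[OF S.lin_space_axioms \<theta>[OF z(1)]] by simp
      qed
      finally show "(f \<ominus>\<^bsub>strong_dual (P J)\<^esub> ?\<psi> z) (incl J i x) = G (tot J0 (incl J i x))" .
    qed
    then show "\<exists>z\<in>carrier Z. f \<ominus>\<^bsub>strong_dual (P J)\<^esub> ?\<psi> z \<in> dual_map (P J) (tot J0) ` carrier (strong_dual (P J0))"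
      using z(1) by blast
  qed
qed

end

subsection \<open>The three homology theories of an exact mixed complex\<close>

lemma homology_image_cong: "f ` carrier W = f' ` carrier W' \<Longrightarrow> homology_at W f X g Y = homology_at W' f' X g Y"
  by (simp only: homology_at_def)

lemma idx_parity: "p mod 2 = q mod 2 \<Longrightarrow> idx p N = idx q N"
  by (simp add: idx_def)

context mixed
begin

lemma total_diff_zero_iff: "tot J x = \<zero>\<^bsub>P J\<^esub> \<longleftrightarrow> (\<forall>j\<in>J. D x j = \<zero>\<^bsub>M j\<^esub>)"
  unfolding total_diff_eq lcs_product_sel by (simp add: restrict_def fun_eq_iff Ball_def)

lemma cyclic_complex_idx: "cyclic_complex M n = P (idx n (enat n))"
  by (simp only: cyclic_complex_def cyclic_index_idx)

lemma periodic_complex_idx: "periodic_complex M \<nu> = P (idx \<nu> \<infinity>)"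
  by (simp only: periodic_complex_def periodic_index_idx)

lemma cyclic_diff_Suc: "cyclic_diff M b B (Suc n) = tot (idx n (enat n))"
  by (simp add: cyclic_diff_def cyclic_index_idx)

lemma cyclic_diff_0: "cyclic_diff M b B 0 = (\<lambda>_. \<zero>\<^bsub>P (idx 0 (enat 0))\<^esub>)"
  by (simp add: cyclic_diff_def cyclic_complex_idx)

lemma below_0: "below 0 (enat 0) = {}"
  by (simp add: below_def idx_def)

lemma periodic_diff_idx: "periodic_diff M b B \<nu> = tot (idx (Suc \<nu>) \<infinity>)"
  by (simp add: periodic_diff_def periodic_index_idx)

lemma periodic_diff_Suc: "periodic_diff M b B (Suc \<nu>) = tot (idx \<nu> \<infinity>)"
  using idx_parity[of "Suc (Suc \<nu>)" \<nu> \<infinity>] by (simp add: periodic_diff_idx)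

lemma lin_cyclic: "lin_space (cyclic_complex M n)"
  unfolding cyclic_complex_idx by (rule lin_product)

lemma cyclic_diff_linear: "linear_map (P (idx n (enat n))) (cyclic_complex M (n - 1)) (cyclic_diff M b B n)"
proof (cases n)
  case 0
  then show ?thesis using linear_map_const_zero[OF lin_product lin_product] by (simp only: cyclic_complex_idx cyclic_diff_0 diff_0_eq_0)
next
  case (Suc m)
  show ?thesis
    unfolding Suc diff_Suc_1 cyclic_complex_idx cyclic_diff_Suc
    by (rule linear_total_diff_idx[of m "enat m", unfolded eSuc_enat])
qed

lemma cyclic_diff_zero_iff:
  "cyclic_diff M b B n x = \<zero>\<^bsub>cyclic_complex M (n - 1)\<^esub> \<longleftrightarrow> (\<forall>j. Suc j \<in> idx n (enat n) \<longrightarrow> D x j = \<zero>\<^bsub>M j\<^esub>)"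
proof (cases n)
  case 0
  then show ?thesis using below_0 by (simp add: cyclic_complex_idx cyclic_diff_0 below_def del: lcs_product_sel)
next
  case (Suc m)
  have "(\<forall>j. Suc j \<in> idx n (enat n) \<longrightarrow> D x j = \<zero>\<^bsub>M j\<^esub>) \<longleftrightarrow> (\<forall>j\<in>idx m (enat m). D x j = \<zero>\<^bsub>M j\<^esub>)"
    unfolding Suc below_cyclic[of m, symmetric] below_def by (simp only: mem_Collect_eq Ball_def)
  then show ?thesis unfolding Suc diff_Suc_1 cyclic_complex_idx cyclic_diff_Suc total_diff_zero_iff by simp
qed

lemma periodic_diff_linear: "linear_map (P (idx \<nu> \<infinity>)) (P (idx (Suc \<nu>) \<infinity>)) (periodic_diff M b B \<nu>)"
  unfolding periodic_diff_idx below_periodic[symmetric] by (rule linear_total_diff[OF adjacentD[OF adjacent_below]])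

lemma periodic_diff_zero_iff:
  "periodic_diff M b B \<nu> x = \<zero>\<^bsub>P (idx (Suc \<nu>) \<infinity>)\<^esub> \<longleftrightarrow> (\<forall>j. Suc j \<in> idx \<nu> \<infinity> \<longrightarrow> D x j = \<zero>\<^bsub>M j\<^esub>)"
  unfolding periodic_diff_idx total_diff_zero_iff below_periodic[symmetric] by (simp add: below_def)

lemma eSuc_infinity: "eSuc \<infinity> = \<infinity>"
  by simp

text \<open>The cyclic and the periodic theory become instances of one complex; \<open>eSuc\<close> raises the truncation by one and
  fixes \<open>\<infinity>\<close>.\<close>

lemma cyclic_homology_idx:
  "chain_homology (cyclic_complex M) (cyclic_diff M b B) n =
    homology_at (P (idx (Suc n) (eSuc (enat n)))) (tot (idx n (enat n))) (P (idx n (enat n)))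
      (cyclic_diff M b B n) (cyclic_complex M (n - 1))"
  unfolding chain_homology_def Suc_eq_plus1[symmetric] cyclic_diff_Suc cyclic_complex_idx eSuc_enat ..

lemma periodic_homology_idx:
  "periodic_homology M b B \<nu> =
    homology_at (P (idx (Suc \<nu>) (eSuc \<infinity>))) (tot (idx \<nu> \<infinity>)) (P (idx \<nu> \<infinity>))
      (periodic_diff M b B \<nu>) (P (idx (Suc \<nu>) \<infinity>))"
  unfolding periodic_homology_def Suc_eq_plus1[symmetric] periodic_diff_Suc periodic_complex_idx eSuc_infinity ..

lemma b_0_cont: "continuous_linear (M 0) (M 0) (b 0)"
  by (rule continuous_linear_cong[OF lc _ continuous_linear_const_zero[OF lc lc]]) (simp add: b_0)

end

text \<open>The map \<^term>\<open>\<rho>\<close> identifies \<^term>\<open>Z\<close> with the cokernel of \<^term>\<open>b\<close> in degree 0.\<close>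

locale augmented_exact_mixed = exact_mixed M b B for M :: "nat \<Rightarrow> 'm lcs" and b B +
  fixes Z :: "(complex, 'z, 'k) module_scheme" and \<rho> :: "'m \<Rightarrow> 'z"
  assumes \<rho>_linear: "linear_map (M 0) Z \<rho>" and \<rho>_onto: "\<rho> ` carrier (M 0) = carrier Z"
    and \<rho>_eq: "u \<in> carrier (M 0) \<Longrightarrow> v \<in> carrier (M 0) \<Longrightarrow> \<rho> u = \<rho> v \<longleftrightarrow> u \<ominus>\<^bsub>M 0\<^esub> v \<in> b (Suc 0) ` carrier (M (Suc 0))"
begin

lemma positive_homology: "0 < n \<Longrightarrow> zero_space (chain_homology M b n)"
proof -
  assume "0 < n"
  then obtain m where n: "n = Suc m" by (cases n) auto
  show ?thesis
    unfolding chain_homology_def n diff_Suc_1 Suc_eq_plus1[symmetric]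
      zero_homology_iff[OF S.lin_space_axioms S.lin_space_axioms b_lin, where g = "b (Suc m)" and Y = "M m", OF b_zero]
  proof (intro ballI impI)
    fix x assume x: "x \<in> carrier (M (Suc m))" "b (Suc m) x = \<zero>\<^bsub>M m\<^esub>"
    have "\<exists>w\<in>carrier (M (Suc (Suc m))). b (Suc (Suc m)) w = x" by (rule exact) (use x in simp_all)
    then obtain w where "w \<in> carrier (M (Suc (Suc m)))" "b (Suc (Suc m)) w = x" by (elim bexE)
    then show "x \<in> b (Suc (Suc m)) ` carrier (M (Suc (Suc m)))" by (intro image_eqI[of _ _ w]) simp_all
  qed
qed

lemma degree_0_homology: "chain_homology M b 0 \<cong>\<^sub>l\<^sub>i\<^sub>n Z"
proof -
  have k: "a_kernel (M 0) (M 0) (b 0) = carrier (M 0)" using b_0 by (auto simp: a_kernel_mem)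
  show ?thesis
    unfolding chain_homology_def diff_0_eq_0 Suc_eq_plus1[symmetric]
  proof (rule homology_iso[OF S.lin_space_axioms S.lin_space_axioms b_lin S.lin_space_axioms, where \<phi> = \<rho>], unfold k)
    show "linear_map (M 0) (M 0) (b 0)" using b_0_cont by (simp add: continuous_linear_def)
  qed (rule \<rho>_onto linear_mapD(2,3)[OF \<rho>_linear] \<rho>_eq; assumption)+
qed

lemma odd_cyclic_homology: "odd n \<Longrightarrow> zero_space (chain_homology (cyclic_complex M) (cyclic_diff M b B) n)"
  unfolding cyclic_homology_idx
  by (rule odd_homology[OF _ cyclic_diff_zero_iff linear_map_zero[OF lin_product lin_cyclic cyclic_diff_linear]])

lemma even_cyclic_homology: "even n \<Longrightarrow> chain_homology (cyclic_complex M) (cyclic_diff M b B) n \<cong>\<^sub>l\<^sub>i\<^sub>n Z"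
  unfolding cyclic_homology_idx
  by (rule even_homology[OF _ lin_cyclic cyclic_diff_linear cyclic_diff_zero_iff \<rho>_linear \<rho>_onto \<rho>_eq])

lemma odd_periodic_homology: "odd \<nu> \<Longrightarrow> zero_space (periodic_homology M b B \<nu>)"
  unfolding periodic_homology_idx
  by (rule odd_homology[OF _ periodic_diff_zero_iff linear_map_zero[OF lin_product lin_product periodic_diff_linear]])

lemma even_periodic_homology: "even \<nu> \<Longrightarrow> periodic_homology M b B \<nu> \<cong>\<^sub>l\<^sub>i\<^sub>n Z"
  unfolding periodic_homology_idx
  by (rule even_homology[OF _ lin_product periodic_diff_linear periodic_diff_zero_iff \<rho>_linear \<rho>_onto \<rho>_eq])

end

context augmented_coexact_mixed
begin

lemma dual_lin: "lin_space (strong_dual (M n))"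
  by (rule lin_space_strong_dual[OF S.lin_space_axioms S.topspace_eq])

lemma dual_b_lin: "linear_map (strong_dual (M n)) (strong_dual (M (Suc n))) (dual_map (M (Suc n)) (b (Suc n)))"
  by (rule linear_dual_map[OF S.lin_space_axioms S.topspace_eq b_cont])

lemma positive_cohomology: "0 < n \<Longrightarrow> zero_space (dual_cohomology M b n)"
proof -
  assume "0 < n"
  then obtain m where n: "n = Suc m" by (cases n) auto
  show ?thesis
    unfolding dual_cohomology_def n diff_Suc_1 Suc_eq_plus1[symmetric]
      zero_homology_iff[OF dual_lin dual_lin dual_b_lin, where g = "dual_map (M (Suc (Suc m))) (b (Suc (Suc m)))" and Y = "strong_dual (M (Suc (Suc m)))",
        OF linear_map_zero[OF dual_lin dual_lin dual_b_lin]] dual_map_zero_iff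
  proof (intro ballI impI)
    fix f assume f: "f \<in> carrier (strong_dual (M (Suc m)))" "\<forall>x\<in>carrier (M (Suc (Suc m))). f (b (Suc (Suc m)) x) = 0"
    have fc: "functional (M (Suc m)) f" using f(1) by simp
    have "\<exists>G. functional (M m) G \<and> (\<forall>x\<in>carrier (M (Suc m)). f x = G (b (Suc m) x))"
      by (rule coexact[OF fc]) (rule bspec[OF f(2)])
    then obtain G where "functional (M m) G" "\<forall>x\<in>carrier (M (Suc m)). f x = G (b (Suc m) x)"
      by (elim exE conjE)
    then show "f \<in> dual_map (M (Suc m)) (b (Suc m)) ` carrier (strong_dual (M m))"
      by (intro dual_imageI[OF S.lin_space_axioms S.topspace_eq b_lin f(1)]) simp_all
  qed
qed

lemma degree_0_cohomology: "dual_cohomology M b 0 \<cong>\<^sub>l\<^sub>i\<^sub>n Z"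
proof -
  have im: "dual_map (M 0) (b 0) g = \<zero>\<^bsub>strong_dual (M 0)\<^esub>" if "functional (M 0) g" for g
    unfolding dual_map_zero_iff using b_0 functional_at_zero[OF S.lin_space_axioms that] by simp
  have b0: "linear_map (strong_dual (M 0)) (strong_dual (M 0)) (dual_map (M 0) (b 0))"
    by (rule linear_dual_map[OF S.lin_space_axioms S.topspace_eq b_0_cont])
  let ?\<psi> = "\<lambda>z. \<lambda>x\<in>carrier (M 0). \<theta> z x"
  have \<psi>m: "?\<psi> z \<in> carrier (strong_dual (M 0))" if "z \<in> carrier Z" for z
    using functional_cong[OF S.lin_space_axioms S.topspace_eq \<theta>[OF that], of "?\<psi> z"] by simp
  show ?thesis
    unfolding dual_cohomology_def diff_0_eq_0 Suc_eq_plus1[symmetric]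
  proof (rule homology_iso_section[OF dual_lin dual_lin b0 Z, where \<psi> = ?\<psi>])
    show "linear_map Z (strong_dual (M 0)) ?\<psi>"
      by (rule linear_mapI[OF \<psi>m]) (auto simp: fun_eq_iff \<theta>_add \<theta>_smult)
    fix z assume z: "z \<in> carrier Z"
    show "dual_map (M (Suc 0)) (b (Suc 0)) (?\<psi> z) = \<zero>\<^bsub>strong_dual (M (Suc 0))\<^esub>"
      unfolding dual_map_zero_iff using \<theta>_b[OF z] by simp
    assume "?\<psi> z \<in> dual_map (M 0) (b 0) ` carrier (strong_dual (M 0))"
    then have "?\<psi> z = \<zero>\<^bsub>strong_dual (M 0)\<^esub>" using im by auto
    then have eq: "?\<psi> z x = (\<lambda>x\<in>carrier (M 0). 0) x" for x by (simp only: strong_dual_sel)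
    show "z = \<zero>\<^bsub>Z\<^esub>"
    proof (rule \<theta>_inj[OF z])
      show "\<theta> z x = 0" if "x \<in> carrier (M 0)" for x using eq[of x] that by simp
    qed
  next
    fix f assume f: "f \<in> carrier (strong_dual (M 0))" "dual_map (M (Suc 0)) (b (Suc 0)) f = \<zero>\<^bsub>strong_dual (M (Suc 0))\<^esub>"
    have "functional (M 0) f" using f(1) by simp
    then have "\<exists>z\<in>carrier Z. \<forall>x\<in>carrier (M 0). f x = \<theta> z x"
      by (rule \<theta>_onto) (rule bspec[OF f(2)[unfolded dual_map_zero_iff]])
    then obtain z where z: "z \<in> carrier Z" "\<forall>x\<in>carrier (M 0). f x = \<theta> z x" by (elim bexE)
    have "?\<psi> z = f" using f(1) z(2) by (auto simp: fun_eq_iff extensional_def)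
    then have "f \<ominus>\<^bsub>strong_dual (M 0)\<^esub> ?\<psi> z = \<zero>\<^bsub>strong_dual (M 0)\<^esub>"
      using lin_space.diff_self[OF dual_lin f(1)] by simp
    then show "\<exists>z\<in>carrier Z. f \<ominus>\<^bsub>strong_dual (M 0)\<^esub> ?\<psi> z \<in> dual_map (M 0) (b 0) ` carrier (strong_dual (M 0))"
      using lin_subspaceD(2)[OF linear_image_subspace[OF dual_lin dual_lin b0]] z(1) by (intro bexI[of _ z]) simp_all
  qed
qed

text \<open>In degree 0 the differential into the dual space is the transpose of the zero operator on the complex of degree 0
  itself, whereas the index set below is empty. Both have image zero, which is all that enters homology.\<close>

lemma cyclic_cohomology_idx:
  "dual_cohomology (cyclic_complex M) (cyclic_diff M b B) n =
    homology_at (strong_dual (P (below n (enat n)))) (dual_map (P (idx n (enat n))) (tot (below n (enat n))))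
      (strong_dual (P (idx n (enat n)))) (dual_map (P (idx (Suc n) (eSuc (enat n)))) (tot (idx n (enat n))))
      (strong_dual (P (idx (Suc n) (eSuc (enat n)))))"
proof (cases n)
  case (Suc m)
  show ?thesis
    unfolding dual_cohomology_def Suc diff_Suc_1 Suc_eq_plus1[symmetric] cyclic_diff_Suc cyclic_complex_idx eSuc_enat below_cyclic ..
next
  case 0
  let ?J = "idx 0 (enat 0)"
  have z: "dual_map (P ?J) h g = \<zero>\<^bsub>strong_dual (P ?J)\<^esub>"
    if "functional (P I) g" "\<And>x. x \<in> carrier (P ?J) \<Longrightarrow> h x = \<zero>\<^bsub>P I\<^esub>" for g h I
    unfolding dual_map_zero_iff using that(2) functional_at_zero[OF lin_product that(1)] by simp
  have ne: "\<zero>\<^bsub>strong_dual (P I)\<^esub> \<in> carrier (strong_dual (P I))" for I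
  proof -
    interpret D: lin_space "strong_dual (P I)" by (rule lin_space_strong_dual[OF lin_product topspace_product])
    show ?thesis by (rule D.M.zero_closed)
  qed
  have im: "dual_map (P ?J) h ` carrier (strong_dual (P I)) = {\<zero>\<^bsub>strong_dual (P ?J)\<^esub>}"
    if h: "\<And>x. x \<in> carrier (P ?J) \<Longrightarrow> h x = \<zero>\<^bsub>P I\<^esub>" for h I
  proof -
    have "dual_map (P ?J) h g = \<zero>\<^bsub>strong_dual (P ?J)\<^esub>" if "g \<in> carrier (strong_dual (P I))" for g
    proof (rule z[OF _ h])
      show "functional (P I) g" using that by (simp del: lcs_product_sel)
    qed
    then have "dual_map (P ?J) h ` carrier (strong_dual (P I)) = (\<lambda>_. \<zero>\<^bsub>strong_dual (P ?J)\<^esub>) ` carrier (strong_dual (P I))"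
      by (rule image_cong[OF refl])
    then show ?thesis unfolding image_constant[OF ne] .
  qed
  have e: "tot {} x = \<zero>\<^bsub>P {}\<^esub>" for x by (simp add: total_diff_zero_iff del: lcs_product_sel)
  show ?thesis
    unfolding dual_cohomology_def 0 diff_0_eq_0 Suc_eq_plus1[symmetric] cyclic_diff_Suc cyclic_complex_idx eSuc_enat below_0 cyclic_diff_0
    by (rule homology_image_cong) (simp only: im[of "\<lambda>_. \<zero>\<^bsub>P ?J\<^esub>" ?J, OF refl] im[of "tot {}" "{}", OF e])
qed

lemma periodic_cohomology_idx:
  "periodic_cohomology M b B \<nu> =
    homology_at (strong_dual (P (below \<nu> \<infinity>))) (dual_map (P (idx \<nu> \<infinity>)) (tot (below \<nu> \<infinity>)))
      (strong_dual (P (idx \<nu> \<infinity>))) (dual_map (P (idx (Suc \<nu>) (eSuc \<infinity>))) (tot (idx \<nu> \<infinity>)))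
      (strong_dual (P (idx (Suc \<nu>) (eSuc \<infinity>))))"
  unfolding periodic_cohomology_def Suc_eq_plus1[symmetric] periodic_diff_Suc periodic_complex_idx eSuc_infinity below_periodic
  unfolding periodic_diff_idx ..

lemma odd_cyclic_cohomology: "odd n \<Longrightarrow> zero_space (dual_cohomology (cyclic_complex M) (cyclic_diff M b B) n)"
  unfolding cyclic_cohomology_idx by (rule odd_cohomology)

lemma even_cyclic_cohomology: "even n \<Longrightarrow> dual_cohomology (cyclic_complex M) (cyclic_diff M b B) n \<cong>\<^sub>l\<^sub>i\<^sub>n Z"
  unfolding cyclic_cohomology_idx by (rule even_cohomology)

lemma odd_periodic_cohomology: "odd \<nu> \<Longrightarrow> zero_space (periodic_cohomology M b B \<nu>)"
  unfolding periodic_cohomology_idx by (rule odd_cohomology)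

lemma even_periodic_cohomology: "even \<nu> \<Longrightarrow> periodic_cohomology M b B \<nu> \<cong>\<^sub>l\<^sub>i\<^sub>n Z"
  unfolding periodic_cohomology_idx by (rule even_cohomology)

end

section \<open>Direct sums and subspaces\<close>

lemma direct_sum_sel [simp]:
  "carrier (X \<oplus>\<^sub>l\<^sub>c\<^sub>s Y) = carrier X \<times> carrier Y" "zero (X \<oplus>\<^sub>l\<^sub>c\<^sub>s Y) = (\<zero>\<^bsub>X\<^esub>, \<zero>\<^bsub>Y\<^esub>)"
  "(x, y) \<oplus>\<^bsub>X \<oplus>\<^sub>l\<^sub>c\<^sub>s Y\<^esub> (x', y') = (x \<oplus>\<^bsub>X\<^esub> x', y \<oplus>\<^bsub>Y\<^esub> y')" "c \<odot>\<^bsub>X \<oplus>\<^sub>l\<^sub>c\<^sub>s Y\<^esub> (x, y) = (c \<odot>\<^bsub>X\<^esub> x, c \<odot>\<^bsub>Y\<^esub> y)"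
  "topo (X \<oplus>\<^sub>l\<^sub>c\<^sub>s Y) = prod_topology (topo X) (topo Y)"
  by (simp_all add: direct_sum_def)

lemma lin_space_direct_sum:
  assumes "lin_space X" "lin_space Y"
  shows "lin_space (X \<oplus>\<^sub>l\<^sub>c\<^sub>s Y)"
proof -
  interpret X: lin_space X by fact
  interpret Y: lin_space Y by fact
  show ?thesis
    by (rule lin_spaceI)
      (auto simp: X.M.a_assoc Y.M.a_assoc X.smult_add_left Y.smult_add_left X.smult_add_right Y.smult_add_right X.smult_smult
        Y.smult_smult X.minus_smult Y.minus_smult X.M.l_neg Y.M.l_neg intro: X.M.a_comm Y.M.a_comm)
qed

lemma direct_sum_minus:
  assumes "lin_space X" "lin_space Y" "x \<in> carrier X" "x' \<in> carrier X" "y \<in> carrier Y" "y' \<in> carrier Y"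
  shows "(x, y) \<ominus>\<^bsub>X \<oplus>\<^sub>l\<^sub>c\<^sub>s Y\<^esub> (x', y') = (x \<ominus>\<^bsub>X\<^esub> x', y \<ominus>\<^bsub>Y\<^esub> y')"
proof -
  interpret X: lin_space X by fact
  interpret Y: lin_space Y by fact
  interpret S: lin_space "X \<oplus>\<^sub>l\<^sub>c\<^sub>s Y" by (rule lin_space_direct_sum[OF assms(1,2)])
  have "\<ominus>\<^bsub>X \<oplus>\<^sub>l\<^sub>c\<^sub>s Y\<^esub> (x', y') = (\<ominus>\<^bsub>X\<^esub> x', \<ominus>\<^bsub>Y\<^esub> y')"
    using S.neg_eq_smult[of "(x', y')"] X.neg_eq_smult[of x'] Y.neg_eq_smult[of y'] assms by simp
  then show ?thesis by (simp add: a_minus_def)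
qed

lemma locally_convex_direct_sum:
  assumes X: "locally_convex X" and Y: "locally_convex Y"
  shows "locally_convex (X \<oplus>\<^sub>l\<^sub>c\<^sub>s Y)"
proof -
  interpret X: locally_convex X by fact
  interpret Y: locally_convex Y by fact
  note fs = continuous_map_fst continuous_map_snd
  note fs2 = fs fs[THEN continuous_map_compose, OF continuous_map_fst] fs[THEN continuous_map_compose, OF continuous_map_snd]
  have add: "continuous_map (prod_topology (topo (X \<oplus>\<^sub>l\<^sub>c\<^sub>s Y)) (topo (X \<oplus>\<^sub>l\<^sub>c\<^sub>s Y))) (topo (X \<oplus>\<^sub>l\<^sub>c\<^sub>s Y)) (\<lambda>(z, w). z \<oplus>\<^bsub>X \<oplus>\<^sub>l\<^sub>c\<^sub>s Y\<^esub> w)"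
  proof -
    let ?f = "\<lambda>u. (((\<lambda>(x, x'). x \<oplus>\<^bsub>X\<^esub> x') \<circ> (\<lambda>u. (fst (fst u), fst (snd u)))) u, ((\<lambda>(y, y'). y \<oplus>\<^bsub>Y\<^esub> y') \<circ> (\<lambda>u. (snd (fst u), snd (snd u)))) u)"
    have "continuous_map (prod_topology (topo (X \<oplus>\<^sub>l\<^sub>c\<^sub>s Y)) (topo (X \<oplus>\<^sub>l\<^sub>c\<^sub>s Y))) (topo (X \<oplus>\<^sub>l\<^sub>c\<^sub>s Y))
        ?f"
      unfolding direct_sum_sel
      by (intro continuous_map_pairedI continuous_map_compose[OF _ X.continuous_add] continuous_map_compose[OF _ Y.continuous_add])
        (use fs2 in \<open>simp_all add: o_def\<close>)
    moreover have "(\<lambda>(z, w). z \<oplus>\<^bsub>X \<oplus>\<^sub>l\<^sub>c\<^sub>s Y\<^esub> w) =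
        ?f"
      by (auto simp: fun_eq_iff)
    ultimately show ?thesis by simp
  qed
  have smult: "continuous_map (prod_topology euclidean (topo (X \<oplus>\<^sub>l\<^sub>c\<^sub>s Y))) (topo (X \<oplus>\<^sub>l\<^sub>c\<^sub>s Y)) (\<lambda>(c, z). c \<odot>\<^bsub>X \<oplus>\<^sub>l\<^sub>c\<^sub>s Y\<^esub> z)"
  proof -
    let ?f = "\<lambda>u. (((\<lambda>(c, x). c \<odot>\<^bsub>X\<^esub> x) \<circ> (\<lambda>u. (fst u, fst (snd u)))) u, ((\<lambda>(c, y). c \<odot>\<^bsub>Y\<^esub> y) \<circ> (\<lambda>u. (fst u, snd (snd u)))) u)"
    have "continuous_map (prod_topology euclidean (topo (X \<oplus>\<^sub>l\<^sub>c\<^sub>s Y))) (topo (X \<oplus>\<^sub>l\<^sub>c\<^sub>s Y))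
        ?f"
      unfolding direct_sum_sel
      by (intro continuous_map_pairedI continuous_map_compose[OF _ X.continuous_smult] continuous_map_compose[OF _ Y.continuous_smult])
        (use fs2 in \<open>simp_all add: o_def\<close>)
    moreover have "(\<lambda>(c, z). c \<odot>\<^bsub>X \<oplus>\<^sub>l\<^sub>c\<^sub>s Y\<^esub> z) =
        ?f"
      by (auto simp: fun_eq_iff)
    ultimately show ?thesis by simp
  qed
  show ?thesis
  proof (rule locally_convex.intro[OF lin_space_direct_sum[OF X.lin_space_axioms Y.lin_space_axioms, unfolded lin_space_def] locally_convex_axioms.intro[OF _ add smult]])
    show "topspace (topo (X \<oplus>\<^sub>l\<^sub>c\<^sub>s Y)) = carrier (X \<oplus>\<^sub>l\<^sub>c\<^sub>s Y)" by (simp add: X.topspace_eq Y.topspace_eq)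
    fix U assume U: "openin (topo (X \<oplus>\<^sub>l\<^sub>c\<^sub>s Y)) U" "\<zero>\<^bsub>X \<oplus>\<^sub>l\<^sub>c\<^sub>s Y\<^esub> \<in> U"
    then obtain V W where VW: "openin (topo X) V" "openin (topo Y) W" "\<zero>\<^bsub>X\<^esub> \<in> V" "\<zero>\<^bsub>Y\<^esub> \<in> W" "V \<times> W \<subseteq> U"
      unfolding direct_sum_sel openin_prod_topology_alt by meson
    from X.convex_base[OF VW(1,3)] obtain V' where V': "openin (topo X) V'" "\<zero>\<^bsub>X\<^esub> \<in> V'" "V' \<subseteq> V"
        "\<forall>x\<in>V'. \<forall>y\<in>V'. \<forall>t\<in>{0..1::real}. (complex_of_real (1 - t) \<odot>\<^bsub>X\<^esub> x) \<oplus>\<^bsub>X\<^esub> (complex_of_real t \<odot>\<^bsub>X\<^esub> y) \<in> V'"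
      by (elim exE conjE)
    from Y.convex_base[OF VW(2,4)] obtain W' where W': "openin (topo Y) W'" "\<zero>\<^bsub>Y\<^esub> \<in> W'" "W' \<subseteq> W"
        "\<forall>x\<in>W'. \<forall>y\<in>W'. \<forall>t\<in>{0..1::real}. (complex_of_real (1 - t) \<odot>\<^bsub>Y\<^esub> x) \<oplus>\<^bsub>Y\<^esub> (complex_of_real t \<odot>\<^bsub>Y\<^esub> y) \<in> W'"
      by (elim exE conjE)
    have "V' \<times> W' \<subseteq> U" using V'(3) W'(3) VW(5) by blast
    then show "\<exists>V. openin (topo (X \<oplus>\<^sub>l\<^sub>c\<^sub>s Y)) V \<and> \<zero>\<^bsub>X \<oplus>\<^sub>l\<^sub>c\<^sub>s Y\<^esub> \<in> V \<and> V \<subseteq> U \<and> (\<forall>x\<in>V. \<forall>y\<in>V. \<forall>t\<in>{0..1::real}.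
        (complex_of_real (1 - t) \<odot>\<^bsub>X \<oplus>\<^sub>l\<^sub>c\<^sub>s Y\<^esub> x) \<oplus>\<^bsub>X \<oplus>\<^sub>l\<^sub>c\<^sub>s Y\<^esub> (complex_of_real t \<odot>\<^bsub>X \<oplus>\<^sub>l\<^sub>c\<^sub>s Y\<^esub> y) \<in> V)"
      using V' W' by (intro exI[of _ "V' \<times> W'"]) (auto simp: openin_prod_Times_iff)
  qed
qed

lemma direct_sum_maps:
  assumes X: "locally_convex X" and Y: "locally_convex Y"
  shows continuous_linear_fst: "continuous_linear (X \<oplus>\<^sub>l\<^sub>c\<^sub>s Y) X fst"
    and continuous_linear_snd: "continuous_linear (X \<oplus>\<^sub>l\<^sub>c\<^sub>s Y) Y snd"
    and continuous_linear_pair: "continuous_linear W X f \<Longrightarrow> continuous_linear W Y g \<Longrightarrow>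
      continuous_linear W (X \<oplus>\<^sub>l\<^sub>c\<^sub>s Y) (\<lambda>w. (f w, g w))"
  by (auto simp: continuous_linear_def linear_map_def continuous_map_fst continuous_map_snd continuous_map_pairwise o_def
      split: prod.splits)

lemma lcs_subspace_sel [simp]:
  "carrier (lcs_subspace X S) = S" "zero (lcs_subspace X S) = zero X" "add (lcs_subspace X S) = add X"
  "smult (lcs_subspace X S) = smult X" "topo (lcs_subspace X S) = subtopology (topo X) S"
  by (simp_all add: lcs_subspace_def)

lemma lin_space_subspace:
  assumes "lin_space X" "lin_subspace S X"
  shows "lin_space (lcs_subspace X S)"
proof -
  interpret X: lin_space X by fact
  note S = lin_subspaceD[OF assms(2)]
  show ?thesis
    by (rule lin_spaceI)
      (auto simp: S X.M.a_assoc X.smult_add_left X.smult_add_right X.smult_smult X.minus_smult X.M.l_neg intro: X.M.a_comm)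
qed

lemma locally_convex_subspace:
  assumes X: "locally_convex X" and S: "lin_subspace S X"
  shows "locally_convex (lcs_subspace X S)"
proof -
  interpret X: locally_convex X by fact
  note Sm = lin_subspaceD[OF S]
  show ?thesis
  proof (rule locally_convex.intro[OF lin_space_subspace[OF X.lin_space_axioms S, unfolded lin_space_def] locally_convex_axioms.intro],
      unfold lcs_subspace_sel)
    show "topspace (subtopology (topo X) S) = S" using Sm(1) by (auto simp: X.topspace_eq)
    show "continuous_map (prod_topology (subtopology (topo X) S) (subtopology (topo X) S)) (subtopology (topo X) S) (\<lambda>(x, y). x \<oplus>\<^bsub>X\<^esub> y)"
      unfolding subtopology_Times[symmetric] continuous_map_in_subtopology
      using continuous_map_from_subtopology[OF X.continuous_add] Sm(3) by auto
    have e: "prod_topology euclidean (subtopology (topo X) S) = subtopology (prod_topology euclidean (topo X)) (UNIV \<times> S)"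
      using subtopology_Times[of euclidean "topo X" UNIV S, symmetric] by simp
    show "continuous_map (prod_topology euclidean (subtopology (topo X) S)) (subtopology (topo X) S) (\<lambda>(c, x). c \<odot>\<^bsub>X\<^esub> x)"
      unfolding e continuous_map_in_subtopology
      using continuous_map_from_subtopology[OF X.continuous_smult, of "UNIV \<times> S"] Sm(4) by auto
    fix U assume U: "openin (subtopology (topo X) S) U" "\<zero>\<^bsub>X\<^esub> \<in> U"
    then obtain V where V: "openin (topo X) V" "U = V \<inter> S" by (auto simp: openin_subtopology)
    from X.convex_base[OF V(1)] U(2) V(2) obtain V' where V': "openin (topo X) V'" "\<zero>\<^bsub>X\<^esub> \<in> V'" "V' \<subseteq> V"
        "\<forall>x\<in>V'. \<forall>y\<in>V'. \<forall>t\<in>{0..1::real}. (complex_of_real (1 - t) \<odot>\<^bsub>X\<^esub> x) \<oplus>\<^bsub>X\<^esub> (complex_of_real t \<odot>\<^bsub>X\<^esub> y) \<in> V'"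
      by blast
    then show "\<exists>V. openin (subtopology (topo X) S) V \<and> \<zero>\<^bsub>X\<^esub> \<in> V \<and> V \<subseteq> U \<and> (\<forall>x\<in>V. \<forall>y\<in>V. \<forall>t\<in>{0..1::real}.
        (complex_of_real (1 - t) \<odot>\<^bsub>X\<^esub> x) \<oplus>\<^bsub>X\<^esub> (complex_of_real t \<odot>\<^bsub>X\<^esub> y) \<in> V)"
      using V(2) Sm by (intro exI[of _ "V' \<inter> S"]) (auto simp: openin_subtopology)
  qed
qed

section \<open>The mixed complex of an algebra\<close>

context tensor_algebra
begin

abbreviation "C n \<equiv> tensor_power A (Suc n)"

text \<open>The second summand of each degree. It is the zero space in degree 0.\<close>

definition second :: "nat \<Rightarrow> 'a tensor lcs" where
  "second n = (if n = 0 then lcs_subspace (C 0) {\<zero>\<^bsub>C 0\<^esub>} else T n)"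

lemma second_Suc [simp]: "second (Suc n) = C n"
  by (simp add: second_def)

lemma second_0: "carrier (second 0) = {\<zero>\<^bsub>C 0\<^esub>}" "zero (second 0) = \<zero>\<^bsub>C 0\<^esub>"
  by (simp_all add: second_def)

lemma second_lc: "locally_convex (second n)"
proof -
  interpret T: lin_space "C 0" by (rule T_lin)
  have "lin_subspace {\<zero>\<^bsub>C 0\<^esub>} (C 0)" by (simp add: lin_subspace_def)
  then show ?thesis using locally_convex_subspace[OF T_lc] T_lc by (simp add: second_def)
qed

lemma second_lin: "lin_space (second n)"
  using second_lc[of n] by (simp add: locally_convex.axioms(1) lin_space_def)

lemma omega_eq: "omega A n = C n \<oplus>\<^sub>l\<^sub>c\<^sub>s second n"
  by (simp add: omega_def second_def chains_def)

lemma omega_lc: "locally_convex (omega A n)"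
  unfolding omega_eq by (rule locally_convex_direct_sum[OF T_lc second_lc])

text \<open>The second row of \<open>b\<close>. It is the zero operator where the target is the zero space.\<close>

definition neg_bar :: "nat \<Rightarrow> 'a tensor \<Rightarrow> 'a tensor" where
  "neg_bar n y = (if n = 0 then \<zero>\<^bsub>C 0\<^esub> else \<ominus>\<^bsub>T n\<^esub> bar_diff A n y)"

lemma neg_bar_linear: "continuous_linear (C n) (second n) (neg_bar n)"
proof (cases n)
  case 0
  have "neg_bar 0 = (\<lambda>x. \<zero>\<^bsub>second 0\<^esub>)" by (simp add: neg_bar_def[abs_def] second_0)
  then show ?thesis unfolding 0 using continuous_linear_const_zero[OF T_lc second_lc] by simp
next
  case (Suc m)
  interpret T: lin_space "C m" by (rule T_lin)
  have "neg_bar n x = \<zero>\<^bsub>C m\<^esub> \<ominus>\<^bsub>C m\<^esub> bar_diff A n x" if "x \<in> carrier (C n)" for x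
    using linear_mapD(1)[OF cl_lin[OF bar_linear] that] Suc by (simp add: neg_bar_def)
  then show ?thesis
    using continuous_linear_cong[OF T_lc _ continuous_linear_diff[OF T_lc T_lc continuous_linear_const_zero[OF T_lc T_lc] bar_linear[of n]],
        of "neg_bar n"] Suc by simp
qed

lemma omega_b_Suc:
  assumes "y \<in> carrier (C n)"
  shows "omega_b A (Suc n) (x, y) =
    (naive_diff A (Suc n) x \<oplus>\<^bsub>C n\<^esub> (y \<ominus>\<^bsub>C n\<^esub> lam (Suc n) y), neg_bar n y)"
proof -
  interpret T: lin_space "C 0" by (rule T_lin)
  show ?thesis using assms by (cases n) (auto simp: omega_b_def neg_bar_def chains_def bar_diff_0)
qed

lemma omega_B_eq: "omega_B A n (x, y) = (\<zero>\<^bsub>C (Suc n)\<^esub>, norm_op A (Suc n) x)"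
  by (simp add: omega_B_def)

lemma fst_omega: "continuous_linear (omega A n) (C n) fst"
  and snd_omega: "continuous_linear (omega A n) (second n) snd"
  unfolding omega_eq by (rule direct_sum_maps[OF T_lc second_lc])+

lemma omega_b_continuous: "continuous_linear (omega A (Suc n)) (omega A n) (omega_b A (Suc n))"
proof -
  let ?h = "\<lambda>z. (naive_diff A (Suc n) (fst z) \<oplus>\<^bsub>C n\<^esub> (snd z \<ominus>\<^bsub>C n\<^esub> lam (Suc n) (snd z)), neg_bar n (snd z))"
  note s = snd_omega[of "Suc n", unfolded second_Suc]
  have 1: "continuous_linear (omega A (Suc n)) (C n)
      (\<lambda>z. naive_diff A (Suc n) (fst z) \<oplus>\<^bsub>C n\<^esub> (snd z \<ominus>\<^bsub>C n\<^esub> lam (Suc n) (snd z)))"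
    by (intro continuous_linear_add[OF omega_lc T_lc] continuous_linear_diff[OF omega_lc T_lc] s
        continuous_linear_compose[OF fst_omega naive_linear] continuous_linear_compose[OF s lam_linear]) simp_all
  have "continuous_linear (omega A (Suc n)) (omega A n) ?h"
    unfolding omega_eq[of n] by (rule continuous_linear_pair[OF T_lc second_lc 1 continuous_linear_compose[OF s neg_bar_linear]])
  moreover have "?h z = omega_b A (Suc n) z" if "z \<in> carrier (omega A (Suc n))" for z
    using that omega_b_Suc by (cases z) (simp add: omega_eq)
  ultimately show ?thesis by (rule continuous_linear_cong[OF omega_lc, rotated])
qed

lemma omega_B_continuous: "continuous_linear (omega A n) (omega A (Suc n)) (omega_B A n)"
proof -
  have "continuous_linear (omega A n) (C (Suc n) \<oplus>\<^sub>l\<^sub>c\<^sub>s second (Suc n)) (\<lambda>z. (\<zero>\<^bsub>C (Suc n)\<^esub>, norm_op A (Suc n) (fst z)))"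
    unfolding second_Suc
    by (intro continuous_linear_pair[OF T_lc T_lc] continuous_linear_const_zero[OF omega_lc T_lc]
        continuous_linear_compose[OF fst_omega norm_linear]) simp
  then show ?thesis unfolding omega_eq[of "Suc n", symmetric]
    by (rule continuous_linear_cong[OF omega_lc, rotated]) (simp add: omega_B_def split: prod.split)
qed

lemma mem_maps [simp]:
  "x \<in> carrier (C n) \<Longrightarrow> lam (Suc n) x \<in> carrier (C n)"
  "x \<in> carrier (C (Suc n)) \<Longrightarrow> naive_diff A (Suc n) x \<in> carrier (C n)"
  "x \<in> carrier (C (Suc n)) \<Longrightarrow> bar_diff A (Suc n) x \<in> carrier (C n)"
  "x \<in> carrier (C n) \<Longrightarrow> norm_op A (Suc n) x \<in> carrier (C n)"
  using linear_mapD(1)[OF cl_lin[OF lam_linear]] linear_mapD(1)[OF cl_lin[OF naive_linear]]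
    linear_mapD(1)[OF cl_lin[OF bar_linear]] linear_mapD(1)[OF cl_lin[OF norm_linear]] by simp_all

lemma zero_maps [simp]:
  "lam (Suc n) \<zero>\<^bsub>C n\<^esub> = \<zero>\<^bsub>C n\<^esub>" "naive_diff A (Suc n) \<zero>\<^bsub>C (Suc n)\<^esub> = \<zero>\<^bsub>C n\<^esub>"
  "bar_diff A (Suc n) \<zero>\<^bsub>C (Suc n)\<^esub> = \<zero>\<^bsub>C n\<^esub>" "norm_op A (Suc n) \<zero>\<^bsub>C n\<^esub> = \<zero>\<^bsub>C n\<^esub>"
  using linear_map_zero[OF T_lin T_lin cl_lin[OF lam_linear]] linear_map_zero[OF T_lin T_lin cl_lin[OF naive_linear]]
    linear_map_zero[OF T_lin T_lin cl_lin[OF bar_linear]] linear_map_zero[OF T_lin T_lin cl_lin[OF norm_linear]] by simp_all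

sublocale T: lin_space "T n" for n
  by (rule T_lin)

text \<open>The relations for \<open>B\<close> are the identities \<open>(1 - \<lambda>) N = 0\<close>, \<open>N (1 - \<lambda>) = 0\<close> and \<open>b' N = N b\<close>.\<close>

lemma omega_mixed: "mixed (omega A) (omega_b A) (omega_B A)"
proof (rule mixed.intro)
  show "locally_convex (omega A n)" for n by (rule omega_lc)
  show "continuous_linear (omega A (Suc n)) (omega A n) (omega_b A (Suc n))" for n by (rule omega_b_continuous)
  show "continuous_linear (omega A n) (omega A (Suc n)) (omega_B A n)" for n by (rule omega_B_continuous)
  show "omega_b A 0 z = \<zero>\<^bsub>omega A 0\<^esub>" for z
    by (simp add: omega_b_def omega_eq chains_def second_0 split: prod.split)
  show "omega_B A (Suc n) (omega_B A n z) = \<zero>\<^bsub>omega A (Suc (Suc n))\<^esub>" for n z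
    by (cases z) (simp add: omega_B_eq omega_eq)
  show "omega_b A (Suc 0) (omega_B A 0 z) = \<zero>\<^bsub>omega A 0\<^esub>" if zm: "z \<in> carrier (omega A 0)" for z
  proof -
    obtain x y where z: "z = (x, y)" "x \<in> carrier (C 0)" using zm by (cases z) (auto simp: omega_eq)
    show ?thesis
      unfolding z(1) omega_B_eq omega_b_Suc[OF mem_maps(4)[OF z(2)]] minus_lam_norm[OF zero_less_Suc z(2)]
      by (simp add: omega_eq second_0 neg_bar_def)
  qed
  show "omega_b A (Suc (Suc n)) (omega_B A (Suc n) z) \<oplus>\<^bsub>omega A (Suc n)\<^esub> omega_B A n (omega_b A (Suc n) z) = \<zero>\<^bsub>omega A (Suc n)\<^esub>"
    if zm: "z \<in> carrier (omega A (Suc n))" for n z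
  proof -
    obtain x y where z: "z = (x, y)" and x: "x \<in> carrier (C (Suc n))" and y: "y \<in> carrier (C n)"
      using zm by (cases z) (auto simp: omega_eq)
    have "norm_op A (Suc n) (naive_diff A (Suc n) x \<oplus>\<^bsub>C n\<^esub> (y \<ominus>\<^bsub>C n\<^esub> lam (Suc n) y)) =
        norm_op A (Suc n) (naive_diff A (Suc n) x) \<oplus>\<^bsub>C n\<^esub> norm_op A (Suc n) (y \<ominus>\<^bsub>C n\<^esub> lam (Suc n) y)"
      by (rule linear_mapD(2)[OF cl_lin[OF norm_linear]]) (use x y in simp_all)
    also have "\<dots> = bar_diff A (Suc n) (norm_op A (Suc (Suc n)) x)"
      using bar_norm[OF zero_less_Suc x] norm_minus_lam[OF zero_less_Suc y] x by simp
    finally have N: "norm_op A (Suc n) (naive_diff A (Suc n) x \<oplus>\<^bsub>C n\<^esub> (y \<ominus>\<^bsub>C n\<^esub> lam (Suc n) y)) =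
        bar_diff A (Suc n) (norm_op A (Suc (Suc n)) x)" .
    show ?thesis
      unfolding z omega_B_eq omega_b_Suc[OF y] omega_b_Suc[OF mem_maps(4)[OF x]] minus_lam_norm[OF zero_less_Suc x] N
      using x by (simp add: omega_eq neg_bar_def T.M.l_neg)
  qed
qed

lemma naive_diff_combine:
  assumes "x \<in> carrier (C (Suc n))" "z \<in> carrier (C (Suc n))"
  shows "naive_diff A (Suc n) (x \<oplus>\<^bsub>C (Suc n)\<^esub> (z \<ominus>\<^bsub>C (Suc n)\<^esub> lam (Suc (Suc n)) z)) =
    naive_diff A (Suc n) x \<oplus>\<^bsub>C n\<^esub> (bar_diff A (Suc n) z \<ominus>\<^bsub>C n\<^esub> lam (Suc n) (bar_diff A (Suc n) z))"
  using linear_mapD(2)[OF cl_lin[OF naive_linear[of "Suc n"]], of x "z \<ominus>\<^bsub>C (Suc n)\<^esub> lam (Suc (Suc n)) z"]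
    naive_minus_lam[OF zero_less_Suc assms(2)] assms by simp

text \<open>A cycle \<open>(x, y)\<close> has \<open>b' y = 0\<close>, so \<open>y = b' z\<close>; subtracting the boundary of \<open>(0, - z)\<close> leaves the
  \<open>b\<close>-cycle \<open>x + (1 - \<lambda>) z\<close>.\<close>

lemma omega_exact:
  assumes naive: "\<And>n x. x \<in> carrier (C (Suc n)) \<Longrightarrow> naive_diff A (Suc n) x = \<zero>\<^bsub>C n\<^esub> \<Longrightarrow>
      \<exists>w\<in>carrier (C (Suc (Suc n))). naive_diff A (Suc (Suc n)) w = x"
    and bar: "\<And>n y. y \<in> carrier (C n) \<Longrightarrow> (0 < n \<longrightarrow> bar_diff A n y = \<zero>\<^bsub>T n\<^esub>) \<Longrightarrow>
      \<exists>z\<in>carrier (C (Suc n)). bar_diff A (Suc n) z = y"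
  shows "exact_mixed (omega A) (omega_b A) (omega_B A)"
proof -
  interpret mixed "omega A" "omega_b A" "omega_B A" by (rule omega_mixed)
  show ?thesis
  proof (rule exact_mixed.intro[OF omega_mixed exact_mixed_axioms.intro])
    fix n u assume n: "0 < n" and u: "u \<in> carrier (omega A n)" "omega_b A n u = \<zero>\<^bsub>omega A (n - 1)\<^esub>"
    obtain m where m: "n = Suc m" using n by (cases n) auto
    obtain x y where xy: "u = (x, y)" and x: "x \<in> carrier (C (Suc m))" and y: "y \<in> carrier (C m)"
      using u(1) unfolding m by (cases u) (auto simp: omega_eq)
    have eq: "naive_diff A (Suc m) x \<oplus>\<^bsub>C m\<^esub> (y \<ominus>\<^bsub>C m\<^esub> lam (Suc m) y) = \<zero>\<^bsub>C m\<^esub>"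
      and nb: "neg_bar m y = \<zero>\<^bsub>second m\<^esub>"
      using u(2) unfolding m xy diff_Suc_1 omega_b_Suc[OF y] by (simp_all add: omega_eq)
    have by0: "bar_diff A m y = \<zero>\<^bsub>T m\<^esub>" if m0: "0 < m"
    proof -
      obtain k where k: "m = Suc k" using m0 by (cases m) auto
      then show ?thesis using nb y T.M.minus_minus[of "bar_diff A m y" m] by (simp add: neg_bar_def)
    qed
    have "\<exists>z\<in>carrier (C (Suc m)). bar_diff A (Suc m) z = y" by (rule bar[OF y]) (use by0 in blast)
    then obtain z where z: "z \<in> carrier (C (Suc m))" "bar_diff A (Suc m) z = y" by (elim bexE)
    let ?t = "x \<oplus>\<^bsub>C (Suc m)\<^esub> (z \<ominus>\<^bsub>C (Suc m)\<^esub> lam (Suc (Suc m)) z)"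
    have t: "?t \<in> carrier (C (Suc m))" using x z(1) by simp
    have "naive_diff A (Suc m) ?t = \<zero>\<^bsub>C m\<^esub>"
      unfolding naive_diff_combine[OF x z(1)] z(2) by (rule eq)
    from naive[OF t this] obtain w where w: "w \<in> carrier (C (Suc (Suc m)))" "naive_diff A (Suc (Suc m)) w = ?t" by (elim bexE)
    let ?z = "\<ominus>\<^bsub>C (Suc m)\<^esub> z"
    have nz: "?z \<in> carrier (C (Suc m))" using z(1) by simp
    have ln: "lam (Suc (Suc m)) ?z = \<ominus>\<^bsub>C (Suc m)\<^esub> lam (Suc (Suc m)) z"
      by (rule linear_map_neg[OF T_lin T_lin cl_lin[OF lam_linear] z(1)]) simp
    have bn: "bar_diff A (Suc m) ?z = \<ominus>\<^bsub>C m\<^esub> y"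
      unfolding z(2)[symmetric] by (rule linear_map_neg[OF T_lin T_lin cl_lin[OF bar_linear] z(1)]) simp
    have "?z \<ominus>\<^bsub>C (Suc m)\<^esub> lam (Suc (Suc m)) ?z = \<ominus>\<^bsub>C (Suc m)\<^esub> (z \<ominus>\<^bsub>C (Suc m)\<^esub> lam (Suc (Suc m)) z)"
      unfolding ln using z(1) by (simp add: T.M.minus_eq T.M.minus_add)
    then have first: "?t \<oplus>\<^bsub>C (Suc m)\<^esub> (?z \<ominus>\<^bsub>C (Suc m)\<^esub> lam (Suc (Suc m)) ?z) = x"
      using x z(1) by (simp add: T.M.a_assoc T.M.r_neg)
    have "omega_b A (Suc (Suc m)) (w, ?z) = (x, y)"
      unfolding omega_b_Suc[OF nz] w(2) first using y by (simp add: neg_bar_def bn)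
    then show "\<exists>w\<in>carrier (omega A (Suc n)). omega_b A (Suc n) w = u"
      unfolding m xy using w(1) nz by (intro bexI[of _ "(w, ?z)"]) (simp_all add: omega_eq)
  qed
qed

text \<open>Dually, a cocycle \<open>(f, g)\<close> has \<open>f = h \<circ> b\<close>, and then \<open>g - h \<circ> (1 - \<lambda>)\<close> vanishes on the image of \<open>b'\<close>.\<close>

lemma omega_coexact:
  assumes naive: "\<And>n F. functional (C (Suc n)) F \<Longrightarrow>
      (\<forall>w\<in>carrier (C (Suc (Suc n))). F (naive_diff A (Suc (Suc n)) w) = 0) \<Longrightarrow>
      \<exists>h. functional (C n) h \<and> (\<forall>x\<in>carrier (C (Suc n)). F x = h (naive_diff A (Suc n) x))"
    and bar: "\<And>n F. functional (C n) F \<Longrightarrow> (\<forall>w\<in>carrier (C (Suc n)). F (bar_diff A (Suc n) w) = 0) \<Longrightarrow>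
      \<exists>k. (0 < n \<longrightarrow> functional (T n) k) \<and> (\<forall>x\<in>carrier (C n). F x = (if n = 0 then 0 else k (bar_diff A n x)))"
  shows "coexact_mixed (omega A) (omega_b A) (omega_B A)"
proof -
  interpret mixed "omega A" "omega_b A" "omega_B A" by (rule omega_mixed)
  show ?thesis
  proof (rule coexact_mixed.intro[OF omega_mixed coexact_mixed_axioms.intro])
    fix F m assume F: "functional (omega A (Suc m)) F"
      and cyc: "\<And>w. w \<in> carrier (omega A (Suc (Suc m))) \<Longrightarrow> F (omega_b A (Suc (Suc m)) w) = 0"
    define f where "f x = F (x, \<zero>\<^bsub>C m\<^esub>)" for x
    define g where "g y = F (\<zero>\<^bsub>C (Suc m)\<^esub>, y)" for y
    have inj1: "continuous_linear (C (Suc m)) (omega A (Suc m)) (\<lambda>x. (x, \<zero>\<^bsub>C m\<^esub>))"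
      unfolding omega_eq second_Suc
      by (intro continuous_linear_pair[OF T_lc T_lc] continuous_linear_const_zero[OF T_lc T_lc])
        (simp add: continuous_linear_def linear_map_def)
    have inj2: "continuous_linear (C m) (omega A (Suc m)) (\<lambda>y. (\<zero>\<^bsub>C (Suc m)\<^esub>, y))"
      unfolding omega_eq second_Suc
      by (intro continuous_linear_pair[OF T_lc T_lc] continuous_linear_const_zero[OF T_lc T_lc])
        (simp add: continuous_linear_def linear_map_def)
    have f: "functional (C (Suc m)) f" unfolding f_def[abs_def] by (rule continuous_linear_compose[OF inj1 F])
    have g: "functional (C m) g" unfolding g_def[abs_def] by (rule continuous_linear_compose[OF inj2 F])
    have Ffg: "F (x, y) = f x + g y" if "x \<in> carrier (C (Suc m))" "y \<in> carrier (C m)" for x y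
      unfolding f_def g_def
      using functionalD(1)[OF F, of "(x, \<zero>\<^bsub>C m\<^esub>)" "(\<zero>\<^bsub>C (Suc m)\<^esub>, y)"] that by (simp add: omega_eq)
    have cyc2: "f (naive_diff A (Suc (Suc m)) w \<oplus>\<^bsub>C (Suc m)\<^esub> (z \<ominus>\<^bsub>C (Suc m)\<^esub> lam (Suc (Suc m)) z)) = g (bar_diff A (Suc m) z)"
      if w: "w \<in> carrier (C (Suc (Suc m)))" and z: "z \<in> carrier (C (Suc m))" for w z
    proof -
      have "g (\<ominus>\<^bsub>C m\<^esub> bar_diff A (Suc m) z) = - g (bar_diff A (Suc m) z)"
        using functionalD(2)[OF g mem_maps(3)[OF z], of "- 1"] T.neg_eq_smult[OF mem_maps(3)[OF z]] by simp
      then show ?thesis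
        using cyc[of "(w, z)"] w z by (simp add: omega_eq omega_b_Suc neg_bar_def Ffg)
    qed
    have "f (naive_diff A (Suc (Suc m)) w) = 0" if w: "w \<in> carrier (C (Suc (Suc m)))" for w
      using cyc2[OF w T.M.zero_closed] w functional_at_zero[OF T_lin g] by simp
    then have "\<forall>w\<in>carrier (C (Suc (Suc m))). f (naive_diff A (Suc (Suc m)) w) = 0" by (rule ballI)
    from naive[OF f this] obtain h where h: "functional (C m) h" and fh: "\<forall>x\<in>carrier (C (Suc m)). f x = h (naive_diff A (Suc m) x)"
      by (elim exE conjE)
    define g' where "g' y = g y - h (y \<ominus>\<^bsub>C m\<^esub> lam (Suc m) y)" for y
    have idc: "continuous_linear (C m) (C m) (\<lambda>y. y)" by (simp add: continuous_linear_def linear_map_def)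
    have g': "functional (C m) g'"
      unfolding g'_def[abs_def]
      by (intro functional_diff g continuous_linear_compose[OF _ h] continuous_linear_diff[OF T_lc T_lc] idc lam_linear) simp
    have "g' (bar_diff A (Suc m) z) = 0" if z: "z \<in> carrier (C (Suc m))" for z
    proof -
      have "g (bar_diff A (Suc m) z) = f (z \<ominus>\<^bsub>C (Suc m)\<^esub> lam (Suc (Suc m)) z)"
        using cyc2[OF T.M.zero_closed z] z by simp
      also have "\<dots> = h (bar_diff A (Suc m) z \<ominus>\<^bsub>C m\<^esub> lam (Suc m) (bar_diff A (Suc m) z))"
        using fh naive_minus_lam[OF zero_less_Suc z] z by simp
      finally show ?thesis by (simp add: g'_def)
    qed
    then have "\<forall>z\<in>carrier (C (Suc m)). g' (bar_diff A (Suc m) z) = 0" by (rule ballI)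
    from bar[OF g' this] obtain k where k: "0 < m \<longrightarrow> functional (T m) k"
      and gk: "\<forall>y\<in>carrier (C m). g' y = (if m = 0 then 0 else k (bar_diff A m y))" by (elim exE conjE)
    let ?k = "\<lambda>v. if m = 0 then 0 else k v"
    have kf: "functional (second m) ?k" using k by (cases m) simp_all
    let ?G = "\<lambda>u. h (fst u) - ?k (snd u)"
    have "functional (omega A m) ?G"
      by (rule functional_diff[OF continuous_linear_compose[OF fst_omega h] continuous_linear_compose[OF snd_omega kf]])
    moreover have "F u = ?G (omega_b A (Suc m) u)" if um: "u \<in> carrier (omega A (Suc m))" for u
    proof -
      obtain x y where u: "u = (x, y)" and x: "x \<in> carrier (C (Suc m))" and y: "y \<in> carrier (C m)"
        using um by (cases u) (auto simp: omega_eq)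
      have "?k (neg_bar m y) = - g' y"
      proof (cases m)
        case 0
        then show ?thesis using bspec[OF gk y] by simp
      next
        case (Suc j)
        have b: "bar_diff A m y \<in> carrier (T m)" using y Suc by simp
        have km: "functional (T m) k" using k Suc by simp
        show ?thesis
          using functionalD(2)[OF km b, of "- 1"] T.neg_eq_smult[OF b] bspec[OF gk y] Suc by (simp add: neg_bar_def)
      qed
      moreover have "h (naive_diff A (Suc m) x \<oplus>\<^bsub>C m\<^esub> (y \<ominus>\<^bsub>C m\<^esub> lam (Suc m) y)) =
          h (naive_diff A (Suc m) x) + h (y \<ominus>\<^bsub>C m\<^esub> lam (Suc m) y)"
        by (rule functionalD(1)[OF h]) (use x y in simp_all)
      ultimately show ?thesis
        unfolding u omega_b_Suc[OF y] fst_conv snd_conv Ffg[OF x y] using bspec[OF fh x] by (simp add: g'_def)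
    qed
    ultimately show "\<exists>G. functional (omega A m) G \<and> (\<forall>x\<in>carrier (omega A (Suc m)). F x = G (omega_b A (Suc m) x))"
      by (intro exI[of _ ?G] conjI ballI)
  qed
qed

end

text \<open>The vanishing of a cohomology group, for functionals with arbitrary values outside the carrier.\<close>

lemma zero_dual_homologyD:
  assumes X: "lin_space X" "topspace (topo X) = carrier X" and W: "lin_space W" "topspace (topo W) = carrier W"
    and V: "lin_space V" "topspace (topo V) = carrier V"
    and u: "continuous_linear X W u" and v: "continuous_linear V X v"
    and zero: "zero_space (homology_at (strong_dual W) (dual_map X u) (strong_dual X) (dual_map V v) (strong_dual V))"
    and F: "functional X F" "\<forall>w\<in>carrier V. F (v w) = 0"
  shows "\<exists>k. functional W k \<and> (\<forall>x\<in>carrier X. F x = k (u x))"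
proof -
  note d = lin_space_strong_dual[OF X] lin_space_strong_dual[OF W] lin_space_strong_dual[OF V]
  note lu = linear_dual_map[OF X u] and lv = linear_dual_map[OF V v]
  let ?F = "restrict F (carrier X)"
  have m: "?F \<in> carrier (strong_dual X)" using functional_cong[OF X F(1), of ?F] by simp
  have "dual_map V v ?F = \<zero>\<^bsub>strong_dual V\<^esub>"
    unfolding dual_map_zero_iff using F(2) linear_mapD(1)[of V X v] v by (simp add: continuous_linear_def)
  then have "?F \<in> dual_map X u ` carrier (strong_dual W)"
    using zero m unfolding zero_homology_iff[OF d(2,1) lu, where g = "dual_map V v" and Y = "strong_dual V", OF linear_map_zero[OF d(1,3) lv]]
    by blast
  then obtain k where k: "functional W k" "?F = dual_map X u k" by auto
  have "F x = k (u x)" if "x \<in> carrier X" for x using fun_cong[OF k(2), of x] that by (simp add: dual_map_def)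
  then show ?thesis using k(1) by blast
qed

context tensor_algebra
begin

subsection \<open>Degree zero\<close>

lemma words_1: "xs \<in> words A (Suc 0) \<longleftrightarrow> (\<exists>a\<in>carrier A. xs = [a])"
  by (auto simp: words_def length_Suc_conv)

lemma words_2: "xs \<in> words A (Suc (Suc 0)) \<longleftrightarrow> (\<exists>a\<in>carrier A. \<exists>b\<in>carrier A. xs = [a, b])"
  by (auto simp: words_def length_Suc_conv)

lemma tens_singleton: "continuous_linear A (C 0) (\<lambda>a. tens A [a])"
proof (rule continuous_linearI[OF locally_convex_axioms T_lin locally_convex.generates_cseminorms[OF T_lc]])
  note B = bounded_multilinearD[OF tens_bounded_multilinear[of "Suc 0"]]
  have w: "[a] \<in> words A (Suc 0)" if "a \<in> carrier A" for a using that by (simp add: words_1)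
  show "linear_map A (C 0) (\<lambda>a. tens A [a])"
  proof (rule linear_mapI)
    show "tens A [a] \<in> carrier (C 0)" if "a \<in> carrier A" for a by (rule tens_mem[OF w[OF that]])
    show "tens A [a \<oplus>\<^bsub>A\<^esub> b] = tens A [a] \<oplus>\<^bsub>C 0\<^esub> tens A [b]" if "a \<in> carrier A" "b \<in> carrier A" for a b
      using B(2)[OF w[OF that(1)], of 0 a b] that by simp
    show "tens A [c \<odot>\<^bsub>A\<^esub> a] = c \<odot>\<^bsub>C 0\<^esub> tens A [a]" if "a \<in> carrier A" for c a
      using B(3)[OF w[OF that], of 0 a c] that by simp
  qed
  fix q assume "q \<in> cseminorms (C 0)"
  then have "continuous_seminorm (C 0) q" by simp
  from B(4)[OF this] obtain p K where p: "continuous_seminorm A p"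
    and K: "\<forall>xs\<in>words A (Suc 0). q (tens A xs) \<le> K * (\<Prod>i<Suc 0. p (xs ! i))" by (elim exE conjE)
  have "q (tens A [a]) \<le> K * p a" if "a \<in> carrier A" for a using bspec[OF K w[OF that]] by simp
  then show "\<exists>p K. continuous_seminorm A p \<and> (\<forall>a\<in>carrier A. q (tens A [a]) \<le> K * p a)" using p by blast
qed

lemma hd_multilinear: "bounded_multilinear (Suc 0) A hd"
  unfolding bounded_multilinear_def
proof (intro conjI allI impI ballI)
  fix q assume q: "continuous_seminorm A q"
  show "\<exists>p K. continuous_seminorm A p \<and> 0 \<le> K \<and> (\<forall>xs\<in>words A (Suc 0). q (hd xs) \<le> K * (\<Prod>i<Suc 0. p (xs ! i)))"
    by (rule exI[of _ q], rule exI[of _ 1]) (use q in \<open>auto simp: words_1\<close>)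
qed (auto simp: words_1)

text \<open>The inverse of the canonical map \<open>a \<mapsto> tens A [a]\<close> from the algebra to its first tensor power.\<close>

definition untens :: "'a tensor \<Rightarrow> 'a" where
  "untens = tensor_lift (replicate (Suc 0) A) A hd"

lemma untens_linear: "continuous_linear (C 0) A untens"
  and untens_tens: "a \<in> carrier A \<Longrightarrow> untens (tens A [a]) = a"
  unfolding untens_def
  using tensor_lift_exists[OF complete_hausdorff_lcs_axioms hd_multilinear] by (auto simp: words_1)

lemma tens_untens:
  assumes "x \<in> carrier (C 0)"
  shows "tens A [untens x] = x"
proof (rule T_ext[OF continuous_linear_compose[OF untens_linear tens_singleton] _ _ assms])
  show "continuous_linear (C 0) (C 0) (\<lambda>x. x)" by (simp add: continuous_linear_def linear_map_def)
qed (auto simp: words_1 untens_tens)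

lemma untens_mem [simp]: "x \<in> carrier (C 0) \<Longrightarrow> untens x \<in> carrier A"
  using linear_mapD(1)[of "C 0" A untens] untens_linear by (simp add: continuous_linear_def)

lemma T2: "proj_tensor [A, A] = C (Suc 0)"
  by (simp add: tensor_power_def)

text \<open>Under the identification in degree 0, the operator \<open>b\<close> from degree 1 is the commutator map.\<close>

lemma commutator_map_eq:
  shows commutator_map_linear: "continuous_linear (C (Suc 0)) A (commutator_map A)"
    and commutator_map_tens: "a \<in> carrier A \<Longrightarrow> b \<in> carrier A \<Longrightarrow>
      commutator_map A (tens A [a, b]) = (a \<otimes>\<^bsub>A\<^esub> b) \<ominus>\<^bsub>A\<^esub> (b \<otimes>\<^bsub>A\<^esub> a)"
    and untens_naive: "t \<in> carrier (C (Suc 0)) \<Longrightarrow> untens (naive_diff A (Suc 0) t) = commutator_map A t"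
proof -
  let ?g = "\<lambda>t. untens (naive_diff A (Suc 0) t)" and ?c = "\<lambda>as. (as ! 0 \<otimes>\<^bsub>A\<^esub> as ! 1) \<ominus>\<^bsub>A\<^esub> (as ! 1 \<otimes>\<^bsub>A\<^esub> as ! 0)"
  have g: "continuous_linear (C (Suc 0)) A ?g" by (rule continuous_linear_compose[OF naive_linear[OF zero_less_Suc] untens_linear])
  have w: "tens A [c] \<in> carrier (C 0)" if "c \<in> carrier A" for c by (rule tens_mem) (use that in \<open>simp add: words_1\<close>)
  have val: "?g (tens A [a, b]) = (a \<otimes>\<^bsub>A\<^esub> b) \<ominus>\<^bsub>A\<^esub> (b \<otimes>\<^bsub>A\<^esub> a)" if ab: "a \<in> carrier A" "b \<in> carrier A" for a b
  proof -
    have xs: "[a, b] \<in> words A (Suc (Suc 0))" using ab by (simp add: words_2)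
    have "bar_value A (Suc 0) [a, b] = tens A [a \<otimes>\<^bsub>A\<^esub> b]"
      using w[OF mult_closed[OF ab]] by (simp add: bar_value_def chains_def face_def lessThan_Suc)
    moreover have "face A 0 (rot [a, b]) = [b \<otimes>\<^bsub>A\<^esub> a]" by (simp add: face_def rot_def)
    ultimately have "naive_diff A (Suc 0) (tens A [a, b]) = tens A [a \<otimes>\<^bsub>A\<^esub> b] \<oplus>\<^bsub>C 0\<^esub> (- 1) \<odot>\<^bsub>C 0\<^esub> tens A [b \<otimes>\<^bsub>A\<^esub> a]"
      using naive_tens[OF zero_less_Suc xs] by simp
    moreover have lu: "linear_map (C 0) A untens" using untens_linear by (simp add: continuous_linear_def)
    ultimately have "?g (tens A [a, b]) = (a \<otimes>\<^bsub>A\<^esub> b) \<oplus>\<^bsub>A\<^esub> (- 1) \<odot>\<^bsub>A\<^esub> (b \<otimes>\<^bsub>A\<^esub> a)"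
      using linear_mapD(2,3)[OF lu] w mult_closed ab untens_tens by simp
    then show ?thesis using mult_closed ab by (simp add: M.minus_eq neg_eq_smult)
  qed
  have "\<forall>xs\<in>words A (Suc (Suc 0)). ?g (tens A xs) = ?c xs" using val by (auto simp: words_2)
  moreover have "commutator_map A = tensor_lift (replicate (Suc (Suc 0)) A) A ?c" by (simp add: commutator_map_def)
  ultimately have c: "commutator_map A = restrict ?g (carrier (C (Suc 0)))"
    using tensor_lift_eq[OF locally_convex_axioms hausdorff g] by simp
  show "continuous_linear (C (Suc 0)) A (commutator_map A)"
    unfolding c by (rule continuous_linear_cong[OF T_lc _ g]) simp
  show "commutator_map A (tens A [a, b]) = (a \<otimes>\<^bsub>A\<^esub> b) \<ominus>\<^bsub>A\<^esub> (b \<otimes>\<^bsub>A\<^esub> a)" if ab: "a \<in> carrier A" "b \<in> carrier A"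
    unfolding c using val[OF ab] tens_mem[of "[a, b]" "Suc (Suc 0)"] ab by (simp add: words_2)
  show "?g t = commutator_map A t" if "t \<in> carrier (C (Suc 0))" for t unfolding c using that by simp
qed

lemma omega_b_1:
  assumes "t \<in> carrier (C (Suc 0))" "y \<in> carrier (C 0)"
  shows "omega_b A (Suc 0) (t, y) = (naive_diff A (Suc 0) t, \<zero>\<^bsub>C 0\<^esub>)"
proof -
  have "lam (Suc 0) y = y" using lam_power[OF zero_less_Suc assms(2)] by simp
  then show ?thesis using assms by (simp add: omega_b_Suc neg_bar_def)
qed

lemma omega_0_mem: "u \<in> carrier (omega A 0) \<longleftrightarrow> (\<exists>x\<in>carrier (C 0). u = (x, \<zero>\<^bsub>C 0\<^esub>))"
  by (cases u) (auto simp: omega_eq second_0)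

text \<open>As \<open>\<lambda>\<close> is the identity in degree 0, the term \<open>(1 - \<lambda>) y\<close> does not enlarge the image of \<open>b\<close>.\<close>

lemma boundary_1:
  "omega_b A (Suc 0) ` carrier (omega A (Suc 0)) = (\<lambda>t. (naive_diff A (Suc 0) t, \<zero>\<^bsub>C 0\<^esub>)) ` carrier (C (Suc 0))" (is "?L = ?R")
proof
  show "?L \<subseteq> ?R"
  proof
    fix u assume "u \<in> ?L"
    then obtain t y where "t \<in> carrier (C (Suc 0))" "y \<in> carrier (C 0)" "u = omega_b A (Suc 0) (t, y)"
      by (auto simp: omega_eq)
    then show "u \<in> ?R" by (simp add: omega_b_1)
  qed
  show "?R \<subseteq> ?L"
  proof
    fix u assume "u \<in> ?R"
    then obtain t where t: "t \<in> carrier (C (Suc 0))" "u = (naive_diff A (Suc 0) t, \<zero>\<^bsub>C 0\<^esub>)" by (rule imageE)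
    have u: "u = omega_b A (Suc 0) (t, \<zero>\<^bsub>C 0\<^esub>)" using t omega_b_1[OF t(1), of "\<zero>\<^bsub>C 0\<^esub>"] by simp
    have "(t, \<zero>\<^bsub>C 0\<^esub>) \<in> carrier (omega A (Suc 0))" using t(1) by (simp add: omega_eq)
    then show "u \<in> ?L" unfolding u by (rule imageI)
  qed
qed

lemma commutators_subspace: "lin_subspace (commutator_map A ` carrier (C (Suc 0))) A"
  by (rule linear_image_subspace[OF T_lin lin_space_axioms]) (use commutator_map_linear in \<open>simp add: continuous_linear_def\<close>)

lemma omega_augmented_exact:
  assumes "exact_mixed (omega A) (omega_b A) (omega_B A)"
  shows "augmented_exact_mixed (omega A) (omega_b A) (omega_B A) (commutator_quotient A)
    (\<lambda>u. commutator_map A ` carrier (C (Suc 0)) +>\<^bsub>A\<^esub> untens (fst u))"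
proof (rule augmented_exact_mixed.intro[OF assms augmented_exact_mixed_axioms.intro])
  let ?I = "commutator_map A ` carrier (C (Suc 0))"
  let ?\<rho> = "\<lambda>u. ?I +>\<^bsub>A\<^esub> untens (fst u)"
  note I = commutators_subspace
  have Q: "commutator_quotient A = A /\<^sub>l\<^sub>i\<^sub>n ?I" by (simp add: commutator_quotient_def T2)
  have lu: "linear_map (C 0) A untens" using untens_linear by (simp add: continuous_linear_def)
  have "linear_map (omega A 0) A (\<lambda>u. untens (fst u))"
    using continuous_linear_compose[OF fst_omega untens_linear] by (simp add: continuous_linear_def)
  then show "linear_map (omega A 0) (commutator_quotient A) ?\<rho>"
    unfolding Q by (rule linear_map_compose[OF _ linear_coset(1)[OF I]])
  show "?\<rho> ` carrier (omega A 0) = carrier (commutator_quotient A)"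
    unfolding Q linear_coset(2)[OF I]
  proof
    show "?\<rho> ` carrier (omega A 0) \<subseteq> (\<lambda>x. ?I +>\<^bsub>A\<^esub> x) ` carrier A" by (auto simp: omega_0_mem)
    show "(\<lambda>x. ?I +>\<^bsub>A\<^esub> x) ` carrier A \<subseteq> ?\<rho> ` carrier (omega A 0)"
    proof (rule image_subsetI)
      fix a assume a: "a \<in> carrier A"
      show "?I +>\<^bsub>A\<^esub> a \<in> ?\<rho> ` carrier (omega A 0)"
        by (rule image_eqI[of _ _ "(tens A [a], \<zero>\<^bsub>C 0\<^esub>)"])
          (use a in \<open>auto simp: untens_tens omega_0_mem words_1 intro: tens_mem\<close>)
    qed
  qed
  fix u v assume "u \<in> carrier (omega A 0)" "v \<in> carrier (omega A 0)"
  then obtain x y where u: "u = (x, \<zero>\<^bsub>C 0\<^esub>)" and v: "v = (y, \<zero>\<^bsub>C 0\<^esub>)"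
    and xy: "x \<in> carrier (C 0)" "y \<in> carrier (C 0)" by (auto simp: omega_0_mem)
  let ?d = "x \<ominus>\<^bsub>C 0\<^esub> y"
  have zs: "\<zero>\<^bsub>C 0\<^esub> \<in> carrier (second 0)" by (simp add: second_0)
  have "\<zero>\<^bsub>C 0\<^esub> \<ominus>\<^bsub>second 0\<^esub> \<zero>\<^bsub>C 0\<^esub> = \<zero>\<^bsub>C 0\<^esub>"
    using lin_space.diff_self[OF second_lin zs] by (simp add: second_0)
  then have uv: "u \<ominus>\<^bsub>omega A 0\<^esub> v = (?d, \<zero>\<^bsub>C 0\<^esub>)"
    unfolding u v omega_eq using direct_sum_minus[OF T_lin second_lin xy zs zs] by simp
  have "?\<rho> u = ?\<rho> v \<longleftrightarrow> untens ?d \<in> ?I"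
    using coset_eq_iff[OF I untens_mem[OF xy(1)] untens_mem[OF xy(2)]] linear_map_diff[OF T_lin lin_space_axioms lu xy] by (simp add: u v)
  also have "\<dots> \<longleftrightarrow> ?d \<in> naive_diff A (Suc 0) ` carrier (C (Suc 0))"
  proof
    assume "untens ?d \<in> ?I"
    then obtain t where t: "t \<in> carrier (C (Suc 0))" "untens ?d = commutator_map A t" by (auto elim: imageE)
    have "untens ?d = untens (naive_diff A (Suc 0) t)" using untens_naive[OF t(1)] t(2) by simp
    then have "tens A [untens ?d] = tens A [untens (naive_diff A (Suc 0) t)]" by (simp only:)
    then have "?d = naive_diff A (Suc 0) t"
      unfolding tens_untens[OF T.diff_mem[OF xy]] tens_untens[OF mem_maps(2)[OF t(1)]] .
    then show "?d \<in> naive_diff A (Suc 0) ` carrier (C (Suc 0))" using t(1) by (intro image_eqI)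
  next
    assume "?d \<in> naive_diff A (Suc 0) ` carrier (C (Suc 0))"
    then obtain t where t: "?d = naive_diff A (Suc 0) t" "t \<in> carrier (C (Suc 0))" by (rule imageE)
    then show "untens ?d \<in> ?I" using untens_naive[OF t(2)] by (intro image_eqI) simp_all
  qed
  also have "\<dots> \<longleftrightarrow> u \<ominus>\<^bsub>omega A 0\<^esub> v \<in> omega_b A (Suc 0) ` carrier (omega A (Suc 0))"
    unfolding uv boundary_1 by auto
  finally show "?\<rho> u = ?\<rho> v \<longleftrightarrow> u \<ominus>\<^bsub>omega A 0\<^esub> v \<in> omega_b A (Suc 0) ` carrier (omega A (Suc 0))" .
qed

lemma traces_mem: "\<tau> \<in> carrier (traces A) \<longleftrightarrow> \<tau> \<in> extensional (carrier A) \<and> functional A \<tau> \<and>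
    (\<forall>a\<in>carrier A. \<forall>b\<in>carrier A. \<tau> (a \<otimes>\<^bsub>A\<^esub> b) = \<tau> (b \<otimes>\<^bsub>A\<^esub> a))"
  by (simp add: traces_def)

lemma traces_sel:
  "zero (traces A) = (\<lambda>a\<in>carrier A. 0)" "add (traces A) = (\<lambda>f g. \<lambda>a\<in>carrier A. f a + g a)"
  "smult (traces A) = (\<lambda>c f. \<lambda>a\<in>carrier A. c * f a)"
  by (simp_all add: traces_def)

lemma traces_lin: "lin_space (traces A)"
proof -
  interpret D: lin_space "strong_dual A" by (rule lin_space_strong_dual[OF lin_space_axioms topspace_eq])
  have z: "\<zero>\<^bsub>strong_dual A\<^esub> \<in> carrier (strong_dual A)" by (rule D.M.zero_closed)
  have a: "f \<oplus>\<^bsub>strong_dual A\<^esub> g \<in> carrier (strong_dual A)" if "f \<in> carrier (strong_dual A)" "g \<in> carrier (strong_dual A)" for f g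
    using that by (rule D.M.add.m_closed)
  have s: "c \<odot>\<^bsub>strong_dual A\<^esub> f \<in> carrier (strong_dual A)" if "f \<in> carrier (strong_dual A)" for c f
    using that by (rule D.smult_mem)
  show ?thesis
    unfolding traces_def
  proof (rule lin_space_subspace[OF D.lin_space_axioms])
    show "lin_subspace {f \<in> carrier (strong_dual A). \<forall>a\<in>carrier A. \<forall>b\<in>carrier A. f (a \<otimes>\<^bsub>A\<^esub> b) = f (b \<otimes>\<^bsub>A\<^esub> a)} (strong_dual A)"
      unfolding lin_subspace_def using z a s by (simp add: mult_closed Collect_mono)
  qed
qed

text \<open>The commutators of elementary tensors determine a continuous functional on the tensor square.\<close>

lemma trace_commutator:
  assumes \<tau>: "\<tau> \<in> carrier (traces A)" and t: "t \<in> carrier (C (Suc 0))"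
  shows "\<tau> (commutator_map A t) = 0"
proof (rule tensor_ext[OF locally_convex_complex _ _ _ _ t])
  have f: "functional A \<tau>" and tr: "\<forall>a\<in>carrier A. \<forall>b\<in>carrier A. \<tau> (a \<otimes>\<^bsub>A\<^esub> b) = \<tau> (b \<otimes>\<^bsub>A\<^esub> a)"
    using \<tau> by (simp_all add: traces_mem)
  show "Hausdorff_space (topo complex_lcs)" by simp
  show "functional (C (Suc 0)) (\<lambda>t. \<tau> (commutator_map A t))"
    by (rule continuous_linear_compose[OF commutator_map_linear f])
  show "functional (C (Suc 0)) (\<lambda>t. 0)" by simp
  fix xs assume "xs \<in> words A (Suc (Suc 0))"
  then obtain a b where ab: "xs = [a, b]" "a \<in> carrier A" "b \<in> carrier A" by (auto simp: words_2)
  have "\<tau> ((a \<otimes>\<^bsub>A\<^esub> b) \<ominus>\<^bsub>A\<^esub> (b \<otimes>\<^bsub>A\<^esub> a)) = \<tau> (a \<otimes>\<^bsub>A\<^esub> b) - \<tau> (b \<otimes>\<^bsub>A\<^esub> a)"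
    by (rule functional_at_diff[OF lin_space_axioms f]) (use ab mult_closed in simp_all)
  then show "\<tau> (commutator_map A (tens A xs)) = 0"
    unfolding ab(1) commutator_map_tens[OF ab(2,3)] using tr ab by simp
qed

lemma omega_augmented_coexact:
  assumes "coexact_mixed (omega A) (omega_b A) (omega_B A)"
  shows "augmented_coexact_mixed (omega A) (omega_b A) (omega_B A) (traces A) (\<lambda>\<tau> u. \<tau> (untens (fst u)))"
proof (rule augmented_coexact_mixed.intro[OF assms augmented_coexact_mixed_axioms.intro])
  show "lin_space (traces A)" by (rule traces_lin)
  show "functional (omega A 0) (\<lambda>u. \<tau> (untens (fst u)))" if "\<tau> \<in> carrier (traces A)" for \<tau>
    by (rule continuous_linear_compose[OF continuous_linear_compose[OF fst_omega untens_linear]]) (use that in \<open>simp add: traces_mem\<close>)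
  show "\<tau> (untens (fst (omega_b A (Suc 0) u))) = 0" if \<tau>: "\<tau> \<in> carrier (traces A)" and u: "u \<in> carrier (omega A (Suc 0))" for \<tau> u
  proof -
    obtain t y where "u = (t, y)" "t \<in> carrier (C (Suc 0))" "y \<in> carrier (C 0)" using u by (cases u) (auto simp: omega_eq)
    then show ?thesis using trace_commutator[OF \<tau>] untens_naive by (simp add: omega_b_1)
  qed
  have um: "untens (fst u) \<in> carrier A" if "u \<in> carrier (omega A 0)" for u using that by (auto simp: omega_0_mem)
  show "(\<sigma> \<oplus>\<^bsub>traces A\<^esub> \<tau>) (untens (fst u)) = \<sigma> (untens (fst u)) + \<tau> (untens (fst u))" if "u \<in> carrier (omega A 0)" for \<sigma> \<tau> u
    using um[OF that] by (simp add: traces_sel)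
  show "(c \<odot>\<^bsub>traces A\<^esub> \<tau>) (untens (fst u)) = c * \<tau> (untens (fst u))" if "u \<in> carrier (omega A 0)" for c \<tau> u
    using um[OF that] by (simp add: traces_sel)
  have jm: "(tens A [a], \<zero>\<^bsub>C 0\<^esub>) \<in> carrier (omega A 0)" if "a \<in> carrier A" for a
    using that by (auto simp: omega_0_mem words_1 intro: tens_mem)
  have "continuous_linear (C 0) (omega A 0) (\<lambda>x. (x, \<zero>\<^bsub>second 0\<^esub>))"
    unfolding omega_eq
    by (intro continuous_linear_pair[OF T_lc second_lc] continuous_linear_const_zero[OF T_lc second_lc])
      (simp add: continuous_linear_def linear_map_def)
  then have j: "continuous_linear A (omega A 0) (\<lambda>a. (tens A [a], \<zero>\<^bsub>C 0\<^esub>))"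
    using continuous_linear_compose[OF tens_singleton, of "omega A 0" "\<lambda>x. (x, \<zero>\<^bsub>second 0\<^esub>)"] by (simp add: second_0)
  show "\<exists>\<tau>\<in>carrier (traces A). \<forall>u\<in>carrier (omega A 0). F u = \<tau> (untens (fst u))"
    if F: "functional (omega A 0) F" and cyc: "\<And>x. x \<in> carrier (omega A (Suc 0)) \<Longrightarrow> F (omega_b A (Suc 0) x) = 0" for F
  proof (rule bexI[of _ "\<lambda>a\<in>carrier A. F (tens A [a], \<zero>\<^bsub>C 0\<^esub>)"], rule ballI)
    let ?f = "\<lambda>a. F (tens A [a], \<zero>\<^bsub>C 0\<^esub>)"
    have f: "functional A ?f" by (rule continuous_linear_compose[OF j F])
    have "functional A (restrict ?f (carrier A))" by (rule functional_cong[OF lin_space_axioms topspace_eq f]) simp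
    moreover have "?f (a \<otimes>\<^bsub>A\<^esub> b) = ?f (b \<otimes>\<^bsub>A\<^esub> a)" if ab: "a \<in> carrier A" "b \<in> carrier A" for a b
    proof -
      have t: "tens A [a, b] \<in> carrier (C (Suc 0))" by (rule tens_mem) (use ab in \<open>simp add: words_2\<close>)
      have "naive_diff A (Suc 0) (tens A [a, b]) = tens A [(a \<otimes>\<^bsub>A\<^esub> b) \<ominus>\<^bsub>A\<^esub> (b \<otimes>\<^bsub>A\<^esub> a)]"
        using tens_untens[OF mem_maps(2)[OF t]] untens_naive[OF t] commutator_map_tens[OF ab] by simp
      then have "?f ((a \<otimes>\<^bsub>A\<^esub> b) \<ominus>\<^bsub>A\<^esub> (b \<otimes>\<^bsub>A\<^esub> a)) = 0"
        using cyc[of "(tens A [a, b], \<zero>\<^bsub>C 0\<^esub>)"] t omega_b_1[OF t, of "\<zero>\<^bsub>C 0\<^esub>"] by (simp add: omega_eq)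
      then show ?thesis using functional_at_diff[OF lin_space_axioms f mult_closed[OF ab] mult_closed[OF ab(2,1)]] by simp
    qed
    ultimately show "restrict ?f (carrier A) \<in> carrier (traces A)" by (simp add: traces_mem mult_closed)
    fix u assume "u \<in> carrier (omega A 0)"
    then obtain x where "x \<in> carrier (C 0)" "u = (x, \<zero>\<^bsub>C 0\<^esub>)" by (auto simp: omega_0_mem)
    then show "F u = restrict ?f (carrier A) (untens (fst u))" by (simp add: tens_untens)
  qed
  show "\<tau> = \<zero>\<^bsub>traces A\<^esub>" if \<tau>: "\<tau> \<in> carrier (traces A)" and z: "\<And>u. u \<in> carrier (omega A 0) \<Longrightarrow> \<tau> (untens (fst u)) = 0" for \<tau>
  proof
    fix a
    show "\<tau> a = \<zero>\<^bsub>traces A\<^esub> a"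
    proof (cases "a \<in> carrier A")
      case True
      then show ?thesis using z[OF jm[OF True]] by (simp add: traces_sel untens_tens)
    next
      case False
      then show ?thesis using \<tau> by (simp add: traces_mem traces_sel extensional_def)
    qed
  qed
qed

subsection \<open>The hypotheses on the naive and bar complexes\<close>

lemma chains_eq: "chains A n = C n"
  by (simp add: chains_def)

lemma T_top: "topspace (topo (T n)) = carrier (T n)"
  by (rule locally_convex.topspace_eq[OF T_lc])

lemma exact_of_homology:
  assumes naive: "\<forall>n\<ge>1. zero_space (naive_homology A n)" and bar: "\<forall>n. zero_space (bar_homology A n)"
  shows "exact_mixed (omega A) (omega_b A) (omega_B A)"
proof (rule omega_exact)
  fix n x assume x: "x \<in> carrier (C (Suc n))" "naive_diff A (Suc n) x = \<zero>\<^bsub>C n\<^esub>"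
  have "zero_space (naive_homology A (Suc n))" using naive by simp
  then have "\<forall>x\<in>carrier (C (Suc n)). naive_diff A (Suc n) x = \<zero>\<^bsub>C n\<^esub> \<longrightarrow>
      x \<in> naive_diff A (Suc (Suc n)) ` carrier (C (Suc (Suc n)))"
    unfolding naive_homology_def chain_homology_def Suc_eq_plus1[symmetric] diff_Suc_1 chains_eq
      zero_homology_iff[OF T_lin T_lin cl_lin[OF naive_linear[OF zero_less_Suc]], where g = "naive_diff A (Suc n)" and Y = "C n", OF zero_maps(2)] .
  with x have "x \<in> naive_diff A (Suc (Suc n)) ` carrier (C (Suc (Suc n)))" by simp
  then show "\<exists>w\<in>carrier (C (Suc (Suc n))). naive_diff A (Suc (Suc n)) w = x" by (auto elim!: imageE)
next
  fix n y assume y: "y \<in> carrier (C n)" "0 < n \<longrightarrow> bar_diff A n y = \<zero>\<^bsub>T n\<^esub>"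
  have b0: "bar_diff A n \<zero>\<^bsub>C n\<^esub> = \<zero>\<^bsub>C (n - 1)\<^esub>" using bar_diff_0 by (cases n) simp_all
  have "zero_space (bar_homology A n)" using bar by simp
  then have "\<forall>y\<in>carrier (C n). bar_diff A n y = \<zero>\<^bsub>C (n - 1)\<^esub> \<longrightarrow>
      y \<in> bar_diff A (Suc n) ` carrier (C (Suc n))"
    unfolding bar_homology_def chain_homology_def Suc_eq_plus1[symmetric] chains_eq
      zero_homology_iff[OF T_lin T_lin cl_lin[OF bar_linear[OF zero_less_Suc]], where g = "bar_diff A n" and Y = "C (n - 1)", OF b0] .
  moreover have "bar_diff A n y = \<zero>\<^bsub>C (n - 1)\<^esub>" using y bar_diff_0 by (cases n) simp_all
  ultimately have "y \<in> bar_diff A (Suc n) ` carrier (C (Suc n))" using y(1) by simp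
  then show "\<exists>z\<in>carrier (C (Suc n)). bar_diff A (Suc n) z = y" by (auto elim!: imageE)
qed

lemma coexact_of_cohomology:
  assumes naive: "\<forall>n\<ge>1. zero_space (naive_cohomology A n)" and bar: "\<forall>n. zero_space (bar_cohomology A n)"
  shows "coexact_mixed (omega A) (omega_b A) (omega_B A)"
proof (rule omega_coexact)
  fix n F assume F: "functional (C (Suc n)) F" "\<forall>w\<in>carrier (C (Suc (Suc n))). F (naive_diff A (Suc (Suc n)) w) = 0"
  have "zero_space (naive_cohomology A (Suc n))" using naive by simp
  then show "\<exists>h. functional (C n) h \<and> (\<forall>x\<in>carrier (C (Suc n)). F x = h (naive_diff A (Suc n) x))"
    unfolding naive_cohomology_def dual_cohomology_def Suc_eq_plus1[symmetric] diff_Suc_1 chains_eq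
    by (rule zero_dual_homologyD[OF T_lin T_top T_lin T_top T_lin T_top naive_linear[OF zero_less_Suc] naive_linear[OF zero_less_Suc] _ F])
next
  fix n F assume F: "functional (C n) F" "\<forall>w\<in>carrier (C (Suc n)). F (bar_diff A (Suc n) w) = 0"
  have "continuous_linear (C 0) (C 0) (bar_diff A 0)"
    by (rule continuous_linear_cong[OF T_lc _ continuous_linear_const_zero[OF T_lc T_lc]]) (simp add: bar_diff_0)
  then have bc: "continuous_linear (C n) (C (n - 1)) (bar_diff A n)" using bar_linear by (cases n) simp_all
  have "zero_space (bar_cohomology A n)" using bar by simp
  then have "\<exists>k. functional (C (n - 1)) k \<and> (\<forall>x\<in>carrier (C n). F x = k (bar_diff A n x))"
    unfolding bar_cohomology_def dual_cohomology_def Suc_eq_plus1[symmetric] chains_eq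
    by (rule zero_dual_homologyD[OF T_lin T_top T_lin T_top T_lin T_top bc bar_linear[OF zero_less_Suc] _ F])
  then obtain k where k: "functional (C (n - 1)) k" "\<forall>x\<in>carrier (C n). F x = k (bar_diff A n x)" by (elim exE conjE)
  show "\<exists>k. (0 < n \<longrightarrow> functional (T n) k) \<and> (\<forall>x\<in>carrier (C n). F x = (if n = 0 then 0 else k (bar_diff A n x)))"
  proof (intro exI[of _ k] conjI impI ballI)
    show "functional (T n) k" if "0 < n" using k(1) that by simp
    show "F x = (if n = 0 then 0 else k (bar_diff A n x))" if x: "x \<in> carrier (C n)" for x
      using bspec[OF k(2) x] x bar_diff_0[of x] functional_at_zero[OF T_lin k(1)] by (cases n) simp_all
  qed
qed

end

theorem proposition4p4:
  fixes \<Phi> :: "'a lcs \<Rightarrow> bool" and A :: "'a lcs"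
  assumes "suitable_category \<Phi>" and "tensor_algebra A" and "\<Phi> A"
  shows
    "((\<forall>n\<ge>1. zero_space (naive_homology A n)) \<and> (\<forall>n. zero_space (bar_homology A n)) \<longrightarrow>
        (\<forall>n\<ge>1. zero_space (HH_homology A n))
        \<and> HH_homology A 0 \<cong>\<^sub>l\<^sub>i\<^sub>n commutator_quotient A
        \<and> (\<forall>l. HC_homology A (2 * l) \<cong>\<^sub>l\<^sub>i\<^sub>n commutator_quotient A)
        \<and> (\<forall>l. zero_space (HC_homology A (2 * l + 1)))
        \<and> HP_homology A 0 \<cong>\<^sub>l\<^sub>i\<^sub>n commutator_quotient A
        \<and> zero_space (HP_homology A 1))
     \<and>
     ((\<forall>n\<ge>1. zero_space (naive_cohomology A n)) \<and> (\<forall>n. zero_space (bar_cohomology A n)) \<longrightarrow>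
        (\<forall>n\<ge>1. zero_space (HH_cohomology A n))
        \<and> HH_cohomology A 0 \<cong>\<^sub>l\<^sub>i\<^sub>n traces A
        \<and> (\<forall>l. HC_cohomology A (2 * l) \<cong>\<^sub>l\<^sub>i\<^sub>n traces A)
        \<and> (\<forall>l. zero_space (HC_cohomology A (2 * l + 1)))
        \<and> HP_cohomology A 0 \<cong>\<^sub>l\<^sub>i\<^sub>n traces A
        \<and> zero_space (HP_cohomology A 1))"
proof (intro conjI impI)
  interpret tensor_algebra A by fact
  {
    assume h: "(\<forall>n\<ge>1. zero_space (naive_homology A n)) \<and> (\<forall>n. zero_space (bar_homology A n))"
    interpret augmented_exact_mixed "omega A" "omega_b A" "omega_B A" "commutator_quotient A"
      "\<lambda>u. commutator_map A ` carrier (tensor_power A (Suc (Suc 0))) +>\<^bsub>A\<^esub> untens (fst u)"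
      by (rule omega_augmented_exact[OF exact_of_homology[OF conjunct1[OF h] conjunct2[OF h]]])
    show "\<forall>n\<ge>1. zero_space (HH_homology A n)" unfolding HH_homology_def using positive_homology by simp
    show "HH_homology A 0 \<cong>\<^sub>l\<^sub>i\<^sub>n commutator_quotient A" unfolding HH_homology_def by (rule degree_0_homology)
    show "\<forall>l. HC_homology A (2 * l) \<cong>\<^sub>l\<^sub>i\<^sub>n commutator_quotient A" unfolding HC_homology_def using even_cyclic_homology by simp
    show "\<forall>l. zero_space (HC_homology A (2 * l + 1))" unfolding HC_homology_def using odd_cyclic_homology by simp
    show "HP_homology A 0 \<cong>\<^sub>l\<^sub>i\<^sub>n commutator_quotient A" unfolding HP_homology_def using even_periodic_homology by simp
    show "zero_space (HP_homology A 1)" unfolding HP_homology_def using odd_periodic_homology by simp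
  }
  {
    assume h: "(\<forall>n\<ge>1. zero_space (naive_cohomology A n)) \<and> (\<forall>n. zero_space (bar_cohomology A n))"
    interpret augmented_coexact_mixed "omega A" "omega_b A" "omega_B A" "traces A" "\<lambda>\<tau> u. \<tau> (untens (fst u))"
      by (rule omega_augmented_coexact[OF coexact_of_cohomology[OF conjunct1[OF h] conjunct2[OF h]]])
    show "\<forall>n\<ge>1. zero_space (HH_cohomology A n)" unfolding HH_cohomology_def using positive_cohomology by simp
    show "HH_cohomology A 0 \<cong>\<^sub>l\<^sub>i\<^sub>n traces A" unfolding HH_cohomology_def by (rule degree_0_cohomology)
    show "\<forall>l. HC_cohomology A (2 * l) \<cong>\<^sub>l\<^sub>i\<^sub>n traces A" unfolding HC_cohomology_def using even_cyclic_cohomology by simp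
    show "\<forall>l. zero_space (HC_cohomology A (2 * l + 1))" unfolding HC_cohomology_def using odd_cyclic_cohomology by simp
    show "HP_cohomology A 0 \<cong>\<^sub>l\<^sub>i\<^sub>n traces A" unfolding HP_cohomology_def using even_periodic_cohomology by simp
    show "zero_space (HP_cohomology A 1)" unfolding HP_cohomology_def using odd_periodic_cohomology by simp
  }
qed

end
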